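(* Let $t$ be a fixed positive integer and let $m\to\infty$. (1) For every integer $s$ with $1\le s<\frac{t+1}{2}$, there are constants $0<c<C$ (depending on $t,s$) such that for all sufficiently large $m$, $c\,m^{s-\frac{t+1}{2}}\le \mathbb P(X(2,t,m)=s)\le C\,m^{s-\frac{t+1}{2}}$. (2) If $t$ is odd and $s=\frac{t+1}{2}$, there are constants $0<c<C$ (depending on $t$) such that for all sufficiently large $m$, $\frac{c}{\log m}\le\mathbb P(X(2,t,m)=s)\le \frac{C}{\log m}$. (3) For every integer $s$ with $\frac{t+1}{2}<s\le t$, there is a constant $c>0$ (depending on $t,s$) such that $\mathbb P(X(2,t,m)=s)\ge c$ for all sufficiently large $m$ (so $\mathbb P(X(2,t,m)=s)=\Theta(1)$).
   Context: For positive integers $k,t,m$, a random necklace is an open necklace (a linear sequence) of $ktm$ beads, containing exactly $km$ beads of each of $t$ types, chosen uniformly at random among all such sequences. A set of cuts (positions between consecutive beads) is called fair if the resulting intervals can be split into $k$ collections each containing exactly $m$ beads of each type. $X(k,t,m)$ denotes the minimum number of cuts in a fair set of cuts of the random necklace. Here $k=2$.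
   Formalization: Part (2) is stated for odd t other than 1, because for t = 1 and s = 1 the necklace has identical beads, so X(2,1,m) = 1 with probability 1 and the upper bound C/log m fails. *)

theory Defs
  imports "HOL-Probability.Probability"
begin

text \<open>Bead types are \<open>0, \<dots>, t - 1\<close>; a necklace is the list of the types of its beads.\<close>

definition necklaces :: "nat \<Rightarrow> nat \<Rightarrow> nat \<Rightarrow> nat list set" where
  "necklaces k t m =
     {w. length w = k * t * m \<and> set w \<subseteq> {..<t} \<and> (\<forall>i<t. count_list w i = k * m)}"

lemma finite_necklaces: "finite (necklaces k t m)"
  by (rule finite_subset[OF _ finite_lists_length_eq[of "{..<t}" "k * t * m"]])
     (auto simp: necklaces_def)

lemma necklaces_nonempty: "necklaces k t m \<noteq> {}"
proof -
  have replicate: "count_list (replicate n x) y = (if x = y then n else 0)" for n and x y :: nat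
    by (induction n) auto
  have count: "count_list (concat (map (replicate (k * m)) [0..<n])) i = (if i < n then k * m else 0)"
    for n i
    by (induction n) (auto simp: replicate)
  have length: "length (concat (map (replicate (k * m)) [0..<n])) = k * n * m" for n
    by (induction n) (auto simp: algebra_simps)
  have "concat (map (replicate (k * m)) [0..<t]) \<in> necklaces k t m"
    unfolding necklaces_def by (auto simp: count length)
  then show ?thesis by blast
qed

definition random_necklace :: "nat \<Rightarrow> nat \<Rightarrow> nat \<Rightarrow> nat list pmf" where
  "random_necklace k t m = pmf_of_set (necklaces k t m)"

text \<open>
  Beads have positions \<open>0, \<dots>, n - 1\<close>. The cut \<open>c \<in> {1..<n}\<close> lies between the beads at
  positions \<open>c - 1\<close> and \<open>c\<close>. An interval is represented by the set of its positions and
  runs from one element of \<open>S \<union> {0, n}\<close> to the next.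
\<close>

definition intervals :: "nat \<Rightarrow> nat set \<Rightarrow> nat set set" where
  "intervals n S =
     {{a..<b} |a b. a < b \<and> a \<in> insert 0 S \<and> b \<in> insert n S \<and> S \<inter> {a<..<b} = {}}"

definition beads_of_type :: "nat list \<Rightarrow> nat \<Rightarrow> nat set \<Rightarrow> nat" where
  "beads_of_type w i I = card {p \<in> I. w ! p = i}"

text \<open>The map \<open>f\<close> assigns each interval to one of the \<open>k\<close> collections; collections may be empty.\<close>

definition fair_cuts :: "nat \<Rightarrow> nat \<Rightarrow> nat \<Rightarrow> nat list \<Rightarrow> nat set \<Rightarrow> bool" where
  "fair_cuts k t m w S \<longleftrightarrow>
     S \<subseteq> {1..<length w} \<and>
     (\<exists>f. f ` intervals (length w) S \<subseteq> {..<k} \<and>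
          (\<forall>j<k. \<forall>i<t.
             (\<Sum>I | I \<in> intervals (length w) S \<and> f I = j. beads_of_type w i I) = m))"

text \<open>The random variable \<open>X(k,t,m)\<close>, on the space of necklaces.\<close>

definition X :: "nat \<Rightarrow> nat \<Rightarrow> nat \<Rightarrow> nat list \<Rightarrow> nat" where
  "X k t m w = (LEAST r. \<exists>S. fair_cuts k t m w S \<and> card S = r)"

end

theory Submission
  imports Defs
begin

text \<open>A necklace is a uniformly random word conditioned on having \<open>2 m\<close> beads of each type, and a set of
  cuts is determined up to order \<open>m powr (s - 1)\<close> choices by the requirement that the two thieves get
  equally many beads. By a local limit theorem each choice is fair with conditional probability of
  order \<open>m powr (- (t - 1) / 2)\<close>, so the first moment gives the upper bound \<open>m powr (s - (t + 1) / 2)\<close>.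

  For the lower bounds, the word is forced to have a surplus of type \<open>i\<close> in the \<open>i\<close>-th of \<open>s\<close> zones, of
  the order of the typical fluctuations; then every fair set has at least \<open>s\<close> cuts. The fair sets with
  one cut near the middle of each zone are counted by the second moment method. Two such sets at
  distance \<open>k\<close> are correlated through \<open>(k + 1) powr (- (t - 1) / 2)\<close>, and the sum of these correlations
  is bounded, logarithmic or polynomial according to the three regimes of \<open>s\<close>.

  The logarithm in the critical upper bound \<open>t = 2 s - 1\<close> comes from clustering: given one fair set,
  each of about \<open>ln m\<close> scales contributes a constant to the expected number of fair sets, so that the
  probability that there is one is smaller than the first moment by a factor \<open>ln m\<close>.\<close>

text \<open>The letters of a word are independent, those of a necklace are not; so
  \<open>balanced\<close> stays a part of every event and is divided out only at the end. A count
  vector over given positions has \<open>t - 1\<close> free coordinates, whence the exponent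
  \<open>(t - 1) / 2\<close> wherever counts are prescribed. Prescribing both sides has probability
  of order \<open>m powr (- (t - 1))\<close>, and dividing by the probability of balance leaves
  \<open>m powr (- (t - 1) / 2)\<close>.

  Cauchy-Schwarz bounds the probability of a fair set only from below, so the critical upper bound
  needs another argument. Its obstacle: a fair set reveals the letters it depends on, while its
  neighbours should be fair through fresh randomness. Hence only the beads after the last cut are
  redrawn. The other cuts move over known letters, and the last cut repairs the imbalance this
  creates. The known letters must behave well at the scale of the move, and the letters after the
  last cut must not be biased much by the balance condition; these are the two random requirements
  in \<open>good_cuts\<close>.\<close>

section \<open>Uniform random words: averages, independence, letter counts\<close>

definition words :: "nat \<Rightarrow> nat \<Rightarrow> (nat \<Rightarrow> nat) set" where
  "words t n = {..<n} \<rightarrow>\<^sub>E {..<t}"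

definition avg :: "nat \<Rightarrow> nat \<Rightarrow> ((nat \<Rightarrow> nat) \<Rightarrow> real) \<Rightarrow> real" where
  "avg t n F = (\<Sum>f\<in>words t n. F f) / real t ^ n"

definition pr :: "nat \<Rightarrow> nat \<Rightarrow> ((nat \<Rightarrow> nat) \<Rightarrow> bool) \<Rightarrow> real" where
  "pr t n P = avg t n (\<lambda>f. of_bool (P f))"

definition cnt :: "(nat \<Rightarrow> nat) \<Rightarrow> nat set \<Rightarrow> nat \<Rightarrow> nat" where
  "cnt f A i = card {p \<in> A. f p = i}"

text \<open>Measurability with respect to the letters at \<open>A\<close>, expressed without a
  sigma-algebra.\<close>

definition depends_on :: "nat set \<Rightarrow> ((nat \<Rightarrow> nat) \<Rightarrow> 'a) \<Rightarrow> bool" where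
  "depends_on A F \<longleftrightarrow> (\<forall>f g. (\<forall>p\<in>A. f p = g p) \<longrightarrow> F f = F g)"

lemma finite_words [simp, intro]: "finite (words t n)"
  by (simp add: words_def finite_PiE)

lemma card_words: "card (words t n) = t ^ n"
  by (simp add: words_def card_PiE)

lemma words_less: "f \<in> words t n \<Longrightarrow> p < n \<Longrightarrow> f p < t"
  by (auto simp: words_def)

lemma override_words: "f \<in> words t n \<Longrightarrow> g \<in> words t n \<Longrightarrow> override_on g f A \<in> words t n"
  by (auto simp: words_def override_on_def PiE_def extensional_def)

lemma avg_add: "avg t n (\<lambda>f. F f + G f) = avg t n F + avg t n G"
  by (simp add: avg_def sum.distrib add_divide_distrib)

lemma avg_diff: "avg t n (\<lambda>f. F f - G f) = avg t n F - avg t n G"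
  by (simp add: avg_def sum_subtractf diff_divide_distrib)

lemma avg_cmult: "avg t n (\<lambda>f. c * F f) = c * avg t n F"
  by (simp add: avg_def sum_distrib_left)

lemma avg_sum: "avg t n (\<lambda>f. \<Sum>x\<in>I. F x f) = (\<Sum>x\<in>I. avg t n (F x))"
  unfolding avg_def by (subst sum.swap) (simp add: sum_divide_distrib)

lemma avg_mono: "(\<And>f. f \<in> words t n \<Longrightarrow> F f \<le> G f) \<Longrightarrow> avg t n F \<le> avg t n G"
  unfolding avg_def by (intro divide_right_mono sum_mono) auto

lemma avg_cong: "(\<And>f. f \<in> words t n \<Longrightarrow> F f = G f) \<Longrightarrow> avg t n F = avg t n G"
  unfolding avg_def by (intro arg_cong2[where f = "(/)"] sum.cong) auto

lemma avg_nonneg: "(\<And>f. f \<in> words t n \<Longrightarrow> 0 \<le> F f) \<Longrightarrow> 0 \<le> avg t n F"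
  unfolding avg_def by (intro divide_nonneg_nonneg sum_nonneg) auto

lemma avg_const: "t \<ge> 1 \<Longrightarrow> avg t n (\<lambda>f. c) = c"
  by (simp add: avg_def card_words)

lemma pr_nonneg: "0 \<le> pr t n P"
  unfolding pr_def by (rule avg_nonneg) simp

lemma pr_mono: "(\<And>f. f \<in> words t n \<Longrightarrow> P f \<Longrightarrow> Q f) \<Longrightarrow> pr t n P \<le> pr t n Q"
  unfolding pr_def by (rule avg_mono) auto

lemma pr_cong: "(\<And>f. f \<in> words t n \<Longrightarrow> P f \<longleftrightarrow> Q f) \<Longrightarrow> pr t n P = pr t n Q"
  unfolding pr_def by (rule avg_cong) auto

lemma pr_le_1: "t \<ge> 1 \<Longrightarrow> pr t n P \<le> 1"
  using avg_mono[of t n "\<lambda>f. of_bool (P f)" "\<lambda>f. 1"] by (simp add: pr_def avg_const)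

lemma pr_eq_card: "pr t n P = card {f \<in> words t n. P f} / real t ^ n"
  by (simp add: pr_def avg_def sum_of_bool_eq Int_def)

lemma pr_Un: "pr t n (\<lambda>f. P f \<or> Q f) \<le> pr t n P + pr t n Q"
proof -
  have "pr t n (\<lambda>f. P f \<or> Q f) \<le> avg t n (\<lambda>f. of_bool (P f) + of_bool (Q f))"
    unfolding pr_def by (rule avg_mono) auto
  then show ?thesis by (simp add: avg_add pr_def)
qed

lemma pr_Ex:
  assumes "finite I"
  shows "pr t n (\<lambda>f. \<exists>x\<in>I. P x f) \<le> (\<Sum>x\<in>I. pr t n (P x))"
  using assms
proof (induction rule: finite_induct)
  case (insert x I)
  have "pr t n (\<lambda>f. \<exists>y\<in>insert x I. P y f) = pr t n (\<lambda>f. P x f \<or> (\<exists>y\<in>I. P y f))"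
    by simp
  also have "\<dots> \<le> pr t n (P x) + pr t n (\<lambda>f. \<exists>y\<in>I. P y f)" by (rule pr_Un)
  finally show ?case using insert by simp
qed (simp add: pr_def avg_def)

lemma pr_disjoint_Ex:
  assumes "finite I" "\<And>x y f. x \<in> I \<Longrightarrow> y \<in> I \<Longrightarrow> f \<in> words t n \<Longrightarrow> P x f \<Longrightarrow> P y f \<Longrightarrow> x = y"
  shows "(\<Sum>x\<in>I. pr t n (P x)) \<le> pr t n (\<lambda>f. \<exists>x\<in>I. P x f)"
proof -
  have "(\<Sum>x\<in>I. pr t n (P x)) = avg t n (\<lambda>f. \<Sum>x\<in>I. of_bool (P x f))"
    by (simp add: pr_def avg_sum)
  also have "\<dots> \<le> pr t n (\<lambda>f. \<exists>x\<in>I. P x f)"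
    unfolding pr_def
  proof (rule avg_mono)
    fix f assume f: "f \<in> words t n"
    show "(\<Sum>x\<in>I. of_bool (P x f)) \<le> (of_bool (\<exists>x\<in>I. P x f) :: real)"
    proof (cases "\<exists>x\<in>I. P x f")
      case True
      then obtain x where x: "x \<in> I" "P x f" by blast
      have "(\<Sum>y\<in>I. of_bool (P y f)) = (\<Sum>y\<in>{x}. of_bool (P y f) :: real)"
        using assms x f by (intro sum.mono_neutral_right) auto
      then show ?thesis using x by auto
    qed simp
  qed
  finally show ?thesis .
qed

lemma markov:
  assumes "\<And>f. f \<in> words t n \<Longrightarrow> 0 \<le> F f" "0 < c"
  shows "pr t n (\<lambda>f. c \<le> F f) \<le> avg t n F / c"
proof -
  have "pr t n (\<lambda>f. c \<le> F f) \<le> avg t n (\<lambda>f. (1 / c) * F f)"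
    unfolding pr_def using assms by (intro avg_mono) (auto simp: field_simps)
  then show ?thesis by (simp only: avg_cmult) simp
qed

text \<open>Exchanging the letters on \<open>A\<close> between two independent words preserves the uniform
  measure on pairs.\<close>

lemma avg_fubini:
  assumes "t \<ge> 1"
  shows "avg t n F = avg t n (\<lambda>g. avg t n (\<lambda>f. F (override_on g f A)))"
proof -
  let ?W = "words t n"
  have swap: "override_on (override_on g f A) (override_on f g A) A = g" for f g :: "nat \<Rightarrow> nat"
    by (auto simp: override_on_def)
  have "(\<Sum>g\<in>?W. \<Sum>f\<in>?W. F (override_on g f A)) = (\<Sum>(g, f)\<in>?W \<times> ?W. F (override_on g f A))"
    by (simp add: sum.cartesian_product)
  also have "\<dots> = (\<Sum>(g, f)\<in>?W \<times> ?W. F g)"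
    by (rule sum.reindex_bij_witness[where i = "\<lambda>(g, f). (override_on g f A, override_on f g A)"
          and j = "\<lambda>(g, f). (override_on g f A, override_on f g A)"])
       (auto simp: override_words swap)
  also have "\<dots> = (\<Sum>g\<in>?W. real t ^ n * F g)"
    by (simp add: card_words flip: sum.cartesian_product)
  finally show ?thesis
    using assms by (simp add: avg_def sum_divide_distrib[symmetric] sum_distrib_left[symmetric])
qed

lemma depends_on_override_off:
  "depends_on B F \<Longrightarrow> A \<inter> B = {} \<Longrightarrow> F (override_on g f A) = F g"
  unfolding depends_on_def by (erule allE[of _ "override_on g f A"], erule allE[of _ g])
     (auto simp: override_on_def)

lemma depends_on_override_on:
  "depends_on B F \<Longrightarrow> B \<subseteq> A \<Longrightarrow> F (override_on g f A) = F f"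
  unfolding depends_on_def by (erule allE[of _ "override_on g f A"], erule allE[of _ f]) auto

lemma depends_on_mono: "depends_on A F \<Longrightarrow> A \<subseteq> B \<Longrightarrow> depends_on B F"
  unfolding depends_on_def by blast

lemma avg_indep:
  assumes "t \<ge> 1" "depends_on A F" "depends_on B G" "A \<inter> B = {}"
  shows "avg t n (\<lambda>f. F f * G f) = avg t n F * avg t n G"
proof -
  have "avg t n (\<lambda>f. F f * G f) = avg t n (\<lambda>g. avg t n (\<lambda>f. F f * G g))"
    using assms by (subst avg_fubini[where A = A])
      (auto simp: depends_on_override_off depends_on_override_on)
  also have "\<dots> = avg t n (\<lambda>g. avg t n F * G g)"
    by (simp add: avg_cmult mult.commute[of _ "G _"])
  also have "\<dots> = avg t n F * avg t n G"
    by (simp only: avg_cmult)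
  finally show ?thesis .
qed

lemma depends_on_comp: "depends_on A F \<Longrightarrow> depends_on A (\<lambda>f. h (F f))"
  unfolding depends_on_def by (intro allI impI arg_cong[where f = h]) blast

lemma pr_indep:
  assumes "t \<ge> 1" "depends_on A P" "depends_on B Q" "A \<inter> B = {}"
  shows "pr t n (\<lambda>f. P f \<and> Q f) = pr t n P * pr t n Q"
proof -
  have "depends_on A (\<lambda>f. of_bool (P f) :: real)" "depends_on B (\<lambda>f. of_bool (Q f) :: real)"
    using assms(2,3) by (auto intro: depends_on_comp)
  from avg_indep[OF assms(1) this assms(4)] show ?thesis
    by (simp add: pr_def of_bool_conj)
qed

text \<open>The letters off \<open>A\<close> are frozen as in \<open>g\<close> and those on
  \<open>A\<close> are drawn afresh. Since \<open>Q\<close> sees only frozen letters, a bound for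
  \<open>R\<close> that is uniform in \<open>g\<close> can be multiplied with the probability of
  \<open>Q\<close>.\<close>

lemma pr_cond_le:
  assumes "t \<ge> 1" "depends_on B Q" "A \<inter> B = {}" "0 \<le> u"
    and "\<And>g. g \<in> words t n \<Longrightarrow> Q g \<Longrightarrow> pr t n (\<lambda>f. R (override_on g f A)) \<le> u"
  shows "pr t n (\<lambda>f. Q f \<and> R f) \<le> u * pr t n Q"
proof -
  have "pr t n (\<lambda>f. Q f \<and> R f) =
      avg t n (\<lambda>g. avg t n (\<lambda>f. of_bool (Q g) * of_bool (R (override_on g f A))))"
    unfolding pr_def
    by (subst avg_fubini[OF assms(1), where A = A])
       (simp add: depends_on_override_off[OF assms(2,3)] of_bool_conj)
  also have "\<dots> \<le> avg t n (\<lambda>g. u * of_bool (Q g))"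
    using assms(4,5) by (intro avg_mono) (auto simp: avg_cmult pr_def)
  finally show ?thesis by (simp add: avg_cmult pr_def)
qed

lemma pr_cond_ge:
  assumes "t \<ge> 1" "depends_on B Q" "A \<inter> B = {}"
    and "\<And>g. g \<in> words t n \<Longrightarrow> Q g \<Longrightarrow> u \<le> pr t n (\<lambda>f. R (override_on g f A))"
  shows "u * pr t n Q \<le> pr t n (\<lambda>f. Q f \<and> R f)"
proof -
  have "pr t n (\<lambda>f. Q f \<and> R f) =
      avg t n (\<lambda>g. avg t n (\<lambda>f. of_bool (Q g) * of_bool (R (override_on g f A))))"
    unfolding pr_def
    by (subst avg_fubini[OF assms(1), where A = A])
       (simp add: depends_on_override_off[OF assms(2,3)] of_bool_conj)
  also have "\<dots> \<ge> avg t n (\<lambda>g. u * of_bool (Q g))"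
    using assms(4) by (intro avg_mono) (auto simp: avg_cmult pr_def)
  finally show ?thesis by (simp add: avg_cmult pr_def)
qed

lemma avg_single:
  assumes "p < n" "t \<ge> 1"
  shows "avg t n (\<lambda>f. F (f p)) = (\<Sum>j<t. F j) / real t"
proof -
  have c: "card {f \<in> words t n. f p = j} = t ^ (n - 1)" if "j < t" for j
  proof -
    have "{f \<in> words t n. f p = j} = (\<Pi>\<^sub>E q\<in>{..<n}. if q = p then {j} else {..<t})"
      using that assms by (auto simp: words_def PiE_def Pi_def split: if_splits)
    then have "card {f \<in> words t n. f p = j} = (\<Prod>q<n. if q = p then 1 else t)"
      by (simp add: card_PiE if_distrib cong: if_cong)
    also have "\<dots> = (\<Prod>q\<in>{..<n} - {p}. t)"
      using assms by (subst prod.remove[of _ p]) auto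
    finally show ?thesis using assms by simp
  qed
  have "(\<Sum>f\<in>words t n. F (f p)) = (\<Sum>j<t. \<Sum>f\<in>{f\<in>words t n. f p = j}. F (f p))"
    using assms by (intro sum.group[symmetric]) (auto dest: words_less)
  also have "\<dots> = (\<Sum>j<t. real t ^ (n - 1) * F j)"
    by (intro sum.cong refl) (simp add: c)
  finally show ?thesis using assms
    by (simp add: avg_def sum_distrib_left[symmetric] power_eq_if[of _ n] divide_simps)
qed

lemma cnt_depends: "depends_on A (\<lambda>f. cnt f A)"
  unfolding depends_on_def cnt_def
  by (intro allI impI ext arg_cong[where f = card] Collect_cong conj_cong refl) auto

lemma cnt_override_in [simp]: "B \<subseteq> A \<Longrightarrow> cnt (override_on g f A) B = cnt f B"
  using depends_on_override_on[OF cnt_depends, of B A g f] by simp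

lemma cnt_override_out [simp]: "A \<inter> B = {} \<Longrightarrow> cnt (override_on g f A) B = cnt g B"
  using depends_on_override_off[OF cnt_depends, of A B g f] by simp

lemma cnt_Un: "finite A \<Longrightarrow> finite B \<Longrightarrow> A \<inter> B = {} \<Longrightarrow> cnt f (A \<union> B) i = cnt f A i + cnt f B i"
  unfolding cnt_def
  by (subst card_Un_disjoint[symmetric]) (auto intro!: arg_cong[where f = card])

lemma cnt_empty [simp]: "cnt f {} i = 0"
  by (simp add: cnt_def)

lemma cnt_UN:
  "finite I \<Longrightarrow> (\<And>x. x \<in> I \<Longrightarrow> finite (B x)) \<Longrightarrow> disjoint_family_on B I \<Longrightarrow>
   cnt f (\<Union>x\<in>I. B x) i = (\<Sum>x\<in>I. cnt f (B x) i)"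
proof (induction rule: finite_induct)
  case (insert x I)
  have "B x \<inter> B y = {}" if "y \<in> I" for y
    using insert.hyps insert.prems(2) that by (intro disjoint_family_onD[of B "insert x I"]) auto
  then have "B x \<inter> (\<Union>y\<in>I. B y) = {}" by blast
  moreover have "disjoint_family_on B I"
    using insert.prems(2) by (rule disjoint_family_on_mono[rotated]) auto
  ultimately show ?case using insert by (simp add: cnt_Un)
qed simp

lemma sum_cnt:
  assumes "f \<in> words t n" "A \<subseteq> {..<n}"
  shows "(\<Sum>i<t. cnt f A i) = card A"
proof -
  have fin: "finite A" using assms(2) finite_subset by blast
  have "(\<Sum>i<t. card {p \<in> A. f p = i}) = card (\<Union>i\<in>{..<t}. {p \<in> A. f p = i})"
    using fin by (intro card_UN_disjoint[symmetric]) auto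
  also have "(\<Union>i\<in>{..<t}. {p \<in> A. f p = i}) = A"
    using assms by (auto dest: words_less)
  finally show ?thesis by (simp add: cnt_def)
qed

section \<open>Local limit bounds for letter counts\<close>

text \<open>Removing one position \<open>p\<close> lowers the entry of the letter \<open>f p\<close>
  by one. The multinomial coefficients of the lowered vectors are the original one times
  \<open>c j\<close>, divided by the new size, and the \<open>c j\<close> add up to that
  size.\<close>

lemma pr_multinomial:
  assumes "t \<ge> 1" "A \<subseteq> {..<n}" "(\<Sum>i<t. c i) = card A"
  shows "pr t n (\<lambda>f. \<forall>i<t. cnt f A i = c i)
    = fact (card A) / (\<Prod>i<t. fact (c i)) / real t ^ card A"
proof -
  have "finite A" using assms(2) finite_subset by blast
  then show ?thesis using assms(2,3)
  proof (induction arbitrary: c rule: finite_induct)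
    case empty
    then show ?case using assms(1) by (simp add: pr_def avg_const)
  next
    case (insert p A)
    have ins: "cnt f (insert p A) i = (if f p = i then 1 else 0) + cnt f A i" for f i
    proof -
      have "{q \<in> insert p A. f q = i} = (if f p = i then {p} else {}) \<union> {q \<in> A. f q = i}"
        by auto
      then show ?thesis using insert.hyps by (simp add: cnt_def)
    qed
    \<comment> \<open>A letter with \<open>c j = 0\<close> cannot stand at \<open>p\<close>; without
      this restriction the truncated \<open>c j - 1\<close> would admit it.\<close>
    define J where "J = {j. j < t \<and> c j > 0}"
    define d where "d = (\<lambda>j. c(j := c j - 1))"
    have ev: "(\<forall>i<t. cnt f (insert p A) i = c i) \<longleftrightarrow>
        (\<exists>j\<in>J. f p = j \<and> (\<forall>i<t. cnt f A i = d j i))" if "f \<in> words t n" for f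
    proof -
      have "f p < t" using that insert.prems words_less by auto
      moreover have "(\<forall>i<t. cnt f (insert p A) i = c i) \<longleftrightarrow>
          0 < c (f p) \<and> (\<forall>i<t. cnt f A i = d (f p) i)" if "f p < t"
      proof -
        have "cnt f (insert p A) i = c i \<longleftrightarrow> cnt f A i = d (f p) i" if "i < t" "0 < c (f p)" for i
          using that by (cases "i = f p") (auto simp: ins d_def)
        moreover have "0 < c (f p)" if "cnt f (insert p A) (f p) = c (f p)"
          using that by (simp add: ins)
        ultimately show ?thesis using \<open>f p < t\<close> by metis
      qed
      ultimately show ?thesis by (auto simp: J_def)
    qed
    let ?P = "\<lambda>j f. f p = j \<and> (\<forall>i<t. cnt f A i = d j i)"
    have J: "finite J" by (simp add: J_def)
    have "pr t n (\<lambda>f. \<forall>i<t. cnt f (insert p A) i = c i) = pr t n (\<lambda>f. \<exists>j\<in>J. ?P j f)"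
      by (rule pr_cong) (rule ev)
    also have "\<dots> = (\<Sum>j\<in>J. pr t n (?P j))"
      by (intro antisym pr_Ex pr_disjoint_Ex J) auto
    also have "\<dots> = (\<Sum>j\<in>J. (1 / t) * (fact (card A) * c j / (\<Prod>i<t. fact (c i)) / real t ^ card A))"
    proof (rule sum.cong[OF refl])
      fix j assume j: "j \<in> J"
      have "depends_on {p} (\<lambda>f. f p = j)" by (auto simp: depends_on_def)
      moreover have "depends_on A (\<lambda>f. \<forall>i<t. cnt f A i = d j i)"
        by (rule depends_on_comp[OF cnt_depends])
      ultimately have "pr t n (?P j) = pr t n (\<lambda>f. f p = j) * pr t n (\<lambda>f. \<forall>i<t. cnt f A i = d j i)"
        using insert.hyps by (intro pr_indep[OF assms(1)]) auto
      also have "pr t n (\<lambda>f. f p = j) = 1 / t"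
      proof -
        have "pr t n (\<lambda>f. f p = j) = (\<Sum>i<t. of_bool (i = j)) / real t"
          unfolding pr_def using insert.prems assms(1) by (subst avg_single) auto
        then show ?thesis using j by (simp add: J_def of_bool_def)
      qed
      also have "pr t n (\<lambda>f. \<forall>i<t. cnt f A i = d j i)
          = fact (card A) / (\<Prod>i<t. fact (d j i)) / real t ^ card A"
      proof (rule insert.IH)
        have "(\<Sum>i<t. c i) = c j + (\<Sum>i\<in>{..<t} - {j}. c i)"
          using j by (intro sum.remove) (auto simp: J_def)
        moreover have "(\<Sum>i<t. d j i) = (c j - 1) + (\<Sum>i\<in>{..<t} - {j}. c i)"
          using j by (subst sum.remove[of _ j]) (auto simp: J_def d_def)
        ultimately show "(\<Sum>i<t. d j i) = card A"
          using insert.prems insert.hyps j by (simp add: J_def)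
      qed (use insert.prems in auto)
      also have "fact (card A) / (\<Prod>i<t. fact (d j i)) =
          (fact (card A) * c j / (\<Prod>i<t. fact (c i)) :: real)"
      proof -
        have "(\<Prod>i<t. fact (c i)) = (fact (c j) * (\<Prod>i\<in>{..<t} - {j}. fact (c i)) :: real)"
          using j by (intro prod.remove) (auto simp: J_def)
        moreover have "(\<Prod>i<t. fact (d j i)) = (fact (c j - 1) * (\<Prod>i\<in>{..<t} - {j}. fact (c i)) :: real)"
          using j by (subst prod.remove[of _ j]) (auto simp: J_def d_def)
        moreover have "(fact (c j) :: real) = c j * fact (c j - 1)"
          using j by (subst fact_reduce) (auto simp: J_def)
        ultimately show ?thesis using j by (simp add: J_def)
      qed
      finally show "pr t n (?P j) = (1 / t) * (fact (card A) * c j / (\<Prod>i<t. fact (c i)) / real t ^ card A)" .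
    qed
    also have "\<dots> = (1 / t) * (fact (card A) * real (\<Sum>j\<in>J. c j) / (\<Prod>i<t. fact (c i)) / real t ^ card A)"
      by (simp add: sum_distrib_left sum_divide_distrib)
    \<comment> \<open>The letters outside \<open>J\<close> contribute zero and may be added
      back.\<close>
    also have "(\<Sum>j\<in>J. c j) = (\<Sum>j<t. c j)"
      by (rule sum.mono_neutral_left) (auto simp: J_def)
    also have "\<dots> = card (insert p A)" using insert.prems by simp
    finally show ?case
      using insert.hyps by (simp add: mult.commute)
  qed
qed

text \<open>The Stirling error \<open>d\<close> decreases, while \<open>d k - 1 / (4 * k)\<close>
  increases. Both bounds are then read off at \<open>k = 1\<close>, where these sequences start with
  \<open>1\<close> and \<open>3 / 4\<close>.\<close>

lemma stirling_aux:
  fixes k :: nat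
  assumes "k \<ge> 1"
  defines "d \<equiv> \<lambda>k::nat. ln (fact k) - (k + 1 / 2) * ln k + k"
  shows "d k \<le> 1" "3 / 4 + 1 / (4 * real k) \<le> d k"
proof -
  have step: "0 \<le> d k - d (Suc k) \<and> d k - d (Suc k) \<le> 1 / (4 * real k) - 1 / (4 * real (Suc k))"
    if "k \<ge> 1" for k
  proof -
    have d: "d k - d (Suc k) = (k + 1 / 2) * (ln (real k + 1) - ln k) - 1"
    proof -
      have "ln (fact (Suc k) :: real) = ln (real k + 1) + ln (fact k)"
        unfolding fact_Suc by (subst ln_mult) (auto simp: add.commute)
      then show ?thesis by (simp add: d_def algebra_simps)
    qed
    \<comment> \<open>The midpoint rule bounds the integral of the convex function
      \<open>1 / x\<close> from below; the trapezoidal rule used further on bounds it from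
      above.\<close>
    have "2 / (2 * real k + 1) \<le> ln (real k + 1) - ln k"
      using ln_inverse_approx_ge[of "real k" "real k + 1"] that by simp
    then have "(k + 1 / 2) * (2 / (2 * real k + 1)) \<le> (k + 1 / 2) * (ln (real k + 1) - ln k)"
      by (rule mult_left_mono) simp
    moreover have "(k + 1 / 2) * (2 / (2 * real k + 1)) = 1"
      by (simp add: field_simps)
    ultimately have 1: "0 \<le> d k - d (Suc k)" unfolding d by linarith
    have "ln (real k + 1) - ln k \<le> (inverse k + inverse (real k + 1)) / 2"
      using ln_inverse_approx_le[of "real k" 1] that by simp
    then have "(k + 1 / 2) * (ln (real k + 1) - ln k)
        \<le> (k + 1 / 2) * ((inverse k + inverse (real k + 1)) / 2)"
      by (rule mult_left_mono) simp
    moreover have "(k + 1 / 2) * ((inverse k + inverse (real k + 1)) / 2) - 1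
        = 1 / (4 * real k) - 1 / (4 * real (Suc k))"
      using that by (simp add: divide_simps) (simp add: algebra_simps)
    ultimately show ?thesis using 1 unfolding d by linarith
  qed
  have "d k \<le> 1 \<and> 3 / 4 + 1 / (4 * real k) \<le> d k"
    using assms(1)
  proof (induction k rule: dec_induct)
    case base
    then show ?case by (simp add: d_def)
  next
    case (step k)
    then show ?case using \<open>\<And>k. 1 \<le> k \<Longrightarrow> _ k\<close>[of k] by linarith
  qed
  then show "d k \<le> 1" "3 / 4 + 1 / (4 * real k) \<le> d k" by auto
qed

text \<open>Having \<open>k + 1\<close> under the root lets both bounds hold at \<open>k = 0\<close>
  as well. It costs at most a factor \<open>sqrt 2\<close>, which is less than the available
  \<open>exp (3 / 4)\<close>.\<close>

lemma stirling:
  "sqrt (real k + 1) * (real k / exp 1) ^ k \<le> fact k"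
  "fact k \<le> exp 1 * sqrt (real k + 1) * (real k / exp 1) ^ k"
proof -
  have "sqrt (real k + 1) * (real k / exp 1) ^ k \<le> fact k \<and>
    fact k \<le> exp 1 * sqrt (real k + 1) * (real k / exp 1) ^ k"
  proof (cases "k = 0")
    case True
    then show ?thesis by (simp add: one_le_exp_iff)
  next
    case False
    then have k: "k \<ge> 1" by simp
    define d where "d = ln (fact k) - (k + 1 / 2) * ln k + k"
    have "0 \<le> 1 / (4 * real k)" by simp
    with stirling_aux[OF k] have d: "d \<le> 1" "3 / 4 \<le> d"
      unfolding d_def by linarith+
    have "ln (fact k :: real) = d + (ln k / 2 + k * (ln k - 1))"
      unfolding d_def by (simp add: algebra_simps)
    then have "fact k = exp (d + (ln k / 2 + k * (ln k - 1)))"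
      by (metis exp_ln fact_gt_zero)
    also have "\<dots> = exp d * (sqrt k * (real k / exp 1) ^ k)"
    proof -
      have "exp (ln (real k) / 2) = sqrt k"
        using k by (simp add: ln_sqrt[symmetric])
      moreover have "exp (k * (ln (real k) - 1)) = (real k / exp 1) ^ k"
        using k by (simp add: exp_of_nat_mult exp_diff)
      ultimately show ?thesis by (simp add: exp_add)
    qed
    finally have f: "fact k = exp d * (sqrt k * (real k / exp 1) ^ k)" .
    have e34: "sqrt 2 \<le> exp d"
    proof -
      have "sqrt 2 \<le> 1 + (3 / 4 :: real)"
        by (rule real_le_lsqrt) (auto simp: power2_eq_square)
      also have "\<dots> \<le> exp (3 / 4)" by (rule exp_ge_add_one_self)
      also have "\<dots> \<le> exp d" using d by simp
      finally show ?thesis .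
    qed
    have "sqrt (real k + 1) \<le> sqrt (2 * k)" using k by simp
    also have "\<dots> = sqrt 2 * sqrt k" by (simp add: real_sqrt_mult)
    also have "\<dots> \<le> exp d * sqrt k" using e34 by (intro mult_right_mono) auto
    finally have "sqrt (real k + 1) * (real k / exp 1) ^ k \<le> (exp d * sqrt k) * (real k / exp 1) ^ k"
      by (intro mult_right_mono) auto
    moreover have "exp d * (sqrt k * (real k / exp 1) ^ k)
        \<le> exp 1 * (sqrt (real k + 1) * (real k / exp 1) ^ k)"
      using d by (intro mult_mono mult_right_mono) auto
    ultimately show ?thesis unfolding f by (simp add: mult.assoc)
  qed
  then show "sqrt (real k + 1) * (real k / exp 1) ^ k \<le> fact k"
    "fact k \<le> exp 1 * sqrt (real k + 1) * (real k / exp 1) ^ k" by auto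
qed

lemma fact_add_le: "(fact (q + j) :: real) \<le> fact q * real (q + j) ^ j"
proof (induction j)
  case (Suc j)
  have "(fact (q + Suc j) :: real) = real (q + Suc j) * fact (q + j)" by simp
  also have "\<dots> \<le> real (q + Suc j) * (fact q * real (q + j) ^ j)"
    using Suc by (intro mult_left_mono) auto
  also have "\<dots> \<le> real (q + Suc j) * (fact q * real (q + Suc j) ^ j)"
    by (intro mult_left_mono power_mono) auto
  finally show ?case by (simp add: mult_ac)
qed simp

lemma fact_add_ge: "fact q * real q ^ j \<le> (fact (q + j) :: real)"
proof (induction j)
  case (Suc j)
  have "fact q * real q ^ Suc j = real q * (fact q * real q ^ j)" by simp
  also have "\<dots> \<le> real (q + Suc j) * fact (q + j)"
    using Suc by (intro mult_mono) auto
  finally show ?case by simp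
qed simp

text \<open>The weights \<open>q ^ c / fact c\<close> of the Poisson law with mean \<open>q\<close>
  are largest at \<open>c = q\<close>. Multiplied over the letters, this makes the balanced count
  vector the most likely one.\<close>

lemma fact_ge_power:
  assumes "q \<ge> 1"
  shows "fact q * real q ^ c \<le> fact c * real q ^ q"
proof (cases "q \<le> c")
  case True
  then obtain j where c: "c = q + j" using le_Suc_ex by blast
  show ?thesis unfolding c power_add
    using mult_right_mono[OF fact_add_ge[of q j], of "real q ^ q"] by (simp add: mult_ac)
next
  case False
  then obtain j where q: "q = c + j" using le_Suc_ex nat_le_linear by blast
  have "(fact q :: real) \<le> fact c * real q ^ j"
    using fact_add_le[of c j] q by simp
  then have "fact q * real q ^ c \<le> fact c * real q ^ j * real q ^ c"
    by (rule mult_right_mono) simp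
  then show ?thesis using q by (simp add: power_add mult_ac)
qed

text \<open>Within distance \<open>D\<close> of the mean, a Poisson weight loses only a Gaussian
  factor: the ratio consists of \<open>j\<close> factors at most \<open>1 + j / q\<close> above the
  mean and \<open>1 + j / c\<close> below it. In the second case \<open>2 * D \<le> q\<close> gives
  \<open>c \<ge> q / 2\<close>, which is the source of the 2 in the exponent.\<close>

lemma fact_le_power_exp:
  assumes "q \<ge> 1" "\<bar>real c - real q\<bar> \<le> D" "2 * D \<le> q"
  shows "fact c * real q ^ q \<le> fact q * real q ^ c * exp (2 * D\<^sup>2 / q)"
proof (cases "q \<le> c")
  case True
  then obtain j where c: "c = q + j" using le_Suc_ex by blast
  have j: "real j \<le> D" using assms(2) c by simp
  have "real (q + j) ^ j = real q ^ j * (1 + j / q) ^ j"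
    using assms(1) by (simp add: power_mult_distrib[symmetric] field_simps)
  also have "(1 + j / q) ^ j \<le> exp (j / q) ^ j"
    by (intro power_mono exp_ge_add_one_self) auto
  also have "exp (real j / q) ^ j = exp (real j ^ 2 / q)"
    by (simp add: exp_of_nat_mult[symmetric] power2_eq_square)
  also have "\<dots> \<le> exp (2 * D\<^sup>2 / q)"
  proof -
    have "real j ^ 2 \<le> D\<^sup>2" using j by (intro power_mono) auto
    then have "real j ^ 2 \<le> 2 * D\<^sup>2" using zero_le_power2[of D] by linarith
    then show ?thesis by (simp add: divide_right_mono)
  qed
  finally have "real (q + j) ^ j \<le> real q ^ j * exp (2 * D\<^sup>2 / q)"
    by (simp add: mult_left_mono)
  then have "fact q * real (q + j) ^ j \<le> fact q * (real q ^ j * exp (2 * D\<^sup>2 / q))"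
    by (intro mult_left_mono) auto
  with fact_add_le[of q j] have "fact c \<le> fact q * (real q ^ j * exp (2 * D\<^sup>2 / q))"
    unfolding c by linarith
  then have "fact c * real q ^ q \<le> fact q * (real q ^ j * exp (2 * D\<^sup>2 / q)) * real q ^ q"
    by (intro mult_right_mono) auto
  then show ?thesis by (simp add: c power_add mult_ac)
next
  case False
  then obtain j where q: "q = c + j" using le_Suc_ex nat_le_linear by blast
  have j: "real j \<le> D" using assms(2) q by simp
  have c: "real c \<ge> q / 2" "c > 0" using assms j q by auto
  have "real q ^ j = real c ^ j * (1 + j / c) ^ j"
    using c(2) q by (simp add: power_mult_distrib[symmetric] field_simps)
  also have "(1 + j / c) ^ j \<le> exp (j / c) ^ j"
    by (intro power_mono exp_ge_add_one_self) auto
  also have "exp (real j / c) ^ j = exp (real j ^ 2 / c)"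
    by (simp add: exp_of_nat_mult[symmetric] power2_eq_square)
  also have "\<dots> \<le> exp (2 * D\<^sup>2 / q)"
  proof -
    have "real j ^ 2 / c \<le> D\<^sup>2 / (q / 2)"
      using j c assms(1) by (intro frac_le power_mono) auto
    then show ?thesis by (simp add: mult.commute)
  qed
  finally have "real q ^ j \<le> real c ^ j * exp (2 * D\<^sup>2 / q)"
    by (simp add: mult_left_mono)
  then have "fact c * real q ^ j \<le> fact c * real c ^ j * exp (2 * D\<^sup>2 / q)"
    by (simp add: mult.assoc)
  also have "\<dots> \<le> fact q * exp (2 * D\<^sup>2 / q)"
    using fact_add_ge[of c j] q by (intro mult_right_mono) auto
  finally have "fact c * real q ^ j * real q ^ c \<le> fact q * exp (2 * D\<^sup>2 / q) * real q ^ c"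
    by (intro mult_right_mono) auto
  moreover have "real q ^ q = real q ^ j * real q ^ c" using q by (simp add: power_add)
  ultimately show ?thesis by (simp add: mult_ac)
qed

text \<open>The multinomial probability at the most balanced count vector, up to the rounding factor.\<close>

definition central :: "nat \<Rightarrow> nat \<Rightarrow> real" where
  "central t a = (let q = a div t in
     fact a * real q ^ (t * q) / (fact q ^ t * real q ^ a * real t ^ a))"

text \<open>Stirling is applied to every factorial. The powers that remain form \<open>P\<close>,
  the effect of replacing \<open>a / t\<close> by its integer part; it stays between constants
  because the remainder is less than \<open>t\<close>.\<close>

lemma central_bounds:
  assumes "t \<ge> 1" "a \<ge> t"
  shows "central t a \<le> exp (3 * real t) * sqrt t ^ t / sqrt (real a + 1) ^ (t - 1)"
    "exp (- 2 * real t) / sqrt (real a + 1) ^ (t - 1) \<le> central t a"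
proof -
  define q where "q = a div t"
  define r where "r = a mod t"
  have a: "a = t * q + r" and r: "r < t" using assms by (auto simp: q_def r_def)
  have q: "q \<ge> 1" using assms by (simp add: q_def div_greater_zero_iff Suc_le_eq)
  define P where "P = (real a / real (t * q)) ^ a * exp (- real r)"
  have id: "(real a / exp 1) ^ a * real q ^ (t * q) / (((real q / exp 1) ^ q) ^ t * real q ^ a * real t ^ a) = P"
  proof -
    have "exp (real r) * exp (1::real) ^ (t * q) = exp 1 ^ a"
      by (simp add: a power_add exp_of_nat_mult[symmetric] exp_add[symmetric] algebra_simps)
    then have "exp (1::real) ^ (t * q) / exp 1 ^ a = exp (- real r)"
      by (simp add: exp_minus field_simps)
    then show ?thesis using q assms unfolding P_def
      by (simp add: power_divide power_mult[symmetric] power_mult_distrib field_simps mult.commute[of t q])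
  qed
  \<comment> \<open>The \<open>t\<close> denominators each contribute a root and
    \<open>fact a\<close> cancels one of them, which leaves \<open>t - 1\<close>.\<close>
  have sq: "sqrt (real a + 1) * (1 / sqrt (real a + 1) ^ t) = 1 / sqrt (real a + 1) ^ (t - 1)"
    using assms by (cases t) (auto simp: field_simps)
  have P_le: "P \<le> exp (2 * real t)"
  proof -
    have "real a / real (t * q) = 1 + r / (t * q)"
      using q assms by (simp add: a field_simps)
    then have "(real a / real (t * q)) ^ a \<le> exp (r / (t * q)) ^ a"
      by (simp only:) (intro power_mono exp_ge_add_one_self, auto)
    also have "\<dots> = exp (a * (r / (t * q)))" by (rule exp_of_nat_mult[symmetric])
    also have "\<dots> \<le> exp (2 * real t)"
    proof -
      have "t * 1 \<le> t * q" using q by (intro mult_left_mono) auto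
      then have "real a \<le> real (2 * (t * q))" using a r by linarith
      then have "a * (r / (t * q)) \<le> (2 * (t * q)) * (r / (t * q))"
        by (intro mult_right_mono) auto
      also have "\<dots> = 2 * r" using q assms by simp
      finally show ?thesis using r by simp
    qed
    finally have "(real a / real (t * q)) ^ a \<le> exp (2 * real t)" .
    moreover have "exp (- real r) \<le> 1" by simp
    ultimately have "P \<le> exp (2 * real t) * 1" unfolding P_def by (intro mult_mono) auto
    then show ?thesis by simp
  qed
  have P_ge: "exp (- real t) \<le> P"
  proof -
    have "1 \<le> real a / real (t * q)" using q assms by (simp add: a field_simps)
    then have "1 \<le> (real a / real (t * q)) ^ a" by simp
    moreover have "exp (- real t) \<le> exp (- real r)" using r by simp
    ultimately have "1 * exp (- real t) \<le> P" unfolding P_def by (intro mult_mono) auto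
    then show ?thesis by simp
  qed
  have q1: "(real a + 1) / t \<le> real q + 1"
  proof -
    have "a + 1 \<le> t * (q + 1)" using a r by simp
    then have "real (a + 1) \<le> real (t * (q + 1))" by (simp only: of_nat_le_iff)
    then have "real a + 1 \<le> t * (real q + 1)" by (simp add: algebra_simps)
    then show ?thesis using assms by (simp add: field_simps)
  qed
  let ?den = "real q ^ a * real t ^ a"
  have "central t a = fact a * real q ^ (t * q) / (fact q ^ t * ?den)"
    by (simp add: central_def Let_def q_def mult.assoc)
  also have "\<dots> \<le> (exp 1 * sqrt (real a + 1) * (real a / exp 1) ^ a) * real q ^ (t * q)
      / ((sqrt (real q + 1) * (real q / exp 1) ^ q) ^ t * ?den)"
    using q assms stirling[of a] stirling[of q]
    by (intro frac_le mult_right_mono power_mono mult_pos_pos zero_less_power) auto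
  also have "\<dots> = exp 1 * sqrt (real a + 1) / sqrt (real q + 1) ^ t * P"
    unfolding id[symmetric] by (simp add: power_mult_distrib mult_ac)
  also have "\<dots> \<le> exp 1 * sqrt (real a + 1) * (sqrt t ^ t / sqrt (real a + 1) ^ t) * exp (2 * real t)"
  proof -
    have "(sqrt (real a + 1) / sqrt t) ^ t \<le> sqrt (real q + 1) ^ t"
      using q1 by (intro power_mono) (auto simp flip: real_sqrt_divide)
    then have "1 / sqrt (real q + 1) ^ t \<le> 1 / (sqrt (real a + 1) / sqrt t) ^ t"
      using assms by (intro divide_left_mono) auto
    also have "\<dots> = sqrt t ^ t / sqrt (real a + 1) ^ t" by (simp add: power_divide)
    finally have "(exp 1 * sqrt (real a + 1)) * (1 / sqrt (real q + 1) ^ t) * P \<le>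
       (exp 1 * sqrt (real a + 1)) * (sqrt t ^ t / sqrt (real a + 1) ^ t) * exp (2 * real t)"
      using P_le by (intro mult_mono mult_left_mono) (auto simp: P_def)
    then show ?thesis by simp
  qed
  also have "\<dots> = exp (1 + 2 * real t) * sqrt t ^ t * (sqrt (real a + 1) * (1 / sqrt (real a + 1) ^ t))"
    by (simp add: exp_add)
  also have "\<dots> \<le> exp (3 * real t) * sqrt t ^ t * (sqrt (real a + 1) * (1 / sqrt (real a + 1) ^ t))"
    using assms by (intro mult_right_mono) auto
  finally show "central t a \<le> exp (3 * real t) * sqrt t ^ t / sqrt (real a + 1) ^ (t - 1)"
    unfolding sq by simp
  have "exp (- 2 * real t) / sqrt (real a + 1) ^ (t - 1) =
      sqrt (real a + 1) * (1 / sqrt (real a + 1) ^ t) * exp (- real t) * exp (- real t)"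
    unfolding sq by (simp add: exp_add[symmetric])
  also have "\<dots> \<le> sqrt (real a + 1) * (1 / sqrt (real q + 1) ^ t) * exp (- real t) * P"
  proof -
    have "q \<le> a" by (simp add: q_def)
    then show ?thesis
      by (intro mult_mono mult_left_mono divide_left_mono power_mono P_ge) auto
  qed
  also have "\<dots> = (sqrt (real a + 1) * (real a / exp 1) ^ a) * real q ^ (t * q)
      / ((exp 1 * sqrt (real q + 1) * (real q / exp 1) ^ q) ^ t * ?den)"
    unfolding id[symmetric] by (simp add: power_mult_distrib exp_of_nat_mult[symmetric] exp_minus field_simps)
  also have "\<dots> \<le> fact a * real q ^ (t * q) / (fact q ^ t * ?den)"
    using q assms stirling[of a] stirling[of q]
    by (intro frac_le mult_right_mono power_mono mult_pos_pos zero_less_power) auto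
  also have "\<dots> = central t a"
    by (simp add: central_def Let_def q_def mult.assoc)
  finally show "exp (- 2 * real t) / sqrt (real a + 1) ^ (t - 1) \<le> central t a" .
qed

definition ub :: "nat \<Rightarrow> real" where
  "ub t = exp (3 * real t) * sqrt t ^ t"

lemma ub_pos: "t \<ge> 1 \<Longrightarrow> ub t > 0"
  by (simp add: ub_def)

text \<open>No vector is more likely than the balanced one, which \<open>central_bounds\<close>
  controls. For fewer than \<open>t\<close> positions the constant \<open>ub t\<close> is so large
  that the bound exceeds 1.\<close>

lemma local_upper:
  assumes "t \<ge> 1" and A: "A \<subseteq> {..<n}"
  shows "pr t n (\<lambda>f. \<forall>i<t. cnt f A i = c i) \<le> ub t / sqrt (real (card A) + 1) ^ (t - 1)"
proof -
  let ?C = "exp (3 * real t) * sqrt t ^ t"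
  let ?a = "card A"
  have "pr t n (\<lambda>f. \<forall>i<t. cnt f A i = c i) \<le> ?C / sqrt (real ?a + 1) ^ (t - 1)"
  proof (cases "(\<Sum>i<t. c i) = ?a")
    case False
    have "pr t n (\<lambda>f. \<forall>i<t. cnt f A i = c i) = pr t n (\<lambda>f. False)"
    proof (rule pr_cong)
      fix f assume "f \<in> words t n"
      then have "(\<Sum>i<t. cnt f A i) = ?a" by (rule sum_cnt[OF _ A])
      moreover have "(\<Sum>i<t. cnt f A i) = (\<Sum>i<t. c i)" if "\<forall>i<t. cnt f A i = c i"
        using that by (intro sum.cong) auto
      ultimately show "(\<forall>i<t. cnt f A i = c i) \<longleftrightarrow> False" using False by metis
    qed
    also have "\<dots> = 0" by (simp add: pr_def avg_def)
    finally show ?thesis by simp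
  next
    case sum: True
    show ?thesis
    proof (cases "?a \<ge> t")
      case True
      define q where "q = ?a div t"
      have q: "q \<ge> 1" using True assms by (simp add: q_def div_greater_zero_iff Suc_le_eq)
      have "(\<Prod>i<t. fact q * real q ^ c i) \<le> (\<Prod>i<t. fact (c i) * real q ^ q)"
        by (intro prod_mono conjI fact_ge_power q) auto
      then have le: "fact q ^ t * real q ^ ?a \<le> (\<Prod>i<t. fact (c i)) * real q ^ (t * q)"
        by (simp add: prod.distrib power_sum[symmetric] sum power_mult[symmetric] mult.commute)
      have "pr t n (\<lambda>f. \<forall>i<t. cnt f A i = c i) = fact ?a / (\<Prod>i<t. fact (c i)) / real t ^ ?a"
        by (rule pr_multinomial[OF assms(1) A sum])
      also have "\<dots> = fact ?a * real q ^ (t * q) / ((\<Prod>i<t. fact (c i)) * real q ^ (t * q) * real t ^ ?a)"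
        using q by simp
      also have "\<dots> \<le> fact ?a * real q ^ (t * q) / (fact q ^ t * real q ^ ?a * real t ^ ?a)"
        using le q assms by (intro divide_left_mono mult_right_mono mult_pos_pos prod_pos) auto
      also have "\<dots> = central t ?a" by (simp add: central_def Let_def q_def)
      finally show ?thesis using central_bounds(1)[OF assms(1) True] by simp
    next
      case False
      have "sqrt (real ?a + 1) ^ (t - 1) \<le> sqrt t ^ (t - 1)"
        using False by (intro power_mono) auto
      also have "\<dots> \<le> sqrt t ^ t" using assms by (intro power_increasing) auto
      also have "\<dots> = 1 * sqrt t ^ t" by simp
      also have "\<dots> \<le> ?C" by (intro mult_right_mono) auto
      finally have "1 \<le> ?C / sqrt (real ?a + 1) ^ (t - 1)" by simp
      then show ?thesis using pr_le_1[OF assms(1)] order_trans by blast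
    qed
  qed
  then show ?thesis by (simp add: ub_def)
qed

text \<open>Count vectors within \<open>K\<close> standard deviations lose only a constant against
  the balanced one. The constant depends on \<open>t\<close> and \<open>K\<close> alone, which
  allows its use at all scales simultaneously.\<close>

lemma local_lower:
  assumes "t \<ge> 1" "K \<ge> 0"
  shows "\<exists>c>0. \<exists>a0. \<forall>n A d. A \<subseteq> {..<n} \<longrightarrow> a0 \<le> card A \<longrightarrow> (\<Sum>i<t. d i) = card A \<longrightarrow>
    (\<forall>i<t. \<bar>real (d i) - card A / t\<bar> \<le> K * sqrt (card A)) \<longrightarrow>
    c / sqrt (real (card A) + 1) ^ (t - 1) \<le> pr t n (\<lambda>f. \<forall>i<t. cnt f A i = d i)"
proof (intro exI conjI allI impI)
  let ?M = "4 * t * (K + 1)"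
  \<comment> \<open>One factor \<open>exp (- 2 * D\<^sup>2 / q)\<close> for each letter, evaluated
    with \<open>D = (K + 1) * sqrt a\<close> and \<open>q \<ge> a / (2 * t)\<close>.\<close>
  let ?c = "exp (- 2 * real t) * exp (- (4 * t * (K + 1)\<^sup>2)) ^ t"
  show "?c > 0" by simp
  fix n d and A :: "nat set"
  let ?a = "card A"
  assume A: "A \<subseteq> {..<n}" and a0: "nat \<lceil>?M\<^sup>2\<rceil> \<le> ?a" and sum: "(\<Sum>i<t. d i) = ?a"
    and near': "\<forall>i<t. \<bar>real (d i) - ?a / t\<bar> \<le> K * sqrt ?a"
  have near: "\<bar>real (d i) - ?a / t\<bar> \<le> K * sqrt ?a" if "i < t" for i
    using near' that by blast
  have "?M\<^sup>2 \<le> ?a" using a0 by linarith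
  then have sqa: "?M \<le> sqrt ?a" using assms by (intro real_le_rsqrt)
  have tK: "1 * 1 \<le> t * (K + 1)" using assms by (intro mult_mono) auto
  have sqa1: "4 \<le> sqrt ?a" using sqa tK by linarith
  define q where "q = ?a div t"
  have a_sq: "real ?a = sqrt ?a * sqrt ?a" by simp
  have at: "4 * t \<le> ?a"
  proof -
    have "4 * t * (1::real) \<le> ?M" using assms by (intro mult_left_mono) auto
    also have "\<dots> \<le> sqrt ?a" by (rule sqa)
    also have "\<dots> = sqrt ?a * 1" by simp
    also have "\<dots> \<le> sqrt ?a * sqrt ?a" using sqa1 by (intro mult_left_mono) linarith+
    finally have "real (4 * t) \<le> real ?a" by simp
    then show ?thesis by linarith
  qed
  have q: "q \<ge> 1" using at assms by (simp add: q_def div_greater_zero_iff Suc_le_eq)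
  have qr: "real q \<le> ?a / t" "?a / t - 1 \<le> q"
  proof -
    have "t * q \<le> ?a" "?a < t * (q + 1)"
      using assms(1) by (auto simp: q_def dividend_less_times_div)
    then have "real (t * q) \<le> real ?a" "real ?a < real (t * (q + 1))"
      by (simp_all only: of_nat_le_iff of_nat_less_iff)
    then show "real q \<le> ?a / t" "?a / t - 1 \<le> q"
      using assms(1) by (auto simp: field_simps)
  qed
  \<comment> \<open>The 1 added to \<open>K\<close> absorbs the rounding of \<open>a / t\<close> to
    \<open>q\<close>.\<close>
  define D where "D = (K + 1) * sqrt ?a"
  have half: "?a / (2 * t) \<le> q"
    using qr at assms by (simp add: field_simps)
  have D: "2 * D \<le> q"
  proof -
    have "(4 * t * (K + 1)) * sqrt ?a \<le> sqrt ?a * sqrt ?a" using sqa by (intro mult_right_mono) auto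
    then have "2 * D \<le> ?a / (2 * t)" using assms by (simp add: D_def field_simps)
    then show ?thesis using half by linarith
  qed
  have dD: "\<bar>real (d i) - q\<bar> \<le> D" if "i < t" for i
  proof -
    have "\<bar>real (d i) - q\<bar> \<le> K * sqrt ?a + 1" using near[OF that] qr by linarith
    also have "\<dots> \<le> D" using sqa1 unfolding D_def distrib_right by linarith
    finally show ?thesis .
  qed
  let ?E = "exp (4 * t * (K + 1)\<^sup>2)"
  have E: "exp (2 * D\<^sup>2 / q) \<le> ?E"
  proof -
    have "2 * D\<^sup>2 / q \<le> 2 * D\<^sup>2 / (?a / (2 * t))"
      using half at assms q by (intro divide_left_mono) (auto intro!: mult_pos_pos)
    also have "\<dots> = 4 * t * (K + 1)\<^sup>2"
      using at assms by (simp add: D_def power_mult_distrib)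
    finally show ?thesis by simp
  qed
  have "(\<Prod>i<t. fact (d i) * real q ^ q) \<le> (\<Prod>i<t. fact q * real q ^ d i * ?E)"
  proof (intro prod_mono conjI)
    fix i assume "i \<in> {..<t}"
    then have "fact (d i) * real q ^ q \<le> fact q * real q ^ d i * exp (2 * D\<^sup>2 / q)"
      using dD D q by (intro fact_le_power_exp) auto
    also have "\<dots> \<le> fact q * real q ^ d i * ?E"
      using E by (intro mult_left_mono) auto
    finally show "fact (d i) * real q ^ q \<le> fact q * real q ^ d i * ?E" .
  qed auto
  then have le: "(\<Prod>i<t. fact (d i)) * real q ^ (t * q) \<le> fact q ^ t * real q ^ ?a * ?E ^ t"
    by (simp add: prod.distrib power_sum[symmetric] sum power_mult[symmetric] mult.commute)
  have "exp (- 2 * real t) / sqrt (real ?a + 1) ^ (t - 1) / ?E ^ t \<le> central t ?a / ?E ^ t"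
    using central_bounds(2)[OF assms(1), of ?a] at by (intro divide_right_mono) auto
  also have "\<dots> = fact ?a * real q ^ (t * q) / (fact q ^ t * real q ^ ?a * ?E ^ t * real t ^ ?a)"
    by (simp add: central_def Let_def q_def)
  also have "\<dots> \<le> fact ?a * real q ^ (t * q) / ((\<Prod>i<t. fact (d i)) * real q ^ (t * q) * real t ^ ?a)"
    using le q assms by (intro divide_left_mono mult_right_mono mult_pos_pos prod_pos) auto
  also have "\<dots> = fact ?a / (\<Prod>i<t. fact (d i)) / real t ^ ?a"
    using q by simp
  also have "\<dots> = pr t n (\<lambda>f. \<forall>i<t. cnt f A i = d i)"
    by (rule pr_multinomial[OF assms(1) A sum, symmetric])
  finally show "?c / sqrt (real ?a + 1) ^ (t - 1) \<le> pr t n (\<lambda>f. \<forall>i<t. cnt f A i = d i)"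
    by (simp add: exp_minus field_simps)
qed

section \<open>Deviations of letter counts along a block\<close>

definition dev :: "nat \<Rightarrow> (nat \<Rightarrow> nat) \<Rightarrow> nat \<Rightarrow> nat \<Rightarrow> nat \<Rightarrow> real" where
  "dev t f i a l = real (cnt f {a..<a + l} i) - l / t"

fun maxdev :: "nat \<Rightarrow> (nat \<Rightarrow> nat) \<Rightarrow> nat \<Rightarrow> nat \<Rightarrow> nat \<Rightarrow> real" where
  "maxdev t f i a 0 = 0"
| "maxdev t f i a (Suc l) = max (maxdev t f i a l) \<bar>dev t f i a (Suc l)\<bar>"

lemma dev_0 [simp]: "dev t f i a 0 = 0"
  by (simp add: dev_def)

lemma dev_add: "dev t f i a (l + k) = dev t f i a l + dev t f i (a + l) k"
proof -
  have "cnt f {a..<a + (l + k)} i = cnt f {a..<a + l} i + cnt f {a + l..<a + l + k} i"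
    by (subst cnt_Un[symmetric]) (auto intro!: arg_cong2[where f = "cnt f"])
  then show ?thesis by (simp add: dev_def add_divide_distrib)
qed

lemma dev_Suc: "dev t f i a (Suc l) = dev t f i a l + (of_bool (f (a + l) = i) - 1 / t)"
proof -
  have "{p \<in> {a + l..<a + l + 1}. f p = i} = (if f (a + l) = i then {a + l} else {})" by auto
  then have "dev t f i (a + l) 1 = of_bool (f (a + l) = i) - 1 / t"
    by (simp add: dev_def cnt_def)
  then show ?thesis using dev_add[of t f i a l 1] by simp
qed

lemma maxdev_nonneg [simp]: "0 \<le> maxdev t f i a l"
  by (induction l) auto

lemma dev_le_maxdev: "l' \<le> l \<Longrightarrow> \<bar>dev t f i a l'\<bar> \<le> maxdev t f i a l"
  by (induction l) (auto simp: le_Suc_eq intro: max.coboundedI1)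

lemma dev_depends: "{a..<a + l} \<subseteq> B \<Longrightarrow> depends_on B (\<lambda>f. dev t f i a l)"
  using depends_on_mono[OF depends_on_comp[OF cnt_depends, where h = "\<lambda>c. real (c i) - l / t"]]
  by (simp add: dev_def)

lemma maxdev_depends: "{a..<a + l} \<subseteq> B \<Longrightarrow> depends_on B (\<lambda>f. maxdev t f i a l)"
proof (induction l)
  case (Suc l)
  have "{a..<a + l} \<subseteq> B" using Suc.prems by (rule order_trans[rotated]) auto
  then have 1: "depends_on B (\<lambda>f. maxdev t f i a l)" by (rule Suc.IH)
  have 2: "depends_on B (\<lambda>f. dev t f i a (Suc l))" using Suc.prems by (rule dev_depends)
  show ?case unfolding depends_on_def
  proof (intro allI impI)
    fix f g :: "nat \<Rightarrow> nat" assume "\<forall>p\<in>B. f p = g p"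
    then show "maxdev t f i a (Suc l) = maxdev t g i a (Suc l)"
      using 1[unfolded depends_on_def, rule_format, of f g]
        2[unfolded depends_on_def, rule_format, of f g] by simp
  qed
qed (simp add: depends_on_def)

text \<open>Doob's \<open>L\<^sup>2\<close> inequality. The potential \<open>4z\<^sup>2 - 4\<bar>z\<bar>M + 2M\<^sup>2\<close> of the walk \<open>z\<close> and its running
  maximum \<open>M\<close> dominates \<open>M\<^sup>2\<close> and increases by at most \<open>4\<close> per step on average.\<close>

lemma maxdev_second_moment:
  assumes "t \<ge> 1" "i < t" "a + l \<le> n"
  shows "avg t n (\<lambda>f. (maxdev t f i a l)\<^sup>2) \<le> 4 * real l"
proof -
  define \<Phi> where "\<Phi> = (\<lambda>z M :: real. 4 * z\<^sup>2 - 4 * \<bar>z\<bar> * M + 2 * M\<^sup>2)"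
  have \<Phi>_ge: "M\<^sup>2 \<le> \<Phi> z M" for z M
  proof -
    have "\<Phi> z M - M\<^sup>2 = (2 * \<bar>z\<bar> - M)\<^sup>2"
      by (simp add: \<Phi>_def power2_eq_square algebra_simps)
    then show ?thesis using zero_le_power2[of "2 * \<bar>z\<bar> - M"] by linarith
  qed
  have \<Phi>_max: "\<Phi> z (max M \<bar>z\<bar>) \<le> \<Phi> z M" for z M
  proof (cases "M \<le> \<bar>z\<bar>")
    case True
    have "\<Phi> z M - \<Phi> z \<bar>z\<bar> = 2 * (\<bar>z\<bar> - M)\<^sup>2"
      by (simp add: \<Phi>_def power2_eq_square algebra_simps)
    then have "\<Phi> z \<bar>z\<bar> \<le> \<Phi> z M" using zero_le_power2[of "\<bar>z\<bar> - M"] by linarith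
    then show ?thesis using True by (simp add: max_absorb2)
  qed (simp add: max_def)
  define \<xi> where "\<xi> = (\<lambda>j. of_bool (j = i) - 1 / real t)"
  have \<xi>0: "(\<Sum>j<t. \<xi> j) = 0"
    using assms by (simp add: \<xi>_def sum_subtractf of_bool_def)
  have \<xi>1: "(\<xi> j)\<^sup>2 \<le> 1" for j
    using assms by (auto simp: \<xi>_def abs_square_le_1 abs_le_iff field_simps)
  \<comment> \<open>The increments \<open>\<xi>\<close> have mean zero, so the mean of
    \<open>\<bar>z + \<xi> j\<bar>\<close> is at least \<open>\<bar>z\<bar>\<close> and the mixed
    term cannot grow. The square grows by at most 1 on average, and its coefficient is 4.\<close>
  have step: "(\<Sum>j<t. \<Phi> (z + \<xi> j) M) / t \<le> \<Phi> z M + 4" if "M \<ge> 0" for z M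
  proof -
    have "t * \<bar>z\<bar> = \<bar>\<Sum>j<t. z + \<xi> j\<bar>" by (simp add: sum.distrib \<xi>0 abs_mult)
    also have "\<dots> \<le> (\<Sum>j<t. \<bar>z + \<xi> j\<bar>)" by (rule sum_abs)
    finally have 1: "4 * M * (t * \<bar>z\<bar>) \<le> 4 * M * (\<Sum>j<t. \<bar>z + \<xi> j\<bar>)"
      using that by (intro mult_left_mono) auto
    have "(\<Sum>j<t. (z + \<xi> j)\<^sup>2) = t * z\<^sup>2 + 2 * z * (\<Sum>j<t. \<xi> j) + (\<Sum>j<t. (\<xi> j)\<^sup>2)"
      by (simp add: power2_sum sum.distrib sum_distrib_left mult_ac)
    moreover have "(\<Sum>j<t. (\<xi> j)\<^sup>2) \<le> (\<Sum>j<t. 1)" using \<xi>1 by (intro sum_mono)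
    ultimately have "(\<Sum>j<t. (z + \<xi> j)\<^sup>2) \<le> t * z\<^sup>2 + (\<Sum>j<t. 1)"
      unfolding \<xi>0 by linarith
    then have 2: "(\<Sum>j<t. (z + \<xi> j)\<^sup>2) \<le> t * z\<^sup>2 + t" by simp
    have "(\<Sum>j<t. \<Phi> (z + \<xi> j) M)
        = 4 * (\<Sum>j<t. (z + \<xi> j)\<^sup>2) - 4 * M * (\<Sum>j<t. \<bar>z + \<xi> j\<bar>) + t * (2 * M\<^sup>2)"
      by (simp add: \<Phi>_def sum.distrib sum_subtractf sum_distrib_left mult_ac)
    also have "\<dots> \<le> 4 * (t * z\<^sup>2 + t) - 4 * M * (t * \<bar>z\<bar>) + t * (2 * M\<^sup>2)"
      using 2 by (intro add_mono diff_mono 1 order_refl) simp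
    also have "\<dots> = t * (\<Phi> z M + 4)" by (simp add: \<Phi>_def algebra_simps)
    finally show ?thesis using assms by (simp add: field_simps)
  qed
  have "avg t n (\<lambda>f. \<Phi> (dev t f i a l) (maxdev t f i a l)) \<le> 4 * real l"
    using assms(3)
  proof (induction l)
    case 0
    then show ?case by (simp add: \<Phi>_def avg_def)
  next
    case (Suc l)
    let ?p = "a + l"
    have "avg t n (\<lambda>f. \<Phi> (dev t f i a (Suc l)) (maxdev t f i a (Suc l)))
        \<le> avg t n (\<lambda>f. \<Phi> (dev t f i a (Suc l)) (maxdev t f i a l))"
      by (intro avg_mono) (simp add: \<Phi>_max del: dev_0)
    also have "\<dots> = avg t n (\<lambda>g. avg t n (\<lambda>f. \<Phi> (dev t g i a l + \<xi> (f ?p)) (maxdev t g i a l)))"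
    proof -
      have "depends_on {a..<a + l} (\<lambda>f. dev t f i a l)"
        "depends_on {a..<a + l} (\<lambda>f. maxdev t f i a l)"
        by (auto intro: dev_depends maxdev_depends)
      then have "dev t (override_on g f {?p}) i a l = dev t g i a l"
        "maxdev t (override_on g f {?p}) i a l = maxdev t g i a l" for f g
        by (auto intro!: depends_on_override_off[where A = "{?p}"])
      then show ?thesis
        by (subst avg_fubini[OF assms(1), where A = "{?p}"]) (simp add: dev_Suc \<xi>_def)
    qed
    also have "\<dots> \<le> avg t n (\<lambda>g. \<Phi> (dev t g i a l) (maxdev t g i a l) + 4)"
    proof (rule avg_mono)
      fix g
      have "avg t n (\<lambda>f. \<Phi> (dev t g i a l + \<xi> (f ?p)) (maxdev t g i a l))
          = (\<Sum>j<t. \<Phi> (dev t g i a l + \<xi> j) (maxdev t g i a l)) / t"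
        using Suc.prems assms
        by (intro avg_single[where F = "\<lambda>j. \<Phi> (dev t g i a l + \<xi> j) (maxdev t g i a l)"]) auto
      then show "avg t n (\<lambda>f. \<Phi> (dev t g i a l + \<xi> (f ?p)) (maxdev t g i a l))
          \<le> \<Phi> (dev t g i a l) (maxdev t g i a l) + 4"
        using step[OF maxdev_nonneg] by simp
    qed
    also have "\<dots> = avg t n (\<lambda>f. \<Phi> (dev t f i a l) (maxdev t f i a l)) + 4"
      using avg_const[OF assms(1)] by (simp add: avg_add)
    also have "\<dots> \<le> 4 * real (Suc l)" using Suc by simp
    finally show ?case by simp
  qed
  moreover have "avg t n (\<lambda>f. (maxdev t f i a l)\<^sup>2) \<le> avg t n (\<lambda>f. \<Phi> (dev t f i a l) (maxdev t f i a l))"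
    by (intro avg_mono \<Phi>_ge)
  ultimately show ?thesis by linarith
qed

lemma pr_maxdev:
  assumes "t \<ge> 1" "i < t" "a + l \<le> n" "0 < u"
  shows "pr t n (\<lambda>f. u < maxdev t f i a l) \<le> 4 * real l / u\<^sup>2"
proof -
  have "pr t n (\<lambda>f. u < maxdev t f i a l) \<le> pr t n (\<lambda>f. u\<^sup>2 \<le> (maxdev t f i a l)\<^sup>2)"
    using assms(4) by (intro pr_mono power_mono) auto
  also have "\<dots> \<le> avg t n (\<lambda>f. (maxdev t f i a l)\<^sup>2) / u\<^sup>2"
    using assms(4) by (intro markov) auto
  also have "\<dots> \<le> 4 * real l / u\<^sup>2"
    using maxdev_second_moment[OF assms(1-3)] by (intro divide_right_mono) auto
  finally show ?thesis .
qed

text \<open>Once the letters on \<open>B\<close> are known, the counts on \<open>A\<close> have a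
  single admissible value \<open>v f\<close>. Hitting it costs the local limit factor, whatever that
  value is.\<close>

lemma forced_upper:
  assumes "t \<ge> 1" "depends_on B Q" "depends_on B v" "A \<inter> B = {}" "A \<subseteq> {..<n}"
  shows "pr t n (\<lambda>f. Q f \<and> (\<forall>i<t. cnt f A i = v f i))
    \<le> ub t / sqrt (real (card A) + 1) ^ (t - 1) * pr t n Q"
proof (rule pr_cond_le[OF assms(1,2,4)])
  show "0 \<le> ub t / sqrt (real (card A) + 1) ^ (t - 1)"
    using ub_pos[OF assms(1)] by simp
  fix g
  have "v (override_on g f A) = v g" for f
    by (rule depends_on_override_off[OF assms(3,4)])
  then show "pr t n (\<lambda>f. \<forall>i<t. cnt (override_on g f A) A i = v (override_on g f A) i)
    \<le> ub t / sqrt (real (card A) + 1) ^ (t - 1)"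
    using local_upper[OF assms(1,5)] by simp
qed

lemma forced_upper':
  assumes "t \<ge> 1" "depends_on B Q" "depends_on B v" "A \<inter> B = {}" "A \<subseteq> {..<n}"
    and "r \<le> real (card A) + 1" "0 < r" "pr t n Q \<le> u"
  shows "pr t n (\<lambda>f. Q f \<and> (\<forall>i<t. cnt f A i = v f i)) \<le> ub t / sqrt r ^ (t - 1) * u"
proof -
  have "ub t / sqrt (real (card A) + 1) ^ (t - 1) \<le> ub t / sqrt r ^ (t - 1)"
    using ub_pos[OF assms(1)] assms(6,7)
    by (intro divide_left_mono power_mono mult_pos_pos zero_less_power) auto
  then have "ub t / sqrt (real (card A) + 1) ^ (t - 1) * pr t n Q \<le> ub t / sqrt r ^ (t - 1) * u"
    using assms(7,8) pr_nonneg ub_pos[OF assms(1)] by (intro mult_mono) auto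
  then show ?thesis using forced_upper[OF assms(1-5)] by linarith
qed

text \<open>Prescribing the counts of a block does not spoil the control of its prefixes. The block
  is halved: if one half has a large deviation, the counts of the other are still forced and cost
  the same local factor as the prescription itself. So the conditional probability of a deviation
  beyond \<open>R * sqrt b\<close> is of order \<open>1 / R\<^sup>2\<close>, uniformly in
  \<open>b\<close>.\<close>

lemma block_prob:
  assumes "t \<ge> 1"
  shows "\<exists>c>0. \<exists>R>0. \<exists>b0. \<forall>n a b d. a + b \<le> n \<longrightarrow> b0 \<le> b \<longrightarrow>
    (\<Sum>i<t. d i) = b \<longrightarrow> (\<forall>i<t. \<bar>real (d i) - b / t\<bar> \<le> sqrt b) \<longrightarrow>
    c / sqrt (real b + 1) ^ (t - 1) \<le> pr t n (\<lambda>f. (\<forall>i<t. cnt f {a..<a + b} i = d i) \<and>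
      (\<forall>i<t. \<forall>l\<le>b. \<bar>dev t f i a l\<bar> \<le> R * sqrt b))"
proof -
  obtain c1 :: real and a0 :: nat where c1: "c1 > 0" "\<forall>n A d. A \<subseteq> {..<n} \<longrightarrow> a0 \<le> card A \<longrightarrow>
    (\<Sum>i<t. d i) = card A \<longrightarrow>
    (\<forall>i<t. \<bar>real (d i) - card A / t\<bar> \<le> 1 * sqrt (card A)) \<longrightarrow>
    c1 / sqrt (real (card A) + 1) ^ (t - 1) \<le> pr t n (\<lambda>f. \<forall>i<t. cnt f A i = d i)"
    using local_lower[OF assms zero_le_one] by blast
  define U where "U = ub t * sqrt 2 ^ (t - 1)"
  have U: "U > 0" using ub_pos[OF assms] by (simp add: U_def)
  \<comment> \<open>There are \<open>2 * t\<close> bad events, one for each half and letter. With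
    this \<open>R\<close> each takes at most \<open>c1 / (4 * t)\<close> of the constant, so half of
    \<open>c1\<close> survives.\<close>
  define R where "R = sqrt (64 * t * U / c1)"
  have R: "R > 0" using U c1(1) assms by (simp add: R_def)
  have R2: "R\<^sup>2 = 64 * t * U / c1" using U c1(1) by (simp add: R_def)
  show ?thesis
  proof (rule exI[of _ "c1 / 2"], rule conjI, simp add: c1(1), rule exI[of _ R], rule conjI, rule R,
      intro exI[of _ "max a0 1"] allI impI)
    fix n a b :: nat and d :: "nat \<Rightarrow> nat"
    assume ab: "a + b \<le> n" and b0: "max a0 1 \<le> b" and sum: "(\<Sum>i<t. d i) = b"
      and near: "\<forall>i<t. \<bar>real (d i) - b / t\<bar> \<le> sqrt b"
    define P where "P = (\<lambda>f. \<forall>i<t. cnt f {a..<a + b} i = d i)"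
    define b1 where "b1 = b div 2"
    define b2 where "b2 = b - b1"
    have b: "b = b1 + b2" and bb: "(real b + 1) / 2 \<le> real b1 + 1" "(real b + 1) / 2 \<le> real b2 + 1"
      by (auto simp: b1_def b2_def)
    let ?A1 = "{a..<a + b1}" and ?A2 = "{a + b1..<a + b1 + b2}"
    have A12: "{a..<a + b} = ?A1 \<union> ?A2" "?A1 \<inter> ?A2 = {}" by (auto simp: b)
    have cnt12: "cnt f {a..<a + b} i = cnt f ?A1 i + cnt f ?A2 i" for f i
      unfolding A12(1) by (rule cnt_Un) auto
    \<comment> \<open>Half of the allowed deviation, because a prefix that ends in the second half
      is the sum of two parts.\<close>
    define lam where "lam = R * sqrt b / 2"
    have b_pos: "b > 0" using b0 by simp
    have l0: "lam > 0" using R b_pos by (simp add: lam_def)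
    have l02: "lam\<^sup>2 = R\<^sup>2 * b / 4" by (simp add: lam_def power_mult_distrib power_divide)
    let ?S = "sqrt (real b + 1) ^ (t - 1)"
    have half: "ub t / sqrt ((real b + 1) / 2) ^ (t - 1) = U / ?S"
      by (simp add: U_def real_sqrt_divide power_divide)
    have bad: "U / ?S * (4 * real b / lam\<^sup>2) = c1 / (4 * t) / ?S"
      unfolding l02 R2 using U c1(1) b_pos assms by (simp add: field_simps)
    have bad1: "pr t n (\<lambda>f. P f \<and> lam < maxdev t f i a b1) \<le> c1 / (4 * t) / ?S" if "i < t" for i
    proof -
      have "pr t n (\<lambda>f. P f \<and> lam < maxdev t f i a b1)
        \<le> pr t n (\<lambda>f. lam < maxdev t f i a b1 \<and> (\<forall>i<t. cnt f ?A2 i = (\<lambda>c i. d i - c i) (cnt f ?A1) i))"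
        by (intro pr_mono) (auto simp: P_def cnt12)
      also have "\<dots> \<le> ub t / sqrt ((real b + 1) / 2) ^ (t - 1) * (4 * real b / lam\<^sup>2)"
      proof (rule forced_upper'[OF assms, where B = ?A1])
        show "depends_on ?A1 (\<lambda>f. lam < maxdev t f i a b1)"
          by (intro depends_on_comp[where h = "\<lambda>x. lam < x"] maxdev_depends) auto
        show "depends_on ?A1 (\<lambda>f. (\<lambda>c i. d i - c i) (cnt f ?A1))"
          by (rule depends_on_comp[OF cnt_depends])
        have "pr t n (\<lambda>f. lam < maxdev t f i a b1) \<le> 4 * real b1 / lam\<^sup>2"
          using ab b that l0 assms by (intro pr_maxdev) auto
        also have "\<dots> \<le> 4 * real b / lam\<^sup>2" by (intro divide_right_mono) (auto simp: b)
        finally show "pr t n (\<lambda>f. lam < maxdev t f i a b1) \<le> 4 * real b / lam\<^sup>2" .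
      qed (use ab b bb b_pos A12 in auto)
      also have "\<dots> = c1 / (4 * t) / ?S" unfolding half bad ..
      finally show ?thesis .
    qed
    have bad2: "pr t n (\<lambda>f. P f \<and> lam < maxdev t f i (a + b1) b2) \<le> c1 / (4 * t) / ?S" if "i < t" for i
    proof -
      have "pr t n (\<lambda>f. P f \<and> lam < maxdev t f i (a + b1) b2)
        \<le> pr t n (\<lambda>f. lam < maxdev t f i (a + b1) b2 \<and> (\<forall>i<t. cnt f ?A1 i = (\<lambda>c i. d i - c i) (cnt f ?A2) i))"
        by (intro pr_mono) (auto simp: P_def cnt12)
      also have "\<dots> \<le> ub t / sqrt ((real b + 1) / 2) ^ (t - 1) * (4 * real b / lam\<^sup>2)"
      proof (rule forced_upper'[OF assms, where B = ?A2])
        show "depends_on ?A2 (\<lambda>f. lam < maxdev t f i (a + b1) b2)"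
          by (intro depends_on_comp[where h = "\<lambda>x. lam < x"] maxdev_depends) auto
        show "depends_on ?A2 (\<lambda>f. (\<lambda>c i. d i - c i) (cnt f ?A2))"
          by (rule depends_on_comp[OF cnt_depends])
        have "pr t n (\<lambda>f. lam < maxdev t f i (a + b1) b2) \<le> 4 * real b2 / lam\<^sup>2"
          using ab b that l0 assms by (intro pr_maxdev) auto
        also have "\<dots> \<le> 4 * real b / lam\<^sup>2" by (intro divide_right_mono) (auto simp: b)
        finally show "pr t n (\<lambda>f. lam < maxdev t f i (a + b1) b2) \<le> 4 * real b / lam\<^sup>2" .
      qed (use ab b bb b_pos A12 in auto)
      also have "\<dots> = c1 / (4 * t) / ?S" unfolding half bad ..
      finally show ?thesis .
    qed
    let ?G = "\<lambda>f. P f \<and> (\<forall>i<t. \<forall>l\<le>b. \<bar>dev t f i a l\<bar> \<le> R * sqrt b)"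
    have good: "\<bar>dev t f i a l\<bar> \<le> R * sqrt b"
      if "maxdev t f i a b1 \<le> lam" "maxdev t f i (a + b1) b2 \<le> lam" "l \<le> b" for f i l
    proof (cases "l \<le> b1")
      case True
      then have "\<bar>dev t f i a l\<bar> \<le> lam" using dev_le_maxdev that(1) order_trans by blast
      then show ?thesis using l0 by (simp add: lam_def)
    next
      case False
      then obtain k where k: "l = b1 + k" using le_Suc_ex nat_le_linear by blast
      have "\<bar>dev t f i a b1\<bar> \<le> lam" using dev_le_maxdev[of b1 b1] that(1) order_trans by blast
      moreover have "\<bar>dev t f i (a + b1) k\<bar> \<le> lam"
        using dev_le_maxdev[of k b2 t f i "a + b1"] that(2,3) k b by linarith
      ultimately show ?thesis by (simp add: k dev_add lam_def)
    qed
    have "{a..<a + b} \<subseteq> {..<n}" using ab by auto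
    then have "c1 / ?S \<le> pr t n P"
      unfolding P_def using c1(2)[rule_format, of "{a..<a + b}" n d] ab b0 sum near by simp
    also have "\<dots> \<le> pr t n (\<lambda>f. ?G f \<or> ((\<exists>i\<in>{..<t}. P f \<and> lam < maxdev t f i a b1) \<or>
        (\<exists>i\<in>{..<t}. P f \<and> lam < maxdev t f i (a + b1) b2)))"
      using good by (intro pr_mono) (auto simp: not_less)
    also have "\<dots> \<le> pr t n ?G + ((\<Sum>i<t. pr t n (\<lambda>f. P f \<and> lam < maxdev t f i a b1)) +
        (\<Sum>i<t. pr t n (\<lambda>f. P f \<and> lam < maxdev t f i (a + b1) b2)))"
      by (intro order_trans[OF pr_Un] add_mono order_refl pr_Ex) auto
    also have "\<dots> \<le> pr t n ?G + ((\<Sum>i<t. c1 / (4 * t) / ?S) + (\<Sum>i<t. c1 / (4 * t) / ?S))"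
      using bad1 bad2 by (intro add_mono sum_mono order_refl) auto
    also have "(\<Sum>i<t. c1 / (4 * t) / ?S) = c1 / 4 / ?S"
      using assms by (simp add: field_simps)
    finally have "c1 / ?S \<le> pr t n ?G + (c1 / 4 / ?S + c1 / 4 / ?S)" .
    moreover have "c1 / ?S = c1 / 2 / ?S + (c1 / 4 / ?S + c1 / 4 / ?S)" by (simp add: field_simps)
    ultimately show "c1 / 2 / ?S \<le> pr t n (\<lambda>f. (\<forall>i<t. cnt f {a..<a + b} i = d i) \<and>
        (\<forall>i<t. \<forall>l\<le>b. \<bar>dev t f i a l\<bar> \<le> R * sqrt b))"
      by (simp add: P_def)
  qed
qed

section \<open>From fair cuts of a necklace to halving sets of a word\<close>

text \<open>Giving the two thieves alternate intervals, \<open>side n S\<close> is the share of the thief who does not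
  get the last interval. Whether a position \<open>p\<close> belongs to it depends only on the cuts to the right
  of \<open>p\<close>, so \<open>side n S\<close> lies to the left of the last cut.\<close>

definition side :: "nat \<Rightarrow> nat set \<Rightarrow> nat set" where
  "side n S = {p \<in> {..<n}. odd (card {c \<in> S. p < c})}"

definition balanced :: "nat \<Rightarrow> nat \<Rightarrow> (nat \<Rightarrow> nat) \<Rightarrow> bool" where
  "balanced t m f \<longleftrightarrow> (\<forall>i<t. cnt f {..<2 * t * m} i = 2 * m)"

definition halves :: "nat \<Rightarrow> nat \<Rightarrow> nat set \<Rightarrow> (nat \<Rightarrow> nat) \<Rightarrow> bool" where
  "halves t m S f \<longleftrightarrow> (\<forall>i<t. cnt f (side (2 * t * m) S) i = m)"

definition min_cuts :: "nat \<Rightarrow> nat \<Rightarrow> (nat \<Rightarrow> nat) \<Rightarrow> nat" where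
  "min_cuts t m f = (LEAST r. \<exists>S\<subseteq>{1..<2 * t * m}. halves t m S f \<and> card S = r)"

lemma side_subset: "side n S \<subseteq> {..<n}"
  by (auto simp: side_def)

lemma finite_side [simp, intro]: "finite (side n S)"
  by (rule finite_subset[OF side_subset]) simp

text \<open>Walking left from the last position, membership in \<open>A\<close> and the parity of
  the number of cuts to the right flip at the same places. They agree at the start because
  \<open>n - 1\<close> lies outside \<open>A\<close> and has no cut to its right.\<close>

lemma side_colour_changes:
  assumes "A \<subseteq> {..<n}" "n - 1 \<notin> A"
  shows "side n {c \<in> {1..<n}. (c - 1 \<in> A) \<noteq> (c \<in> A)} = A"
proof -
  define S where "S = {c \<in> {1..<n}. (c - 1 \<in> A) \<noteq> (c \<in> A)}"
  have S: "finite S" by (simp add: S_def)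
  have *: "odd (card {c \<in> S. n - 1 - k < c}) \<longleftrightarrow> n - 1 - k \<in> A" if "k < n" for k
    using that
  proof (induction k)
    case 0
    have "card {c \<in> S. n - 1 < c} = card ({} :: nat set)" by (intro arg_cong[where f = card]) (auto simp: S_def)
    then show ?case using assms(2) by simp
  next
    case (Suc k)
    define p where "p = n - 1 - Suc k"
    have p: "n - 1 - k = Suc p" "Suc p < n" using Suc.prems by (auto simp: p_def)
    have eq: "{c \<in> S. p < c} = (if Suc p \<in> S then {Suc p} else {}) \<union> {c \<in> S. Suc p < c}"
      by (auto, metis Suc_lessI)
    have "card {c \<in> S. p < c} = (if Suc p \<in> S then 1 else 0) + card {c \<in> S. Suc p < c}"
      unfolding eq using S by (subst card_Un_disjoint) auto
    moreover have "Suc p \<in> S \<longleftrightarrow> (p \<in> A) \<noteq> (Suc p \<in> A)" using p by (auto simp: S_def)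
    moreover have "odd (card {c \<in> S. Suc p < c}) \<longleftrightarrow> Suc p \<in> A" using Suc p by simp
    ultimately show ?case unfolding p_def[symmetric] by auto
  qed
  have "odd (card {c \<in> S. p < c}) \<longleftrightarrow> p \<in> A" if "p < n" for p
  proof -
    have "n - 1 - (n - 1 - p) = p" "n - 1 - p < n" using that by auto
    then show ?thesis using *[of "n - 1 - p"] by simp
  qed
  then show ?thesis using assms(1) unfolding side_def S_def[symmetric] by auto
qed

lemma intervals_props:
  assumes "S \<subseteq> {1..<n}"
  shows "I \<in> intervals n S \<Longrightarrow> I \<subseteq> {..<n} \<and> I \<noteq> {}"
    and "\<lbrakk>I \<in> intervals n S; J \<in> intervals n S; p \<in> I; p \<in> J\<rbrakk> \<Longrightarrow> I = J"
    and "p < n \<Longrightarrow> \<exists>I\<in>intervals n S. p \<in> I"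
    and "\<lbrakk>I \<in> intervals n S; p \<in> I; q \<in> I\<rbrakk> \<Longrightarrow> {c \<in> S. p < c} = {c \<in> S. q < c}"
    and "\<lbrakk>c \<in> {1..<n}; c \<notin> S; I \<in> intervals n S\<rbrakk> \<Longrightarrow> c - 1 \<in> I \<Longrightarrow> c \<in> I"
    and "finite (intervals n S)"
proof -
  have S: "finite S" using assms finite_subset by blast
  show 1: "I \<subseteq> {..<n} \<and> I \<noteq> {}" if I: "I \<in> intervals n S" for I
    using I assms by (fastforce simp: intervals_def)
  show "I = J" if I: "I \<in> intervals n S" and J: "J \<in> intervals n S" and p: "p \<in> I" "p \<in> J" for I J p
  proof -
    obtain a b where I: "I = {a..<b}" "a \<in> insert 0 S" "b \<in> insert n S" "S \<inter> {a<..<b} = {}"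
      using I by (auto simp: intervals_def)
    obtain a' b' where J: "J = {a'..<b'}" "a' \<in> insert 0 S" "b' \<in> insert n S" "S \<inter> {a'<..<b'} = {}"
      using J by (auto simp: intervals_def)
    have *: "x \<notin> S \<or> x \<le> a \<or> b \<le> x" "x \<notin> S \<or> x \<le> a' \<or> b' \<le> x" for x
      using I(4) J(4) by (auto simp: disjoint_iff not_less)
    have pp: "a \<le> p" "p < b" "a' \<le> p" "p < b'" using p I J by auto
    have n: "x < n" if "x \<in> S" for x using that assms by auto
    have "b \<le> n" "b' \<le> n" using I(3) J(3) n by (auto intro: less_imp_le)
    have "a = a'" using *(1)[of a'] *(2)[of a] pp I(2) J(2) by auto
    moreover have "b = b'"
      using *(1)[of b'] *(2)[of b] pp I(3) J(3) \<open>b \<le> n\<close> \<open>b' \<le> n\<close> by auto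
    ultimately show ?thesis using I J by simp
  qed
  show "\<exists>I\<in>intervals n S. p \<in> I" if p: "p < n" for p
  proof -
    define a where "a = Max {x \<in> insert 0 S. x \<le> p}"
    define b where "b = Min {x \<in> insert n S. p < x}"
    have fa: "finite {x \<in> insert 0 S. x \<le> p}" "{x \<in> insert 0 S. x \<le> p} \<noteq> {}"
      and fb: "finite {x \<in> insert n S. p < x}" "{x \<in> insert n S. p < x} \<noteq> {}"
      using S p by auto
    have a: "a \<in> insert 0 S" "a \<le> p" using Max_in[OF fa] unfolding a_def by auto
    have b: "b \<in> insert n S" "p < b" using Min_in[OF fb] unfolding b_def by auto
    have "S \<inter> {a<..<b} = {}"
    proof (rule ccontr)
      assume "S \<inter> {a<..<b} \<noteq> {}"
      then obtain x where x: "x \<in> S" "a < x" "x < b" by auto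
      show False
      proof (cases "x \<le> p")
        case True
        then have "x \<le> a" unfolding a_def using x fa by (intro Max_ge) auto
        then show False using x by simp
      next
        case False
        then have "b \<le> x" unfolding b_def using x fb by (intro Min_le) auto
        then show False using x by simp
      qed
    qed
    with a b have "{a..<b} \<in> intervals n S"
      unfolding intervals_def by (intro CollectI exI[of "\<lambda>x. \<exists>y. _ x y" a], intro exI[of _ b]) auto
    then show ?thesis using a b by (intro bexI[of _ "{a..<b}"]) auto
  qed
  show "{c \<in> S. p < c} = {c \<in> S. q < c}" if I: "I \<in> intervals n S" and pq: "p \<in> I" "q \<in> I" for I p q
  proof -
    obtain a b where I: "I = {a..<b}" "S \<inter> {a<..<b} = {}"
      using I by (auto simp: intervals_def)
    have "x < c \<longleftrightarrow> b \<le> c" if "c \<in> S" "x \<in> I" for c x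
    proof -
      have "c \<notin> {a<..<b}" using I that by blast
      then show ?thesis using I that by auto
    qed
    then show ?thesis using pq by blast
  qed
  show "c \<in> I" if c: "c \<in> {1..<n}" "c \<notin> S" and I: "I \<in> intervals n S" and "c - 1 \<in> I" for c I
  proof -
    obtain a b where I: "I = {a..<b}" "b \<in> insert n S"
      using I by (auto simp: intervals_def)
    then show ?thesis using that by (cases "b = c") auto
  qed
  show "finite (intervals n S)"
    by (rule finite_subset[of _ "Pow {..<n}"]) (use 1 in auto)
qed

lemma cnt_Union_intervals:
  assumes "S \<subseteq> {1..<n}"
  shows "(\<Sum>I | I \<in> intervals n S \<and> P I. beads_of_type w i I) = cnt ((!) w) (\<Union>{I \<in> intervals n S. P I}) i"
proof -
  note ip = intervals_props[OF assms]
  have "cnt ((!) w) (\<Union>I\<in>{I \<in> intervals n S. P I}. I) i = (\<Sum>I | I \<in> intervals n S \<and> P I. cnt ((!) w) I i)"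
  proof (rule cnt_UN)
    show "disjoint_family_on (\<lambda>I. I) {I \<in> intervals n S. P I}"
      unfolding disjoint_family_on_def using ip(2) by blast
  qed (use ip(1,6) finite_subset in auto)
  then show ?thesis by (simp add: beads_of_type_def cnt_def)
qed

text \<open>With two collections, the assignment of the intervals is determined by the union
  \<open>A\<close> of those sent to collection 1. The quantification over functions on intervals
  thus becomes one over sets of positions.\<close>

lemma fair_cuts_iff:
  assumes "S \<subseteq> {1..<n}" "length w = n"
  shows "fair_cuts 2 t m w S \<longleftrightarrow> (\<exists>A\<subseteq>{..<n}. (\<forall>i<t. cnt ((!) w) A i = m \<and> cnt ((!) w) ({..<n} - A) i = m)
    \<and> (\<forall>I\<in>intervals n S. I \<subseteq> A \<or> I \<inter> A = {}))"
proof
  note ip = intervals_props[OF assms(1)]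
  assume "fair_cuts 2 t m w S"
  then obtain f :: "nat set \<Rightarrow> nat" where f: "f ` intervals n S \<subseteq> {..<2}"
    "\<forall>j<2. \<forall>i<t. (\<Sum>I | I \<in> intervals n S \<and> f I = j. beads_of_type w i I) = m"
    unfolding fair_cuts_def assms(2) by blast
  define A where "A = (\<lambda>j. \<Union>{I \<in> intervals n S. f I = j})"
  have "{..<n} - A 1 = A 0"
  proof (intro equalityI subsetI)
    fix p assume p: "p \<in> {..<n} - A 1"
    then obtain I where I: "I \<in> intervals n S" "p \<in> I" using ip(3) by blast
    then have "f I \<noteq> 1" using p by (auto simp: A_def)
    moreover have "f I < 2" using f(1) I by auto
    ultimately have "f I = 0" by linarith
    then show "p \<in> A 0" using I by (auto simp: A_def)
  next
    fix p assume p: "p \<in> A 0"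
    then obtain I where I: "I \<in> intervals n S" "p \<in> I" "f I = 0" by (auto simp: A_def)
    have "p \<notin> A 1"
    proof
      assume "p \<in> A 1"
      then obtain J where "J \<in> intervals n S" "p \<in> J" "f J = 1" by (auto simp: A_def)
      with I ip(2)[of I J p] show False by simp
    qed
    then show "p \<in> {..<n} - A 1" using I ip(1) by blast
  qed
  moreover have "A 1 \<subseteq> {..<n}" using ip(1) by (auto simp: A_def)
  moreover have "cnt ((!) w) (A j) i = m" if "j < 2" "i < t" for i j
    using f(2)[rule_format, OF that] unfolding A_def cnt_Union_intervals[OF assms(1)] .
  moreover have "I \<subseteq> A 1 \<or> I \<inter> A 1 = {}" if I: "I \<in> intervals n S" for I
  proof (cases "f I = 1")
    case False
    have "I \<inter> J = {}" if "J \<in> intervals n S" "f J = 1" for J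
      using that I False ip(2)[of I J] by blast
    then show ?thesis by (auto simp: A_def)
  qed (use I in \<open>auto simp: A_def\<close>)
  ultimately show "\<exists>A\<subseteq>{..<n}. (\<forall>i<t. cnt ((!) w) A i = m \<and> cnt ((!) w) ({..<n} - A) i = m)
    \<and> (\<forall>I\<in>intervals n S. I \<subseteq> A \<or> I \<inter> A = {})"
    by (intro exI[of _ "A 1"]) auto
next
  note ip = intervals_props[OF assms(1)]
  assume "\<exists>A\<subseteq>{..<n}. (\<forall>i<t. cnt ((!) w) A i = m \<and> cnt ((!) w) ({..<n} - A) i = m)
    \<and> (\<forall>I\<in>intervals n S. I \<subseteq> A \<or> I \<inter> A = {})"
  then obtain A where A: "A \<subseteq> {..<n}" "\<forall>i<t. cnt ((!) w) A i = m \<and> cnt ((!) w) ({..<n} - A) i = m"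
    "\<forall>I\<in>intervals n S. I \<subseteq> A \<or> I \<inter> A = {}"
    by blast
  define f :: "nat set \<Rightarrow> nat" where "f = (\<lambda>I. if I \<subseteq> A then 1 else 0)"
  have 1: "\<Union>{I \<in> intervals n S. f I = 1} = A"
  proof (intro equalityI subsetI)
    fix p assume p: "p \<in> A"
    then obtain I where I: "I \<in> intervals n S" "p \<in> I" using ip(3) A(1) by blast
    then have "I \<subseteq> A" using A(3) p by blast
    then show "p \<in> \<Union>{I \<in> intervals n S. f I = 1}" using I by (auto simp: f_def)
  qed (auto simp: f_def split: if_splits)
  have 0: "\<Union>{I \<in> intervals n S. f I = 0} = {..<n} - A"
  proof (intro equalityI subsetI)
    fix p assume p: "p \<in> {..<n} - A"
    then obtain I where I: "I \<in> intervals n S" "p \<in> I" using ip(3) by blast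
    then have "\<not> I \<subseteq> A" using p by blast
    then show "p \<in> \<Union>{I \<in> intervals n S. f I = 0}" using I by (auto simp: f_def)
  next
    fix p assume "p \<in> \<Union>{I \<in> intervals n S. f I = 0}"
    then obtain I where I: "I \<in> intervals n S" "p \<in> I" "\<not> I \<subseteq> A" by (auto simp: f_def split: if_splits)
    then show "p \<in> {..<n} - A" using A(3)[rule_format, OF I(1)] ip(1)[OF I(1)] by blast
  qed
  show "fair_cuts 2 t m w S"
    unfolding fair_cuts_def assms(2)
  proof (intro conjI exI[of _ f] allI impI)
    fix i j :: nat assume "j < 2" "i < t"
    then show "(\<Sum>I | I \<in> intervals n S \<and> f I = j. beads_of_type w i I) = m"
      unfolding cnt_Union_intervals[OF assms(1)] using 0 1 A by (cases "j = 0") (auto simp: less_2_cases_iff)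
  qed (use assms in \<open>auto simp: f_def\<close>)
qed

lemma cnt_Compl:
  assumes "A \<subseteq> {..<n}" "cnt f A i = m" "cnt f {..<n} i = 2 * m"
  shows "cnt f ({..<n} - A) i = m"
proof -
  have "{..<n} = A \<union> ({..<n} - A)" using assms(1) by auto
  then have "cnt f {..<n} i = cnt f A i + cnt f ({..<n} - A) i"
    using cnt_Un[of A "{..<n} - A" f i] finite_subset[OF assms(1)] by auto
  then show ?thesis using assms by simp
qed

text \<open>Restricted to the positions so that the result is extensional, as the members of
  \<open>words\<close> are; this gives a bijection with the necklaces.\<close>

definition nth_fun :: "nat list \<Rightarrow> nat \<Rightarrow> nat" where
  "nth_fun w = (\<lambda>p\<in>{..<length w}. w ! p)"

lemma cnt_nth_fun: "A \<subseteq> {..<length w} \<Longrightarrow> cnt (nth_fun w) A = cnt ((!) w) A"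
  unfolding cnt_def nth_fun_def by (rule ext, rule arg_cong[where f = card]) auto

lemma halves_imp_fair_cuts:
  assumes "S \<subseteq> {1..<2 * t * m}" "length w = 2 * t * m" "balanced t m (nth_fun w)" "halves t m S (nth_fun w)"
  shows "fair_cuts 2 t m w S"
  unfolding fair_cuts_iff[OF assms(1,2)]
proof (intro exI[of _ "side (2 * t * m) S"] conjI allI impI ballI side_subset)
  fix i assume i: "i < t"
  show 1: "cnt ((!) w) (side (2 * t * m) S) i = m"
    using assms(2,4) i side_subset by (simp add: halves_def cnt_nth_fun)
  show "cnt ((!) w) ({..<2 * t * m} - side (2 * t * m) S) i = m"
    using assms(2,3) i by (intro cnt_Compl side_subset 1) (simp add: balanced_def cnt_nth_fun)
next
  fix I assume I: "I \<in> intervals (2 * t * m) S"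
  note ip = intervals_props[OF assms(1)]
  show "I \<subseteq> side (2 * t * m) S \<or> I \<inter> side (2 * t * m) S = {}"
  proof -
    have "odd (card {c \<in> S. p < c}) = odd (card {c \<in> S. q < c})" if "p \<in> I" "q \<in> I" for p q
      using ip(4)[OF I that] by simp
    then show ?thesis using ip(1)[OF I] unfolding side_def by blast
  qed
qed

lemma fair_partition_imp_halves:
  assumes A: "A \<subseteq> {..<2 * t * m}" "\<And>i. i < t \<Longrightarrow> cnt f A i = m"
    "\<And>i. i < t \<Longrightarrow> cnt f ({..<2 * t * m} - A) i = m"
  shows "halves t m {c \<in> {1..<2 * t * m}. (c - 1 \<in> A) \<noteq> (c \<in> A)} f"
proof -
  let ?n = "2 * t * m"
  \<comment> \<open>\<open>side\<close> never contains the last position. If \<open>A\<close> does,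
    its complement is taken; the colour changes are the same.\<close>
  define B where "B = (if ?n - 1 \<in> A then {..<?n} - A else A)"
  have "{c \<in> {1..<?n}. (c - 1 \<in> A) \<noteq> (c \<in> A)} = {c \<in> {1..<?n}. (c - 1 \<in> B) \<noteq> (c \<in> B)}"
    by (auto simp: B_def)
  moreover have "side ?n {c \<in> {1..<?n}. (c - 1 \<in> B) \<noteq> (c \<in> B)} = B"
    by (rule side_colour_changes) (use A(1) in \<open>auto simp: B_def\<close>)
  ultimately show ?thesis using A by (simp add: halves_def B_def)
qed

lemma fair_cuts_imp_halves:
  assumes "fair_cuts 2 t m w S" "length w = 2 * t * m"
  shows "\<exists>S'\<subseteq>S. halves t m S' (nth_fun w)"
proof -
  let ?n = "2 * t * m"
  have S: "S \<subseteq> {1..<?n}" using assms by (simp add: fair_cuts_def)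
  note ip = intervals_props[OF S]
  obtain A where A: "A \<subseteq> {..<?n}" "\<forall>i<t. cnt ((!) w) A i = m \<and> cnt ((!) w) ({..<?n} - A) i = m"
    "\<forall>I\<in>intervals ?n S. I \<subseteq> A \<or> I \<inter> A = {}"
    using assms(1) unfolding fair_cuts_iff[OF S assms(2)] by blast
  let ?S = "{c \<in> {1..<?n}. (c - 1 \<in> A) \<noteq> (c \<in> A)}"
  have "?S \<subseteq> S"
  proof
    fix c assume c: "c \<in> ?S"
    then have "c - 1 < ?n" by auto
    then obtain I where I: "I \<in> intervals ?n S" "c - 1 \<in> I" using ip(3) by blast
    show "c \<in> S"
    proof (rule ccontr)
      assume "c \<notin> S"
      then have "c \<in> I" using ip(5)[OF _ _ I(1,2)] c by blast
      then show False using A(3)[rule_format, OF I(1)] I(2) c by blast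
    qed
  qed
  moreover have "halves t m ?S (nth_fun w)"
    using A assms(2) by (intro fair_partition_imp_halves) (auto simp: cnt_nth_fun)
  ultimately show ?thesis by blast
qed

text \<open>Any choice of \<open>m\<close> beads of each letter is a half, possibly with very many
  cuts. This makes the minimum in \<open>min_cuts\<close> an attained one.\<close>

lemma halves_exists:
  assumes "balanced t m f"
  shows "\<exists>S\<subseteq>{1..<2 * t * m}. halves t m S f"
proof -
  let ?n = "2 * t * m"
  have "\<exists>B\<subseteq>{p \<in> {..<?n}. f p = i}. card B = m" if "i < t" for i
    using assms that by (intro ex_card) (auto simp: balanced_def cnt_def)
  then have "\<forall>i\<in>{..<t}. \<exists>B. B \<subseteq> {p \<in> {..<?n}. f p = i} \<and> card B = m" by blast
  from bchoice[OF this] obtain B where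
    "\<forall>i\<in>{..<t}. B i \<subseteq> {p \<in> {..<?n}. f p = i} \<and> card (B i) = m" by blast
  then have B: "B i \<subseteq> {p \<in> {..<?n}. f p = i} \<and> card (B i) = m" if "i < t" for i
    using that by blast
  define A where "A = (\<Union>i<t. B i)"
  have A: "A \<subseteq> {..<?n}" using B by (fastforce simp: A_def)
  have c: "cnt f A i = m" if "i < t" for i
  proof -
    have "{p \<in> A. f p = i} = B i" using B that by (fastforce simp: A_def)
    then show ?thesis using B that by (simp add: cnt_def)
  qed
  have "halves t m {c \<in> {1..<?n}. (c - 1 \<in> A) \<noteq> (c \<in> A)} f"
    using assms A c by (intro fair_partition_imp_halves cnt_Compl) (auto simp: balanced_def)
  then show ?thesis by (intro exI[of _ "{c \<in> {1..<?n}. (c - 1 \<in> A) \<noteq> (c \<in> A)}"]) auto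
qed

lemma min_cuts_le: "S \<subseteq> {1..<2 * t * m} \<Longrightarrow> halves t m S f \<Longrightarrow> min_cuts t m f \<le> card S"
  unfolding min_cuts_def by (rule Least_le) auto

lemma min_cuts_attained:
  assumes "balanced t m f"
  shows "\<exists>S\<subseteq>{1..<2 * t * m}. halves t m S f \<and> card S = min_cuts t m f"
proof -
  obtain S where "S \<subseteq> {1..<2 * t * m}" "halves t m S f" using halves_exists[OF assms] by auto
  then have "\<exists>r. \<exists>S\<subseteq>{1..<2 * t * m}. halves t m S f \<and> card S = r" by auto
  from LeastI_ex[OF this] show ?thesis unfolding min_cuts_def .
qed

lemma count_list_cnt: "count_list w i = cnt (nth_fun w) {..<length w} i"
proof -
  have "count_list w i = length (filter ((=) i) w)"
    by (induction w) auto
  also have "\<dots> = card {p. p < length w \<and> i = w ! p}" by (rule length_filter_conv_card)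
  finally show ?thesis
    by (simp add: cnt_def nth_fun_def conj_commute eq_commute cong: conj_cong)
qed

lemma X_eq_min_cuts:
  assumes "length w = 2 * t * m" "balanced t m (nth_fun w)"
  shows "X 2 t m w = min_cuts t m (nth_fun w)"
proof (rule antisym)
  obtain S where S: "S \<subseteq> {1..<2 * t * m}" "halves t m S (nth_fun w)" "card S = min_cuts t m (nth_fun w)"
    using min_cuts_attained[OF assms(2)] by blast
  then have f: "fair_cuts 2 t m w S" using halves_imp_fair_cuts assms by blast
  then show "X 2 t m w \<le> min_cuts t m (nth_fun w)"
    unfolding X_def S(3)[symmetric] by (intro Least_le) blast
  have "\<exists>S. fair_cuts 2 t m w S \<and> card S = X 2 t m w"
    unfolding X_def by (rule LeastI_ex) (use f in blast)
  then obtain S where S: "fair_cuts 2 t m w S" "card S = X 2 t m w" by blast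
  then obtain S' where S': "S' \<subseteq> S" "halves t m S' (nth_fun w)"
    using fair_cuts_imp_halves assms by blast
  have "S \<subseteq> {1..<2 * t * m}" using S assms by (simp add: fair_cuts_def)
  then have "min_cuts t m (nth_fun w) \<le> card S'" "card S' \<le> card S"
    using S' by (auto intro!: min_cuts_le card_mono finite_subset[of S "{1..<2 * t * m}"])
  then show "min_cuts t m (nth_fun w) \<le> X 2 t m w" using S(2) by simp
qed

lemma bij_necklaces:
  "bij_betw nth_fun (necklaces 2 t m) {f \<in> words t (2 * t * m). balanced t m f}"
proof (rule bij_betw_byWitness[where f' = "\<lambda>f. map f [0..<2 * t * m]"])
  show "\<forall>w\<in>necklaces 2 t m. map (nth_fun w) [0..<2 * t * m] = w"
    by (auto simp: necklaces_def nth_fun_def intro!: nth_equalityI)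
  show *: "\<forall>f\<in>{f \<in> words t (2 * t * m). balanced t m f}. nth_fun (map f [0..<2 * t * m]) = f"
    by (auto simp: nth_fun_def words_def PiE_def extensional_def fun_eq_iff)
  show "nth_fun ` necklaces 2 t m \<subseteq> {f \<in> words t (2 * t * m). balanced t m f}"
  proof (intro subsetI, elim imageE)
    fix f w assume fw: "f = nth_fun w" and w: "w \<in> necklaces 2 t m"
    have "w ! p < t" if "p < 2 * t * m" for p
    proof -
      have "length w = 2 * t * m" "set w \<subseteq> {..<t}" using w by (auto simp: necklaces_def)
      then show ?thesis using nth_mem[of p w] that by (metis lessThan_iff subsetD)
    qed
    then have "f \<in> words t (2 * t * m)" using w by (auto simp: fw words_def nth_fun_def necklaces_def)
    moreover have "balanced t m f" using w by (auto simp: fw balanced_def necklaces_def count_list_cnt)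
    ultimately show "f \<in> {f \<in> words t (2 * t * m). balanced t m f}" by simp
  qed
  show "(\<lambda>f. map f [0..<2 * t * m]) ` {f \<in> words t (2 * t * m). balanced t m f} \<subseteq> necklaces 2 t m"
  proof (intro subsetI, elim imageE)
    fix w f assume w: "w = map f [0..<2 * t * m]" and f: "f \<in> {f \<in> words t (2 * t * m). balanced t m f}"
    have "set w \<subseteq> {..<t}" using f words_less[of f t "2 * t * m"] by (auto simp: w)
    then show "w \<in> necklaces 2 t m"
      using f * by (simp add: w necklaces_def count_list_cnt balanced_def)
  qed
qed

lemma prob_X:
  assumes "t \<ge> 1"
  shows "measure_pmf.prob (random_necklace 2 t m) {w. X 2 t m w = s} =
    pr t (2 * t * m) (\<lambda>f. balanced t m f \<and> min_cuts t m f = s) / pr t (2 * t * m) (balanced t m)"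
proof -
  let ?N = "necklaces 2 t m" and ?n = "2 * t * m"
  have "measure_pmf.prob (random_necklace 2 t m) {w. X 2 t m w = s} = card (?N \<inter> {w. X 2 t m w = s}) / card ?N"
    unfolding random_necklace_def
    by (rule measure_pmf_of_set[OF necklaces_nonempty finite_necklaces])
  also have "card ?N = card {f \<in> words t ?n. balanced t m f}"
    by (rule bij_betw_same_card[OF bij_necklaces])
  also have "card (?N \<inter> {w. X 2 t m w = s}) = card {f \<in> words t ?n. balanced t m f \<and> min_cuts t m f = s}"
  proof -
    have eq: "X 2 t m w = min_cuts t m (nth_fun w)" if "w \<in> ?N" for w
      using that bij_betwE[OF bij_necklaces, of t m] by (intro X_eq_min_cuts) (auto simp: necklaces_def)
    have "bij_betw nth_fun (?N \<inter> {w. X 2 t m w = s}) (nth_fun ` (?N \<inter> {w. X 2 t m w = s}))"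
      by (rule bij_betw_subset[OF bij_necklaces]) auto
    moreover have "nth_fun ` (?N \<inter> {w. X 2 t m w = s}) = {f \<in> words t ?n. balanced t m f \<and> min_cuts t m f = s}"
    proof (intro equalityI subsetI)
      fix f assume "f \<in> nth_fun ` (?N \<inter> {w. X 2 t m w = s})"
      then show "f \<in> {f \<in> words t ?n. balanced t m f \<and> min_cuts t m f = s}"
        using bij_betw_imp_surj_on[OF bij_necklaces, of t m] eq by auto
    next
      fix f assume f: "f \<in> {f \<in> words t ?n. balanced t m f \<and> min_cuts t m f = s}"
      then obtain w where "w \<in> ?N" "f = nth_fun w"
        using bij_betw_imp_surj_on[OF bij_necklaces, of t m] by blast
      then show "f \<in> nth_fun ` (?N \<inter> {w. X 2 t m w = s})" using f eq by auto
    qed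
    ultimately show ?thesis using bij_betw_same_card by fastforce
  qed
  finally show ?thesis using assms by (simp add: pr_eq_card)
qed

section \<open>The probability of balance and the first moment bound\<close>

lemma pr_balanced_upper:
  assumes "t \<ge> 1" "m \<ge> 1"
  shows "pr t (2 * t * m) (balanced t m) \<le> ub t / sqrt m ^ (t - 1)"
proof -
  have "pr t (2 * t * m) (balanced t m) \<le> ub t / sqrt (real (card {..<2 * t * m}) + 1) ^ (t - 1)"
    unfolding balanced_def[abs_def] by (rule local_upper[OF assms(1)]) auto
  also have "\<dots> \<le> ub t / sqrt m ^ (t - 1)"
  proof -
    have "1 * m \<le> 2 * t * m" using assms by (intro mult_right_mono) auto
    then have "real m \<le> real (2 * t * m)" by (simp only: of_nat_le_iff mult_1)
    then have "sqrt m ^ (t - 1) \<le> sqrt (real (card {..<2 * t * m}) + 1) ^ (t - 1)"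
      by (intro power_mono) auto
    moreover have "0 < sqrt m ^ (t - 1)" using assms by simp
    ultimately show ?thesis using ub_pos[OF assms(1)] by (intro divide_left_mono mult_pos_pos) auto
  qed
  finally show ?thesis .
qed

lemma pr_balanced_lower:
  assumes "t \<ge> 1"
  shows "\<exists>c>0. \<forall>\<^sub>F m in sequentially. c / sqrt (real m) ^ (t - 1) \<le> pr t (2 * t * m) (balanced t m)"
proof -
  obtain c :: real and a0 :: nat where c: "c > 0" "\<forall>n A d. A \<subseteq> {..<n} \<longrightarrow> a0 \<le> card A \<longrightarrow>
    (\<Sum>i<t. d i) = card A \<longrightarrow>
    (\<forall>i<t. \<bar>real (d i) - card A / t\<bar> \<le> 1 * sqrt (card A)) \<longrightarrow>
    c / sqrt (real (card A) + 1) ^ (t - 1) \<le> pr t n (\<lambda>f. \<forall>i<t. cnt f A i = d i)"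
    using local_lower[OF assms zero_le_one] by blast
  have "c / sqrt (3 * t) ^ (t - 1) / sqrt (real m) ^ (t - 1) \<le> pr t (2 * t * m) (balanced t m)"
    if "m \<ge> max a0 1" for m
  proof -
    have m: "m \<ge> 1" "m \<ge> a0" using that by auto
    have "1 * m \<le> 2 * t * m" using assms by (intro mult_right_mono) auto
    then have "a0 \<le> 2 * t * m" using m by linarith
    then have "c / sqrt (real (card {..<2 * t * m}) + 1) ^ (t - 1) \<le> pr t (2 * t * m) (balanced t m)"
      unfolding balanced_def[abs_def] using assms
      by (intro c(2)[rule_format]) auto
    moreover have "c / (sqrt (3 * t) * sqrt m) ^ (t - 1) \<le> c / sqrt (real (card {..<2 * t * m}) + 1) ^ (t - 1)"
    proof -
      have "1 * 1 \<le> real m * real t" using assms m by (intro mult_mono) auto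
      then have "sqrt (real (card {..<2 * t * m}) + 1) \<le> sqrt (3 * t) * sqrt m"
        by (simp flip: real_sqrt_mult)
      moreover have "0 < real (card {..<2 * t * m}) + 1" by (rule add_nonneg_pos) auto
      ultimately show ?thesis using c(1) assms m
        by (intro divide_left_mono power_mono mult_pos_pos zero_less_power) (auto simp del: card_lessThan)
    qed
    ultimately show ?thesis by (simp add: power_mult_distrib)
  qed
  then show ?thesis using c(1) assms
    by (intro exI[of _ "c / sqrt (3 * t) ^ (t - 1)"] conjI eventually_sequentiallyI[of "max a0 1"]) auto
qed

lemma halves_card_side:
  assumes "f \<in> words t (2 * t * m)" "halves t m S f"
  shows "card (side (2 * t * m) S) = t * m"
  using sum_cnt[OF assms(1) side_subset, of S] assms(2) by (simp add: halves_def)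

lemma depends_on_comp2:
  "depends_on A F \<Longrightarrow> depends_on A G \<Longrightarrow> depends_on A (\<lambda>f. h (F f) (G f))"
  unfolding depends_on_def by (intro allI impI arg_cong2[where f = h]) blast+

lemma depends_cnt_eq: "depends_on A (\<lambda>f. \<forall>i<t. cnt f A i = c i)"
  by (rule depends_on_comp[OF cnt_depends])

text \<open>Outside \<open>V\<close> both sides keep many free beads, whose counts are forced: each side costs a factor of
  order \<open>m powr (- (t - 1) / 2)\<close>, whatever happens on \<open>V\<close>.\<close>

lemma pr_halves_upper:
  assumes t: "t \<ge> 1" "m \<ge> 1" and Q: "depends_on V Q" "finite V" "2 * card V \<le> t * m"
  shows "pr t (2 * t * m) (\<lambda>f. balanced t m f \<and> halves t m S f \<and> Q f)
    \<le> (2 * ub t * sqrt 2 ^ (t - 1))\<^sup>2 / m ^ (t - 1) * pr t (2 * t * m) Q"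
proof (cases "card (side (2 * t * m) S) = t * m")
  case False
  have "pr t (2 * t * m) (\<lambda>f. balanced t m f \<and> halves t m S f \<and> Q f) = pr t (2 * t * m) (\<lambda>f. False)"
    using False halves_card_side by (intro pr_cong) auto
  also have "\<dots> = 0" by (simp add: pr_def avg_def)
  finally show ?thesis using pr_nonneg[of t "2 * t * m" Q] by simp
next
  case True
  let ?n = "2 * t * m"
  define A where "A = side ?n S"
  define B where "B = {..<?n} - A"
  have A: "A \<subseteq> {..<?n}" by (simp add: A_def side_subset)
  have cA: "card A = t * m" using True by (simp add: A_def)
  have cB: "card B = t * m" using A cA by (simp add: B_def card_Diff_subset finite_subset)
  let ?r = "real m / 2"
  \<comment> \<open>Each side has \<open>t * m\<close> positions and \<open>V\<close> covers at most
    half that number, so at least \<open>m / 2\<close> positions of either side stay free.\<close>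
  have big: "?r \<le> real (card (D - V)) + 1" if "card D = t * m" "finite D" for D
  proof -
    have "t * m - card V \<le> card (D - V)" using that diff_card_le_card_Diff[OF Q(2), of D] by simp
    moreover have "1 * m \<le> t * m" using t by (intro mult_right_mono) auto
    ultimately have "m \<le> 2 * card (D - V)" using Q(3) by linarith
    then show ?thesis by linarith
  qed
  have split: "cnt f D i = cnt f (D - V) i + cnt f (D \<inter> V) i" if "finite D" for f D i
    using that by (subst cnt_Un[symmetric]) (auto intro!: arg_cong2[where f = "cnt f"])
  let ?Q1 = "\<lambda>f. Q f \<and> (\<forall>i<t. cnt f (A - V) i = (\<lambda>c i. m - c i) (cnt f (A \<inter> V)) i)"
  let ?Q2 = "\<lambda>f. ?Q1 f \<and> (\<forall>i<t. cnt f (B - V) i = (\<lambda>c i. m - c i) (cnt f (B \<inter> V)) i)"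
  let ?K = "ub t / sqrt ?r ^ (t - 1)"
  have "pr t ?n (\<lambda>f. balanced t m f \<and> halves t m S f \<and> Q f) \<le> pr t ?n ?Q2"
  proof (rule pr_mono)
    fix f assume f: "f \<in> words t ?n" "balanced t m f \<and> halves t m S f \<and> Q f"
    have "cnt f A i = m" "cnt f B i = m" if "i < t" for i
      using f that A unfolding A_def B_def by (auto simp: halves_def balanced_def intro!: cnt_Compl)
    then have "cnt f (A - V) i + cnt f (A \<inter> V) i = m" "cnt f (B - V) i + cnt f (B \<inter> V) i = m"
      if "i < t" for i
      using that split[of A f i] split[of B f i] finite_subset[OF A] by (auto simp: B_def)
    then have "cnt f (A - V) i = m - cnt f (A \<inter> V) i" "cnt f (B - V) i = m - cnt f (B \<inter> V) i"
      if "i < t" for i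
      using that by (metis add_diff_cancel_right')+
    then show "?Q2 f" using f by auto
  qed
  also have "\<dots> \<le> ?K * (?K * pr t ?n Q)"
  proof (rule forced_upper'[OF t(1), where B = "V \<union> A"])
    have "depends_on (V \<union> A) Q" using Q(1) by (rule depends_on_mono) auto
    moreover have "depends_on (V \<union> A) (\<lambda>f. cnt f (A - V))" "depends_on (V \<union> A) (\<lambda>f. cnt f (A \<inter> V))"
      by (auto intro: depends_on_mono[OF cnt_depends])
    then have "depends_on (V \<union> A) (\<lambda>f. \<forall>i<t. cnt f (A - V) i = (\<lambda>c i. m - c i) (cnt f (A \<inter> V)) i)"
      by (rule depends_on_comp2[where h = "\<lambda>x y. \<forall>i<t. x i = (\<lambda>c i. m - c i) y i"])
    ultimately show "depends_on (V \<union> A) ?Q1"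
      by (rule depends_on_comp2[where h = "(\<and>)"])
    show "depends_on (V \<union> A) (\<lambda>f. (\<lambda>c i. m - c i) (cnt f (B \<inter> V)))"
      by (rule depends_on_mono[OF depends_on_comp[OF cnt_depends]]) auto
    show "(B - V) \<inter> (V \<union> A) = {}" by (auto simp: B_def)
    show "B - V \<subseteq> {..<?n}" by (auto simp: B_def)
    show "?r \<le> real (card (B - V)) + 1" using cB by (intro big) (auto simp: B_def)
    show "0 < ?r" using t by simp
    show "pr t ?n ?Q1 \<le> ?K * pr t ?n Q"
    proof (rule forced_upper'[OF t(1), where B = V])
      show "depends_on V Q" by (rule Q(1))
      show "depends_on V (\<lambda>f. (\<lambda>c i. m - c i) (cnt f (A \<inter> V)))"
        by (rule depends_on_mono[OF depends_on_comp[OF cnt_depends]]) auto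
      show "?r \<le> real (card (A - V)) + 1" using cA A by (intro big) (auto simp: finite_subset)
    qed (use A t in auto)
  qed
  also have "?K = ub t * sqrt 2 ^ (t - 1) / sqrt m ^ (t - 1)"
    by (simp add: real_sqrt_divide power_divide)
  also have "ub t * sqrt 2 ^ (t - 1) / sqrt m ^ (t - 1) * (ub t * sqrt 2 ^ (t - 1) / sqrt m ^ (t - 1) * pr t ?n Q)
      = (ub t * sqrt 2 ^ (t - 1))\<^sup>2 / m ^ (t - 1) * pr t ?n Q"
    by (simp add: power2_eq_square power_mult_distrib[symmetric])
  also have "\<dots> \<le> (2 * ub t * sqrt 2 ^ (t - 1))\<^sup>2 / m ^ (t - 1) * pr t ?n Q"
    using pr_nonneg ub_pos[OF t(1)] by (intro mult_right_mono divide_right_mono power_mono) auto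
  finally show ?thesis .
qed

lemma side_insert_last:
  assumes "R \<subseteq> {..<a}" "a \<le> a'" "a' \<le> n"
  shows "side n (insert a' R) = side n (insert a R) \<union> {a..<a'}" "side n (insert a R) \<subseteq> {..<a}"
proof -
  have R: "finite R" using assms(1) finite_subset by blast
  have c: "card {c \<in> insert b R. p < c} = (if p < b then 1 else 0) + card {c \<in> R. p < c}"
    if "a \<le> b" for b p
  proof -
    have "{c \<in> insert b R. p < c} = (if p < b then {b} else {}) \<union> {c \<in> R. p < c}" by auto
    moreover have "b \<notin> R" using assms(1) that by auto
    ultimately show ?thesis using R by simp
  qed
  have z: "card {c \<in> R. p < c} = 0" if "a \<le> p" for p using assms(1) that R by auto
  have e: "odd (card {c \<in> insert b R. p < c}) \<longleftrightarrow> (p < b \<and> a \<le> p) \<or> (p < a \<and> even (card {c \<in> R. p < c}))"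
    if "a \<le> b" for b p
    unfolding c[OF that] using z[of p] that by (cases "p < a") (auto simp: not_less)
  show "side n (insert a' R) = side n (insert a R) \<union> {a..<a'}" "side n (insert a R) \<subseteq> {..<a}"
    unfolding side_def e[OF assms(2)] e[OF order_refl] using assms(2,3) by auto
qed

text \<open>Moving the last cut to the right strictly enlarges \<open>side\<close>. Hence the size
  \<open>h\<close> and the other cuts determine the last one, which accounts for the exponent
  \<open>r - 1\<close>.\<close>

lemma card_balanced_cut_sets:
  assumes "r \<ge> 1"
  shows "card {S. S \<subseteq> {1..<n} \<and> card S = r \<and> card (side n S) = h} \<le> n ^ (r - 1)"
proof -
  let ?F = "{S. S \<subseteq> {1..<n} \<and> card S = r \<and> card (side n S) = h}"
  have inj: "inj_on (\<lambda>S. S - {Max S}) ?F"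
  proof -
    have key: False if "S \<in> ?F" "S' \<in> ?F" "S - {Max S} = S' - {Max S'}" "Max S < Max S'" for S S'
    proof -
      define R a a' where "R = S - {Max S}" and "a = Max S" and "a' = Max S'"
      have fin: "finite S" "finite S'" "S \<noteq> {}" "S' \<noteq> {}"
        using that assms finite_subset[of _ "{1..<n}"] by auto
      have S: "S = insert a R" "S' = insert a' R"
        using that(3) Max_in[OF fin(1,3)] Max_in[OF fin(2,4)] by (auto simp: R_def a_def a'_def)
      have "R \<subseteq> {..<a}" using fin Max_ge[of S] by (fastforce simp: R_def a_def le_less)
      moreover have "a < a'" "a' \<le> n"
        using that Max_in[OF fin(2,4)] by (auto simp: a_def a'_def)
      ultimately have "side n S' = side n S \<union> {a..<a'}" "side n S \<subseteq> {..<a}"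
        using side_insert_last[of R a a' n] by (auto simp: S)
      then have "card (side n S') = card (side n S) + card {a..<a'}"
        by (simp only:) (intro card_Un_disjoint, auto)
      moreover have "card (side n S') = h" "card (side n S) = h" using that by auto
      ultimately show False using \<open>a < a'\<close> by simp
    qed
    show ?thesis
    proof (rule inj_onI)
      fix S S' assume *: "S \<in> ?F" "S' \<in> ?F" "S - {Max S} = S' - {Max S'}"
      then have "Max S = Max S'" using key[of S S'] key[of S' S] by (metis linorder_neqE_nat)
      moreover have "S \<noteq> {}" "S' \<noteq> {}" "finite S" "finite S'"
        using * assms finite_subset[of _ "{1..<n}"] by auto
      ultimately show "S = S'" using *(3) Max_in by (metis insert_Diff)
    qed
  qed
  have "card ?F = card ((\<lambda>S. S - {Max S}) ` ?F)" using inj by (simp add: card_image)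
  also have "\<dots> \<le> card {T. T \<subseteq> {..<n} \<and> card T = r - 1}"
  proof (rule card_mono)
    show "(\<lambda>S. S - {Max S}) ` ?F \<subseteq> {T. T \<subseteq> {..<n} \<and> card T = r - 1}"
    proof (rule image_subsetI)
      fix S assume S: "S \<in> ?F"
      then have "finite S" "S \<noteq> {}" using assms finite_subset[of _ "{1..<n}"] by auto
      then have "card (S - {Max S}) = r - 1" using S by simp
      then show "S - {Max S} \<in> {T. T \<subseteq> {..<n} \<and> card T = r - 1}" using S by auto
    qed
  qed auto
  also have "\<dots> = n choose (r - 1)" by (simp add: n_subsets)
  also have "\<dots> \<le> n ^ (r - 1)"
    by (cases "r - 1 \<le> n") (auto simp: binomial_le_pow binomial_eq_0)
  finally show ?thesis .
qed

definition cut_sets :: "nat \<Rightarrow> nat \<Rightarrow> nat \<Rightarrow> nat set set" where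
  "cut_sets t m s = {S. S \<subseteq> {1..<2 * t * m} \<and> card S = s \<and> card (side (2 * t * m) S) = t * m}"

lemma finite_cut_sets [simp, intro]: "finite (cut_sets t m s)"
  by (rule finite_subset[of _ "Pow {1..<2 * t * m}"]) (auto simp: cut_sets_def)

lemma card_cut_sets: "s \<ge> 1 \<Longrightarrow> card (cut_sets t m s) \<le> (2 * t * m) ^ (s - 1)"
  unfolding cut_sets_def by (rule card_balanced_cut_sets)

lemma min_cuts_upper:
  assumes "f \<in> words t (2 * t * m)" "balanced t m f" "min_cuts t m f = s"
  shows "\<exists>S\<in>cut_sets t m s. halves t m S f"
proof -
  obtain S where "S \<subseteq> {1..<2 * t * m}" "halves t m S f" "card S = s"
    using min_cuts_attained[OF assms(2)] assms(3) by auto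
  then show ?thesis using halves_card_side[OF assms(1)] by (auto simp: cut_sets_def)
qed

definition ub2 :: "nat \<Rightarrow> real" where
  "ub2 t = (2 * ub t * sqrt 2 ^ (t - 1))\<^sup>2"

lemma ub2_pos: "t \<ge> 1 \<Longrightarrow> ub2 t > 0"
  using ub_pos[of t] by (simp add: ub2_def)

lemma pr_halves_upper':
  assumes "t \<ge> 1" "m \<ge> 1"
  shows "pr t (2 * t * m) (\<lambda>f. balanced t m f \<and> halves t m S f) \<le> ub2 t / m ^ (t - 1)"
  using pr_halves_upper[OF assms, of "{}" "\<lambda>f. True" S] avg_const[OF assms(1), of _ 1]
  by (simp add: depends_on_def ub2_def pr_def)

lemma pr_min_cuts_upper:
  assumes "t \<ge> 1" "m \<ge> 1" "s \<ge> 1"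
  shows "pr t (2 * t * m) (\<lambda>f. balanced t m f \<and> min_cuts t m f = s)
    \<le> (2 * t * m) ^ (s - 1) * (ub2 t / m ^ (t - 1))"
proof -
  have "pr t (2 * t * m) (\<lambda>f. balanced t m f \<and> min_cuts t m f = s)
      \<le> pr t (2 * t * m) (\<lambda>f. \<exists>S\<in>cut_sets t m s. balanced t m f \<and> halves t m S f)"
    using min_cuts_upper by (intro pr_mono) auto
  also have "\<dots> \<le> (\<Sum>S\<in>cut_sets t m s. ub2 t / m ^ (t - 1))"
    by (intro order_trans[OF pr_Ex] sum_mono pr_halves_upper' assms) auto
  also have "\<dots> = card (cut_sets t m s) * (ub2 t / m ^ (t - 1))" by simp
  also have "\<dots> \<le> real ((2 * t * m) ^ (s - 1)) * (ub2 t / m ^ (t - 1))"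
    using card_cut_sets[OF assms(3), of t m] ub2_pos[OF assms(1)]
    by (intro mult_right_mono) (simp_all only: of_nat_le_iff, auto)
  finally show ?thesis by simp
qed

lemma prob_X_upper:
  assumes "t \<ge> 1" "s \<ge> 1"
  shows "\<exists>C>0. \<forall>\<^sub>F m in sequentially. measure_pmf.prob (random_necklace 2 t m) {w. X 2 t m w = s}
    \<le> C * real m powr (real s - (real t + 1) / 2)"
proof -
  obtain c where c: "c > 0" and ev: "\<forall>\<^sub>F m in sequentially. c / sqrt (real m) ^ (t - 1) \<le> pr t (2 * t * m) (balanced t m)"
    using pr_balanced_lower[OF assms(1)] by blast
  define C where "C = (2 * t) ^ (s - 1) * ub2 t / c"
  have "\<forall>\<^sub>F m in sequentially. measure_pmf.prob (random_necklace 2 t m) {w. X 2 t m w = s}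
    \<le> C * real m powr (real s - (real t + 1) / 2)"
    using ev eventually_ge_at_top[of 1]
  proof eventually_elim
    case (elim m)
    have sq: "sqrt m ^ (t - 1) = real m powr ((real t - 1) / 2)"
      using elim assms by (simp add: powr_half_sqrt[symmetric] powr_powr flip: powr_realpow)
    have "measure_pmf.prob (random_necklace 2 t m) {w. X 2 t m w = s}
      \<le> (2 * t * m) ^ (s - 1) * (ub2 t / m ^ (t - 1)) / (c / sqrt (real m) ^ (t - 1))"
      unfolding prob_X[OF assms(1)] using elim c pr_min_cuts_upper[OF assms(1) elim(2) assms(2)] pr_nonneg
      using ub2_pos[OF assms(1)] by (intro frac_le) auto
    also have "\<dots> = C * (m ^ (s - 1) / m ^ (t - 1) * sqrt m ^ (t - 1))"
      by (simp add: C_def power_mult_distrib mult_ac)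
    also have "m ^ (s - 1) / m ^ (t - 1) * sqrt m ^ (t - 1) = real m powr (real s - (real t + 1) / 2)"
    proof -
      have "m ^ (s - 1) / m ^ (t - 1) * sqrt m ^ (t - 1)
          = real m powr ((real s - 1) - (real t - 1) + (real t - 1) / 2)"
        unfolding sq powr_add powr_diff[of _ "real s - 1"] using elim(2) assms
        by (simp flip: powr_realpow)
      also have "(real s - 1) - (real t - 1) + (real t - 1) / 2 = real s - (real t + 1) / 2"
        by (simp add: field_simps)
      finally show ?thesis .
    qed
    finally show ?case .
  qed
  moreover have "C > 0" using c ub2_pos assms by (simp add: C_def)
  ultimately show ?thesis by blast
qed

section \<open>Second moment of the number of fair sets in a window\<close>

text \<open>The two sides divide the positions into four classes. Once \<open>B2\<close> is known,
  the counts of \<open>B1\<close>, \<open>B3\<close> and \<open>B4\<close> are forced in turn: by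
  the first fair set, by the second one, and by balance. \<open>B1\<close> and \<open>B4\<close>
  have order \<open>m\<close> positions, and \<open>B3\<close> is as large as \<open>B2\<close>
  because both sides have the same size; so the price of the second fair set, given the first,
  depends only on how far they differ.\<close>

lemma pr_halves_pair:
  assumes t: "t \<ge> 1" "m \<ge> 1"
    and card: "card (side (2 * t * m) S) = t * m" "card (side (2 * t * m) S') = t * m"
    and b: "b \<le> card (side (2 * t * m) S - side (2 * t * m) S')"
      "2 * card (side (2 * t * m) S - side (2 * t * m) S') \<le> t * m"
  shows "pr t (2 * t * m) (\<lambda>f. balanced t m f \<and> halves t m S f \<and> halves t m S' f)
    \<le> ub2 t * ub t / m ^ (t - 1) * (1 / sqrt (real b + 1) ^ (t - 1))"
proof -
  let ?n = "2 * t * m"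
  define A where "A = side ?n S"
  define A' where "A' = side ?n S'"
  have A: "A \<subseteq> {..<?n}" "A' \<subseteq> {..<?n}" "finite A" "finite A'"
    by (auto simp: A_def A'_def side_def)
  define B1 B2 B3 B4 where "B1 = A \<inter> A'" and "B2 = A - A'" and "B3 = A' - A" and "B4 = {..<?n} - (A \<union> A')"
  note B_defs = B1_def B2_def B3_def B4_def
  have cA: "card A = t * m" "card A' = t * m" using card by (auto simp: A_def A'_def)
  have bA: "b \<le> card B2" "2 * card B2 \<le> t * m" using b by (auto simp: A_def A'_def B2_def)
  have c12: "card B1 + card B2 = t * m" unfolding cA(1)[symmetric] B_defs
    using A by (subst card_Un_disjoint[symmetric]) (auto intro!: arg_cong[where f = card])
  have c13: "card B1 + card B3 = t * m" unfolding cA(2)[symmetric] B_defs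
    using A by (subst card_Un_disjoint[symmetric]) (auto intro!: arg_cong[where f = card])
  have c34: "card A + card B3 + card B4 = ?n"
  proof -
    have "card A + card B3 = card (A \<union> A')"
      unfolding B3_def using A by (subst card_Un_disjoint[symmetric]) (auto intro!: arg_cong[where f = card])
    moreover have "card (A \<union> A') + card B4 = card {..<?n}"
    proof -
      have "{..<?n} = (A \<union> A') \<union> B4" using A by (auto simp: B4_def)
      moreover have "card ((A \<union> A') \<union> B4) = card (A \<union> A') + card B4"
        using A by (intro card_Un_disjoint) (auto simp: B4_def)
      ultimately show ?thesis by simp
    qed
    ultimately show ?thesis by simp
  qed
  have tm: "1 * m \<le> t * m" using t by (intro mult_right_mono) auto
  let ?r = "real m / 2"
  have r: "?r \<le> real (card B1) + 1" "?r \<le> real (card B4) + 1" "real b + 1 \<le> real (card B3) + 1"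
    using c12 c13 c34 cA bA tm by linarith+
  let ?E1 = "\<lambda>f. True \<and> (\<forall>i<t. cnt f B1 i = (\<lambda>c i. m - c i) (cnt f B2) i)"
  let ?E2 = "\<lambda>f. ?E1 f \<and> (\<forall>i<t. cnt f B3 i = (\<lambda>c i. m - c i) (cnt f B1) i)"
  let ?E3 = "\<lambda>f. ?E2 f \<and> (\<forall>i<t. cnt f B4 i = (\<lambda>c i. m - c i) (cnt f B3) i)"
  have dep: "depends_on B (\<lambda>f. \<forall>i<t. cnt f C i = (\<lambda>c i. m - c i) (cnt f D) i)" if "C \<subseteq> B" "D \<subseteq> B" for B C D
    by (rule depends_on_comp2[where h = "\<lambda>x y. \<forall>i<t. x i = (\<lambda>c i. m - c i) y i"])
       (use that in \<open>auto intro: depends_on_mono[OF cnt_depends]\<close>)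
  have dep': "depends_on B (\<lambda>f. (\<lambda>c i. m - c i) (cnt f D))" if "D \<subseteq> B" for B D
    by (rule depends_on_mono[OF depends_on_comp[OF cnt_depends] that])
  have depT: "depends_on B (\<lambda>f. True)" for B by (simp add: depends_on_def)
  note conj = depends_on_comp2[where h = "(\<and>)"]
  have "pr t ?n (\<lambda>f. balanced t m f \<and> halves t m S f \<and> halves t m S' f) \<le> pr t ?n ?E3"
  proof (rule pr_mono)
    fix f assume f: "f \<in> words t ?n" "balanced t m f \<and> halves t m S f \<and> halves t m S' f"
    show "?E3 f"
    proof (intro conjI allI impI TrueI)
      fix i assume i: "i < t"
      have m: "cnt f A i = m" "cnt f A' i = m" "cnt f {..<?n} i = 2 * m"
        using f i by (auto simp: halves_def balanced_def A_def A'_def)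
      have "cnt f A i = cnt f B1 i + cnt f B2 i" unfolding B_defs
        using A by (subst cnt_Un[symmetric]) (auto intro!: arg_cong2[where f = "cnt f"])
      moreover have "cnt f A' i = cnt f B1 i + cnt f B3 i" unfolding B_defs
        using A by (subst cnt_Un[symmetric]) (auto intro!: arg_cong2[where f = "cnt f"])
      moreover have "cnt f ({..<?n} - A) i = cnt f B3 i + cnt f B4 i" unfolding B_defs
        using A by (subst cnt_Un[symmetric]) (auto intro!: arg_cong2[where f = "cnt f"])
      moreover have "cnt f ({..<?n} - A) i = m" using m A by (intro cnt_Compl)
      ultimately show "cnt f B1 i = m - cnt f B2 i" "cnt f B3 i = m - cnt f B1 i" "cnt f B4 i = m - cnt f B3 i"
        using m by linarith+
    qed
  qed
  also have "\<dots> \<le> ub t / sqrt ?r ^ (t - 1) * (ub t / sqrt (real b + 1) ^ (t - 1) * (ub t / sqrt ?r ^ (t - 1) * 1))"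
  proof (rule forced_upper'[OF t(1), where B = "B1 \<union> B2 \<union> B3"])
    show "depends_on (B1 \<union> B2 \<union> B3) ?E2"
      by (intro conj dep depT) auto
    show "depends_on (B1 \<union> B2 \<union> B3) (\<lambda>f. (\<lambda>c i. m - c i) (cnt f B3))"
      by (intro dep') auto
    show "pr t ?n ?E2 \<le> ub t / sqrt (real b + 1) ^ (t - 1) * (ub t / sqrt ?r ^ (t - 1) * 1)"
    proof (rule forced_upper'[OF t(1), where B = "B1 \<union> B2"])
      show "depends_on (B1 \<union> B2) ?E1" by (intro conj dep depT) auto
      show "depends_on (B1 \<union> B2) (\<lambda>f. (\<lambda>c i. m - c i) (cnt f B1))" by (intro dep') auto
      show "pr t ?n ?E1 \<le> ub t / sqrt ?r ^ (t - 1) * 1"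
      proof (rule forced_upper'[OF t(1), where B = B2])
        show "depends_on B2 (\<lambda>f. True)" by (rule depT)
        show "depends_on B2 (\<lambda>f. (\<lambda>c i. m - c i) (cnt f B2))" by (intro dep') auto
        show "?r \<le> real (card B1) + 1" by (rule r)
      qed (use A t pr_le_1[OF t(1)] in \<open>auto simp: B_defs\<close>)
    qed (use A t r in \<open>auto simp: B_defs\<close>)
  qed (use A t r in \<open>auto simp: B_defs\<close>)
  also have "\<dots> = (ub t * sqrt 2 ^ (t - 1))\<^sup>2 * ub t / m ^ (t - 1) * (1 / sqrt (real b + 1) ^ (t - 1))"
  proof -
    have K: "ub t / sqrt ?r ^ (t - 1) = ub t * sqrt 2 ^ (t - 1) / sqrt m ^ (t - 1)"
      by (simp add: real_sqrt_divide power_divide)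
    have M: "real (m ^ (t - 1)) = sqrt m ^ (t - 1) * sqrt m ^ (t - 1)"
      by (simp flip: power_mult_distrib)
    have alg: "u * k / x * (u / y * (u * k / x * 1)) = (u * k)\<^sup>2 * u / (x * x) * (1 / y)" for u k x y :: real
      by (simp add: power2_eq_square mult_ac)
    show ?thesis unfolding K M by (rule alg)
  qed
  also have "\<dots> \<le> ub2 t * ub t / m ^ (t - 1) * (1 / sqrt (real b + 1) ^ (t - 1))"
    unfolding ub2_def using ub_pos[OF t(1)]
    by (intro mult_right_mono divide_right_mono power_mono) auto
  finally show ?thesis .
qed

text \<open>The word is divided into \<open>s\<close> zones \<open>{zs j..<zs (Suc j)}\<close> of nearly equal even lengths \<open>2 * hz j\<close>,
  and the cut sets under consideration have one cut close to the middle of each zone. The first \<open>s - 1\<close>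
  displacements are free, the last one is determined by the size of \<open>side\<close>.\<close>

locale cut_windows =
  fixes t m s r :: nat
  assumes s: "1 \<le> s" "s \<le> t" and m: "1 \<le> m" and r: "4 * s * s * r \<le> m"
begin

abbreviation n :: nat where "n \<equiv> 2 * t * m"

text \<open>Zone \<open>0\<close> takes up the rounding remainder, so that the half lengths add up
  to \<open>t * m\<close> exactly.\<close>

definition hz :: "nat \<Rightarrow> nat" where
  "hz j = (if j = 0 then t * m - (s - 1) * (t * m div s) else t * m div s)"

definition zs :: "nat \<Rightarrow> nat" where "zs j = 2 * (\<Sum>i<j. hz i)"

definition disp :: "(nat \<Rightarrow> nat) \<Rightarrow> nat \<Rightarrow> int" where
  "disp d j = (if j < s - 1 then int (d j) else - (\<Sum>i<s - 1. (- 1) ^ (s - 1 - i) * int (d i)))"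

definition cut :: "(nat \<Rightarrow> nat) \<Rightarrow> nat \<Rightarrow> nat" where
  "cut d j = nat (int (zs j) + int (hz j) + disp d j)"

definition cuts :: "(nat \<Rightarrow> nat) \<Rightarrow> nat set" where "cuts d = cut d ` {..<s}"

definition disps :: "(nat \<Rightarrow> nat) set" where "disps = {..<s - 1} \<rightarrow>\<^sub>E {..<r}"

lemma t_pos: "1 \<le> t" using s by simp

lemma finite_disps [simp]: "finite disps"
  by (simp add: disps_def finite_PiE)

lemma card_disps: "card disps = r ^ (s - 1)"
  by (simp add: disps_def card_PiE)

lemma zs_simps [simp]: "zs 0 = 0" "zs (Suc j) = zs j + 2 * hz j"
  by (auto simp: zs_def)

lemma zs_mono: "i \<le> j \<Longrightarrow> zs i \<le> zs j"
  unfolding zs_def by (intro mult_le_mono2 sum_mono2) auto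

lemma div_bounds: "m \<le> t * m div s" "s * (t * m div s) \<le> t * m" "t * m < s * (t * m div s) + s"
proof -
  have "s * m \<le> t * m" using s by (intro mult_right_mono) auto
  then show "m \<le> t * m div s" using s by (simp add: less_eq_div_iff_mult_less_eq mult.commute)
  show "s * (t * m div s) \<le> t * m" by simp
  show "t * m < s * (t * m div s) + s" using dividend_less_times_div[of s "t * m"] s by simp
qed

lemma div_bounds': "(s - 1) * (t * m div s) + t * m div s \<le> t * m"
  using div_bounds(2) s by (simp add: diff_mult_distrib)

lemma hz_ge: "m \<le> hz j"
proof -
  have "m \<le> t * m - (s - 1) * (t * m div s)"
    using div_bounds(1) div_bounds' by linarith
  then show ?thesis using div_bounds(1) by (simp add: hz_def)
qed

lemma hz_near: "\<bar>real s * real (hz j) - real t * real m\<bar> \<le> real s * real s"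
proof -
  let ?q = "t * m div s"
  have q: "real s * real ?q \<le> real t * real m" "real t * real m < real s * real ?q + real s"
    using div_bounds(2,3) by (simp_all only: of_nat_mult[symmetric] of_nat_add[symmetric] of_nat_le_iff of_nat_less_iff)
  have ss: "real s * 1 \<le> real s * real s" using s by (intro mult_left_mono) auto
  show ?thesis
  proof (cases "j = 0")
    case True
    have le: "(s - 1) * ?q \<le> t * m" using div_bounds' by linarith
    have "real (hz 0) = real t * real m - (real s - 1) * real ?q"
      using s of_nat_diff[OF le, where 'a = real] by (simp add: hz_def of_nat_diff)
    then have "real s * real (hz 0) - real t * real m = (real s - 1) * (real t * real m - real s * real ?q)"
      by (simp only:) (simp add: algebra_simps)
    moreover have "0 \<le> (real s - 1) * (real t * real m - real s * real ?q)"
      using s q by (intro mult_nonneg_nonneg) auto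
    moreover have "(real s - 1) * (real t * real m - real s * real ?q) \<le> real s * real s"
      using s q by (intro mult_mono) auto
    ultimately show ?thesis using True by simp
  next
    case False
    then have "hz j = ?q" by (simp add: hz_def)
    then show ?thesis using q ss by (simp only:)
  qed
qed

lemma sum_hz: "(\<Sum>j<s. hz j) = t * m"
proof -
  let ?q = "t * m div s"
  have "(\<Sum>j<s. hz j) = hz 0 + (\<Sum>j\<in>{..<s} - {0}. hz j)"
    using s by (intro sum.remove) auto
  also have "(\<Sum>j\<in>{..<s} - {0}. hz j) = (\<Sum>j\<in>{..<s} - {0}. ?q)"
    by (intro sum.cong) (auto simp: hz_def)
  also have "\<dots> = (s - 1) * ?q" using s by (simp add: card_Diff_singleton)
  also have "hz 0 + (s - 1) * ?q = t * m"
    using div_bounds' by (simp add: hz_def)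
  finally show ?thesis .
qed

lemma zs_s: "zs s = n"
  by (simp add: zs_def sum_hz)

lemma disp_bound:
  assumes "d \<in> disps"
  shows "\<bar>disp d j\<bar> \<le> int (s * r)"
proof (cases "j < s - 1")
  case True
  then have "d j < r" using assms by (auto simp: disps_def)
  moreover have "1 * r \<le> s * r" using s by (intro mult_right_mono) auto
  ultimately have "d j \<le> s * r" by linarith
  then show ?thesis using True unfolding disp_def by (simp only: if_True)
next
  case False
  have "\<bar>\<Sum>i<s - 1. (- 1) ^ (s - 1 - i) * int (d i)\<bar> \<le> (\<Sum>i<s - 1. \<bar>(- 1) ^ (s - 1 - i) * int (d i)\<bar>)"
    by (rule sum_abs)
  also have "\<dots> \<le> (\<Sum>i<s - 1. int r)"
    using assms by (intro sum_mono) (auto simp: abs_mult power_abs disps_def intro!: less_imp_le)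
  also have "\<dots> \<le> int (s * r)"
  proof -
    have "(s - 1) * r \<le> s * r" by (intro mult_right_mono) auto
    then show ?thesis by (simp flip: of_nat_mult)
  qed
  finally show ?thesis using False by (simp add: disp_def)
qed

lemma sr_bounds: "4 * (s * r) \<le> m"
proof -
  have "s * r * 1 \<le> s * r * s" using s by (intro mult_left_mono) auto
  moreover have "4 * (s * r * s) \<le> m" using r by (simp add: mult_ac)
  ultimately show ?thesis by linarith
qed

lemma disp_bound':
  assumes "d \<in> disps"
  shows "4 * \<bar>disp d j\<bar> \<le> int m"
proof -
  have "int (4 * (s * r)) \<le> int m" using sr_bounds by (simp only: of_nat_le_iff)
  then have "4 * int (s * r) \<le> int m" by (simp only: of_nat_mult of_nat_numeral)
  then show ?thesis using disp_bound[OF assms, of j] by linarith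
qed

lemma cut_int:
  assumes "d \<in> disps"
  shows "int (cut d j) = int (zs j) + int (hz j) + disp d j"
  using disp_bound[OF assms, of j] hz_ge[of j] sr_bounds unfolding cut_def by linarith

lemma cut_zone:
  assumes "d \<in> disps"
  shows "4 * zs j + 3 * m \<le> 4 * cut d j" "4 * cut d j + 3 * m \<le> 4 * zs (Suc j)"
proof -
  have d: "4 * disp d j \<le> int m" "- int m \<le> 4 * disp d j"
    using disp_bound'[OF assms, of j] by linarith+
  have h: "int m \<le> int (hz j)" using hz_ge by simp
  have "int (4 * zs j + 3 * m) \<le> int (4 * cut d j)" "int (4 * cut d j + 3 * m) \<le> int (4 * zs (Suc j))"
    using d h cut_int[OF assms, of j] by simp_all
  then show "4 * zs j + 3 * m \<le> 4 * cut d j" "4 * cut d j + 3 * m \<le> 4 * zs (Suc j)"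
    by (simp_all only: of_nat_le_iff)
qed

lemma cut_zone':
  assumes "d \<in> disps"
  shows "zs j < cut d j" "cut d j < zs (Suc j)"
  using cut_zone[OF assms, of j] m by linarith+

lemma cut_less:
  assumes "d \<in> disps" "i < j"
  shows "cut d i < cut d j"
  using cut_zone'[OF assms(1), of i] cut_zone'[OF assms(1), of j] zs_mono[of "Suc i" j] assms(2) by linarith

lemma inj_cut: "d \<in> disps \<Longrightarrow> inj_on (cut d) A"
  using cut_less by (metis inj_onI linorder_neqE_nat order_less_irrefl)

lemma card_cuts: "d \<in> disps \<Longrightarrow> card (cuts d) = s"
  by (simp add: cuts_def card_image inj_cut)

lemma cuts_subset:
  assumes "d \<in> disps"
  shows "cuts d \<subseteq> {1..<n}"
proof
  fix c assume "c \<in> cuts d"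
  then obtain j where j: "j < s" "c = cut d j" by (auto simp: cuts_def)
  show "c \<in> {1..<n}"
    using cut_zone'[OF assms, of j] zs_mono[of "Suc j" s] j zs_s by auto
qed

lemma zone_exists:
  assumes "p < n"
  shows "\<exists>j<s. zs j \<le> p \<and> p < zs (Suc j)"
proof -
  define j where "j = (LEAST j. p < zs (Suc j))"
  have ex: "p < zs (Suc (s - 1))" using assms zs_s s by (simp del: zs_simps(2))
  then have 1: "p < zs (Suc j)" "j \<le> s - 1" unfolding j_def by (auto intro: LeastI Least_le simp del: zs_simps(2))
  have "zs j \<le> p"
  proof (cases j)
    case (Suc k)
    then have "k < (LEAST j. p < zs (Suc j))" by (simp add: j_def)
    then have "\<not> p < zs (Suc k)" by (rule not_less_Least)
    then show ?thesis by (simp only: Suc not_less)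
  qed simp
  then show ?thesis using 1 s by (intro exI[of _ j]) auto
qed

lemma side_zone:
  assumes "d \<in> disps" "j < s" "zs j \<le> p" "p < zs (Suc j)"
  shows "p \<in> side n (cuts d) \<longleftrightarrow> odd ((s - 1 - j) + (if p < cut d j then 1 else 0))"
proof -
  have "{c \<in> cuts d. p < c} = cut d ` ({j<..<s} \<union> (if p < cut d j then {j} else {}))"
  proof (intro equalityI subsetI)
    fix c assume "c \<in> {c \<in> cuts d. p < c}"
    then obtain i where i: "i < s" "c = cut d i" "p < cut d i" by (auto simp: cuts_def)
    have "\<not> i < j"
      using cut_zone'[OF assms(1), of i] zs_mono[of "Suc i" j] assms i by linarith
    then show "c \<in> cut d ` ({j<..<s} \<union> (if p < cut d j then {j} else {}))"
      using i by (cases "i = j") auto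
  next
    fix c assume "c \<in> cut d ` ({j<..<s} \<union> (if p < cut d j then {j} else {}))"
    then obtain i where i: "c = cut d i" "(j < i \<and> i < s) \<or> (i = j \<and> p < cut d j)"
      by (auto split: if_splits)
    have "p < cut d i" if "j < i"
      using cut_zone'[OF assms(1), of i] zs_mono[of "Suc j" i] that assms by linarith
    then show "c \<in> {c \<in> cuts d. p < c}" using i assms(2) by (auto simp: cuts_def)
  qed
  then have "card {c \<in> cuts d. p < c} = card ({j<..<s} \<union> (if p < cut d j then {j} else {}))"
    using inj_cut[OF assms(1)] by (simp add: card_image)
  also have "\<dots> = (s - 1 - j) + (if p < cut d j then 1 else 0)" by auto
  finally have *: "card {c \<in> cuts d. p < c} = (s - 1 - j) + (if p < cut d j then 1 else 0)" .
  have "p < n" using assms zs_mono[of "Suc j" s] zs_s by simp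
  then show ?thesis unfolding side_def mem_Collect_eq * by simp
qed

lemma side_Int_zone:
  assumes "d \<in> disps" "j < s"
  shows "side n (cuts d) \<inter> {zs j..<zs (Suc j)} =
    (if even (s - 1 - j) then {zs j..<cut d j} else {cut d j..<zs (Suc j)})"
  using side_zone[OF assms] cut_zone'[OF assms(1), of j] by (auto split: if_splits)

lemma zones_partition: "{..<n} = (\<Union>j<s. {zs j..<zs (Suc j)})"
proof (intro equalityI subsetI)
  fix p assume "p \<in> {..<n}"
  then show "p \<in> (\<Union>j<s. {zs j..<zs (Suc j)})" using zone_exists[of p] by auto
next
  fix p assume "p \<in> (\<Union>j<s. {zs j..<zs (Suc j)})"
  then obtain j where "j < s" "p < zs (Suc j)" by auto
  then show "p \<in> {..<n}" using zs_mono[of "Suc j" s] zs_s by simp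
qed

lemma zones_disjoint: "i \<noteq> j \<Longrightarrow> {zs i..<zs (Suc i)} \<inter> {zs j..<zs (Suc j)} = {}"
  using zs_mono[of "Suc i" j] zs_mono[of "Suc j" i] by (cases "i < j") auto

text \<open>Zone \<open>j\<close> contributes \<open>hz j\<close> plus the displacement of its cut
  with alternating sign, and the last displacement is chosen so that the alternating sum
  vanishes.\<close>

lemma card_side:
  assumes "d \<in> disps"
  shows "card (side n (cuts d)) = t * m"
proof -
  let ?A = "side n (cuts d)"
  have "?A = (\<Union>j<s. ?A \<inter> {zs j..<zs (Suc j)})"
    using side_subset[of n "cuts d"] zones_partition by blast
  then have "card ?A = card (\<Union>j<s. ?A \<inter> {zs j..<zs (Suc j)})" by simp
  also have "\<dots> = (\<Sum>j<s. card (?A \<inter> {zs j..<zs (Suc j)}))"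
    by (rule card_UN_disjoint) (use zones_disjoint in blast)+
  finally have "int (card ?A) = (\<Sum>j<s. int (card (?A \<inter> {zs j..<zs (Suc j)})))" by simp
  also have "\<dots> = (\<Sum>j<s. int (hz j) + (- 1) ^ (s - 1 - j) * disp d j)"
  proof (rule sum.cong[OF refl])
    fix j assume "j \<in> {..<s}"
    then show "int (card (?A \<inter> {zs j..<zs (Suc j)})) = int (hz j) + (- 1) ^ (s - 1 - j) * disp d j"
      using side_Int_zone[OF assms, of j] cut_int[OF assms, of j] cut_zone'[OF assms, of j]
      by (auto simp: of_nat_diff)
  qed
  also have "\<dots> = int (t * m) + (\<Sum>j<s. (- 1) ^ (s - 1 - j) * disp d j)"
    unfolding sum.distrib sum_hz[symmetric] by simp
  also have "(\<Sum>j<s. (- 1) ^ (s - 1 - j) * disp d j) = 0"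
  proof -
    have "{..<s} = insert (s - 1) {..<s - 1}" using s by auto
    then have "(\<Sum>j<s. (- 1) ^ (s - 1 - j) * disp d j) =
      (- 1) ^ (s - 1 - (s - 1)) * disp d (s - 1) + (\<Sum>j<s - 1. (- 1) ^ (s - 1 - j) * disp d j)"
      by simp
    then show ?thesis by (simp add: disp_def)
  qed
  finally have "int (card ?A) = int (t * m)" by simp
  then show ?thesis by (simp only: of_nat_eq_iff)
qed

text \<open>Two sides differ exactly on the stretches between corresponding cuts, one in each zone,
  and their equal sizes split this symmetric difference evenly. The first claim holds because
  displacements are at most \<open>s * r\<close>; it is the overlap condition of
  \<open>pr_halves_pair\<close>. The second one makes correlations decay with the distance of the
  displacement vectors.\<close>

lemma side_diff_card:
  assumes "d \<in> disps" "d' \<in> disps"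
  shows "2 * card (side n (cuts d) - side n (cuts d')) \<le> t * m"
    and "j < s - 1 \<Longrightarrow> \<bar>int (d j) - int (d' j)\<bar> \<le> 2 * int (card (side n (cuts d) - side n (cuts d')))"
proof -
  let ?A = "side n (cuts d)" and ?A' = "side n (cuts d')"
  have eq: "card (?A - ?A') = card (?A' - ?A)"
  proof -
    have "card (?A - ?A') = card ?A - card (?A \<inter> ?A')" "card (?A' - ?A) = card ?A' - card (?A \<inter> ?A')"
      by (simp_all add: card_Diff_subset_Int Int_commute)
    then show ?thesis using card_side assms by simp
  qed
  let ?D = "(?A - ?A') \<union> (?A' - ?A)"
  have D: "card ?D = 2 * card (?A - ?A')"
    using eq by (subst card_Un_disjoint) auto
  have iff: "p \<in> ?D \<longleftrightarrow> (p < cut d j) \<noteq> (p < cut d' j)" if "j < s" "zs j \<le> p" "p < zs (Suc j)" for j p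
    using side_zone[OF assms(1) that] side_zone[OF assms(2) that] by auto
  let ?I = "\<lambda>j. {min (cut d j) (cut d' j)..<max (cut d j) (cut d' j)}"
  have I_card: "int (card (?I j)) = \<bar>disp d j - disp d' j\<bar>" for j
    using cut_int[OF assms(1), of j] cut_int[OF assms(2), of j] by (auto simp: min_def max_def)
  have "?D \<subseteq> (\<Union>j<s. ?I j)"
  proof
    fix p assume p: "p \<in> ?D"
    then have "p < n" using side_subset by fastforce
    then obtain j where j: "j < s" "zs j \<le> p" "p < zs (Suc j)" using zone_exists by blast
    then have "p \<in> ?I j" using iff[OF j] p by auto
    then show "p \<in> (\<Union>j<s. ?I j)" using j by blast
  qed
  then have "card ?D \<le> card (\<Union>j<s. ?I j)" by (intro card_mono) auto
  also have "\<dots> \<le> (\<Sum>j<s. card (?I j))" by (rule card_UN_le) simp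
  also have "\<dots> \<le> (\<Sum>j<s. 2 * (s * r))"
  proof (rule sum_mono)
    fix j
    have "int (card (?I j)) \<le> 2 * int (s * r)"
      unfolding I_card using disp_bound[OF assms(1), of j] disp_bound[OF assms(2), of j] by linarith
    then show "card (?I j) \<le> 2 * (s * r)" by linarith
  qed
  also have "\<dots> \<le> m" using r by simp
  also have "\<dots> \<le> t * m" using s by simp
  finally show "2 * card (?A - ?A') \<le> t * m" unfolding D .
  assume j: "j < s - 1"
  have "?I j \<subseteq> ?D"
  proof
    fix p assume p: "p \<in> ?I j"
    then have "zs j \<le> p" "p < zs (Suc j)"
      using cut_zone'[OF assms(1), of j] cut_zone'[OF assms(2), of j] by auto
    then show "p \<in> ?D" using iff[of j p] j p by auto
  qed
  then have "card (?I j) \<le> card ?D" by (intro card_mono) auto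
  then have "int (card (?I j)) \<le> int (2 * card (?A - ?A'))" unfolding D by simp
  then show "\<bar>int (d j) - int (d' j)\<bar> \<le> 2 * int (card (?A - ?A'))"
    unfolding I_card using j by (simp add: disp_def)
qed

text \<open>Up to constants, a bound for the expected number of fair sets in the window, given one
  of them. About \<open>(k + 1) ^ (s - 2)\<close> displacement vectors lie at maximum distance
  \<open>k\<close>, and each is correlated through \<open>(k + 1) powr (- (t - 1) / 2)\<close>. The
  leading 1 is the set itself; the factor \<open>s - 1\<close> counts the coordinates that may
  attain the maximum.\<close>

definition clump :: real where
  "clump = 1 + real (s - 1) * (\<Sum>k=1..r. real (k + 1) ^ (s - 2) / sqrt (real (k + 1)) ^ (t - 1))"

lemma clump_pos: "clump \<ge> 1"
  unfolding clump_def by (simp add: sum_nonneg)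

text \<open>The vectors \<open>d'\<close> are grouped by their maximum distance \<open>k\<close>
  from \<open>d\<close> and by a coordinate \<open>j\<close> that attains it. Distance
  \<open>k\<close> in one zone forces the sides to differ in at least \<open>k / 2\<close>
  positions.\<close>

lemma sum_disps:
  assumes d: "d \<in> disps"
  shows "(\<Sum>d'\<in>disps. 1 / sqrt (real (card (side n (cuts d) - side n (cuts d'))) + 1) ^ (t - 1))
    \<le> real (2 * s) * 2 ^ s * sqrt 2 ^ t * clump"
proof -
  let ?b = "\<lambda>d'. card (side n (cuts d) - side n (cuts d'))"
  let ?w = "\<lambda>k::nat. sqrt 2 ^ (t - 1) / sqrt (real (k + 1)) ^ (t - 1)"
  define F where "F = (\<lambda>j k. {d' \<in> disps. \<bar>int (d j) - int (d' j)\<bar> = int k \<and>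
    (\<forall>i<s - 1. \<bar>int (d i) - int (d' i)\<bar> \<le> int k)})"
  have cover: "disps \<subseteq> insert d (\<Union>j<s - 1. \<Union>k\<in>{1..r}. F j k)"
  proof
    fix d' assume d': "d' \<in> disps"
    show "d' \<in> insert d (\<Union>j<s - 1. \<Union>k\<in>{1..r}. F j k)"
    proof (cases "d' = d")
      case False
      let ?V = "(\<lambda>i. nat \<bar>int (d i) - int (d' i)\<bar>) ` {..<s - 1}"
      have "\<exists>i<s - 1. d i \<noteq> d' i"
      proof (rule ccontr)
        assume "\<not> ?thesis"
        then have "d = d'" using d d' unfolding disps_def by (intro PiE_ext) auto
        then show False using False by simp
      qed
      then obtain i0 where i0: "i0 < s - 1" "d i0 \<noteq> d' i0" by blast
      then have "?V \<noteq> {}" by auto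
      define k where "k = Max ?V"
      have "k \<in> ?V" unfolding k_def using \<open>?V \<noteq> {}\<close> by (intro Max_in) auto
      then obtain j where j: "j < s - 1" "k = nat \<bar>int (d j) - int (d' j)\<bar>" by auto
      have le: "nat \<bar>int (d i) - int (d' i)\<bar> \<le> k" if "i < s - 1" for i
        unfolding k_def using that by (intro Max_ge) auto
      have "k \<ge> 1" using le[OF i0(1)] i0(2) by linarith
      moreover have "d j < r" "d' j < r" using d d' j by (auto simp: disps_def)
      then have "k \<le> r" using j by linarith
      moreover have "\<bar>int (d i) - int (d' i)\<bar> \<le> int k" if "i < s - 1" for i using le[OF that] by linarith
      moreover have "\<bar>int (d j) - int (d' j)\<bar> = int k" using j by linarith
      then have "d' \<in> F j k" using d' calculation unfolding F_def by auto
      ultimately show ?thesis using j by auto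
    qed simp
  qed
  have cardF: "card (F j k) \<le> 2 * (2 * k + 1) ^ (s - 2)" if j: "j < s - 1" for j k
  proof -
    \<comment> \<open>The coordinate \<open>j\<close> has at most two possible values, each of the
      other \<open>s - 2\<close> coordinates at most \<open>2 * k + 1\<close>.\<close>
    let ?P = "\<Pi>\<^sub>E i\<in>{..<s - 1}. if i = j then {d j - k, d j + k} else {d i - k..d i + k}"
    have "F j k \<subseteq> ?P"
    proof
      fix d' assume d': "d' \<in> F j k"
      then have "d' \<in> extensional {..<s - 1}" by (auto simp: F_def disps_def PiE_def)
      moreover have "d' i \<in> (if i = j then {d j - k, d j + k} else {d i - k..d i + k})" if "i < s - 1" for i
      proof -
        have "\<bar>int (d j) - int (d' j)\<bar> = int k" "\<bar>int (d i) - int (d' i)\<bar> \<le> int k"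
          using d' that by (auto simp: F_def)
        then show ?thesis by auto
      qed
      ultimately show "d' \<in> ?P" by (auto simp: PiE_def Pi_def)
    qed
    then have "card (F j k) \<le> card ?P" by (intro card_mono finite_PiE) auto
    also have "\<dots> = (\<Prod>i<s - 1. card (if i = j then {d j - k, d j + k} else {d i - k..d i + k}))"
      by (simp add: card_PiE)
    also have "\<dots> = card {d j - k, d j + k} * (\<Prod>i\<in>{..<s - 1} - {j}. card {d i - k..d i + k})"
      using j by (subst prod.remove[of _ j]) auto
    also have "\<dots> \<le> 2 * (\<Prod>i\<in>{..<s - 1} - {j}. 2 * k + 1)"
      by (intro mult_mono prod_mono) (auto simp: card_insert_if)
    also have "\<dots> = 2 * (2 * k + 1) ^ (s - 2)" using j by (simp add: card_Diff_singleton numeral_2_eq_2)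
    finally show ?thesis .
  qed
  have wF: "1 / sqrt (real (?b d') + 1) ^ (t - 1) \<le> ?w k" if "d' \<in> F j k" "j < s - 1" for d' j k
  proof -
    have "int k \<le> 2 * int (?b d')"
      using side_diff_card(2)[OF d, of d' j] that by (auto simp: F_def)
    then have "k \<le> 2 * ?b d'" by linarith
    then have "real k \<le> real (2 * ?b d')" by (simp only: of_nat_le_iff)
    then have "real k + 1 \<le> 2 * (real (?b d') + 1)" by simp
    then have "sqrt (real (k + 1)) \<le> sqrt 2 * sqrt (real (?b d') + 1)"
      by (simp add: real_sqrt_mult[symmetric])
    then have "sqrt (real (k + 1)) ^ (t - 1) \<le> (sqrt 2 * sqrt (real (?b d') + 1)) ^ (t - 1)"
      by (intro power_mono) auto
    then show ?thesis by (simp add: field_simps power_mult_distrib)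
  qed
  have "(\<Sum>d'\<in>disps. 1 / sqrt (real (?b d') + 1) ^ (t - 1))
    \<le> (\<Sum>d'\<in>insert d (\<Union>j<s - 1. \<Union>k\<in>{1..r}. F j k). 1 / sqrt (real (?b d') + 1) ^ (t - 1))"
    by (rule sum_mono2[OF _ cover]) (auto simp: F_def)
  also have "\<dots> \<le> 1 / sqrt (real (?b d) + 1) ^ (t - 1)
      + (\<Sum>d'\<in>(\<Union>j<s - 1. \<Union>k\<in>{1..r}. F j k). 1 / sqrt (real (?b d') + 1) ^ (t - 1))"
    by (subst sum.insert_if) (auto simp: F_def)
  also have "\<dots> \<le> 1 + (\<Sum>j<s - 1. \<Sum>k\<in>{1..r}. \<Sum>d'\<in>F j k. 1 / sqrt (real (?b d') + 1) ^ (t - 1))"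
  proof (rule add_mono)
    show "1 / sqrt (real (?b d) + 1) ^ (t - 1) \<le> 1" by simp
    have UN_le: "(\<Sum>x\<in>(\<Union>i\<in>I. G i). h x) \<le> (\<Sum>i\<in>I. \<Sum>x\<in>G i. h x)"
      if "finite I" "\<And>i. finite (G i)" "\<And>x. (0::real) \<le> h x"
      for I :: "nat set" and G :: "nat \<Rightarrow> (nat \<Rightarrow> nat) set" and h
      using that(1)
    proof (induction rule: finite_induct)
      case (insert i I)
      have "(\<Sum>x\<in>(\<Union>i\<in>insert i I. G i). h x) \<le> (\<Sum>x\<in>G i. h x) + (\<Sum>x\<in>(\<Union>i\<in>I. G i). h x)"
        using sum_Un[of "G i" "\<Union>i\<in>I. G i" h] that insert.hyps sum_nonneg[of "G i \<inter> (\<Union>i\<in>I. G i)" h]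
        by auto
      then show ?case using insert by simp
    qed simp
    have fF: "finite (F j k)" for j k by (simp add: F_def)
    show "(\<Sum>d'\<in>(\<Union>j<s - 1. \<Union>k\<in>{1..r}. F j k). 1 / sqrt (real (?b d') + 1) ^ (t - 1))
      \<le> (\<Sum>j<s - 1. \<Sum>k\<in>{1..r}. \<Sum>d'\<in>F j k. 1 / sqrt (real (?b d') + 1) ^ (t - 1))"
      by (intro order_trans[OF UN_le] sum_mono UN_le) (auto simp: fF)
  qed
  also have "\<dots> \<le> 1 + (\<Sum>j<s - 1. \<Sum>k\<in>{1..r}. real (2 * (2 * k + 1) ^ (s - 2)) * ?w k)"
  proof (intro add_left_mono sum_mono)
    fix j k assume "j \<in> {..<s - 1}"
    then have j: "j < s - 1" by simp
    have "(\<Sum>d'\<in>F j k. 1 / sqrt (real (?b d') + 1) ^ (t - 1)) \<le> real (card (F j k)) * ?w k"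
      by (rule sum_bounded_above) (rule wF[OF _ j])
    also have "\<dots> \<le> real (2 * (2 * k + 1) ^ (s - 2)) * ?w k"
      using cardF[OF j, of k] by (intro mult_right_mono) (simp_all only: of_nat_le_iff, auto)
    finally show "(\<Sum>d'\<in>F j k. 1 / sqrt (real (?b d') + 1) ^ (t - 1)) \<le> real (2 * (2 * k + 1) ^ (s - 2)) * ?w k" .
  qed
  also have "\<dots> \<le> 1 + (\<Sum>j<s - 1. \<Sum>k\<in>{1..r}. 2 * 2 ^ s * sqrt 2 ^ t * (real (k + 1) ^ (s - 2) / sqrt (real (k + 1)) ^ (t - 1)))"
  proof (intro add_left_mono sum_mono)
    fix k :: nat
    have "real ((2 * k + 1) ^ (s - 2)) \<le> (2 * real (k + 1)) ^ (s - 2)"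
      by (simp only: of_nat_power) (intro power_mono, auto)
    also have "\<dots> = 2 ^ (s - 2) * real (k + 1) ^ (s - 2)" by (rule power_mult_distrib)
    also have "\<dots> \<le> 2 ^ s * real (k + 1) ^ (s - 2)"
      by (intro mult_right_mono power_increasing) auto
    finally have "real ((2 * k + 1) ^ (s - 2)) \<le> 2 ^ s * real (k + 1) ^ (s - 2)" .
    moreover have "sqrt 2 ^ (t - 1) \<le> sqrt 2 ^ t" by (intro power_increasing) auto
    ultimately have "real ((2 * k + 1) ^ (s - 2)) * sqrt 2 ^ (t - 1) / sqrt (real (k + 1)) ^ (t - 1)
      \<le> (2 ^ s * real (k + 1) ^ (s - 2)) * sqrt 2 ^ t / sqrt (real (k + 1)) ^ (t - 1)"
      by (intro divide_right_mono mult_mono) auto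
    then show "real (2 * (2 * k + 1) ^ (s - 2)) * ?w k
      \<le> 2 * 2 ^ s * sqrt 2 ^ t * (real (k + 1) ^ (s - 2) / sqrt (real (k + 1)) ^ (t - 1))"
      by (simp add: mult_ac)
  qed
  also have "\<dots> = 1 + (2 * 2 ^ s * sqrt 2 ^ t) * (clump - 1)"
    by (simp only: sum_distrib_left[symmetric] clump_def) simp
  also have "\<dots> \<le> real (2 * s) * 2 ^ s * sqrt 2 ^ t * clump"
  proof -
    let ?K = "2 * 2 ^ s * sqrt 2 ^ t :: real"
    have K1: "1 * 1 * 1 \<le> ?K" by (intro mult_mono one_le_power) auto
    have "1 * ?K \<le> real s * ?K" using s by (intro mult_right_mono) auto
    then have "1 * ?K * clump \<le> real s * ?K * clump" using clump_pos by (intro mult_right_mono) auto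
    moreover have "1 + ?K * (clump - 1) \<le> ?K * clump" using K1 by (simp add: algebra_simps)
    ultimately have "1 + ?K * (clump - 1) \<le> real s * ?K * clump" by linarith
    then show ?thesis by (simp add: algebra_simps)
  qed
  finally show ?thesis .
qed

definition num :: "(nat \<Rightarrow> nat) \<Rightarrow> real" where
  "num f = (\<Sum>d\<in>disps. of_bool (halves t m (cuts d) f))"

lemma num_second_moment:
  "avg t n (\<lambda>f. of_bool (balanced t m f) * (num f)\<^sup>2)
    \<le> real (2 * s) * 2 ^ s * sqrt 2 ^ t * ub2 t * ub t * (r ^ (s - 1) / m ^ (t - 1)) * clump"
proof -
  let ?b = "\<lambda>d d'. card (side n (cuts d) - side n (cuts d'))"
  have "avg t n (\<lambda>f. of_bool (balanced t m f) * (num f)\<^sup>2) =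
    (\<Sum>d\<in>disps. \<Sum>d'\<in>disps. pr t n (\<lambda>f. balanced t m f \<and> halves t m (cuts d) f \<and> halves t m (cuts d') f))"
    proof -
    define H :: "(nat \<Rightarrow> nat) \<Rightarrow> (nat \<Rightarrow> nat) \<Rightarrow> real" where "H d f = of_bool (halves t m (cuts d) f)" for d f
    define B :: "(nat \<Rightarrow> nat) \<Rightarrow> real" where "B f = of_bool (balanced t m f)" for f
    have "(of_bool (balanced t m f \<and> halves t m (cuts d) f \<and> halves t m (cuts d') f) :: real) = B f * (H d f * H d' f)" for f d d'
      by (simp add: H_def B_def of_bool_conj)
    moreover have "of_bool (balanced t m f) * (num f)\<^sup>2 = (\<Sum>d\<in>disps. \<Sum>d'\<in>disps. B f * (H d f * H d' f))" for f
    proof -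
      have "num f = (\<Sum>d\<in>disps. H d f)" by (simp only: num_def H_def)
      then have "of_bool (balanced t m f) * (num f)\<^sup>2 = B f * ((\<Sum>d\<in>disps. H d f) * (\<Sum>d'\<in>disps. H d' f))"
        by (simp only: B_def power2_eq_square)
      also have "(\<Sum>d\<in>disps. H d f) * (\<Sum>d'\<in>disps. H d' f) = (\<Sum>d\<in>disps. \<Sum>d'\<in>disps. H d f * H d' f)"
        by (rule sum_product)
      also have "B f * \<dots> = (\<Sum>d\<in>disps. \<Sum>d'\<in>disps. B f * (H d f * H d' f))"
        by (simp only: sum_distrib_left)
      finally show ?thesis .
    qed
    ultimately show ?thesis by (simp only: pr_def avg_sum)
  qed
  also have "\<dots> \<le> (\<Sum>d\<in>disps. \<Sum>d'\<in>disps. ub2 t * ub t / m ^ (t - 1) * (1 / sqrt (real (?b d d') + 1) ^ (t - 1)))"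
    using t_pos m by (intro sum_mono pr_halves_pair card_side side_diff_card(1)) auto
  also have "\<dots> = ub2 t * ub t / m ^ (t - 1) * (\<Sum>d\<in>disps. \<Sum>d'\<in>disps. 1 / sqrt (real (?b d d') + 1) ^ (t - 1))"
    by (simp only: sum_distrib_left)
  also have "\<dots> \<le> ub2 t * ub t / m ^ (t - 1) * (\<Sum>d\<in>disps. real (2 * s) * 2 ^ s * sqrt 2 ^ t * clump)"
    using ub_pos[OF t_pos] ub2_pos[OF t_pos] by (intro mult_left_mono sum_mono sum_disps) auto
  also have "\<dots> = real (2 * s) * 2 ^ s * sqrt 2 ^ t * ub2 t * ub t * (r ^ (s - 1) / m ^ (t - 1)) * clump"
    by (simp add: card_disps)
  finally show ?thesis .
qed

text \<open>Cauchy-Schwarz for the number of fair sets times an indicator. The event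
  \<open>Q\<close>, later the necessity of \<open>s\<close> cuts, enters only through the first
  moment, so the second moment can be estimated without it.\<close>

lemma pr_lower_from_num:
  fixes c :: real
  assumes "\<And>d. d \<in> disps \<Longrightarrow> c \<le> pr t n (\<lambda>f. balanced t m f \<and> halves t m (cuts d) f \<and> Q f)" "0 \<le> c"
  shows "(r ^ (s - 1) * c)\<^sup>2 \<le> pr t n (\<lambda>f. balanced t m f \<and> Q f \<and> (\<exists>d\<in>disps. halves t m (cuts d) f))
    * avg t n (\<lambda>f. of_bool (balanced t m f) * (num f)\<^sup>2)"
proof -
  define I :: "(nat \<Rightarrow> nat) \<Rightarrow> real" where
    "I f = of_bool (balanced t m f \<and> Q f \<and> (\<exists>d\<in>disps. halves t m (cuts d) f))" for f
  define G where "G f = of_bool (balanced t m f) * num f" for f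
  have "r ^ (s - 1) * c = (\<Sum>d\<in>disps. c)" by (simp add: card_disps)
  also have "\<dots> \<le> (\<Sum>d\<in>disps. pr t n (\<lambda>f. balanced t m f \<and> halves t m (cuts d) f \<and> Q f))"
    by (intro sum_mono assms)
  also have "\<dots> = avg t n (\<lambda>f. \<Sum>d\<in>disps. of_bool (balanced t m f \<and> halves t m (cuts d) f \<and> Q f))"
    by (simp only: pr_def avg_sum)
  also have "\<dots> \<le> avg t n (\<lambda>f. I f * G f)"
  proof (rule avg_mono)
    fix f
    show "(\<Sum>d\<in>disps. of_bool (balanced t m f \<and> halves t m (cuts d) f \<and> Q f)) \<le> I f * G f"
    proof (cases "balanced t m f \<and> Q f \<and> (\<exists>d\<in>disps. halves t m (cuts d) f)")
      case True
      then show ?thesis by (simp add: I_def G_def num_def)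
    next
      case False
      then have "(\<Sum>d\<in>disps. of_bool (balanced t m f \<and> halves t m (cuts d) f \<and> Q f)) = (0::real)"
        by (intro sum.neutral) auto
      then show ?thesis using False by (simp only: I_def of_bool_eq)
    qed
  qed
  finally have "r ^ (s - 1) * c \<le> avg t n (\<lambda>f. I f * G f)" by simp
  then have "(r ^ (s - 1) * c)\<^sup>2 \<le> (avg t n (\<lambda>f. I f * G f))\<^sup>2"
    using assms(2) by (intro power_mono) auto
  also have "\<dots> \<le> avg t n (\<lambda>f. (I f)\<^sup>2) * avg t n (\<lambda>f. (G f)\<^sup>2)"
  proof -
    have "(\<Sum>f\<in>words t n. I f * G f)\<^sup>2 \<le> (\<Sum>f\<in>words t n. (I f)\<^sup>2) * (\<Sum>f\<in>words t n. (G f)\<^sup>2)"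
      by (rule Cauchy_Schwarz_ineq_sum)
    then have "(\<Sum>f\<in>words t n. I f * G f)\<^sup>2 / (real t ^ n)\<^sup>2
      \<le> (\<Sum>f\<in>words t n. (I f)\<^sup>2) * (\<Sum>f\<in>words t n. (G f)\<^sup>2) / (real t ^ n)\<^sup>2"
      by (intro divide_right_mono) auto
    then show ?thesis unfolding avg_def by (simp add: power_divide power2_eq_square)
  qed
  also have "(\<lambda>f. (I f)\<^sup>2) = I" by (auto simp: I_def)
  also have "(\<lambda>f. (G f)\<^sup>2) = (\<lambda>f. of_bool (balanced t m f) * (num f)\<^sup>2)"
    by (auto simp: G_def)
  finally show ?thesis by (simp add: I_def[abs_def] pr_def)
qed

end

section \<open>Words that follow a prescribed deviation profile\<close>

lemma pr_indep_family:
  assumes "t \<ge> 1" "finite I" "disjoint_family_on B I" "\<And>x. x \<in> I \<Longrightarrow> depends_on (B x) (P x)"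
    "\<And>x. x \<in> I \<Longrightarrow> c \<le> pr t n (P x)" "0 \<le> c"
  shows "c ^ card I \<le> pr t n (\<lambda>f. \<forall>x\<in>I. P x f)"
  using assms(2-5)
proof (induction rule: finite_induct)
  case empty
  then show ?case using avg_const[OF assms(1), of n 1] by (simp add: pr_def)
next
  case (insert x I)
  have dj: "disjoint_family_on B I"
    using insert.prems(1) by (rule disjoint_family_on_mono[rotated]) auto
  have "B x \<inter> B y = {}" if "y \<in> I" for y
    using insert.hyps insert.prems(1) that by (intro disjoint_family_onD[of B "insert x I"]) auto
  then have disj: "B x \<inter> (\<Union>y\<in>I. B y) = {}" by blast
  have dep: "depends_on (\<Union>y\<in>I. B y) (\<lambda>f. \<forall>y\<in>I. P y f)"
    unfolding depends_on_def
  proof (intro allI impI)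
    fix f g :: "nat \<Rightarrow> nat" assume fg: "\<forall>p\<in>\<Union>y\<in>I. B y. f p = g p"
    have "P y f = P y g" if "y \<in> I" for y
      using insert.prems(2)[of y] that fg unfolding depends_on_def by blast
    then show "(\<forall>y\<in>I. P y f) = (\<forall>y\<in>I. P y g)" by blast
  qed
  have "c ^ card (insert x I) = c * c ^ card I" using insert.hyps by simp
  also have "\<dots> \<le> pr t n (P x) * pr t n (\<lambda>f. \<forall>y\<in>I. P y f)"
    using insert.IH[OF dj] insert.prems assms(6) pr_nonneg by (intro mult_mono) auto
  also have "\<dots> = pr t n (\<lambda>f. P x f \<and> (\<forall>y\<in>I. P y f))"
    using insert.prems(2) by (intro pr_indep[symmetric, OF assms(1) _ dep disj]) auto
  also have "\<dots> = pr t n (\<lambda>f. \<forall>y\<in>insert x I. P y f)" by simp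
  finally show ?case .
qed

text \<open>A box of side \<open>\<tau>\<close>, comparable to \<open>sqrt b\<close>, contains of
  the order of \<open>sqrt b ^ (t - 1)\<close> integer count vectors, each of probability at least
  of order \<open>1 / sqrt b ^ (t - 1)\<close>. Their disjoint events add up to a constant. The
  first \<open>t - 1\<close> counts are chosen freely, the last is what remains of
  \<open>b\<close>.\<close>

lemma box_prob:
  fixes c R \<theta> :: real
  assumes t: "t \<ge> 1" and c: "c > 0" and \<theta>: "\<theta> > 0"
    and block: "\<forall>n a b d. a + b \<le> n \<longrightarrow> b0 \<le> b \<longrightarrow>
    (\<Sum>i<t. d i) = b \<longrightarrow> (\<forall>i<t. \<bar>real (d i) - b / t\<bar> \<le> sqrt b) \<longrightarrow>
    c / sqrt (real b + 1) ^ (t - 1) \<le> pr t n (\<lambda>f. (\<forall>i<t. cnt f {a..<a + b} i = d i) \<and>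
      (\<forall>i<t. \<forall>l\<le>b. \<bar>dev t f i a l\<bar> \<le> R * sqrt b))"
  shows "\<exists>c0>0. \<exists>b1. \<forall>n a b \<tau> E. a + b \<le> n \<longrightarrow> b1 \<le> b \<longrightarrow> (\<Sum>i<t. E i) = 0 \<longrightarrow>
    \<theta> * sqrt b \<le> \<tau> \<longrightarrow> (\<forall>i<t. \<bar>E i\<bar> + \<tau> \<le> sqrt b) \<longrightarrow>
    c0 \<le> pr t n (\<lambda>f. (\<forall>i<t. \<bar>real (cnt f {a..<a + b} i) - b / t - E i\<bar> \<le> \<tau>) \<and>
      (\<forall>i<t. \<forall>l\<le>b. \<bar>dev t f i a l\<bar> \<le> R * sqrt b))"
proof -
  define c0 where "c0 = c * (\<theta> / (8 * t)) ^ (t - 1)"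
  have c0: "c0 > 0" using c \<theta> t by (simp add: c0_def)
  \<comment> \<open>\<open>t\<^sup>2 \<le> b\<close> gives \<open>sqrt b \<le> b / t\<close>, which
    keeps all counts nonnegative; \<open>(4 * t / \<theta>)\<^sup>2 \<le> b\<close> gives
    \<open>4 * t \<le> \<tau>\<close>, which leaves room for rounding.\<close>
  define b1 where "b1 = max b0 (max (t\<^sup>2) (nat \<lceil>(4 * t / \<theta>)\<^sup>2\<rceil> + 1))"
  have "c0 \<le> pr t n (\<lambda>f. (\<forall>i<t. \<bar>real (cnt f {a..<a + b} i) - b / t - E i\<bar> \<le> \<tau>) \<and>
      (\<forall>i<t. \<forall>l\<le>b. \<bar>dev t f i a l\<bar> \<le> R * sqrt b))"
    if ab: "a + b \<le> n" and b1: "b1 \<le> b" and E0: "(\<Sum>i<t. E i) = 0"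
      and \<tau>: "\<theta> * sqrt b \<le> \<tau>" and E: "\<forall>i<t. \<bar>E i\<bar> + \<tau> \<le> sqrt b"
    for n a b and \<tau> :: real and E :: "nat \<Rightarrow> real"
  proof -
    have b: "b0 \<le> b" "t\<^sup>2 \<le> b" "(4 * t / \<theta>)\<^sup>2 \<le> b" "1 \<le> b"
      using b1 unfolding b1_def by (linarith+)
    have sqb: "4 * t / \<theta> \<le> sqrt b" using b(3) by (rule real_le_rsqrt)
    have \<tau>t: "4 * t \<le> \<tau>"
    proof -
      have "4 * t = \<theta> * (4 * t / \<theta>)" using \<theta> by simp
      also have "\<dots> \<le> \<theta> * sqrt b" using sqb \<theta> by (intro mult_left_mono) auto
      finally show ?thesis using \<tau> by simp
    qed
    \<comment> \<open>The number of choices for each free count. Each is off by at most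
      \<open>W + 1\<close>, so the last count, which collects all these errors, is off by at most
      \<open>t * (W + 1)\<close>, and this is below \<open>\<tau>\<close>.\<close>
    define W where "W = nat \<lfloor>\<tau> / (2 * t)\<rfloor>"
    have W: "W \<le> \<tau> / (2 * t)" "\<tau> / (2 * t) < real W + 1" "2 \<le> \<tau> / (2 * t)"
    proof -
      show 2: "2 \<le> \<tau> / (2 * t)" using \<tau>t t by (simp add: field_simps)
      then have "\<lfloor>\<tau> / (2 * t)\<rfloor> \<ge> 0" by simp
      then have "real W = of_int \<lfloor>\<tau> / (2 * t)\<rfloor>" by (simp add: W_def)
      then show "W \<le> \<tau> / (2 * t)" "\<tau> / (2 * t) < real W + 1" by linarith+
    qed
    have Wt: "real t * (real W + 1) \<le> \<tau>"
    proof -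
      have "real t * (real W + 1) \<le> real t * (\<tau> / (2 * t) + 1)" using W by (intro mult_left_mono) auto
      also have "\<dots> = \<tau> / 2 + t" using t by (simp add: field_simps)
      finally show ?thesis using \<tau>t by linarith
    qed
    have W1: "real W + 1 \<le> \<tau>"
    proof -
      have "1 * (real W + 1) \<le> real t * (real W + 1)" using t by (intro mult_right_mono) auto
      then show ?thesis unfolding mult_1 using Wt by (rule order_trans)
    qed
    have bt: "sqrt b \<le> b / t"
    proof -
      have "real (t\<^sup>2) \<le> real b" using b(2) by (simp only: of_nat_le_iff)
      then have "real t \<le> sqrt b" by (intro real_le_rsqrt) simp
      then have "t * sqrt b \<le> sqrt b * sqrt b" by (intro mult_right_mono) auto
      then show ?thesis using t by (simp add: field_simps)
    qed
    define base where "base i = \<lfloor>b / t + E i\<rfloor>" for i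
    define J where "J = {..<t - 1}"
    define v :: "(nat \<Rightarrow> nat) \<Rightarrow> nat \<Rightarrow> int" where
      "v w i = (if i < t - 1 then base i + int (w i) else int b - (\<Sum>j\<in>J. base j + int (w j)))" for w i
    define Ws where "Ws = J \<rightarrow>\<^sub>E {..<W}"
    have t_split: "{..<t} = insert (t - 1) J" "t - 1 \<notin> J" "finite J" "card J = t - 1"
      using t by (auto simp: J_def)
    have v_sum: "(\<Sum>i<t. v w i) = int b" for w
    proof -
      have "(\<Sum>j\<in>J. v w j) = (\<Sum>j\<in>J. base j + int (w j))"
        by (intro sum.cong) (auto simp: v_def J_def)
      then show ?thesis unfolding t_split(1) using t_split by (simp add: v_def)
    qed
    have near1: "- 1 \<le> real_of_int (v w i) - (b / t + E i)" "real_of_int (v w i) - (b / t + E i) \<le> W"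
      if "w \<in> Ws" "i \<in> J" for w i
    proof -
      have "w i < W" using that by (auto simp: Ws_def)
      then have "real (w i) \<le> real W" by simp
      moreover have "real_of_int (v w i) = of_int (base i) + real (w i)"
        using that by (simp add: v_def J_def)
      moreover have "of_int (base i) \<le> b / t + E i" "b / t + E i - 1 \<le> of_int (base i)"
        unfolding base_def by linarith+
      ultimately show "- 1 \<le> real_of_int (v w i) - (b / t + E i)" "real_of_int (v w i) - (b / t + E i) \<le> W"
        by linarith+
    qed
    have near: "\<bar>real_of_int (v w i) - b / t - E i\<bar> \<le> \<tau>" if w: "w \<in> Ws" and i: "i < t" for w i
    proof (cases "i \<in> J")
      case True
      then show ?thesis using near1[OF w True] W1 by linarith
    next
      case False
      then have it: "i = t - 1" using i by (auto simp: J_def)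
      have "(\<Sum>k<t. real_of_int (v w k) - (b / t + E k)) = 0"
      proof -
        have "(\<Sum>k<t. real_of_int (v w k)) = real b"
          using v_sum[of w] by (simp flip: of_int_sum)
        then show ?thesis using E0 t by (simp add: sum_subtractf sum.distrib)
      qed
      then have "real_of_int (v w i) - (b / t + E i) = - (\<Sum>k\<in>J. real_of_int (v w k) - (b / t + E k))"
        unfolding t_split(1) using t_split it by simp
      moreover have "\<bar>\<Sum>k\<in>J. real_of_int (v w k) - (b / t + E k)\<bar> \<le> (\<Sum>k\<in>J. real W + 1)"
      proof (rule order_trans[OF sum_abs], rule sum_mono)
        fix k assume "k \<in> J"
        then show "\<bar>real_of_int (v w k) - (b / t + E k)\<bar> \<le> real W + 1"
          using near1[OF w, of k] by linarith
      qed
      moreover have "(\<Sum>k\<in>J. real W + 1) \<le> real t * (real W + 1)"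
        using t_split t by (simp add: mult_right_mono)
      ultimately show ?thesis using Wt by linarith
    qed
    have v_nonneg: "0 \<le> v w i" if "w \<in> Ws" "i < t" for w i
    proof -
      have "b / t + E i - \<tau> \<le> real_of_int (v w i)" using near[OF that] by linarith
      moreover have "\<bar>E i\<bar> + \<tau> \<le> sqrt b" using E that by blast
      ultimately have "0 \<le> real_of_int (v w i)" using bt by linarith
      then show ?thesis by simp
    qed
    define P where "P w f \<longleftrightarrow> (\<forall>i<t. cnt f {a..<a + b} i = nat (v w i)) \<and>
      (\<forall>i<t. \<forall>l\<le>b. \<bar>dev t f i a l\<bar> \<le> R * sqrt b)" for w f
    have P_ge: "c / sqrt (real b + 1) ^ (t - 1) \<le> pr t n (P w)" if w: "w \<in> Ws" for w
    proof -
      have "(\<Sum>i<t. nat (v w i)) = b"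
      proof -
        have "int (\<Sum>i<t. nat (v w i)) = (\<Sum>i<t. v w i)"
          unfolding of_nat_sum using v_nonneg[OF w] by (intro sum.cong) auto
        then show ?thesis unfolding v_sum by (simp only: of_nat_eq_iff)
      qed
      moreover have "\<bar>real (nat (v w i)) - b / t\<bar> \<le> sqrt b" if "i < t" for i
      proof -
        have "\<bar>real_of_int (v w i) - b / t\<bar> \<le> sqrt b"
          using near[OF w that] E[rule_format, OF that] by linarith
        then show ?thesis using v_nonneg[OF w that] by simp
      qed
      ultimately show ?thesis
        unfolding P_def[abs_def] by (intro block[rule_format] ab b(1)) auto
    qed
    have "c0 \<le> (real W / sqrt (real b + 1)) ^ (t - 1) * c"
    proof -
      have "\<theta> / (8 * t) \<le> real W / sqrt (real b + 1)"
      proof -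
        have "sqrt (real b + 1) \<le> sqrt (4 * b)" using b(4) by simp
        also have "\<dots> = 2 * sqrt b" by (simp add: real_sqrt_mult)
        finally have "\<theta> / (8 * t) * sqrt (real b + 1) \<le> \<theta> / (8 * t) * (2 * sqrt b)"
          using \<theta> by (intro mult_left_mono) auto
        also have "\<dots> = \<theta> * sqrt b / (4 * t)" by simp
        also have "\<dots> \<le> \<tau> / (4 * t)" using \<tau> by (intro divide_right_mono) auto
        also have "\<dots> = \<tau> / (2 * t) / 2" by simp
        also have "\<dots> \<le> real W"
        proof -
          have "x / 2 \<le> real W" if "x < real W + 1" "2 \<le> x" for x using that by linarith
          then show ?thesis using W(2,3) by blast
        qed
        finally show ?thesis by (subst pos_le_divide_eq) auto
      qed
      then have "(\<theta> / (8 * t)) ^ (t - 1) \<le> (real W / sqrt (real b + 1)) ^ (t - 1)"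
        using \<theta> by (intro power_mono) auto
      then show ?thesis using c unfolding c0_def by (simp add: mult.commute mult_right_mono)
    qed
    also have "\<dots> = (\<Sum>w\<in>Ws. c / sqrt (real b + 1) ^ (t - 1))"
      using t_split by (simp add: Ws_def card_PiE power_divide)
    also have "\<dots> \<le> (\<Sum>w\<in>Ws. pr t n (P w))" by (intro sum_mono P_ge)
    also have "\<dots> \<le> pr t n (\<lambda>f. \<exists>w\<in>Ws. P w f)"
    proof (rule pr_disjoint_Ex)
      show "finite Ws" using t_split by (simp add: Ws_def finite_PiE)
      fix w w' f assume w: "w \<in> Ws" "w' \<in> Ws" "P w f" "P w' f"
      have "w i = w' i" if "i \<in> J" for i
      proof -
        have "i < t" "i < t - 1" using that by (auto simp: J_def)
        then have "nat (v w i) = nat (v w' i)" using w(3,4) unfolding P_def by metis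
        then have "v w i = v w' i" using v_nonneg w(1,2) \<open>i < t\<close> by (metis nat_eq_iff2)
        then show ?thesis using \<open>i < t - 1\<close> by (simp add: v_def)
      qed
      then show "w = w'" using w(1,2) unfolding Ws_def by (intro PiE_ext) auto
    qed
    also have "\<dots> \<le> pr t n (\<lambda>f. (\<forall>i<t. \<bar>real (cnt f {a..<a + b} i) - b / t - E i\<bar> \<le> \<tau>) \<and>
      (\<forall>i<t. \<forall>l\<le>b. \<bar>dev t f i a l\<bar> \<le> R * sqrt b))"
    proof (rule pr_mono)
      fix f assume "\<exists>w\<in>Ws. P w f"
      then obtain w where w: "w \<in> Ws" "P w f" by blast
      have "\<bar>real (cnt f {a..<a + b} i) - b / t - E i\<bar> \<le> \<tau>" if "i < t" for i
      proof -
        have "real (cnt f {a..<a + b} i) = real_of_int (v w i)"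
          using w that v_nonneg[OF w(1) that] unfolding P_def by simp
        then show ?thesis using near[OF w(1) that] by simp
      qed
      then show "(\<forall>i<t. \<bar>real (cnt f {a..<a + b} i) - b / t - E i\<bar> \<le> \<tau>) \<and>
        (\<forall>i<t. \<forall>l\<le>b. \<bar>dev t f i a l\<bar> \<le> R * sqrt b)"
        using w unfolding P_def by blast
    qed
    finally show ?thesis .
  qed
  then show ?thesis using c0 by (intro exI[of _ c0] conjI exI[of _ b1]) auto
qed

text \<open>The word is cut into \<open>N\<close> blocks; block \<open>k\<close> has drift \<open>v k i\<close> per bead for type \<open>i\<close>. All blocks but
  one on each side are only required to follow their drift up to \<open>\<tau>\<close>; the counts of the last block on
  each side are then forced, which costs a factor \<open>b powr (- (t - 1) / 2)\<close>.\<close>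

lemma tube_prob:
  fixes c R \<theta> c0 \<tau> \<beta> \<sigma> :: real and g :: "nat \<Rightarrow> nat" and v :: "nat \<Rightarrow> nat \<Rightarrow> real"
  assumes t: "t \<ge> 1" and c: "c > 0" "c0 > 0" "R > 0"
    and block: "\<forall>n a b d. a + b \<le> n \<longrightarrow> b0 \<le> b \<longrightarrow>
    (\<Sum>i<t. d i) = b \<longrightarrow> (\<forall>i<t. \<bar>real (d i) - b / t\<bar> \<le> sqrt b) \<longrightarrow>
    c / sqrt (real b + 1) ^ (t - 1) \<le> pr t n (\<lambda>f. (\<forall>i<t. cnt f {a..<a + b} i = d i) \<and>
      (\<forall>i<t. \<forall>l\<le>b. \<bar>dev t f i a l\<bar> \<le> R * sqrt b))"
    and box: "\<forall>n a b \<tau> E. a + b \<le> n \<longrightarrow> b1 \<le> b \<longrightarrow> (\<Sum>i<t. E i) = 0 \<longrightarrow>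
    \<theta> * sqrt b \<le> \<tau> \<longrightarrow> (\<forall>i<t. \<bar>E i\<bar> + \<tau> \<le> sqrt b) \<longrightarrow>
    c0 \<le> pr t n (\<lambda>f. (\<forall>i<t. \<bar>real (cnt f {a..<a + b} i) - b / t - E i\<bar> \<le> \<tau>) \<and>
      (\<forall>i<t. \<forall>l\<le>b. \<bar>dev t f i a l\<bar> \<le> R * sqrt b))"
    and g: "g 0 = 0" "g N = n" "\<And>k. k < N \<Longrightarrow> g k \<le> g (Suc k)"
    and b: "\<And>k. k < N \<Longrightarrow> max (max b0 b1) (t\<^sup>2) \<le> g (Suc k) - g k"
    and v: "\<And>k. k < N \<Longrightarrow> (\<Sum>i<t. v k i) = 0"
      "\<And>k i. k < N \<Longrightarrow> i < t \<Longrightarrow> real (g (Suc k) - g k) * \<bar>v k i\<bar> \<le> \<beta>"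
    and \<tau>: "\<theta> * \<sigma> \<le> \<tau>" "N * \<tau> \<le> \<beta>" "0 < \<theta>" "0 \<le> \<tau>"
    and sq: "\<And>k. k < N \<Longrightarrow> sqrt (real (g (Suc k) - g k)) \<le> \<sigma>"
      "\<And>k. k < N \<Longrightarrow> \<beta> + \<tau> \<le> sqrt (real (g (Suc k) - g k))"
      "\<And>k. k < N \<Longrightarrow> 3 * \<beta> \<le> sqrt (real (g (Suc k) - g k))"
    and A: "A \<subseteq> {..<n}" "n = 2 * t * m" "card A = t * m"
      "\<And>k. k < N \<Longrightarrow> {g k..<g (Suc k)} \<subseteq> A \<or> {g k..<g (Suc k)} \<inter> A = {}"
    and a1: "a1 < N" "{g a1..<g (Suc a1)} \<subseteq> A"
    and a2: "a2 < N" "{g a2..<g (Suc a2)} \<inter> A = {}"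
    and drift: "\<And>i. i < t \<Longrightarrow> \<bar>\<Sum>k | k < N \<and> {g k..<g (Suc k)} \<subseteq> A. real (g (Suc k) - g k) * v k i\<bar> \<le> \<beta>"
      "\<And>i. i < t \<Longrightarrow> \<bar>\<Sum>k | k < N \<and> {g k..<g (Suc k)} \<inter> A = {}. real (g (Suc k) - g k) * v k i\<bar> \<le> \<beta>"
  shows "c0 ^ N * (c / sqrt (\<sigma>\<^sup>2 + 1) ^ (t - 1))\<^sup>2 \<le> pr t n (\<lambda>f. (\<forall>i<t. cnt f A i = m) \<and>
    (\<forall>i<t. cnt f ({..<n} - A) i = m) \<and>
    (\<forall>k<N. \<forall>i<t. \<forall>l\<le>g (Suc k) - g k.
      \<bar>dev t f i 0 (g k + l) - (\<Sum>k'<k. real (g (Suc k') - g k') * v k' i) - l * v k i\<bar> \<le> (R + 2) * \<sigma> + 4 * \<beta>))"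
proof -
  define B where "B k = {g k..<g (Suc k)}" for k
  define b' where "b' k = g (Suc k) - g k" for k
  have B_eq: "B k = {g k..<g k + b' k}" if "k < N" for k
    using g(3)[OF that] by (simp add: B_def b'_def)
  have cB: "card (B k) = b' k" for k by (simp add: B_def b'_def)
  have g_mono: "g k \<le> g k'" if "k \<le> k'" "k' \<le> N" for k k'
    using that
  proof (induction rule: dec_induct)
    case (step j)
    then show ?case using g(3)[of j] by simp
  qed simp
  have B_disj: "B k \<inter> B k' = {}" if "k \<noteq> k'" "k < N" "k' < N" for k k'
    using g_mono[of "Suc k" k'] g_mono[of "Suc k'" k] that by (cases "k < k'") (auto simp: B_def)
  have UN_B: "(\<Union>k'<k. B k') = {..<g k}" if "k \<le> N" for k
    using that
  proof (induction k)
    case 0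
    then show ?case by (simp add: g)
  next
    case (Suc k)
    have "(\<Union>k'<Suc k. B k') = {..<g k} \<union> B k" using Suc by (simp add: lessThan_Suc Un_commute)
    also have "\<dots> = {..<g (Suc k)}" using g(3)[of k] Suc.prems by (auto simp: B_def)
    finally show ?case .
  qed
  have B_n: "B k \<subseteq> {..<n}" if "k < N" for k
    using g_mono[of "Suc k" N] that g(2) by (auto simp: B_def)
  define IA where "IA = {k. k < N \<and> B k \<subseteq> A}"
  define IB where "IB = {k. k < N \<and> B k \<inter> A = {}}"
  have b'_pos: "b' k > 0" if "k < N" for k
  proof -
    have "t\<^sup>2 \<le> b' k" using b[OF that] by (simp add: b'_def)
    moreover have "0 < t\<^sup>2" using t by simp
    ultimately show ?thesis by linarith
  qed
  have I: "IA \<union> IB = {..<N}" "IA \<inter> IB = {}" "finite IA" "finite IB"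
  proof -
    show "IA \<union> IB = {..<N}" using A(4) by (auto simp: IA_def IB_def B_def)
    have "B k \<noteq> {}" if "k < N" for k using cB[of k] b'_pos[OF that] by auto
    then show "IA \<inter> IB = {}" by (auto simp: IA_def IB_def)
  qed (auto simp: IA_def IB_def)
  have a: "a1 \<in> IA" "a2 \<in> IB" using a1 a2 by (auto simp: IA_def IB_def B_def)
  then have a_ne: "a1 \<noteq> a2" using I(2) by blast
  have UA: "(\<Union>k\<in>IA. B k) = A"
  proof (intro equalityI subsetI)
    fix p assume p: "p \<in> A"
    then have "p \<in> (\<Union>k<N. B k)" using A(1) UN_B[of N] g(2) by auto
    then obtain k where k: "k < N" "p \<in> B k" by blast
    then have "B k \<subseteq> A" using A(4)[OF k(1)] p unfolding B_def by blast
    then show "p \<in> (\<Union>k\<in>IA. B k)" using k by (auto simp: IA_def)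
  qed (auto simp: IA_def)
  have UB: "(\<Union>k\<in>IB. B k) = {..<n} - A"
  proof (intro equalityI subsetI)
    fix p assume p: "p \<in> {..<n} - A"
    then have "p \<in> (\<Union>k<N. B k)" using UN_B[of N] g(2) by auto
    then obtain k where k: "k < N" "p \<in> B k" by blast
    then have "B k \<inter> A = {}" using A(4)[OF k(1)] p unfolding B_def by blast
    then show "p \<in> (\<Union>k\<in>IB. B k)" using k by (auto simp: IB_def)
  next
    fix p assume "p \<in> (\<Union>k\<in>IB. B k)"
    then obtain k where "k < N" "B k \<inter> A = {}" "p \<in> B k" by (auto simp: IB_def)
    then show "p \<in> {..<n} - A" using B_n[of k] by blast
  qed
  define D where "D f k i = real (cnt f (B k) i) - b' k / t - b' k * v k i" for f k i
  define H where "H f k \<longleftrightarrow> (\<forall>i<t. \<forall>l\<le>b' k. \<bar>dev t f i (g k) l\<bar> \<le> R * sqrt (b' k))" for f k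
  define T where "T k f \<longleftrightarrow> (\<forall>i<t. \<bar>D f k i\<bar> \<le> \<tau>) \<and> H f k" for k f
  define E where "E K a f \<longleftrightarrow> (\<forall>i<t. cnt f (B a) i = m - (\<Sum>k\<in>K - {a}. cnt f (B k) i)) \<and> H f a" for K a f
  define K where "K = {..<N} - {a1, a2}"
  have H_dep: "depends_on (B k) (\<lambda>f. H f k)" if k: "k < N" for k
    unfolding depends_on_def
  proof (intro allI impI)
    fix f h :: "nat \<Rightarrow> nat" assume fh: "\<forall>p\<in>B k. f p = h p"
    have "dev t f i (g k) l = dev t h i (g k) l" if "l \<le> b' k" for i l
    proof -
      have "{g k..<g k + l} \<subseteq> B k" using that k by (auto simp: B_eq)
      then have "depends_on (B k) (\<lambda>f. dev t f i (g k) l)" by (rule dev_depends)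
      then show ?thesis using fh unfolding depends_on_def by blast
    qed
    then show "H f k = H h k" unfolding H_def by simp
  qed
  have T_dep: "depends_on (B k) (T k)" if k: "k < N" for k
  proof -
    have "depends_on (B k) (\<lambda>f. (\<lambda>x. \<forall>i<t. \<bar>real (x i) - b' k / t - b' k * v k i\<bar> \<le> \<tau>) (cnt f (B k)))"
      by (rule depends_on_comp[OF cnt_depends])
    then show ?thesis unfolding T_def[abs_def] D_def
      by (rule depends_on_comp2[where h = "(\<and>)", OF _ H_dep[OF k]])
  qed
  have T_pr: "c0 \<le> pr t n (T k)" if k: "k < N" for k
  proof -
    have "sqrt (b' k) \<le> \<sigma>" using sq(1)[OF k] by (simp add: b'_def)
    then have "\<theta> * sqrt (b' k) \<le> \<theta> * \<sigma>" using \<tau>(3) by (intro mult_left_mono) auto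
    then have \<tau>b: "\<theta> * sqrt (b' k) \<le> \<tau>" using \<tau>(1) by linarith
    have s0: "(\<Sum>i<t. b' k * v k i) = 0" using v(1)[OF k] by (simp flip: sum_distrib_left)
    have "\<bar>b' k * v k i\<bar> + \<tau> \<le> sqrt (b' k)" if "i < t" for i
      using v(2)[OF k that] sq(2)[OF k] by (simp add: abs_mult b'_def)
    then have "c0 \<le> pr t n (\<lambda>f. (\<forall>i<t. \<bar>real (cnt f {g k..<g k + b' k} i) - b' k / t - b' k * v k i\<bar> \<le> \<tau>) \<and>
      (\<forall>i<t. \<forall>l\<le>b' k. \<bar>dev t f i (g k) l\<bar> \<le> R * sqrt (b' k)))"
      using b[OF k] B_n[OF k] b'_pos[OF k] g_mono[of "Suc k" N] k g
      by (intro box[rule_format] s0 \<tau>b) (auto simp: b'_def)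
    then show ?thesis unfolding T_def[abs_def] D_def H_def B_eq[OF k] .
  qed
  \<comment> \<open>The three \<open>\<beta>\<close> stand for the accumulated errors of the free
    blocks, at most \<open>N * \<tau>\<close>, for the total drift over the side, and for the drift
    of block \<open>a\<close> itself.\<close>
  have forced: "\<bar>real m - (\<Sum>k\<in>K' - {a}. real (cnt f (B k) i)) - b' a / t\<bar> \<le> 3 * \<beta>"
    if K': "K' \<subseteq> {..<N}" "a \<in> K'" "(\<Sum>k\<in>K'. b' k) = t * m" "\<bar>\<Sum>k\<in>K'. b' k * v k i\<bar> \<le> \<beta>"
      and T: "\<And>k. k \<in> K' - {a} \<Longrightarrow> T k f" and i: "i < t" for K' a f i
  proof -
    have fin: "finite K'" using K'(1) finite_subset by blast
    have "(\<Sum>k\<in>K' - {a}. real (cnt f (B k) i)) = (\<Sum>k\<in>K' - {a}. D f k i) + (\<Sum>k\<in>K' - {a}. real (b' k)) / t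
        + (\<Sum>k\<in>K' - {a}. b' k * v k i)"
      by (simp add: D_def sum.distrib sum_subtractf sum_divide_distrib)
    moreover have "(\<Sum>k\<in>K' - {a}. real (b' k)) = real t * real m - real (b' a)"
    proof -
      have "(\<Sum>k\<in>K'. b' k) = b' a + (\<Sum>k\<in>K' - {a}. b' k)" using fin K'(2) by (rule sum.remove)
      then have "real (t * m) = b' a + real (\<Sum>k\<in>K' - {a}. b' k)" using K'(3) by simp
      then show ?thesis by simp
    qed
    moreover have "(\<Sum>k\<in>K'. b' k * v k i) = b' a * v a i + (\<Sum>k\<in>K' - {a}. b' k * v k i)"
      using fin K'(2) by (rule sum.remove)
    moreover have "\<bar>b' a * v a i\<bar> \<le> \<beta>" using v(2)[of a i] K' i by (auto simp: b'_def abs_mult)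
    moreover have "\<bar>\<Sum>k\<in>K' - {a}. D f k i\<bar> \<le> \<beta>"
    proof -
      have "\<bar>\<Sum>k\<in>K' - {a}. D f k i\<bar> \<le> (\<Sum>k\<in>K' - {a}. \<tau>)"
        by (rule order_trans[OF sum_abs], rule sum_mono) (use T i in \<open>auto simp: T_def\<close>)
      also have "\<dots> = card (K' - {a}) * \<tau>" by simp
      also have "\<dots> \<le> N * \<tau>"
      proof -
        have "card (K' - {a}) \<le> card {..<N}" using K'(1) by (intro card_mono) auto
        then show ?thesis using \<tau>(4) by (intro mult_right_mono) auto
      qed
      finally show ?thesis using \<tau>(2) by linarith
    qed
    moreover have "(real t * real m - real (b' a)) / t = m - b' a / t" using t by (simp add: field_simps)
    ultimately show ?thesis using K'(4) by (simp only:)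
  qed
  have E_pr: "c / sqrt (\<sigma>\<^sup>2 + 1) ^ (t - 1) \<le> pr t n (\<lambda>f. E K' a (override_on h f (B a)))"
    if K': "K' \<subseteq> {..<N}" "a \<in> K'" "(\<Sum>k\<in>K'. b' k) = t * m" "\<And>i. i < t \<Longrightarrow> \<bar>\<Sum>k\<in>K'. b' k * v k i\<bar> \<le> \<beta>"
      and T: "\<And>k. k \<in> K' - {a} \<Longrightarrow> T k h" and h: "h \<in> words t n" for K' a h
  proof -
    have aN: "a < N" using K' by auto
    have fin: "finite K'" using K'(1) finite_subset by blast
    define d where "d i = m - (\<Sum>k\<in>K' - {a}. cnt h (B k) i)" for i
    have bt: "sqrt (b' a) \<le> b' a / t"
    proof -
      have "t\<^sup>2 \<le> b' a" using b[OF aN] by (simp add: b'_def)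
      then have "real (t\<^sup>2) \<le> real (b' a)" by (simp only: of_nat_le_iff)
      then have "real t \<le> sqrt (b' a)" by (intro real_le_rsqrt) simp
      then have "t * sqrt (b' a) \<le> sqrt (b' a) * sqrt (b' a)" by (intro mult_right_mono) auto
      then show ?thesis using t by (simp add: field_simps)
    qed
    have f: "\<bar>real m - real (\<Sum>k\<in>K' - {a}. cnt h (B k) i) - b' a / t\<bar> \<le> sqrt (b' a)" if "i < t" for i
      using forced[OF K'(1-3) K'(4)[OF that] T that] sq(3)[OF aN] by (simp add: b'_def)
    have le: "(\<Sum>k\<in>K' - {a}. cnt h (B k) i) \<le> m" if "i < t" for i
    proof -
      have "real (\<Sum>k\<in>K' - {a}. cnt h (B k) i) \<le> real m" using f[OF that] bt by linarith
      then show ?thesis by (simp only: of_nat_le_iff)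
    qed
    have dsum: "(\<Sum>i<t. d i) = b' a"
    proof -
      have "(\<Sum>i<t. d i) + (\<Sum>i<t. \<Sum>k\<in>K' - {a}. cnt h (B k) i) = (\<Sum>i<t. m)"
        unfolding sum.distrib[symmetric] using le by (intro sum.cong) (auto simp: d_def)
      moreover have "(\<Sum>i<t. \<Sum>k\<in>K' - {a}. cnt h (B k) i) = (\<Sum>k\<in>K' - {a}. b' k)"
      proof (subst sum.swap, rule sum.cong[OF refl])
        fix k assume "k \<in> K' - {a}"
        then have "B k \<subseteq> {..<n}" using K'(1) B_n by auto
        then show "(\<Sum>i<t. cnt h (B k) i) = b' k" using sum_cnt[OF h] cB by simp
      qed
      moreover have "(\<Sum>k\<in>K'. b' k) = b' a + (\<Sum>k\<in>K' - {a}. b' k)" using fin K'(2) by (rule sum.remove)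
      ultimately show ?thesis using K'(3) by simp
    qed
    have "c / sqrt (\<sigma>\<^sup>2 + 1) ^ (t - 1) \<le> c / sqrt (real (b' a) + 1) ^ (t - 1)"
    proof -
      have "sqrt (b' a) \<le> \<sigma>" using sq(1)[OF aN] by (simp add: b'_def)
      then have "(sqrt (b' a))\<^sup>2 \<le> \<sigma>\<^sup>2" by (intro power_mono) auto
      then show ?thesis using c by (intro divide_left_mono power_mono mult_pos_pos zero_less_power) auto
    qed
    also have "\<dots> \<le> pr t n (\<lambda>f. (\<forall>i<t. cnt f {g a..<g a + b' a} i = d i) \<and>
      (\<forall>i<t. \<forall>l\<le>b' a. \<bar>dev t f i (g a) l\<bar> \<le> R * sqrt (b' a)))"
    proof (rule block[rule_format, OF _ _ dsum])
      show "g a + b' a \<le> n" using g_mono[of "Suc a" N] aN g by (simp add: b'_def)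
      show "b0 \<le> b' a" using b[OF aN] by (simp add: b'_def)
      fix i assume i: "i < t"
      show "\<bar>real (d i) - b' a / t\<bar> \<le> sqrt (b' a)"
        using f[OF i] le[OF i] by (simp add: d_def of_nat_diff)
    qed
    also have "\<dots> \<le> pr t n (\<lambda>f. E K' a (override_on h f (B a)))"
    proof (rule pr_mono)
      fix f assume f: "(\<forall>i<t. cnt f {g a..<g a + b' a} i = d i) \<and>
        (\<forall>i<t. \<forall>l\<le>b' a. \<bar>dev t f i (g a) l\<bar> \<le> R * sqrt (b' a))"
      have "cnt (override_on h f (B a)) (B k) = cnt h (B k)" if "k \<in> K' - {a}" for k
        using that K'(1) B_disj[of a k] aN by (intro cnt_override_out) auto
      then have "(\<Sum>k\<in>K' - {a}. cnt (override_on h f (B a)) (B k) i) = (\<Sum>k\<in>K' - {a}. cnt h (B k) i)" for i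
        by simp
      moreover have "H (override_on h f (B a)) a = H f a"
        by (rule depends_on_override_on[OF H_dep[OF aN]]) simp
      ultimately show "E K' a (override_on h f (B a))"
        using f unfolding E_def by (simp add: d_def H_def B_eq[OF aN])
    qed
    finally show ?thesis .
  qed
  have cnt_A: "cnt f A i = (\<Sum>k\<in>IA. cnt f (B k) i)" for f i
    unfolding UA[symmetric] using I B_disj
    by (intro cnt_UN) (auto simp: disjoint_family_on_def IA_def B_def)
  have cnt_B: "cnt f ({..<n} - A) i = (\<Sum>k\<in>IB. cnt f (B k) i)" for f i
    unfolding UB[symmetric] using I B_disj
    by (intro cnt_UN) (auto simp: disjoint_family_on_def IB_def B_def)
  have sum_A: "(\<Sum>k\<in>IA. b' k) = t * m"
  proof -
    have "card (\<Union>k\<in>IA. B k) = (\<Sum>k\<in>IA. card (B k))"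
      using I B_disj by (intro card_UN_disjoint) (auto simp: IA_def B_def)
    then show ?thesis using A(3) by (simp add: UA cB)
  qed
  have sum_B: "(\<Sum>k\<in>IB. b' k) = t * m"
  proof -
    have "card (\<Union>k\<in>IB. B k) = (\<Sum>k\<in>IB. card (B k))"
      using I B_disj by (intro card_UN_disjoint) (auto simp: IB_def B_def)
    moreover have "card ({..<n} - A) = t * m"
      using A finite_subset[OF A(1)] by (simp add: card_Diff_subset)
    ultimately show ?thesis by (simp add: UB cB)
  qed
  have drA: "\<bar>\<Sum>k\<in>IA. b' k * v k i\<bar> \<le> \<beta>" and drB: "\<bar>\<Sum>k\<in>IB. b' k * v k i\<bar> \<le> \<beta>" if "i < t" for i
    using drift[OF that] by (simp_all add: IA_def IB_def B_def b'_def)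
  let ?q = "c / sqrt (\<sigma>\<^sup>2 + 1) ^ (t - 1)"
  let ?F0 = "\<lambda>f. \<forall>k\<in>K. T k f"
  let ?F1 = "\<lambda>f. ?F0 f \<and> E IA a1 f"
  let ?F2 = "\<lambda>f. ?F1 f \<and> E IB a2 f"
  have KI: "IA - {a1} \<subseteq> K" "IB - {a2} \<subseteq> K" using I a a_ne by (auto simp: K_def)
  let ?UK = "\<Union>k\<in>K. B k"
  have F0_dep: "depends_on ?UK ?F0"
    unfolding depends_on_def
  proof (intro allI impI)
    fix f h :: "nat \<Rightarrow> nat" assume fh: "\<forall>p\<in>?UK. f p = h p"
    have "T k f = T k h" if "k \<in> K" for k
      using T_dep[of k] that fh unfolding depends_on_def K_def by blast
    then show "?F0 f = ?F0 h" by blast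
  qed
  have E_dep: "depends_on (?UK \<union> B a1) (E IA a1)"
    unfolding depends_on_def
  proof (intro allI impI)
    fix f h :: "nat \<Rightarrow> nat" assume fh: "\<forall>p\<in>?UK \<union> B a1. f p = h p"
    have "cnt f (B k) = cnt h (B k)" if "k \<in> IA" for k
    proof -
      have "B k \<subseteq> ?UK \<union> B a1" using KI that by blast
      then have "depends_on (?UK \<union> B a1) (\<lambda>f. cnt f (B k))" by (rule depends_on_mono[OF cnt_depends])
      then show ?thesis using fh unfolding depends_on_def by blast
    qed
    moreover have "H f a1 = H h a1"
      using H_dep[OF a1(1)] fh unfolding depends_on_def by blast
    ultimately show "E IA a1 f = E IA a1 h" using a unfolding E_def by simp
  qed
  have dK1: "B a1 \<inter> B k = {}" and dK2: "B a2 \<inter> B k = {}" if "k \<in> K" for k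
    using B_disj[of a1 k] B_disj[of a2 k] that a1(1) a2(1) by (auto simp: K_def)
  \<comment> \<open>The free blocks are independent and come first. Then block \<open>a1\<close> is
    drawn given them, and \<open>a2\<close> given all the rest; each hits its forced counts and
    keeps its prefixes under control with probability at least \<open>?q\<close>.\<close>
  have "c0 ^ card K * ?q\<^sup>2 = ?q * (?q * c0 ^ card K)" by (simp add: power2_eq_square)
  also have "\<dots> \<le> ?q * (?q * pr t n ?F0)"
  proof -
    have "c0 ^ card K \<le> pr t n ?F0"
      using T_dep T_pr c B_disj by (intro pr_indep_family[OF t, where B = B]) (auto simp: K_def disjoint_family_on_def)
    moreover have "0 \<le> ?q" using c by simp
    ultimately show ?thesis by (intro mult_left_mono)
  qed
  also have "\<dots> \<le> ?q * pr t n ?F1"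
  proof -
    have "?q * pr t n ?F0 \<le> pr t n ?F1"
    proof (rule pr_cond_ge[OF t F0_dep, where A = "B a1"])
      show "B a1 \<inter> ?UK = {}" using dK1 by blast
      fix h assume h: "h \<in> words t n" "?F0 h"
      show "?q \<le> pr t n (\<lambda>f. E IA a1 (override_on h f (B a1)))"
        using h KI a I(1) by (intro E_pr sum_A drA) auto
    qed
    moreover have "0 \<le> ?q" using c by simp
    ultimately show ?thesis by (intro mult_left_mono)
  qed
  also have "\<dots> \<le> pr t n ?F2"
  proof (rule pr_cond_ge[OF t, where A = "B a2" and B = "?UK \<union> B a1"])
    show "depends_on (?UK \<union> B a1) ?F1"
      by (rule depends_on_comp2[where h = "(\<and>)", OF depends_on_mono[OF F0_dep] E_dep]) auto
    show "B a2 \<inter> (?UK \<union> B a1) = {}" using dK2 B_disj[of a2 a1] a1(1) a2(1) a_ne by blast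
    fix h assume h: "h \<in> words t n" "?F1 h"
    show "?q \<le> pr t n (\<lambda>f. E IB a2 (override_on h f (B a2)))"
      using h KI a I(1) by (intro E_pr sum_B drB) auto
  qed
  also have "\<dots> \<le> pr t n (\<lambda>f. (\<forall>i<t. cnt f A i = m) \<and> (\<forall>i<t. cnt f ({..<n} - A) i = m) \<and>
    (\<forall>k<N. \<forall>i<t. \<forall>l\<le>g (Suc k) - g k.
      \<bar>dev t f i 0 (g k + l) - (\<Sum>k'<k. real (g (Suc k') - g k') * v k' i) - l * v k i\<bar> \<le> (R + 2) * \<sigma> + 4 * \<beta>))"
  proof (rule pr_mono)
    fix f assume f: "f \<in> words t n" "?F2 f"
    have TA: "T k f" if "k \<in> IA - {a1}" for k using f that KI by blast
    have TB: "T k f" if "k \<in> IB - {a2}" for k using f that KI by blast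
    have sum_rm: "(\<Sum>k\<in>K'. cnt f (B k) i) = m \<and> \<bar>D f a i\<bar> \<le> \<sigma> + \<beta>"
      if K': "K' \<subseteq> {..<N}" "a \<in> K'" "(\<Sum>k\<in>K'. b' k) = t * m" "\<bar>\<Sum>k\<in>K'. b' k * v k i\<bar> \<le> \<beta>"
        and T: "\<And>k. k \<in> K' - {a} \<Longrightarrow> T k f" and E: "E K' a f" and i: "i < t" for K' a i
    proof -
      have aN: "a < N" using K' by auto
      have fin: "finite K'" using K'(1) finite_subset by blast
      have fo: "\<bar>real m - real (\<Sum>k\<in>K' - {a}. cnt f (B k) i) - b' a / t\<bar> \<le> sqrt (b' a)"
        using forced[OF K'(1-4) T i] sq(3)[OF aN] by (simp add: b'_def)
      have bt: "sqrt (b' a) \<le> b' a / t"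
      proof -
        have "t\<^sup>2 \<le> b' a" using b[OF aN] by (simp add: b'_def)
        then have "real (t\<^sup>2) \<le> real (b' a)" by (simp only: of_nat_le_iff)
        then have "real t \<le> sqrt (b' a)" by (intro real_le_rsqrt) simp
        then have "t * sqrt (b' a) \<le> sqrt (b' a) * sqrt (b' a)" by (intro mult_right_mono) auto
        then show ?thesis using t by (simp add: field_simps)
      qed
      have "real (\<Sum>k\<in>K' - {a}. cnt f (B k) i) \<le> real m" using fo bt by linarith
      then have le: "(\<Sum>k\<in>K' - {a}. cnt f (B k) i) \<le> m" by (simp only: of_nat_le_iff)
      have ca: "cnt f (B a) i = m - (\<Sum>k\<in>K' - {a}. cnt f (B k) i)" using E i by (simp add: E_def)
      have "(\<Sum>k\<in>K'. cnt f (B k) i) = cnt f (B a) i + (\<Sum>k\<in>K' - {a}. cnt f (B k) i)"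
        using fin K'(2) by (rule sum.remove)
      then have 1: "(\<Sum>k\<in>K'. cnt f (B k) i) = m" using le ca by simp
      have "\<bar>real (cnt f (B a) i) - b' a / t\<bar> \<le> sqrt (b' a)"
        using fo le by (simp add: ca of_nat_diff)
      moreover have "\<bar>b' a * v a i\<bar> \<le> \<beta>" using v(2)[OF aN i] by (simp add: b'_def abs_mult)
      moreover have "sqrt (b' a) \<le> \<sigma>" using sq(1)[OF aN] by (simp add: b'_def)
      ultimately show ?thesis using 1 unfolding D_def by linarith
    qed
    have s1: "(\<Sum>k\<in>IA. cnt f (B k) i) = m \<and> \<bar>D f a1 i\<bar> \<le> \<sigma> + \<beta>" if "i < t" for i
      using f TA I(1) that by (intro sum_rm a sum_A drA) auto
    have s2: "(\<Sum>k\<in>IB. cnt f (B k) i) = m \<and> \<bar>D f a2 i\<bar> \<le> \<sigma> + \<beta>" if "i < t" for i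
      using f TB I(1) that by (intro sum_rm a sum_B drB) auto
    have "\<bar>dev t f i 0 (g k + l) - (\<Sum>k'<k. b' k' * v k' i) - l * v k i\<bar> \<le> (R + 2) * \<sigma> + 4 * \<beta>"
      if k: "k < N" and i: "i < t" and l: "l \<le> b' k" for k i l
    proof -
      have "dev t f i 0 (g k) = (\<Sum>k'<k. real (cnt f (B k') i)) - (\<Sum>k'<k. real (b' k')) / t"
      proof -
        have "cnt f {..<g k} i = (\<Sum>k'<k. cnt f (B k') i)"
          unfolding UN_B[OF less_imp_le[OF k], symmetric] using B_disj k
          by (intro cnt_UN) (auto simp: disjoint_family_on_def B_def)
        moreover have "g k = (\<Sum>k'<k. b' k')"
        proof -
          have "card (\<Union>k'<k. B k') = (\<Sum>k'<k. card (B k'))"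
            using B_disj k by (intro card_UN_disjoint) (auto simp: B_def)
          then show ?thesis using UN_B[of k] k by (simp add: cB)
        qed
        ultimately show ?thesis by (simp add: dev_def lessThan_atLeast0)
      qed
      then have d1: "dev t f i 0 (g k) - (\<Sum>k'<k. b' k' * v k' i) = (\<Sum>k'<k. D f k' i)"
        by (simp add: D_def sum_subtractf sum_divide_distrib)
      have "\<bar>\<Sum>k'<k. D f k' i\<bar> \<le> (\<Sum>k'<k. \<bar>D f k' i\<bar>)" by (rule sum_abs)
      also have "\<dots> \<le> (\<Sum>k'<N. \<bar>D f k' i\<bar>)" using k by (intro sum_mono2) auto
      also have "\<dots> = \<bar>D f a1 i\<bar> + (\<bar>D f a2 i\<bar> + (\<Sum>k'\<in>K. \<bar>D f k' i\<bar>))"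
      proof -
        have "(\<Sum>k'<N. \<bar>D f k' i\<bar>) = \<bar>D f a1 i\<bar> + (\<Sum>k'\<in>{..<N} - {a1}. \<bar>D f k' i\<bar>)"
          using a1(1) by (intro sum.remove) auto
        also have "(\<Sum>k'\<in>{..<N} - {a1}. \<bar>D f k' i\<bar>) = \<bar>D f a2 i\<bar> + (\<Sum>k'\<in>{..<N} - {a1} - {a2}. \<bar>D f k' i\<bar>)"
          using a2(1) a_ne by (intro sum.remove) auto
        also have "{..<N} - {a1} - {a2} = K" by (auto simp: K_def)
        finally show ?thesis .
      qed
      also have "(\<Sum>k'\<in>K. \<bar>D f k' i\<bar>) \<le> (\<Sum>k'\<in>K. \<tau>)"
        using f i by (intro sum_mono) (auto simp: T_def)
      also have "(\<Sum>k'\<in>K. \<tau>) \<le> \<beta>"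
      proof -
        have "card K \<le> card {..<N}" by (intro card_mono) (auto simp: K_def)
        then have "card K * \<tau> \<le> N * \<tau>" using \<tau>(4) by (intro mult_right_mono) auto
        then show ?thesis using \<tau>(2) by simp
      qed
      \<comment> \<open>Each of the two forced blocks is off by at most
        \<open>\<sigma> + \<beta>\<close>, all the others together by at most
        \<open>\<beta>\<close>.\<close>
      finally have d2: "\<bar>\<Sum>k'<k. D f k' i\<bar> \<le> 2 * \<sigma> + 3 * \<beta>" using s1[OF i] s2[OF i] by linarith
      have "H f k" using f k KI a unfolding T_def E_def K_def by blast
      then have "\<bar>dev t f i (g k) l\<bar> \<le> R * sqrt (b' k)" using i l by (simp add: H_def)
      also have "\<dots> \<le> R * \<sigma>" using sq(1)[OF k] c by (simp add: b'_def)
      finally have d3: "\<bar>dev t f i (g k) l\<bar> \<le> R * \<sigma>" .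
      have "\<bar>l * v k i\<bar> \<le> b' k * \<bar>v k i\<bar>" using l by (simp add: abs_mult mult_right_mono)
      then have d4: "\<bar>l * v k i\<bar> \<le> \<beta>" using v(2)[OF k i] by (simp add: b'_def)
      have "dev t f i 0 (g k + l) = dev t f i 0 (g k) + dev t f i (g k) l"
        using dev_add[of t f i 0 "g k" l] by simp
      then show ?thesis using d1 d2 d3 d4 by (simp add: algebra_simps)
    qed
    then show "(\<forall>i<t. cnt f A i = m) \<and> (\<forall>i<t. cnt f ({..<n} - A) i = m) \<and>
    (\<forall>k<N. \<forall>i<t. \<forall>l\<le>g (Suc k) - g k.
      \<bar>dev t f i 0 (g k + l) - (\<Sum>k'<k. real (g (Suc k') - g k') * v k' i) - l * v k i\<bar> \<le> (R + 2) * \<sigma> + 4 * \<beta>)"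
      using s1 s2 by (simp add: cnt_A cnt_B b'_def)
  qed
  finally have main: "c0 ^ card K * ?q\<^sup>2 \<le> \<dots>" .
  \<comment> \<open>As a lower bound for a probability, \<open>c0\<close> is at most 1; so the
    exponent may be raised from \<open>card K\<close> to \<open>N\<close>.\<close>
  have "c0 \<le> 1"
    using T_pr[OF a1(1)] pr_le_1[OF t] order_trans by blast
  moreover have "card K \<le> N" using card_mono[of "{..<N}" K] by (auto simp: K_def)
  ultimately have "c0 ^ N \<le> c0 ^ card K" using c by (intro power_decreasing) auto
  then have "c0 ^ N * ?q\<^sup>2 \<le> c0 ^ card K * ?q\<^sup>2" by (intro mult_right_mono) auto
  then show ?thesis using main by linarith
qed

text \<open>Summation by parts against a sign that flips only at the points of \<open>S\<close>.\<close>

lemma abel_sign_bound: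
  fixes F :: "nat \<Rightarrow> real" and \<epsilon> :: "nat \<Rightarrow> real"
  assumes F: "F 0 = 0" "\<And>p. p \<le> n \<Longrightarrow> \<bar>F p\<bar> \<le> M" and \<epsilon>: "\<And>p. \<bar>\<epsilon> p\<bar> = 1"
    "\<And>p. Suc p \<notin> S \<Longrightarrow> \<epsilon> (Suc p) = \<epsilon> p" and S: "finite S"
  shows "\<bar>\<Sum>p<n. \<epsilon> p * (F (Suc p) - F p)\<bar> \<le> M * (2 * card S + 1)"
proof -
  have "\<bar>(\<Sum>p<k. \<epsilon> p * (F (Suc p) - F p)) - \<epsilon> k * F k\<bar> \<le> 2 * M * card {c \<in> S. c \<le> k}" if "k \<le> n" for k
    using that
  proof (induction k)
    case 0
    then show ?case using F(1) F(2)[of 0] by simp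
  next
    case (Suc k)
    have fin: "finite {c \<in> S. c \<le> k}" using S by simp
    have e: "(\<Sum>p<Suc k. \<epsilon> p * (F (Suc p) - F p)) - \<epsilon> (Suc k) * F (Suc k) =
      ((\<Sum>p<k. \<epsilon> p * (F (Suc p) - F p)) - \<epsilon> k * F k) + (\<epsilon> k - \<epsilon> (Suc k)) * F (Suc k)"
      by (simp add: algebra_simps)
    show ?case
    proof (cases "Suc k \<in> S")
      case True
      then have "{c \<in> S. c \<le> Suc k} = insert (Suc k) {c \<in> S. c \<le> k}" by auto
      then have "card {c \<in> S. c \<le> Suc k} = Suc (card {c \<in> S. c \<le> k})" using fin by simp
      moreover have "\<bar>(\<epsilon> k - \<epsilon> (Suc k)) * F (Suc k)\<bar> \<le> 2 * M"
      proof -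
        have "\<bar>\<epsilon> k - \<epsilon> (Suc k)\<bar> \<le> 2" using \<epsilon>(1)[of k] \<epsilon>(1)[of "Suc k"] by linarith
        then show ?thesis unfolding abs_mult using F(2)[OF Suc.prems] by (intro mult_mono) auto
      qed
      ultimately show ?thesis unfolding e using Suc by (simp add: algebra_simps)
    next
      case False
      then have "{c \<in> S. c \<le> Suc k} = {c \<in> S. c \<le> k}" using le_Suc_eq by auto
      then show ?thesis unfolding e using Suc \<epsilon>(2)[OF False] by simp
    qed
  qed
  from this[of n] have 1: "\<bar>(\<Sum>p<n. \<epsilon> p * (F (Suc p) - F p)) - \<epsilon> n * F n\<bar> \<le> 2 * M * card {c \<in> S. c \<le> n}"
    by simp
  have M: "0 \<le> M" using F(2)[of 0] by simp
  have "card {c \<in> S. c \<le> n} \<le> card S" using S by (intro card_mono) auto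
  then have "2 * M * card {c \<in> S. c \<le> n} \<le> 2 * M * card S" using M by (intro mult_left_mono) auto
  moreover have "\<bar>\<epsilon> n * F n\<bar> \<le> M" using F(2)[of n] \<epsilon>(1)[of n] by (simp add: abs_mult)
  ultimately have "\<bar>\<Sum>p<n. \<epsilon> p * (F (Suc p) - F p)\<bar> \<le> 2 * M * card S + M" using 1 by linarith
  then show ?thesis by (simp add: algebra_simps)
qed

context cut_windows
begin

text \<open>The target deviation profile: zone \<open>i\<close> has a surplus of type \<open>i\<close>, spread evenly over the zone and
  compensated evenly over the whole word. Each zone then needs a cut of its own.\<close>

definition slope :: "nat \<Rightarrow> nat \<Rightarrow> real" where
  "slope i p = 3 / sqrt m * ((if p \<in> {zs i..<zs (Suc i)} then real s else 0) - 1)"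

definition profile :: "nat \<Rightarrow> nat \<Rightarrow> real" where
  "profile i p = (\<Sum>q<p. slope i q)"

text \<open>With fewer than \<open>s\<close> cuts, some zone \<open>l\<close> lies entirely on one
  side. The letters \<open>l\<close> are divided evenly, so the surplus of the profile in zone
  \<open>l\<close> must be made up by the differences between the word and the profile. With slope
  \<open>3 / sqrt m\<close> that surplus has signed sum at least \<open>6 * s * sqrt m\<close>,
  while summation by parts allows only \<open>(2 * card S + 1) * sqrt m\<close>.\<close>

lemma profile_imp_many_cuts:
  assumes f: "f \<in> words t n" "balanced t m f" "halves t m S f" and S: "S \<subseteq> {1..<n}"
    and tube: "\<And>i p. i < s \<Longrightarrow> p \<le> n \<Longrightarrow> \<bar>dev t f i 0 p - profile i p\<bar> \<le> sqrt m"
  shows "s \<le> card S"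
proof (rule ccontr)
  assume "\<not> s \<le> card S"
  then have cS: "card S < s" by simp
  have fin: "finite S" using S finite_subset by blast
  \<comment> \<open>The interval is open because a cut at \<open>zs i\<close> separates two zones
    and does not divide zone \<open>i\<close>.\<close>
  have "\<exists>i<s. S \<inter> {zs i<..<zs (Suc i)} = {}"
  proof (rule ccontr)
    assume "\<not> ?thesis"
    then have "\<forall>i\<in>{..<s}. \<exists>c. c \<in> S \<inter> {zs i<..<zs (Suc i)}" by blast
    from bchoice[OF this] obtain h where h: "\<forall>i\<in>{..<s}. h i \<in> S \<inter> {zs i<..<zs (Suc i)}" by blast
    have "inj_on h {..<s}"
    proof (rule inj_onI)
      fix i j assume ij: "i \<in> {..<s}" "j \<in> {..<s}" "h i = h j"
      then have "h i \<in> {zs i..<zs (Suc i)} \<inter> {zs j..<zs (Suc j)}" using h by force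
      then show "i = j" using zones_disjoint[of i j] by blast
    qed
    then have "card (h ` {..<s}) = s" by (simp add: card_image)
    moreover have "card (h ` {..<s}) \<le> card S" using h fin by (intro card_mono) auto
    ultimately show False using cS by simp
  qed
  then obtain l where l: "l < s" "S \<inter> {zs l<..<zs (Suc l)} = {}" by blast
  let ?Z = "{zs l..<zs (Suc l)}"
  define \<epsilon> :: "nat \<Rightarrow> real" where "\<epsilon> p = (if odd (card {c \<in> S. p < c}) then 1 else - 1)" for p
  let ?A = "side n S"
  have \<epsilon>A: "\<epsilon> p = 2 * of_bool (p \<in> ?A) - 1" if "p < n" for p
    using that by (simp add: \<epsilon>_def side_def)
  have sum_\<epsilon>: "(\<Sum>p<n. \<epsilon> p * h p) = 2 * (\<Sum>p\<in>?A. h p) - (\<Sum>p<n. h p)" for h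
  proof -
    have "(\<Sum>p<n. \<epsilon> p * h p) = (\<Sum>p<n. 2 * (of_bool (p \<in> ?A) * h p) - h p)"
      by (intro sum.cong) (auto simp: \<epsilon>A)
    also have "\<dots> = 2 * (\<Sum>p<n. of_bool (p \<in> ?A) * h p) - (\<Sum>p<n. h p)"
      by (simp only: sum_subtractf sum_distrib_left)
    also have "(\<Sum>p<n. of_bool (p \<in> ?A) * h p) = (\<Sum>p\<in>?A. h p)"
      using side_subset[of n S] by (intro sum.mono_neutral_cong_right) auto
    finally show ?thesis .
  qed
  have cA: "card ?A = t * m" using halves_card_side[OF f(1,3)] .
  define F where "F p = dev t f l 0 p - profile l p" for p
  have F_step: "F (Suc p) - F p = (of_bool (f p = l) - 1 / t + 3 / sqrt m) - 3 / sqrt m * (real s * of_bool (p \<in> ?Z))" for p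
    by (simp add: F_def dev_Suc profile_def slope_def algebra_simps)
  have lt: "l < t" using l s by simp
  have count: "(\<Sum>p\<in>B. of_bool (f p = l)) = real (cnt f B l)" if "finite B" for B
    using that by (simp add: cnt_def sum.If_cases of_bool_def Int_def)
  \<comment> \<open>Fairness and balance cancel the counts of letter \<open>l\<close>; the constants
    cancel because both sides have \<open>t * m\<close> positions.\<close>
  have z1: "(\<Sum>p<n. \<epsilon> p * (of_bool (f p = l) - 1 / t + 3 / sqrt m)) = 0"
  proof -
    have "cnt f ?A l = m" "cnt f {..<n} l = 2 * m"
      using f(2,3) lt by (auto simp: halves_def balanced_def)
    moreover have bs: "(\<Sum>p\<in>B. of_bool (f p = l) - 1 / t + 3 / sqrt m) =
        real (cnt f B l) + real (card B) * (3 / sqrt m - 1 / t)" if "finite B" for B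
    proof -
      have "(\<Sum>p\<in>B. of_bool (f p = l) - 1 / t + 3 / sqrt m) = (\<Sum>p\<in>B. of_bool (f p = l) + (3 / sqrt m - 1 / t))"
        by (intro sum.cong) auto
      also have "\<dots> = (\<Sum>p\<in>B. of_bool (f p = l)) + real (card B) * (3 / sqrt m - 1 / t)"
        by (simp only: sum.distrib sum_constant)
      finally show ?thesis by (simp only: count[OF that])
    qed
    ultimately show ?thesis
      unfolding sum_\<epsilon> bs[OF finite_side] bs[OF finite_lessThan] cA by (simp add: algebra_simps)
  qed
  have "(\<Sum>p<n. \<epsilon> p * (F (Suc p) - F p))
      = (\<Sum>p<n. \<epsilon> p * (of_bool (f p = l) - 1 / t + 3 / sqrt m)) - 3 / sqrt m * (real s * (\<Sum>p<n. \<epsilon> p * of_bool (p \<in> ?Z)))"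
  proof -
    have "(\<Sum>p<n. \<epsilon> p * (K * (real s * h p))) = K * (real s * (\<Sum>p<n. \<epsilon> p * h p))" for K h
      by (simp add: sum_distrib_left mult_ac)
    then show ?thesis unfolding F_step right_diff_distrib sum_subtractf by (simp only:)
  qed
  also have "(\<Sum>p<n. \<epsilon> p * of_bool (p \<in> ?Z)) = (\<Sum>p\<in>?Z. \<epsilon> p)"
    using zones_partition l(1) by (intro sum.mono_neutral_cong_right) (auto simp del: zs_simps)
  also have "\<dots> = 2 * real (hz l) * \<epsilon> (zs l)"
  proof -
    have *: "\<epsilon> p = \<epsilon> (zs l)" if "p \<in> ?Z" for p
    proof -
      have "{c \<in> S. p < c} = {c \<in> S. zs l < c}" using l(2) that by force
      then show ?thesis by (simp add: \<epsilon>_def)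
    qed
    have "(\<Sum>p\<in>?Z. \<epsilon> p) = (\<Sum>p\<in>?Z. \<epsilon> (zs l))" by (intro sum.cong refl *)
    then show ?thesis by simp
  qed
  finally have eq: "(\<Sum>p<n. \<epsilon> p * (F (Suc p) - F p)) = - (3 / sqrt m * (real s * (2 * real (hz l) * \<epsilon> (zs l))))"
    unfolding z1 by simp
  have "\<bar>\<Sum>p<n. \<epsilon> p * (F (Suc p) - F p)\<bar> \<le> sqrt m * (2 * card S + 1)"
  proof (rule abel_sign_bound[OF _ _ _ _ fin])
    show "F 0 = 0" by (simp add: F_def profile_def)
    show "\<bar>F p\<bar> \<le> sqrt m" if "p \<le> n" for p using tube[OF l(1) that] by (simp add: F_def)
    show "\<bar>\<epsilon> p\<bar> = 1" for p by (simp add: \<epsilon>_def)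
    show "\<epsilon> (Suc p) = \<epsilon> p" if "Suc p \<notin> S" for p
    proof -
      have "Suc p < c \<longleftrightarrow> p < c" if "c \<in> S" for c
        using that \<open>Suc p \<notin> S\<close> by (cases "c = Suc p") auto
      then have "{c \<in> S. Suc p < c} = {c \<in> S. p < c}" by blast
      then show ?thesis by (simp add: \<epsilon>_def)
    qed
  qed
  moreover have "\<bar>- (3 / sqrt m * (real s * (2 * real (hz l) * \<epsilon> (zs l))))\<bar> = 3 / sqrt m * (real s * (2 * real (hz l)))"
    by (simp add: \<epsilon>_def abs_mult)
  ultimately have "3 / sqrt m * (real s * (2 * real (hz l))) \<le> sqrt m * (2 * card S + 1)"
    unfolding eq by linarith
  moreover have "3 / sqrt m * (real s * (2 * real m)) \<le> 3 / sqrt m * (real s * (2 * real (hz l)))"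
    using hz_ge[of l] by (intro mult_left_mono) auto
  moreover have "3 / sqrt m * (real s * (2 * real m)) = sqrt m * (6 * s)"
    using m by (simp add: field_simps)
  ultimately have "sqrt m * (6 * s) \<le> sqrt m * real (2 * card S + 1)" by linarith
  then have "real (6 * s) \<le> real (2 * card S + 1)" using m by simp
  then have "6 * s \<le> 2 * card S + 1" by (simp only: of_nat_le_iff)
  then show False using cS by simp
qed

text \<open>Either side holds nearly a share \<open>1 / s\<close> of its positions in each zone. On
  either side the surplus of the profile and its compensation therefore almost cancel, which is the
  drift condition of \<open>tube_prob\<close>.\<close>

lemma zone_share_near:
  assumes "\<bar>int c - int (hz i)\<bar> \<le> int (s * r)"
  shows "\<bar>real s * real c - real t * real m\<bar> \<le> (real s)\<^sup>2 * (1 + real r)"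
proof -
  have "real_of_int \<bar>int c - int (hz i)\<bar> \<le> real_of_int (int (s * r))"
    using assms by (simp only: of_int_le_iff)
  then have 1: "\<bar>real c - real (hz i)\<bar> \<le> real s * real r" by simp
  have "\<bar>real s * real c - real t * real m\<bar> \<le> real s * \<bar>real c - real (hz i)\<bar> + \<bar>real s * real (hz i) - real t * real m\<bar>"
  proof -
    have "real s * real c - real t * real m = real s * (real c - real (hz i)) + (real s * real (hz i) - real t * real m)"
      by (simp add: algebra_simps)
    then have "\<bar>real s * real c - real t * real m\<bar> \<le> \<bar>real s * (real c - real (hz i))\<bar> + \<bar>real s * real (hz i) - real t * real m\<bar>"
      by (simp only: abs_triangle_ineq)
    then show ?thesis by (simp add: abs_mult)
  qed
  also have "\<dots> \<le> real s * (real s * real r) + real s * real s"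
    using 1 by (intro add_mono mult_left_mono hz_near) auto
  finally show ?thesis by (simp add: power2_eq_square algebra_simps)
qed

lemma side_zone_card:
  assumes "d \<in> disps" "i < s"
  shows "\<bar>int (card (side n (cuts d) \<inter> {zs i..<zs (Suc i)})) - int (hz i)\<bar> \<le> int (s * r)"
    and "\<bar>int (card (({..<n} - side n (cuts d)) \<inter> {zs i..<zs (Suc i)})) - int (hz i)\<bar> \<le> int (s * r)"
proof -
  let ?A = "side n (cuts d)" and ?Z = "{zs i..<zs (Suc i)}"
  have "\<bar>int (card (?A \<inter> ?Z)) - int (hz i)\<bar> = \<bar>disp d i\<bar>"
    unfolding side_Int_zone[OF assms]
    using cut_int[OF assms(1), of i] cut_zone'[OF assms(1), of i] by (auto simp: of_nat_diff)
  then show 1: "\<bar>int (card (?A \<inter> ?Z)) - int (hz i)\<bar> \<le> int (s * r)"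
    using disp_bound[OF assms(1), of i] by simp
  have "?Z = (?A \<inter> ?Z) \<union> (({..<n} - ?A) \<inter> ?Z)" using zones_partition assms(2) by blast
  moreover have "card ((?A \<inter> ?Z) \<union> (({..<n} - ?A) \<inter> ?Z)) = card (?A \<inter> ?Z) + card (({..<n} - ?A) \<inter> ?Z)"
    by (rule card_Un_disjoint) auto
  ultimately have "card ?Z = card (?A \<inter> ?Z) + card (({..<n} - ?A) \<inter> ?Z)" by (simp only:)
  moreover have "card ?Z = 2 * hz i" by simp
  ultimately show "\<bar>int (card (({..<n} - ?A) \<inter> ?Z)) - int (hz i)\<bar> \<le> int (s * r)"
    using 1 by linarith
qed

text \<open>Zone boundaries and cuts in alternation. Between consecutive values lies half a zone,
  all of it on one side.\<close>

definition half_end :: "(nat \<Rightarrow> nat) \<Rightarrow> nat \<Rightarrow> nat" where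
  "half_end d k = (if even k then zs (k div 2) else cut d (k div 2))"

text \<open>Every half zone is divided into \<open>L\<close> nearly equal blocks, so that each block
  lies in one zone, where the slope is constant, and on one side.\<close>

definition grid :: "nat \<Rightarrow> (nat \<Rightarrow> nat) \<Rightarrow> nat \<Rightarrow> nat" where
  "grid L d k = half_end d (k div L) + (k mod L) * (half_end d (Suc (k div L)) - half_end d (k div L)) div L"

lemma half_end_props:
  assumes "d \<in> disps"
  shows "3 * m + 4 * half_end d k \<le> 4 * half_end d (Suc k)"
    and "zs (k div 2) \<le> half_end d k" "half_end d (Suc k) \<le> zs (Suc (k div 2))"
    and "k < 2 * s \<Longrightarrow> half_end d (Suc k) - half_end d k \<le> 2 * (t * m)"
proof -
  let ?j = "k div 2"
  have S: "Suc k div 2 = (if even k then ?j else Suc ?j)" by simp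
  show 1: "3 * m + 4 * half_end d k \<le> 4 * half_end d (Suc k)"
    using cut_zone[OF assms, of ?j] by (cases "even k") (auto simp: half_end_def simp del: zs_simps)
  show 2: "zs ?j \<le> half_end d k" "half_end d (Suc k) \<le> zs (Suc ?j)"
    using cut_zone'[OF assms, of ?j] by (auto simp: half_end_def simp del: zs_simps)
  assume k: "k < 2 * s"
  then have "zs (Suc ?j) \<le> n" using zs_mono[of "Suc ?j" s] zs_s by (simp del: zs_simps)
  then show "half_end d (Suc k) - half_end d k \<le> 2 * (t * m)" using 2 by simp
qed

lemma grid_eq:
  assumes "d \<in> disps" "L > 0"
  shows "grid L d (Suc k) = half_end d (k div L)
    + Suc (k mod L) * (half_end d (Suc (k div L)) - half_end d (k div L)) div L"
proof (cases "Suc (k mod L) = L")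
  case True
  then have dm: "Suc k div L = Suc (k div L)" "Suc k mod L = 0"
    by (simp_all add: div_Suc mod_Suc)
  show ?thesis
  proof -
    have "Suc (k mod L) * (half_end d (Suc (k div L)) - half_end d (k div L)) div L
      = half_end d (Suc (k div L)) - half_end d (k div L)"
      unfolding True using assms(2) by (simp del: mult_Suc)
    moreover have "half_end d (k div L) \<le> half_end d (Suc (k div L))"
      using half_end_props(1)[OF assms(1), of "k div L"] by linarith
    ultimately show ?thesis unfolding grid_def dm by simp
  qed
next
  case False
  then have "Suc k div L = k div L" "Suc k mod L = Suc (k mod L)"
    by (simp_all add: div_Suc mod_Suc)
  then show ?thesis unfolding grid_def by simp
qed

lemma grid_block:
  assumes d: "d \<in> disps" and L: "L > 0" and k: "k < 2 * s * L"
  shows "grid L d k \<le> grid L d (Suc k)"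
    and "{grid L d k..<grid L d (Suc k)} \<subseteq> {half_end d (k div L)..<half_end d (Suc (k div L))}"
    and "3 * real m / (4 * real L) - 1 \<le> real (grid L d (Suc k) - grid L d k)"
    and "real (grid L d (Suc k) - grid L d k) \<le> 2 * real t * real m / real L + 1"
proof -
  define e where "e = half_end d (k div L)"
  define H where "H = half_end d (Suc (k div L)) - e"
  define l where "l = k mod L"
  have kL: "k div L < 2 * s" using k L by (simp add: less_mult_imp_div_less)
  have eH: "half_end d (Suc (k div L)) = e + H"
    using half_end_props(1)[OF d, of "k div L"] by (simp add: H_def e_def)
  have H: "3 * m \<le> 4 * H" "H \<le> 2 * (t * m)"
    using half_end_props(1)[OF d, of "k div L"] half_end_props(4)[OF d kL] by (auto simp: H_def e_def)
  have g: "grid L d k = e + l * H div L" "grid L d (Suc k) = e + Suc l * H div L"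
    using grid_eq[OF d L, of k] by (auto simp: grid_def e_def H_def l_def)
  have l: "Suc l \<le> L" using L by (simp add: l_def Suc_le_eq)
  have mono: "l * H div L \<le> Suc l * H div L" by (intro div_le_mono mult_le_mono1) auto
  then show "grid L d k \<le> grid L d (Suc k)" by (simp add: g)
  have "Suc l * H div L \<le> L * H div L" using l by (intro div_le_mono mult_le_mono1)
  then have "Suc l * H div L \<le> H" using L by simp
  then show "{grid L d k..<grid L d (Suc k)} \<subseteq> {half_end d (k div L)..<half_end d (Suc (k div L))}"
    unfolding g eH e_def[symmetric] by auto
  have fl: "real x / L - 1 \<le> real (x div L)" "real (x div L) \<le> real x / L" for x
  proof -
    have "L * (x div L) \<le> x" "x < L + L * (x div L)" using L by (auto simp: dividend_less_times_div)
    then have "real (L * (x div L)) \<le> real x" "real x < real (L + L * (x div L))"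
      by (simp_all only: of_nat_le_iff of_nat_less_iff)
    then show "real x / L - 1 \<le> real (x div L)" "real (x div L) \<le> real x / L"
      using L by (auto simp: field_simps)
  qed
  have sz: "real (grid L d (Suc k) - grid L d k) = real (Suc l * H div L) - real (l * H div L)"
    using mono by (simp add: g of_nat_diff)
  have diff: "real (Suc l * H) / L - real (l * H) / L = H / L" by (simp add: add_divide_distrib)
  have "real (3 * m) \<le> real (4 * H)" "real H \<le> real (2 * (t * m))" using H by (simp_all only: of_nat_le_iff)
  then have "3 * real m \<le> 4 * real H" "real H \<le> 2 * real t * real m" by simp_all
  then have "3 * real m / (4 * real L) \<le> H / L" "H / L \<le> 2 * real t * real m / real L"
    using L by (auto simp: field_simps)
  then show "3 * real m / (4 * real L) - 1 \<le> real (grid L d (Suc k) - grid L d k)"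
    "real (grid L d (Suc k) - grid L d k) \<le> 2 * real t * real m / real L + 1"
    using fl[of "Suc l * H"] fl[of "l * H"] diff unfolding sz by linarith+
qed

lemma half_zone_side:
  assumes d: "d \<in> disps" and k: "k < 2 * s" and p: "p \<in> {half_end d k..<half_end d (Suc k)}"
  shows "p \<in> side n (cuts d) \<longleftrightarrow> odd ((s - 1 - k div 2) + (if even k then 1 else 0))"
proof -
  let ?j = "k div 2"
  have "zs ?j \<le> p" "p < zs (Suc ?j)" using half_end_props(2,3)[OF d, of k] p by auto
  moreover have "?j < s" using k by simp
  moreover have "p < cut d ?j \<longleftrightarrow> even k" using p by (cases "even k") (auto simp: half_end_def)
  ultimately show ?thesis using side_zone[OF d, of ?j p] by simp
qed

lemma slope_on_block:
  assumes d: "d \<in> disps" and L: "L > 0" and k: "k < 2 * s * L"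
    and q: "q \<in> {grid L d k..<grid L d (Suc k)}"
  shows "slope i q = 3 / sqrt m * ((if i = k div (2 * L) then real s else 0) - 1)"
proof -
  let ?j = "k div L div 2"
  have j: "k div (2 * L) = ?j" by (metis div_mult2_eq mult.commute)
  have "q \<in> {half_end d (k div L)..<half_end d (Suc (k div L))}" using grid_block(2)[OF d L k] q by blast
  then have z: "q \<in> {zs ?j..<zs (Suc ?j)}" using half_end_props(2,3)[OF d, of "k div L"] by auto
  then have "q \<in> {zs i..<zs (Suc i)} \<longleftrightarrow> i = ?j" using zones_disjoint[of i ?j] by blast
  then show ?thesis by (simp only: slope_def j)
qed

text \<open>The achievable tube has width of order \<open>sqrt m / w\<close>, whereas
  \<open>profile_imp_many_cuts\<close> tolerates \<open>sqrt m\<close>. A large fixed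
  \<open>w\<close> suffices, and the number of blocks, hence the power of \<open>c0\<close>, does
  not grow with \<open>m\<close>.\<close>

lemma tube_lower:
  fixes c R \<theta> c0 :: real
  assumes d: "d \<in> disps" and c: "c > 0" "c0 > 0" "R > 0"
    and block: "\<forall>n a b d. a + b \<le> n \<longrightarrow> b0 \<le> b \<longrightarrow>
    (\<Sum>i<t. d i) = b \<longrightarrow> (\<forall>i<t. \<bar>real (d i) - b / t\<bar> \<le> sqrt b) \<longrightarrow>
    c / sqrt (real b + 1) ^ (t - 1) \<le> pr t n (\<lambda>f. (\<forall>i<t. cnt f {a..<a + b} i = d i) \<and>
      (\<forall>i<t. \<forall>l\<le>b. \<bar>dev t f i a l\<bar> \<le> R * sqrt b))"
    and box: "\<forall>n a b \<tau> E. a + b \<le> n \<longrightarrow> b1 \<le> b \<longrightarrow> (\<Sum>i<t. E i) = 0 \<longrightarrow>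
    \<theta> * sqrt b \<le> \<tau> \<longrightarrow> (\<forall>i<t. \<bar>E i\<bar> + \<tau> \<le> sqrt b) \<longrightarrow>
    c0 \<le> pr t n (\<lambda>f. (\<forall>i<t. \<bar>real (cnt f {a..<a + b} i) - b / t - E i\<bar> \<le> \<tau>) \<and>
      (\<forall>i<t. \<forall>l\<le>b. \<bar>dev t f i a l\<bar> \<le> R * sqrt b))"
    and \<theta>: "\<theta> = 1 / (16 * s * (real w)\<^sup>2 * sqrt (3 * t))"
    and w: "72 * t * s \<le> w" "(R + 2) * sqrt (3 * t) + 1 \<le> w"
    and m_large: "24 * w * s\<^sup>2 * (1 + r) \<le> m" "2 * w\<^sup>2 * max (max b0 b1) (t\<^sup>2) \<le> m" "4 * w\<^sup>2 \<le> m"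
  shows "c0 ^ (2 * s * w\<^sup>2) * (c / sqrt (3 * t * m / (real w)\<^sup>2 + 1) ^ (t - 1))\<^sup>2
    \<le> pr t n (\<lambda>f. balanced t m f \<and> halves t m (cuts d) f \<and> s \<le> min_cuts t m f)"
proof -
  define \<mu> where "\<mu> = sqrt m"
  \<comment> \<open>Blocks of length about \<open>m / w\<^sup>2\<close> fluctuate by about
    \<open>sqrt m / w\<close>.\<close>
  define L where "L = w\<^sup>2"
  define \<sigma> where "\<sigma> = sqrt (3 * t) * \<mu> / w"
  \<comment> \<open>Small enough that \<open>4 * \<beta>\<close> is below the square root of every
    block length. Large enough for the drift of one block, which is at most
    \<open>9 * t * s * \<mu> / w\<^sup>2\<close>; this is where \<open>72 * t * s \<le> w\<close>
    comes from.\<close>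
  define \<beta> where "\<beta> = \<mu> / (8 * w)"
  define \<tau> where "\<tau> = \<beta> / (2 * s * (real w)\<^sup>2)"
  define g where "g = grid L d"
  define A where "A = side n (cuts d)"
  define v where "v k i = (if i < s then 3 / \<mu> * ((if i = k div (2 * L) then real s else 0) - 1) else 0)" for k i
  have "1 * 1 \<le> t * s" using s by (intro mult_mono) auto
  then have w1: "1 \<le> w" "72 \<le> w" using w(1) by linarith+
  have L: "L > 0" using w1 by (simp add: L_def)
  have Lr: "real L = (real w)\<^sup>2" by (simp add: L_def)
  have \<mu>: "\<mu> > 0" "\<mu>\<^sup>2 = m" using m by (auto simp: \<mu>_def)
  have pos: "\<sigma> > 0" "\<beta> > 0" "\<tau> > 0" using \<mu> w1 s by (auto simp: \<sigma>_def \<beta>_def \<tau>_def)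
  have \<sigma>2: "\<sigma>\<^sup>2 = 3 * t * m / (real w)\<^sup>2"
    using \<mu> by (simp add: \<sigma>_def power_divide power_mult_distrib)
  have sl: "1 \<le> real s * (real w)\<^sup>2"
  proof -
    have "1 * 1 \<le> real s * (real w)\<^sup>2" using s w1 by (intro mult_mono) auto
    then show ?thesis by simp
  qed
  have size_lo: "m / (2 * L) \<le> real (g (Suc k) - g k)" and size_hi: "real (g (Suc k) - g k) \<le> 3 * real t * real m / real L"
    if k: "k < 2 * s * L" for k
  proof -
    have "real (4 * L) \<le> real m" using m_large(3) by (simp only: of_nat_le_iff L_def)
    then have m1: "1 \<le> m / (4 * L)" using L by simp
    have "3 * real m / (4 * real L) - 1 \<le> real (g (Suc k) - g k)" unfolding g_def by (rule grid_block(3)[OF d L k])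
    moreover have "3 * real m / (4 * real L) = m / (2 * L) + m / (4 * L)" by (simp add: field_simps)
    ultimately show "m / (2 * L) \<le> real (g (Suc k) - g k)" using m1 by linarith
    have "real (g (Suc k) - g k) \<le> 2 * real t * real m / real L + 1" unfolding g_def by (rule grid_block(4)[OF d L k])
    moreover have "1 \<le> t * m / L"
    proof -
      have "1 * real m \<le> 4 * t * real m" using s by (intro mult_right_mono) auto
      then have "m / (4 * L) \<le> t * m / L" using L by (simp add: field_simps)
      then show ?thesis using m1 by linarith
    qed
    moreover have "3 * real t * real m / real L = 2 * real t * real m / real L + t * m / L" by (simp add: field_simps)
    ultimately show "real (g (Suc k) - g k) \<le> 3 * real t * real m / real L" by linarith
  qed
  have sqrt_lo: "4 * \<beta> \<le> sqrt (real (g (Suc k) - g k))" if "k < 2 * s * L" for k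
  proof (rule real_le_rsqrt)
    have "(4 * \<beta>)\<^sup>2 = m / (4 * L)" using \<mu> by (simp add: \<beta>_def power_divide power_mult_distrib Lr)
    also have "\<dots> \<le> m / (2 * L)" using L by (intro divide_left_mono) auto
    finally show "(4 * \<beta>)\<^sup>2 \<le> real (g (Suc k) - g k)" using size_lo[OF that] by linarith
  qed
  have sqrt_hi: "sqrt (real (g (Suc k) - g k)) \<le> \<sigma>" if "k < 2 * s * L" for k
  proof (rule real_le_lsqrt)
    show "real (g (Suc k) - g k) \<le> \<sigma>\<^sup>2" using size_hi[OF that] unfolding \<sigma>2 Lr by simp
  qed (use pos in auto)
  have \<tau>\<beta>: "\<tau> \<le> \<beta>"
  proof -
    have "\<beta> / (2 * s * (real w)\<^sup>2) \<le> \<beta> / 1" using pos sl by (intro divide_left_mono) auto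
    then show ?thesis by (simp add: \<tau>_def)
  qed
  have block_sum: "real (g (Suc k) - g k) * v k i = (\<Sum>q\<in>{g k..<g (Suc k)}. slope i q)"
    if k: "k < 2 * s * L" and i: "i < s" for k i
  proof -
    have "(\<Sum>q\<in>{g k..<g (Suc k)}. slope i q) = (\<Sum>q\<in>{g k..<g (Suc k)}. v k i)"
      using slope_on_block[OF d L k] i by (intro sum.cong) (auto simp: v_def g_def \<mu>_def)
    then show ?thesis by simp
  qed
  have div_s: "k div (2 * L) < s" if "k < 2 * s * L" for k
    using that L by (simp add: less_mult_imp_div_less mult_ac)
  have slope_sum: "(\<Sum>q\<in>B. slope i q) = 3 / \<mu> * (real s * card (B \<inter> {zs i..<zs (Suc i)}) - card B)" if "finite B" for B i
  proof -
    have "(\<Sum>q\<in>B. (if q \<in> {zs i..<zs (Suc i)} then real s else 0)) = (\<Sum>q\<in>B \<inter> {zs i..<zs (Suc i)}. real s)"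
      using that by (intro sum.inter_restrict[symmetric])
    then show ?thesis unfolding slope_def \<mu>_def sum_distrib_left[symmetric] sum_subtractf
      by (simp add: mult.commute del: zs_simps)
  qed
  have g0: "g 0 = 0" by (simp add: g_def grid_def half_end_def)
  have gN: "g (2 * s * L) = n" using L by (simp add: g_def grid_def half_end_def zs_s)
  have A: "A \<subseteq> {..<n}" "finite A" "card A = t * m"
    using card_side[OF d] by (auto simp: A_def side_def)
  have blk: "p \<in> A \<longleftrightarrow> odd ((s - 1 - k div L div 2) + (if even (k div L) then 1 else 0))"
    if k: "k < 2 * s * L" and p: "p \<in> {g k..<g (Suc k)}" for p k
    unfolding A_def using grid_block(2)[OF d L k] p k L
    by (intro half_zone_side[OF d]) (auto simp: g_def less_mult_imp_div_less)
  have N_UN: "(\<Union>k<K. {g k..<g (Suc k)}) = {..<g K} \<and> (\<forall>k<K. g k \<le> g (Suc k))" if "K \<le> 2 * s * L" for K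
    using that
  proof (induction K)
    case 0
    then show ?case by (simp add: g0)
  next
    case (Suc K)
    have "g K \<le> g (Suc K)" using grid_block(1)[OF d L, of K] Suc.prems by (simp add: g_def)
    moreover have "(\<Union>k<Suc K. {g k..<g (Suc k)}) = {..<g K} \<union> {g K..<g (Suc K)}"
      using Suc by (simp add: lessThan_Suc Un_commute)
    ultimately show ?case using Suc by (auto simp: less_Suc_eq)
  qed
  have disj: "{g k..<g (Suc k)} \<inter> {g k'..<g (Suc k')} = {}" if kk: "k < k'" "k' < 2 * s * L" for k k'
  proof -
    have "{g k..<g (Suc k)} \<subseteq> {..<g k'}" using N_UN[of k'] kk by auto
    then have "x < g k'" if "x \<in> {g k..<g (Suc k)}" for x using that by blast
    then show ?thesis by fastforce
  qed
  have disj': "{g k..<g (Suc k)} \<inter> {g k'..<g (Suc k')} = {}" if "k \<noteq> k'" "k < 2 * s * L" "k' < 2 * s * L" for k k'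
    using disj[of k k'] disj[of k' k] that by (cases "k < k'") auto
  have collect: "(\<Sum>k\<in>K. \<Sum>q\<in>{g k..<g (Suc k)}. slope i q) = (\<Sum>q\<in>(\<Union>k\<in>K. {g k..<g (Suc k)}). slope i q)"
    if "K \<subseteq> {..<2 * s * L}" for K i
    using that disj' finite_subset[OF that] by (intro sum.UNION_disjoint[symmetric]) auto
  have g24: "3 / \<mu> * ((real s)\<^sup>2 * (1 + real r)) \<le> \<beta>"
  proof -
    have "real (24 * w * s\<^sup>2 * (1 + r)) \<le> real m" using m_large(1) by (simp only: of_nat_le_iff)
    then have "24 * w * (real s)\<^sup>2 * (1 + real r) \<le> \<mu> * \<mu>" using \<mu>(2) by (simp add: power2_eq_square algebra_simps)
    then show ?thesis using \<mu>(1) w1 by (simp add: \<beta>_def field_simps)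
  qed
  have drift: "\<bar>\<Sum>k\<in>K. real (g (Suc k) - g k) * v k i\<bar> \<le> \<beta>"
    if K: "K \<subseteq> {..<2 * s * L}" and U: "(\<Union>k\<in>K. {g k..<g (Suc k)}) = B" "card B = t * m" "finite B"
      and near: "i < s \<Longrightarrow> \<bar>real s * real (card (B \<inter> {zs i..<zs (Suc i)})) - real t * real m\<bar> \<le> (real s)\<^sup>2 * (1 + real r)"
    for K B i
  proof (cases "i < s")
    case False
    then show ?thesis using pos by (simp add: v_def)
  next
    case True
    have "(\<Sum>k\<in>K. real (g (Suc k) - g k) * v k i) = (\<Sum>k\<in>K. \<Sum>q\<in>{g k..<g (Suc k)}. slope i q)"
      using K True by (intro sum.cong refl block_sum) auto
    also have "\<dots> = (\<Sum>q\<in>B. slope i q)" unfolding collect[OF K] U(1) ..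
    also have "\<dots> = 3 / \<mu> * (real s * card (B \<inter> {zs i..<zs (Suc i)}) - real t * real m)"
      unfolding slope_sum[OF U(3)] U(2) by simp
    finally have e: "(\<Sum>k\<in>K. real (g (Suc k) - g k) * v k i) =
      3 / \<mu> * (real s * card (B \<inter> {zs i..<zs (Suc i)}) - real t * real m)" .
    have "\<bar>3 / \<mu>\<bar> = 3 / \<mu>" using \<mu>(1) by simp
    then have "\<bar>\<Sum>k\<in>K. real (g (Suc k) - g k) * v k i\<bar> =
      3 / \<mu> * \<bar>real s * card (B \<inter> {zs i..<zs (Suc i)}) - real t * real m\<bar>"
      by (simp only: e abs_mult)
    also have "\<dots> \<le> 3 / \<mu> * ((real s)\<^sup>2 * (1 + real r))"
      using near[OF True] \<mu>(1) by (intro mult_left_mono) auto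
    finally show ?thesis using g24 by linarith
  qed
  have blk_cases: "{g k..<g (Suc k)} \<subseteq> A \<or> {g k..<g (Suc k)} \<inter> A = {}" if "k < 2 * s * L" for k
    using blk[OF that] by blast
  have blk_ne: "{g k..<g (Suc k)} \<noteq> {}" if "k < 2 * s * L" for k
  proof -
    have "0 < m / (2 * L)" using m L by simp
    then show ?thesis using size_lo[OF that] by auto
  qed
  let ?IA = "{k. k < 2 * s * L \<and> {g k..<g (Suc k)} \<subseteq> A}"
  let ?IB = "{k. k < 2 * s * L \<and> {g k..<g (Suc k)} \<inter> A = {}}"
  have UA: "(\<Union>k\<in>?IA. {g k..<g (Suc k)}) = A"
  proof (intro equalityI subsetI)
    fix p assume p: "p \<in> A"
    then have "p \<in> (\<Union>k<2 * s * L. {g k..<g (Suc k)})" using A(1) N_UN[of "2 * s * L"] gN by auto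
    then obtain k where k: "k < 2 * s * L" "p \<in> {g k..<g (Suc k)}" by blast
    then have "{g k..<g (Suc k)} \<subseteq> A" using blk_cases[OF k(1)] p by blast
    then show "p \<in> (\<Union>k\<in>?IA. {g k..<g (Suc k)})" using k by blast
  qed blast
  have UB: "(\<Union>k\<in>?IB. {g k..<g (Suc k)}) = {..<n} - A"
  proof (intro equalityI subsetI)
    fix p assume p: "p \<in> {..<n} - A"
    then have "p \<in> (\<Union>k<2 * s * L. {g k..<g (Suc k)})" using N_UN[of "2 * s * L"] gN by auto
    then obtain k where k: "k < 2 * s * L" "p \<in> {g k..<g (Suc k)}" by blast
    then have "{g k..<g (Suc k)} \<inter> A = {}" using blk_cases[OF k(1)] p by blast
    then show "p \<in> (\<Union>k\<in>?IB. {g k..<g (Suc k)})" using k by blast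
  next
    fix p assume "p \<in> (\<Union>k\<in>?IB. {g k..<g (Suc k)})"
    then obtain k where k: "k < 2 * s * L" "{g k..<g (Suc k)} \<inter> A = {}" "p \<in> {g k..<g (Suc k)}" by blast
    then have "p \<in> (\<Union>k<2 * s * L. {g k..<g (Suc k)})" by blast
    then have "p < n" using N_UN[of "2 * s * L"] gN by simp
    then show "p \<in> {..<n} - A" using k by blast
  qed
  have cB: "card ({..<n} - A) = t * m" using A by (simp add: card_Diff_subset)
  have nearA: "\<bar>real s * real (card (A \<inter> {zs i..<zs (Suc i)})) - real t * real m\<bar> \<le> (real s)\<^sup>2 * (1 + real r)" if "i < s" for i
    unfolding A_def by (intro zone_share_near[of _ i] side_zone_card[OF d that])
  have nearB: "\<bar>real s * real (card (({..<n} - A) \<inter> {zs i..<zs (Suc i)})) - real t * real m\<bar> \<le> (real s)\<^sup>2 * (1 + real r)"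
    if "i < s" for i
    unfolding A_def by (intro zone_share_near[of _ i] side_zone_card[OF d that])
  have tp: "c0 ^ (2 * s * L) * (c / sqrt (\<sigma>\<^sup>2 + 1) ^ (t - 1))\<^sup>2 \<le> pr t n (\<lambda>f. (\<forall>i<t. cnt f A i = m) \<and>
    (\<forall>i<t. cnt f ({..<n} - A) i = m) \<and>
    (\<forall>k<2 * s * L. \<forall>i<t. \<forall>l\<le>g (Suc k) - g k.
      \<bar>dev t f i 0 (g k + l) - (\<Sum>k'<k. real (g (Suc k') - g k') * v k' i) - l * v k i\<bar> \<le> (R + 2) * \<sigma> + 4 * \<beta>))"
  \<comment> \<open>The forced blocks are the last block before the last cut, which always lies in
    \<open>side\<close>, and the last block of the word, which never does.\<close>
  proof (rule tube_prob[OF t_pos c block box g0 gN, where \<tau> = \<tau> and m = m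
        and ?a1.0 = "(2 * s - 1) * L - 1" and ?a2.0 = "2 * s * L - 1"])
    fix k assume k: "k < 2 * s * L"
    show "g k \<le> g (Suc k)" unfolding g_def by (rule grid_block(1)[OF d L k])
    show "max (max b0 b1) (t\<^sup>2) \<le> g (Suc k) - g k"
    proof -
      have "real (2 * L * max (max b0 b1) (t\<^sup>2)) \<le> real m" using m_large(2) by (simp only: of_nat_le_iff L_def)
      then have "real (max (max b0 b1) (t\<^sup>2)) \<le> m / (2 * L)" using L by (simp add: field_simps)
      then have "real (max (max b0 b1) (t\<^sup>2)) \<le> real (g (Suc k) - g k)" using size_lo[OF k] by linarith
      then show ?thesis by (simp only: of_nat_le_iff)
    qed
    show "(\<Sum>i<t. v k i) = 0"
    proof -
      have "(\<Sum>i<t. v k i) = (\<Sum>i<s. 3 / \<mu> * ((if i = k div (2 * L) then real s else 0) - 1))"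
        using s by (intro sum.mono_neutral_cong_right) (auto simp: v_def)
      also have "\<dots> = 3 / \<mu> * ((\<Sum>i<s. if i = k div (2 * L) then real s else 0) - real s)"
        by (simp only: sum_distrib_left[symmetric] sum_subtractf) simp
      also have "(\<Sum>i<s. if i = k div (2 * L) then real s else 0) = real s"
        using div_s[OF k] by simp
      finally show ?thesis by simp
    qed
    show "sqrt (real (g (Suc k) - g k)) \<le> \<sigma>" by (rule sqrt_hi[OF k])
    show "\<beta> + \<tau> \<le> sqrt (real (g (Suc k) - g k))" using sqrt_lo[OF k] \<tau>\<beta> pos by linarith
    show "3 * \<beta> \<le> sqrt (real (g (Suc k) - g k))" using sqrt_lo[OF k] pos by linarith
    show "{g k..<g (Suc k)} \<subseteq> A \<or> {g k..<g (Suc k)} \<inter> A = {}" by (rule blk_cases[OF k])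
    fix i :: nat
    show "real (g (Suc k) - g k) * \<bar>v k i\<bar> \<le> \<beta>"
    proof -
      have "\<bar>v k i\<bar> \<le> 3 / \<mu> * real s"
      proof -
        have "\<bar>(if i = k div (2 * L) then real s else 0) - 1\<bar> \<le> real s" using s by auto
        then have "3 / \<mu> * \<bar>(if i = k div (2 * L) then real s else 0) - 1\<bar> \<le> 3 / \<mu> * real s"
          using \<mu> by (intro mult_left_mono) auto
        then show ?thesis using \<mu> by (simp only: v_def abs_mult) (auto simp: abs_mult)
      qed
      then have "real (g (Suc k) - g k) * \<bar>v k i\<bar> \<le> (3 * real t * real m / real L) * (3 / \<mu> * real s)"
        using size_hi[OF k] by (intro mult_mono) auto
      also have "\<dots> = \<mu> / real w * (9 * real t * real s / real w)"
        using \<mu>(1) by (simp add: \<mu>(2)[symmetric] Lr power2_eq_square)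
      also have "\<dots> \<le> \<mu> / real w * (1 / 8)"
      proof -
        have "real (72 * t * s) \<le> real w" using w(1) by (simp only: of_nat_le_iff)
        then have "9 * real t * real s / real w \<le> 1 / 8" using w1 by (simp add: field_simps)
        then show ?thesis using \<mu>(1) by (intro mult_left_mono) auto
      qed
      finally show ?thesis by (simp add: \<beta>_def)
    qed
  next
    have "\<theta> * \<sigma> = \<tau>"
      using s w1 \<mu>(1) t_pos by (simp add: \<theta> \<sigma>_def \<tau>_def \<beta>_def field_simps)
    then show "\<theta> * \<sigma> \<le> \<tau>" by simp
    show "real (2 * s * L) * \<tau> \<le> \<beta>" using s w1 by (simp add: \<tau>_def Lr)
    show "0 < \<theta>" using s w1 t_pos by (simp add: \<theta>)
    show "0 \<le> \<tau>" using pos by simp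
    show "A \<subseteq> {..<n}" "card A = t * m" using A by auto
    show "n = 2 * t * m" ..
    have dl: "((L - 1) + q * L) div L = q" for q
      using L by (subst div_mult_self1) auto
    have a1: "(2 * s - 1) * L - 1 = (L - 1) + (2 * s - 2) * L"
      using L s by (cases L; cases s) auto
    have a1d: "((2 * s - 1) * L - 1) div L = 2 * s - 2"
      unfolding a1 by (rule dl)
    have "(2 * s - 1) * L \<le> 2 * s * L" by (intro mult_le_mono1) auto
    moreover have "0 < (2 * s - 1) * L" "0 < 2 * s * L" using L s by auto
    ultimately show lt: "(2 * s - 1) * L - 1 < 2 * s * L" "2 * s * L - 1 < 2 * s * L" by linarith+
    have a2: "2 * s * L - 1 = (L - 1) + (2 * s - 1) * L"
      using L s by (cases L; cases s) auto
    have a2d: "(2 * s * L - 1) div L = 2 * s - 1"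
      unfolding a2 by (rule dl)
    have "even (2 * s - 2)" "(2 * s - 2) div 2 = s - 1" using s by auto
    then show "{g ((2 * s - 1) * L - 1)..<g (Suc ((2 * s - 1) * L - 1))} \<subseteq> A"
      using blk[OF lt(1)] unfolding a1d by auto
    have "odd (2 * s - 1)" "(2 * s - 1) div 2 = s - 1" using s by auto
    then show "{g (2 * s * L - 1)..<g (Suc (2 * s * L - 1))} \<inter> A = {}"
      using blk[OF lt(2)] unfolding a2d by auto
    fix i
    show "\<bar>\<Sum>k\<in>?IA. real (g (Suc k) - g k) * v k i\<bar> \<le> \<beta>"
      using A nearA by (intro drift[OF _ UA]) auto
    show "\<bar>\<Sum>k\<in>?IB. real (g (Suc k) - g k) * v k i\<bar> \<le> \<beta>"
      using A nearB cB by (intro drift[OF _ UB]) auto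
  qed
  have width: "(R + 2) * \<sigma> + 4 * \<beta> \<le> \<mu>"
  proof -
    have "(R + 2) * \<sigma> + 4 * \<beta> = \<mu> / w * ((R + 2) * sqrt (3 * t) + 1 / 2)"
    proof -
      have "(R + 2) * (x * y) + 4 * (x * (1 / 8)) = x * ((R + 2) * y + 1 / 2)" for x y :: real
        by (simp add: algebra_simps)
      moreover have "\<sigma> = \<mu> / w * sqrt (3 * t)" "\<beta> = \<mu> / w * (1 / 8)"
        by (simp_all add: \<sigma>_def \<beta>_def)
      ultimately show ?thesis by (simp only:)
    qed
    also have "\<dots> \<le> \<mu> / w * w" using w(2) \<mu>(1) by (intro mult_left_mono) auto
    finally show ?thesis using w1 by simp
  qed
  have "pr t n (\<lambda>f. (\<forall>i<t. cnt f A i = m) \<and> (\<forall>i<t. cnt f ({..<n} - A) i = m) \<and>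
    (\<forall>k<2 * s * L. \<forall>i<t. \<forall>l\<le>g (Suc k) - g k.
      \<bar>dev t f i 0 (g k + l) - (\<Sum>k'<k. real (g (Suc k') - g k') * v k' i) - l * v k i\<bar> \<le> (R + 2) * \<sigma> + 4 * \<beta>))
    \<le> pr t n (\<lambda>f. balanced t m f \<and> halves t m (cuts d) f \<and> s \<le> min_cuts t m f)"
  proof (rule pr_mono)
    fix f assume f: "f \<in> words t n" and ev: "(\<forall>i<t. cnt f A i = m) \<and> (\<forall>i<t. cnt f ({..<n} - A) i = m) \<and>
    (\<forall>k<2 * s * L. \<forall>i<t. \<forall>l\<le>g (Suc k) - g k.
      \<bar>dev t f i 0 (g k + l) - (\<Sum>k'<k. real (g (Suc k') - g k') * v k' i) - l * v k i\<bar> \<le> (R + 2) * \<sigma> + 4 * \<beta>)"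
    have An: "{..<n} = A \<union> ({..<n} - A)" using A by blast
    have bal: "balanced t m f"
      unfolding balanced_def
    proof (intro allI impI)
      fix i assume "i < t"
      then have "cnt f A i = m" "cnt f ({..<n} - A) i = m" using ev by auto
      then show "cnt f {..<n} i = 2 * m"
        by (subst An) (subst cnt_Un, use A in auto)
    qed
    have hal: "halves t m (cuts d) f" using ev by (simp add: halves_def A_def)
    have tube: "\<bar>dev t f i 0 p - profile i p\<bar> \<le> sqrt m" if i: "i < s" and p: "p \<le> n" for i p
    proof -
      \<comment> \<open>The end point \<open>p = n\<close> lies in no block; it is reached as the
        full length of the last one, hence \<open>l\<close> may equal the block length.\<close>
      have "\<exists>k<2 * s * L. \<exists>l\<le>g (Suc k) - g k. p = g k + l"
      proof (cases "p = n")
        case True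
        have sL: "0 < 2 * s * L" using s L by simp
        then have "g (Suc (2 * s * L - 1)) = n" using gN by simp
        moreover have "g (2 * s * L - 1) \<le> g (Suc (2 * s * L - 1))"
          using sL unfolding g_def by (intro grid_block(1)[OF d L]) simp
        ultimately show ?thesis using True sL
          by (intro exI[of _ "2 * s * L - 1"] conjI exI[of _ "n - g (2 * s * L - 1)"]) auto
      next
        case False
        then have "p \<in> (\<Union>k<2 * s * L. {g k..<g (Suc k)})" using p N_UN[of "2 * s * L"] gN by simp
        then obtain k where k: "k < 2 * s * L" "g k \<le> p" "p < g (Suc k)" by auto
        then show ?thesis by (intro exI[of _ k] conjI exI[of _ "p - g k"]) auto
      qed
      then obtain k l where kl: "k < 2 * s * L" "l \<le> g (Suc k) - g k" "p = g k + l" by blast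
      have "\<bar>dev t f i 0 (g k + l) - (\<Sum>k'<k. real (g (Suc k') - g k') * v k' i) - l * v k i\<bar> \<le> \<mu>"
      proof -
        have it: "i < t" using i s by simp
        have "\<forall>k<2 * s * L. \<forall>i<t. \<forall>l\<le>g (Suc k) - g k.
          \<bar>dev t f i 0 (g k + l) - (\<Sum>k'<k. real (g (Suc k') - g k') * v k' i) - l * v k i\<bar> \<le> (R + 2) * \<sigma> + 4 * \<beta>"
          using ev by blast
        from this[rule_format, OF kl(1) it kl(2)] show ?thesis using width by linarith
      qed
      moreover have "(\<Sum>k'<k. real (g (Suc k') - g k') * v k' i) = (\<Sum>q<g k. slope i q)"
      proof -
        have "(\<Sum>k'<k. real (g (Suc k') - g k') * v k' i) = (\<Sum>k'<k. \<Sum>q\<in>{g k'..<g (Suc k')}. slope i q)"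
          using kl i by (intro sum.cong refl block_sum) auto
        also have "\<dots> = (\<Sum>q\<in>(\<Union>k'<k. {g k'..<g (Suc k')}). slope i q)"
          using kl by (intro collect) auto
        finally show ?thesis using N_UN[of k] kl by simp
      qed
      moreover have "l * v k i = (\<Sum>q\<in>{g k..<g k + l}. slope i q)"
      proof -
        have "(\<Sum>q\<in>{g k..<g k + l}. slope i q) = (\<Sum>q\<in>{g k..<g k + l}. v k i)"
          using slope_on_block[OF d L kl(1)] i kl(2) by (intro sum.cong) (auto simp: v_def g_def \<mu>_def)
        then show ?thesis by simp
      qed
      moreover have "(\<Sum>q<g k + l. slope i q) = (\<Sum>q<g k. slope i q) + (\<Sum>q\<in>{g k..<g k + l}. slope i q)"
        by (simp add: lessThan_atLeast0 sum.atLeastLessThan_concat)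
      ultimately show ?thesis by (simp add: kl(3) profile_def \<mu>_def)
    qed
    obtain S where S: "S \<subseteq> {1..<n}" "halves t m S f" "card S = min_cuts t m f"
      using min_cuts_attained[OF bal] by blast
    have "s \<le> min_cuts t m f" using profile_imp_many_cuts[OF f bal S(2,1) tube] S(3) by simp
    then show "balanced t m f \<and> halves t m (cuts d) f \<and> s \<le> min_cuts t m f" using bal hal by simp
  qed
  then show ?thesis using tp unfolding \<sigma>2 L_def by linarith
qed

end

section \<open>Lower bounds for the probability and the three regimes of the clump size\<close>

definition clump_sum :: "nat \<Rightarrow> nat \<Rightarrow> nat \<Rightarrow> real" where
  "clump_sum t s m = 1 + real (s - 1) * (\<Sum>k=1..m. real (k + 1) ^ (s - 2) / sqrt (real (k + 1)) ^ (t - 1))"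

text \<open>The window width \<open>r\<close> is a fixed fraction of \<open>m\<close>, so there are
  of order \<open>m ^ (s - 1)\<close> candidate sets. The square of the first moment divided by the
  second is then of order \<open>m ^ (s - 1) / m ^ (t - 1)\<close>, reduced by the clump factor. Any
  fair set in the window has \<open>s\<close> cuts, so together with
  \<open>s \<le> min_cuts t m f\<close> the minimum is exact.\<close>

lemma pr_min_cuts_lower:
  assumes s: "1 \<le> s" "s \<le> t"
  shows "\<exists>c>0. \<forall>\<^sub>F m in sequentially. c * real m ^ (s - 1) / real m ^ (t - 1) / clump_sum t s m
    \<le> pr t (2 * t * m) (\<lambda>f. balanced t m f \<and> min_cuts t m f = s)"
proof -
  have t: "t \<ge> 1" using s by simp
  obtain c R :: real and b0 :: nat where c: "c > 0" "R > 0" and block: "\<forall>n a b d. a + b \<le> n \<longrightarrow> b0 \<le> b \<longrightarrow>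
    (\<Sum>i<t. d i) = b \<longrightarrow> (\<forall>i<t. \<bar>real (d i) - b / t\<bar> \<le> sqrt b) \<longrightarrow>
    c / sqrt (real b + 1) ^ (t - 1) \<le> pr t n (\<lambda>f. (\<forall>i<t. cnt f {a..<a + b} i = d i) \<and>
      (\<forall>i<t. \<forall>l\<le>b. \<bar>dev t f i a l\<bar> \<le> R * sqrt b))"
    using block_prob[OF t] by blast
  define w where "w = max (72 * t * s) (nat \<lceil>(R + 2) * sqrt (3 * t) + 1\<rceil>)"
  have w: "72 * t * s \<le> w" "(R + 2) * sqrt (3 * t) + 1 \<le> w" unfolding w_def by linarith+
  have "1 * 1 \<le> t * s" using s by (intro mult_mono) auto
  then have w1: "1 \<le> w" using w(1) by linarith
  define \<theta> where "\<theta> = 1 / (16 * s * (real w)\<^sup>2 * sqrt (3 * t))"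
  have \<theta>: "\<theta> > 0" using s w1 by (simp add: \<theta>_def)
  obtain c0 :: real and b1 :: nat where c0: "c0 > 0" and box: "\<forall>n a b \<tau> E. a + b \<le> n \<longrightarrow> b1 \<le> b \<longrightarrow> (\<Sum>i<t. E i) = 0 \<longrightarrow>
    \<theta> * sqrt b \<le> \<tau> \<longrightarrow> (\<forall>i<t. \<bar>E i\<bar> + \<tau> \<le> sqrt b) \<longrightarrow>
    c0 \<le> pr t n (\<lambda>f. (\<forall>i<t. \<bar>real (cnt f {a..<a + b} i) - b / t - E i\<bar> \<le> \<tau>) \<and>
      (\<forall>i<t. \<forall>l\<le>b. \<bar>dev t f i a l\<bar> \<le> R * sqrt b))"
    using box_prob[OF t c(1) \<theta> block] by blast
  \<comment> \<open>Twice the factor required by \<open>tube_lower\<close>, so that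
    \<open>u \<le> m\<close> and \<open>u * r \<le> m\<close> together yield its condition with
    \<open>1 + r\<close>.\<close>
  define u where "u = 48 * w * s\<^sup>2"
  have u: "u > 0" using w1 s by (simp add: u_def)
  define \<kappa> where "\<kappa> = c0 ^ (2 * s * w\<^sup>2) * c\<^sup>2 / (4 * t) ^ (t - 1)"
  have \<kappa>: "\<kappa> > 0" using c c0 t by (simp add: \<kappa>_def)
  define C where "C = real (2 * s) * 2 ^ s * sqrt 2 ^ t * ub2 t * ub t"
  have C: "C > 0" using s ub_pos[OF t] ub2_pos[OF t] by (simp add: C_def)
  define M0 where "M0 = max (2 * u) (max (2 * w\<^sup>2 * max (max b0 b1) (t\<^sup>2)) (4 * w\<^sup>2))"
  have "\<kappa>\<^sup>2 / (C * (2 * real u) ^ (s - 1)) * real m ^ (s - 1) / real m ^ (t - 1) / clump_sum t s m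
    \<le> pr t (2 * t * m) (\<lambda>f. balanced t m f \<and> min_cuts t m f = s)" if m: "m \<ge> M0" for m
  proof -
    have mb: "2 * u \<le> m" "2 * w\<^sup>2 * max (max b0 b1) (t\<^sup>2) \<le> m" "4 * w\<^sup>2 \<le> m"
      using m unfolding M0_def by linarith+
    have m1: "1 \<le> m" using mb(1) u by linarith
    define r where "r = m div u"
    have ur: "u * r \<le> m" by (simp add: r_def)
    have r_lo: "m < 2 * u * r"
    proof -
      have "m < u + u * r" using u by (simp add: r_def dividend_less_times_div)
      moreover have "1 \<le> r" using mb(1) u by (simp add: r_def less_eq_div_iff_mult_less_eq)
      then have "u * 1 \<le> u * r" by (intro mult_left_mono) auto
      ultimately show ?thesis by linarith
    qed
    have rr: "4 * s * s * r \<le> m"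
    proof -
      have "4 * (s * s * r) \<le> 48 * w * (s * s * r)" using w1 by (intro mult_right_mono) auto
      also have "\<dots> \<le> m" using ur by (simp add: u_def power2_eq_square mult_ac)
      finally show ?thesis by (simp add: mult_ac)
    qed
    have wr: "24 * w * s\<^sup>2 * (1 + r) \<le> m"
    proof -
      have "2 * (24 * w * s\<^sup>2 * (1 + r)) = u + u * r" by (simp add: u_def algebra_simps)
      then show ?thesis using mb(1) ur by linarith
    qed
    interpret cut_windows t m s r using s m1 rr by unfold_locales
    have \<kappa>_le: "\<kappa> / m ^ (t - 1) \<le> pr t n (\<lambda>f. balanced t m f \<and> halves t m (cuts d) f \<and> s \<le> min_cuts t m f)"
      if d: "d \<in> disps" for d
    proof -
      have "3 * t * m / (real w)\<^sup>2 + 1 \<le> 4 * t * m"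
      proof -
        have "3 * t * m / (real w)\<^sup>2 \<le> 3 * t * m / 1"
          using w1 by (intro divide_left_mono) auto
        moreover have "1 * 1 \<le> t * m" using t m1 by (intro mult_mono) auto
        then have "1 \<le> real (t * m)" by linarith
        ultimately show ?thesis by simp
      qed
      then have "sqrt (3 * t * m / (real w)\<^sup>2 + 1) ^ (t - 1) \<le> sqrt (4 * t * m) ^ (t - 1)"
        by (intro power_mono) auto
      moreover have "0 < sqrt (3 * t * m / (real w)\<^sup>2 + 1) ^ (t - 1)"
        by (intro zero_less_power) (simp add: add_nonneg_pos)
      ultimately have "c / sqrt (4 * t * m) ^ (t - 1) \<le> c / sqrt (3 * t * m / (real w)\<^sup>2 + 1) ^ (t - 1)"
        using c t m1 by (intro divide_left_mono mult_pos_pos) auto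
      then have "(c / sqrt (4 * t * m) ^ (t - 1))\<^sup>2 \<le> (c / sqrt (3 * t * m / (real w)\<^sup>2 + 1) ^ (t - 1))\<^sup>2"
        using c by (intro power_mono) auto
      then have "c0 ^ (2 * s * w\<^sup>2) * (c / sqrt (4 * t * m) ^ (t - 1))\<^sup>2
        \<le> c0 ^ (2 * s * w\<^sup>2) * (c / sqrt (3 * t * m / (real w)\<^sup>2 + 1) ^ (t - 1))\<^sup>2"
        using c0 by (intro mult_left_mono) auto
      also have "\<dots> \<le> pr t n (\<lambda>f. balanced t m f \<and> halves t m (cuts d) f \<and> s \<le> min_cuts t m f)"
        by (rule tube_lower[OF d c(1) c0 c(2) block box \<theta>_def w wr mb(2,3)])
      also have "(c / sqrt (4 * t * m) ^ (t - 1))\<^sup>2 = c\<^sup>2 / ((4 * t) ^ (t - 1) * m ^ (t - 1))"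
      proof -
        have "(sqrt (4 * t * m) ^ (t - 1))\<^sup>2 = (4 * t * m) ^ (t - 1)"
          by (simp add: power_mult[symmetric] mult.commute[of _ 2]) (simp add: power_mult)
        then show ?thesis by (simp add: power_divide power_mult_distrib)
      qed
      finally show ?thesis by (simp add: \<kappa>_def)
    qed
    define P where "P = pr t n (\<lambda>f. balanced t m f \<and> min_cuts t m f = s)"
    define V where "V = avg t n (\<lambda>f. of_bool (balanced t m f) * (num f)\<^sup>2)"
    have "(r ^ (s - 1) * (\<kappa> / m ^ (t - 1)))\<^sup>2 \<le>
      pr t n (\<lambda>f. balanced t m f \<and> s \<le> min_cuts t m f \<and> (\<exists>d\<in>disps. halves t m (cuts d) f)) * V"
      unfolding V_def by (rule pr_lower_from_num[OF \<kappa>_le]) (use \<kappa> in auto)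
    also have "\<dots> \<le> P * V"
    proof (rule mult_right_mono)
      show "0 \<le> V" unfolding V_def by (rule avg_nonneg) simp
      show "pr t n (\<lambda>f. balanced t m f \<and> s \<le> min_cuts t m f \<and> (\<exists>d\<in>disps. halves t m (cuts d) f)) \<le> P"
        unfolding P_def
      proof (rule pr_mono)
        fix f assume f: "balanced t m f \<and> s \<le> min_cuts t m f \<and> (\<exists>d\<in>disps. halves t m (cuts d) f)"
        then obtain d where "d \<in> disps" "halves t m (cuts d) f" by blast
        then have "min_cuts t m f \<le> s" using min_cuts_le[OF cuts_subset] card_cuts by metis
        then show "balanced t m f \<and> min_cuts t m f = s" using f by simp
      qed
    qed
    finally have PV: "(r ^ (s - 1) * (\<kappa> / m ^ (t - 1)))\<^sup>2 \<le> P * V" .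
    have "V \<le> C * (r ^ (s - 1) / m ^ (t - 1)) * clump"
      unfolding V_def C_def by (rule num_second_moment)
    also have "\<dots> \<le> C * (r ^ (s - 1) / m ^ (t - 1)) * clump_sum t s m"
    proof (rule mult_left_mono)
    show "clump \<le> clump_sum t s m"
    proof -
      have "1 * r \<le> u * r" using u by (intro mult_right_mono) auto
      then have "r \<le> m" using ur by linarith
      then have "(\<Sum>k=1..r. real (k + 1) ^ (s - 2) / sqrt (real (k + 1)) ^ (t - 1))
        \<le> (\<Sum>k=1..m. real (k + 1) ^ (s - 2) / sqrt (real (k + 1)) ^ (t - 1))"
        by (intro sum_mono2) auto
      then show ?thesis unfolding clump_def clump_sum_def by (intro add_left_mono mult_left_mono) auto
    qed
    qed (use C in simp)
    finally have "P * V \<le> P * (C * (r ^ (s - 1) / m ^ (t - 1)) * clump_sum t s m)"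
      using pr_nonneg unfolding P_def by (intro mult_left_mono)
    with PV have main: "(r ^ (s - 1) * (\<kappa> / m ^ (t - 1)))\<^sup>2 \<le> P * (C * (r ^ (s - 1) / m ^ (t - 1)) * clump_sum t s m)"
      by (rule order_trans)
    define Q where "Q = clump_sum t s m"
    have Q: "Q > 0" unfolding Q_def clump_sum_def by (intro add_pos_nonneg mult_nonneg_nonneg sum_nonneg) auto
    have rpos: "0 < r" using r_lo by (cases r) auto
    define X Y where "X = real r ^ (s - 1)" and "Y = real m ^ (t - 1)"
    have XY: "X > 0" "Y > 0" using rpos m1 by (auto simp: X_def Y_def)
    have "(X * (\<kappa> / Y))\<^sup>2 \<le> P * (C * (X / Y) * Q)"
      using main by (simp add: X_def Y_def Q_def)
    then have "\<kappa>\<^sup>2 / C * X / Y / Q \<le> P"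
      using XY C Q by (simp add: power2_eq_square field_simps)
    moreover have "\<kappa>\<^sup>2 / (C * (2 * real u) ^ (s - 1)) * real m ^ (s - 1) \<le> \<kappa>\<^sup>2 / C * X"
    proof -
      have "real m ^ (s - 1) \<le> (2 * real u * real r) ^ (s - 1)"
      proof (rule power_mono)
        have "real m \<le> real (2 * u * r)" using r_lo by (simp only: of_nat_le_iff less_imp_le)
        then show "real m \<le> 2 * real u * real r" by simp
      qed simp
      then have "\<kappa>\<^sup>2 / (C * (2 * real u) ^ (s - 1)) * real m ^ (s - 1)
        \<le> \<kappa>\<^sup>2 / (C * (2 * real u) ^ (s - 1)) * (2 * real u * real r) ^ (s - 1)"
        using C by (intro mult_left_mono) auto
      also have "\<dots> = \<kappa>\<^sup>2 / C * X" using u by (simp add: X_def power_mult_distrib)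
      finally show ?thesis .
    qed
    then have "\<kappa>\<^sup>2 / (C * (2 * real u) ^ (s - 1)) * real m ^ (s - 1) / Y / Q \<le> \<kappa>\<^sup>2 / C * X / Y / Q"
      using XY Q by (intro divide_right_mono) auto
    ultimately show ?thesis unfolding P_def Q_def Y_def by linarith
  qed
  then show ?thesis using \<kappa> C u
    by (intro exI[of _ "\<kappa>\<^sup>2 / (C * (2 * real u) ^ (s - 1))"] conjI eventually_sequentiallyI[of M0]) auto
qed

lemma clump_term:
  assumes "2 \<le> s" "1 \<le> t"
  shows "real (k + 1) ^ (s - 2) / sqrt (real (k + 1)) ^ (t - 1) = real (k + 1) powr (real s - (real t + 1) / 2 - 1)"
proof -
  have sq: "sqrt (real (k + 1)) ^ (t - 1) = real (k + 1) powr ((real t - 1) / 2)"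
    using assms by (simp add: powr_half_sqrt[symmetric] powr_powr flip: powr_realpow)
  have "real (k + 1) ^ (s - 2) = real (k + 1) powr (real s - 2)"
    using assms by (simp add: of_nat_diff flip: powr_realpow)
  then have "real (k + 1) ^ (s - 2) / sqrt (real (k + 1)) ^ (t - 1)
    = real (k + 1) powr ((real s - 2) - (real t - 1) / 2)"
    unfolding sq powr_diff by simp
  also have "(real s - 2) - (real t - 1) / 2 = real s - (real t + 1) / 2 - 1" by (simp add: field_simps)
  finally show ?thesis .
qed

lemma prob_X_lower:
  assumes s: "1 \<le> s" "s \<le> t"
  shows "\<exists>c>0. \<forall>\<^sub>F m in sequentially. c * real m powr (real s - (real t + 1) / 2) / clump_sum t s m
    \<le> measure_pmf.prob (random_necklace 2 t m) {w. X 2 t m w = s}"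
proof -
  have t: "t \<ge> 1" using s by simp
  obtain c where c: "c > 0" and ev: "\<forall>\<^sub>F m in sequentially. c * real m ^ (s - 1) / real m ^ (t - 1) / clump_sum t s m
    \<le> pr t (2 * t * m) (\<lambda>f. balanced t m f \<and> min_cuts t m f = s)"
    using pr_min_cuts_lower[OF s] by blast
  have "\<forall>\<^sub>F m in sequentially. c / ub t * real m powr (real s - (real t + 1) / 2) / clump_sum t s m
    \<le> measure_pmf.prob (random_necklace 2 t m) {w. X 2 t m w = s}"
  proof -
    obtain c' where c': "c' > 0" and ev': "\<forall>\<^sub>F m in sequentially. c' / sqrt (real m) ^ (t - 1) \<le> pr t (2 * t * m) (balanced t m)"
      using pr_balanced_lower[OF t] by blast
    show ?thesis
      using ev ev' eventually_ge_at_top[of 1]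
    proof eventually_elim
      case (elim m)
      have sq: "sqrt m ^ (t - 1) = real m powr ((real t - 1) / 2)"
        using elim(3) t by (simp add: powr_half_sqrt[symmetric] powr_powr flip: powr_realpow)
      have "m ^ (s - 1) / m ^ (t - 1) * sqrt m ^ (t - 1)
          = real m powr ((real s - 1) - (real t - 1) + (real t - 1) / 2)"
        unfolding sq powr_add powr_diff[of _ "real s - 1"] using elim(3) s t
        by (simp flip: powr_realpow)
      also have "(real s - 1) - (real t - 1) + (real t - 1) / 2 = real s - (real t + 1) / 2"
        by (simp add: field_simps)
      finally have pw: "m ^ (s - 1) / m ^ (t - 1) * sqrt m ^ (t - 1) = real m powr (real s - (real t + 1) / 2)" .
      have "0 < c' / sqrt (real m) ^ (t - 1)" using c' elim(3) by simp
      then have pos: "0 < pr t (2 * t * m) (balanced t m)" using elim(2) by linarith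
      have Q: "0 < clump_sum t s m"
        unfolding clump_sum_def by (intro add_pos_nonneg mult_nonneg_nonneg sum_nonneg) auto
      have "c / ub t * real m powr (real s - (real t + 1) / 2) / clump_sum t s m
        = (c * real m ^ (s - 1) / real m ^ (t - 1) / clump_sum t s m) / (ub t / sqrt m ^ (t - 1))"
        unfolding pw[symmetric] by (simp add: mult_ac)
      also have "\<dots> \<le> pr t (2 * t * m) (\<lambda>f. balanced t m f \<and> min_cuts t m f = s) / pr t (2 * t * m) (balanced t m)"
        using elim(1) pr_nonneg pos pr_balanced_upper[OF t elim(3)] by (intro frac_le) auto
      finally show ?case unfolding prob_X[OF t] .
    qed
  qed
  then show ?thesis using c ub_pos[OF t] by (intro exI[of _ "c / ub t"]) auto
qed

lemma clump_sum_pos: "1 \<le> clump_sum t s m"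
  unfolding clump_sum_def by (simp add: sum_nonneg)

lemma clump_sum_eq:
  assumes "2 \<le> s" "1 \<le> t"
  shows "clump_sum t s m = 1 + real (s - 1) * (\<Sum>k=1..m. real (k + 1) powr (real s - (real t + 1) / 2 - 1))"
  unfolding clump_sum_def clump_term[OF assms] ..

text \<open>The exponent in the sum is below \<open>- 1\<close>, so the series converges. For
  \<open>s = 1\<close> the factor \<open>s - 1\<close> removes the sum altogether.\<close>

lemma clump_sum_subcritical:
  assumes "1 \<le> t" "1 \<le> s" "real s < (real t + 1) / 2"
  shows "\<exists>K>0. \<forall>m. clump_sum t s m \<le> K"
proof (cases "s = 1")
  case True
  then show ?thesis by (intro exI[of _ 1]) (simp add: clump_sum_def)
next
  case False
  then have s: "2 \<le> s" using assms by simp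
  define e where "e = real s - (real t + 1) / 2 - 1"
  have e: "e < - 1" using assms by (simp add: e_def)
  have "summable (\<lambda>k. real k powr e)" using e by (simp add: summable_real_powr_iff)
  then have sm: "summable (\<lambda>k. real (k + 1) powr e)" by (subst summable_iff_shift)
  have "clump_sum t s m \<le> 1 + real (s - 1) * (\<Sum>k. real (k + 1) powr e)" for m
    unfolding clump_sum_eq[OF s assms(1)] e_def[symmetric]
    using sm by (intro add_left_mono mult_left_mono sum_le_suminf) auto
  moreover have "0 < 1 + real (s - 1) * (\<Sum>k. real (k + 1) powr e)"
    using sm by (intro add_pos_nonneg mult_nonneg_nonneg suminf_nonneg) auto
  ultimately show ?thesis by blast
qed

text \<open>The exponent is exactly \<open>- 1\<close>. The harmonic sum is compared with the
  telescoping differences of \<open>ln\<close>.\<close>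

lemma clump_sum_critical:
  assumes "1 \<le> t" "2 \<le> s" "real s = (real t + 1) / 2"
  shows "\<exists>K>0. \<forall>\<^sub>F m in sequentially. clump_sum t s m \<le> K * ln (real m)"
proof -
  have e: "real s - (real t + 1) / 2 - 1 = - 1" using assms by simp
  have step: "real (k + 1) powr - 1 \<le> ln (real (Suc k)) - ln (real k)" if "k \<ge> 1" for k
  proof -
    have "ln (real k / real (Suc k)) \<le> real k / real (Suc k) - 1"
      using that by (intro ln_le_minus_one) auto
    moreover have "real k / real (Suc k) - 1 = - (1 / real (Suc k))" by (simp add: field_simps)
    moreover have "ln (real k / real (Suc k)) = ln (real k) - ln (real (Suc k))"
      using that by (simp add: ln_div)
    moreover have "real (k + 1) powr - 1 = 1 / real (Suc k)" by (simp add: powr_minus_divide)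
    ultimately show ?thesis by linarith
  qed
  have bound: "(\<Sum>k=1..m. real (k + 1) powr - 1) \<le> ln (real (Suc m))" if "m \<ge> 1" for m
  proof -
    have "(\<Sum>k=1..m. real (k + 1) powr - 1) \<le> (\<Sum>k=1..m. ln (real (Suc k)) - ln (real k))"
      by (intro sum_mono step) auto
    also have "\<dots> = ln (real (Suc m)) - ln (real 1)"
      using that by (intro sum_Suc_diff[where f = "\<lambda>k. ln (real k)"]) auto
    finally show ?thesis by simp
  qed
  have "clump_sum t s m \<le> (1 + 2 * real s) * ln (real m)" if m: "m \<ge> 3" for m
  proof -
    have "1 \<le> ln (3 :: real)"
    proof -
      have "exp 1 \<le> (3 :: real)" by (rule exp_le)
      then have "ln (exp 1) \<le> ln (3 :: real)" by (intro ln_mono) auto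
      then show ?thesis by simp
    qed
    also have "ln 3 \<le> ln (real m)" using m by (intro ln_mono) auto
    finally have l1: "1 \<le> ln (real m)" .
    have "ln (real (Suc m)) \<le> ln ((real m)\<^sup>2)"
    proof (rule ln_mono)
      have "2 * real m \<le> real m * real m" using m by (intro mult_right_mono) auto
      moreover have "real (Suc m) \<le> 2 * real m" using m by simp
      ultimately show "real (Suc m) \<le> (real m)\<^sup>2" unfolding power2_eq_square by (rule order_trans[rotated])
    qed simp
    also have "\<dots> = 2 * ln (real m)" using m by (simp add: ln_realpow)
    finally have "(\<Sum>k=1..m. real (k + 1) powr - 1) \<le> 2 * ln (real m)" using bound[of m] m by linarith
    then have "real (s - 1) * (\<Sum>k=1..m. real (k + 1) powr - 1) \<le> real s * (2 * ln (real m))"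
      by (intro mult_mono sum_nonneg) auto
    then have "clump_sum t s m \<le> 1 + real s * (2 * ln (real m))"
      unfolding clump_sum_eq[OF assms(2,1)] e by linarith
    then show ?thesis using l1 by (simp add: algebra_simps)
  qed
  moreover have "0 < 1 + 2 * real s" by (intro add_pos_nonneg) auto
  ultimately show ?thesis
    by (intro exI[of _ "1 + 2 * real s"] conjI eventually_sequentiallyI[of 3])
qed

text \<open>The clump grows at the same rate as the first moment, so their quotient is bounded below
  by a constant.\<close>

lemma clump_sum_supercritical:
  assumes "1 \<le> t" "(real t + 1) / 2 < real s"
  shows "\<exists>K>0. \<forall>m\<ge>1. clump_sum t s m \<le> K * real m powr (real s - (real t + 1) / 2)"
proof -
  have "real (t + 1) < real (2 * s)" using assms(2) by (simp add: field_simps)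
  then have ts: "t + 1 < 2 * s" by (simp only: of_nat_less_iff)
  then have s: "2 \<le> s" using assms(1) by linarith
  define a where "a = real s - (real t + 1) / 2"
  have a: "a \<ge> 1 / 2"
  proof -
    have "t + 2 \<le> 2 * s" using ts by simp
    then have "real (t + 2) \<le> real (2 * s)" by (simp only: of_nat_le_iff)
    then show ?thesis by (simp add: a_def field_simps)
  qed
  have "\<exists>K>0. \<forall>m\<ge>1. (\<Sum>k=1..m. real (k + 1) powr (a - 1)) \<le> K * real m powr a"
  proof (cases "a \<ge> 1")
    case True
    have "(\<Sum>k=1..m. real (k + 1) powr (a - 1)) \<le> 2 powr (a - 1) * real m powr a" if m: "m \<ge> 1" for m :: nat
    proof -
      have "(\<Sum>k=1..m. real (k + 1) powr (a - 1)) \<le> (\<Sum>k=1..m. (2 * real m) powr (a - 1))"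
        using True by (intro sum_mono powr_mono2) auto
      also have "\<dots> = 2 powr (a - 1) * (real m powr (a - 1) * real m powr 1)"
        using m by (simp add: powr_mult)
      also have "real m powr (a - 1) * real m powr 1 = real m powr a"
        by (simp only: powr_add[symmetric]) simp
      finally show ?thesis .
    qed
    then show ?thesis by (intro exI[of _ "2 powr (a - 1)"]) auto
  next
    case False
    \<comment> \<open>\<open>a\<close> is a positive multiple of \<open>1 / 2\<close>, so only this
      value lies below 1; here the summands decrease and telescoping square roots replace the bound
      by the largest term.\<close>
    then have ah: "a = 1 / 2"
    proof -
      have "real (2 * s) < real (t + 3)" using False by (simp add: a_def field_simps)
      then have "2 * s < t + 3" by (simp only: of_nat_less_iff)
      then have "2 * s = t + 2" using ts by simp
      then have "real (2 * s) = real (t + 2)" by (simp only:)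
      then show ?thesis by (simp add: a_def field_simps)
    qed
    have step: "real (k + 1) powr (a - 1) \<le> 2 * sqrt (real (Suc k)) - 2 * sqrt (real k)" for k
    proof -
      have "real (k + 1) powr (a - 1) = 1 / sqrt (real (Suc k))"
      proof -
        have "a - 1 = - (1 / 2)" using ah by simp
        then show ?thesis by (simp only: powr_minus_divide) (simp add: powr_half_sqrt)
      qed
      moreover have "1 / sqrt (real (Suc k)) \<le> 2 * sqrt (real (Suc k)) - 2 * sqrt (real k)"
      proof -
        have "0 \<le> (sqrt (real (Suc k)) - sqrt (real k))\<^sup>2" by simp
        then have "1 \<le> (2 * sqrt (real (Suc k)) - 2 * sqrt (real k)) * sqrt (real (Suc k))"
          by (simp add: power2_eq_square algebra_simps)
        then show ?thesis by (subst pos_divide_le_eq) auto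
      qed
      ultimately show ?thesis by simp
    qed
    have "(\<Sum>k=1..m. real (k + 1) powr (a - 1)) \<le> 4 * real m powr a" if m: "m \<ge> 1" for m :: nat
    proof -
      have "(\<Sum>k=1..m. real (k + 1) powr (a - 1)) \<le> (\<Sum>k=1..m. 2 * sqrt (real (Suc k)) - 2 * sqrt (real k))"
        by (intro sum_mono step)
      also have "\<dots> = 2 * sqrt (real (Suc m)) - 2 * sqrt (real 1)"
        using m by (intro sum_Suc_diff[where f = "\<lambda>k. 2 * sqrt (real k)"]) auto
      also have "\<dots> \<le> 2 * sqrt (4 * real m)"
      proof -
        have h: "sqrt (real (Suc m)) \<le> sqrt (4 * real m)" using m by simp
        have "2 * x - 2 * sqrt (real 1) \<le> 2 * y" if "x \<le> y" for x y using that by simp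
        then show ?thesis using h by blast
      qed
      also have "\<dots> = 4 * real m powr a" unfolding ah by (simp add: real_sqrt_mult powr_half_sqrt)
      finally show ?thesis .
    qed
    then show ?thesis by (intro exI[of _ 4]) auto
  qed
  then obtain K where K: "K > 0" "\<forall>m\<ge>1. (\<Sum>k=1..m. real (k + 1) powr (a - 1)) \<le> K * real m powr a" by blast
  have "clump_sum t s m \<le> (1 + real s * K) * real m powr a" if m: "m \<ge> 1" for m
  proof -
    have "real (s - 1) * (\<Sum>k=1..m. real (k + 1) powr (a - 1)) \<le> real s * (K * real m powr a)"
      using K m by (intro mult_mono sum_nonneg) auto
    moreover have "1 \<le> real m powr a" using m a by (intro ge_one_powr_ge_zero) auto
    ultimately show ?thesis
      unfolding clump_sum_eq[OF s assms(1)] a_def[symmetric] by (simp add: algebra_simps)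
  qed
  moreover have "0 < 1 + real s * K" using K(1) by (intro add_pos_nonneg) auto
  ultimately show ?thesis unfolding a_def by blast
qed

section \<open>Counting exceptional cut sets\<close>

text \<open>If a cut moves without meeting another one, exactly the positions it passes change
  sides, and all of them in the same direction.\<close>

lemma card_side_exchange:
  assumes "finite R" "c < c'" "c' \<le> n" "R \<inter> {c..c'} = {}"
  shows "card (side n (insert c R)) \<noteq> card (side n (insert c' R))"
proof -
  have ins: "card {b \<in> insert a R. p < b} = (if p < a then 1 else 0) + card {b \<in> R. p < b}"
    if "a \<in> {c, c'}" for a p
  proof -
    have "a \<notin> R" using assms that by auto
    moreover have "{b \<in> insert a R. p < b} = (if p < a then {a} else {}) \<union> {b \<in> R. p < b}" by auto
    ultimately show ?thesis using assms(1) by simp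
  qed
  let ?I = "{c..<c'}"
  have out: "p \<in> side n (insert c R) \<longleftrightarrow> p \<in> side n (insert c' R)" if "p \<notin> ?I" for p
    using that assms(2) unfolding side_def mem_Collect_eq
    by (simp only: ins[of c p, OF insertI1] ins[of c' p, OF insertI2[OF singletonI]]) auto
  have const: "card {b \<in> R. p < b} = card {b \<in> R. c < b}" if "p \<in> ?I" for p
  proof -
    have "p < b \<longleftrightarrow> c < b" if "b \<in> R" for b
      using that \<open>p \<in> ?I\<close> assms(4) by (cases "b \<le> c'") auto
    then have "{b \<in> R. p < b} = {b \<in> R. c < b}" by blast
    then show ?thesis by simp
  qed
  let ?A = "side n (insert c R)" and ?A' = "side n (insert c' R)"
  have I1: "p \<in> ?A \<longleftrightarrow> odd (card {b \<in> R. c < b})" "p \<in> ?A' \<longleftrightarrow> even (card {b \<in> R. c < b})" if "p \<in> ?I" for p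
    using that assms(2,3) const[OF that] unfolding side_def mem_Collect_eq
    by (simp_all only: ins[of c p, OF insertI1] ins[of c' p, OF insertI2[OF singletonI]]) auto
  show ?thesis
  proof (cases "odd (card {b \<in> R. c < b})")
    case True
    then have "?A = ?A' \<union> ?I" "?A' \<inter> ?I = {}" using I1 out by blast+
    then have "card ?A = card ?A' + card ?I" by (simp add: card_Un_disjoint)
    then show ?thesis using assms(2) by simp
  next
    case False
    then have "?A' = ?A \<union> ?I" "?A \<inter> ?I = {}" using I1 out by blast+
    then have "card ?A' = card ?A + card ?I" by (simp add: card_Un_disjoint)
    then show ?thesis using assms(2) by simp
  qed
qed

text \<open>The prescribed size of \<open>side\<close> removes one degree of freedom, and it can be
  charged to the first cut or to the last one, whichever is convenient.\<close>

lemma extreme_determined: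
  assumes "finite R" "card (side n (insert e R)) = card (side n (insert e' R))" "e \<le> n" "e' \<le> n"
    and "(\<forall>b\<in>R. e < b \<and> e' < b) \<or> (\<forall>b\<in>R. b < e \<and> b < e')"
  shows "e = e'"
proof (rule ccontr)
  assume "e \<noteq> e'"
  moreover have "R \<inter> {e..e'} = {}" "R \<inter> {e'..e} = {}" using assms(5) by fastforce+
  ultimately show False
    using card_side_exchange[OF assms(1), of e e' n] card_side_exchange[OF assms(1), of e' e n] assms(2-4)
    by (cases "e < e'") auto
qed

lemma card_subsets_le: "card {T. T \<subseteq> {..<n} \<and> card T = k} \<le> n ^ k"
  by (cases "k \<le> n") (auto simp: n_subsets binomial_le_pow binomial_eq_0)

lemma cut_sets_props:
  assumes "S \<in> cut_sets t m s" "1 \<le> s"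
  shows "finite S" "S \<noteq> {}" "S \<subseteq> {..<2 * t * m}" "card S = s" "card (side (2 * t * m) S) = t * m"
  using assms by (auto simp: cut_sets_def intro: finite_subset)

text \<open>The last cut has only \<open>G\<close> places, and the first one is determined by the
  rest and the size of \<open>side\<close>; so \<open>s - 2\<close> cuts are free.\<close>

lemma card_late_cut_sets:
  assumes "2 \<le> s"
  shows "card {S \<in> cut_sets t m s. 2 * t * m < Max S + G} \<le> G * (2 * t * m) ^ (s - 2)"
proof -
  let ?n = "2 * t * m"
  let ?F = "{S \<in> cut_sets t m s. ?n < Max S + G}"
  let ?h = "\<lambda>S. (?n - 1 - Max S, S - {Max S} - {Min S})"
  have p: "finite S" "S \<noteq> {}" "S \<subseteq> {..<?n}" "card S = s" "card (side ?n S) = t * m"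
    "Max S \<in> S" "Min S \<in> S" "Min S \<noteq> Max S" if "S \<in> ?F" for S
  proof -
    have "S \<in> cut_sets t m s" using that by simp
    note q = cut_sets_props[OF this]
    show "finite S" "S \<noteq> {}" "S \<subseteq> {..<?n}" "card S = s" "card (side ?n S) = t * m" using q assms by auto
    then show "Max S \<in> S" "Min S \<in> S" by auto
    show "Min S \<noteq> Max S"
    proof
      assume "Min S = Max S"
      then have "S \<subseteq> {Max S}" using \<open>finite S\<close> Min_le[of S] Max_ge[of S] by (metis antisym insertI1 subsetI)
      then have "card S \<le> 1" using card_mono[of "{Max S}" S] by simp
      then show False using \<open>card S = s\<close> assms by simp
    qed
  qed
  have "inj_on ?h ?F"
  proof (rule inj_onI)
    fix S S' assume S: "S \<in> ?F" "S' \<in> ?F" "?h S = ?h S'"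
    note q = p[OF S(1)] p[OF S(2)]
    have mx: "Max S = Max S'"
    proof -
      have "Max S < ?n" "Max S' < ?n" using q(3,6,11,14) by auto
      moreover have "?n - 1 - Max S = ?n - 1 - Max S'" using S(3) by (simp only: prod.inject)
      ultimately show ?thesis by linarith
    qed
    define R where "R = S - {Min S}"
    have R': "R = S' - {Min S'}"
    proof -
      have "R = insert (Max S) (S - {Max S} - {Min S})" using q(6,8) by (auto simp: R_def)
      also have "\<dots> = insert (Max S') (S' - {Max S'} - {Min S'})" using S(3) mx by (simp only: prod.inject)
      also have "\<dots> = S' - {Min S'}" using q(14,16) by auto
      finally show ?thesis .
    qed
    have e1: "S = insert (Min S) R" using q(7) by (auto simp: R_def)
    have e2: "S' = insert (Min S') R" using q(15) by (auto simp: R')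
    have lt: "\<forall>b\<in>R. Min S < b \<and> Min S' < b"
    proof
      fix b assume b: "b \<in> R"
      have "b \<in> S" "b \<noteq> Min S" using b by (simp_all add: R_def)
      moreover have "b \<in> S'" "b \<noteq> Min S'" using b by (simp_all add: R')
      ultimately show "Min S < b \<and> Min S' < b" using Min_le[OF q(1)] Min_le[OF q(9)]
        by (metis order_less_le)
    qed
    have fR: "finite R" using q(1) by (simp add: R_def)
    have le: "Min S \<le> ?n" "Min S' \<le> ?n" using q(3,7,11,15) by auto
    have ceq: "card (side ?n (insert (Min S) R)) = card (side ?n (insert (Min S') R))"
      unfolding e1[symmetric] e2[symmetric] q(5) q(13) ..
    have "Min S = Min S'" using extreme_determined[OF fR ceq le disjI1[OF lt]] .
    then show "S = S'" using e1 e2 by metis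
  qed
  then have "card ?F = card (?h ` ?F)" by (simp add: card_image)
  also have "\<dots> \<le> card ({..<G} \<times> {T. T \<subseteq> {..<?n} \<and> card T = s - 2})"
  proof (rule card_mono)
    show "?h ` ?F \<subseteq> {..<G} \<times> {T. T \<subseteq> {..<?n} \<and> card T = s - 2}"
    proof (rule image_subsetI)
      fix S assume S: "S \<in> ?F"
      note q = p[OF S]
      have "card (S - {Max S} - {Min S}) = s - 2"
        using q by (simp add: card_Diff_singleton)
      moreover have "?n - 1 - Max S < G"
      proof -
        have "Max S < ?n" using q(3,6) by auto
        then show ?thesis using S by auto
      qed
      ultimately show "?h S \<in> {..<G} \<times> {T. T \<subseteq> {..<?n} \<and> card T = s - 2}" using q(3) by auto
    qed
  qed auto
  also have "\<dots> \<le> G * ?n ^ (s - 2)" using card_subsets_le by (simp add: card_cartesian_product)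
  finally show ?thesis .
qed

text \<open>A close pair is given by its left cut and a gap below \<open>G\<close>. An extreme cut
  outside the pair is determined by the rest, so \<open>s - 3\<close> further cuts are free. The
  factor 2 covers the choice between first and last cut.\<close>

lemma card_close_cut_sets:
  assumes "2 \<le> s" "G \<le> t * m" "1 \<le> t * m"
  shows "card {S \<in> cut_sets t m s. \<exists>c g. 0 < g \<and> g < G \<and> c \<in> S \<and> c + g \<in> S} \<le> 2 * G * (2 * t * m) ^ (s - 2)"
proof (cases "s = 2")
  case True
  have "{S \<in> cut_sets t m s. \<exists>c g. 0 < g \<and> g < G \<and> c \<in> S \<and> c + g \<in> S} = {}"
  proof -
    have False if S: "S \<in> cut_sets t m s" and g: "0 < g" "g < G" "c \<in> S" "c + g \<in> S" for S c g
    proof -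
      note q = cut_sets_props[OF S]
      have "{c, c + g} \<subseteq> S" "card {c, c + g} = card S" using g q(4) True by auto
      then have eq: "S = {c, c + g}" using q(1) True card_subset_eq[of S "{c, c + g}"] by auto
      \<comment> \<open>With only two cuts, \<open>side\<close> is the stretch between them and has
        fewer than \<open>G\<close> beads, too few for \<open>t * m\<close>. So for
        \<open>s = 2\<close> there are no close pairs.\<close>
      have "side (2 * t * m) S \<subseteq> {c..<c + g}"
      proof
        fix p assume p: "p \<in> side (2 * t * m) S"
        have "{b \<in> S. p < b} = {c, c + g}" if "p < c" using that eq by auto
        moreover have "{b \<in> S. p < b} = {}" if "c + g \<le> p" using that eq by auto
        moreover have "odd (card {b \<in> S. p < b})" using p by (simp add: side_def)
        ultimately show "p \<in> {c..<c + g}" using g(1) by (cases "p < c"; cases "c + g \<le> p") auto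
      qed
      then have "card (side (2 * t * m) S) \<le> card {c..<c + g}" by (intro card_mono) auto
      then show False using q(5) True g assms by simp
    qed
    then show ?thesis by blast
  qed
  then show ?thesis by (simp only: card.empty)
next
  case False
  then have s3: "3 \<le> s" using assms by simp
  let ?n = "2 * t * m"
  let ?P = "\<lambda>S (c, g) e. 0 < g \<and> g < G \<and> c \<in> S \<and> c + g \<in> S \<and> e \<in> S \<and> e \<noteq> c \<and> e \<noteq> c + g"
  have bound: "card {S \<in> cut_sets t m s. \<exists>cg. ?P S cg (ext S)} \<le> G * ?n ^ (s - 2)"
    if ext: "(ext = Min) \<or> (ext = Max)" for ext :: "nat set \<Rightarrow> nat"
  proof -
    let ?F = "{S \<in> cut_sets t m s. \<exists>cg. ?P S cg (ext S)}"
    have "\<forall>S\<in>?F. \<exists>cg. ?P S cg (ext S)" by blast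
    from bchoice[OF this] obtain \<phi> where \<phi>: "\<forall>S\<in>?F. ?P S (\<phi> S) (ext S)" by blast
    let ?h = "\<lambda>S. (\<phi> S, S - {fst (\<phi> S), fst (\<phi> S) + snd (\<phi> S), ext S})"
    have p: "finite S" "S \<subseteq> {..<?n}" "card S = s" "card (side ?n S) = t * m"
      "0 < snd (\<phi> S)" "snd (\<phi> S) < G" "fst (\<phi> S) \<in> S" "fst (\<phi> S) + snd (\<phi> S) \<in> S" "ext S \<in> S"
      "ext S \<noteq> fst (\<phi> S)" "ext S \<noteq> fst (\<phi> S) + snd (\<phi> S)" if "S \<in> ?F" for S
      using cut_sets_props[of S t m s] \<phi>[rule_format, OF that] that assms(1) by (auto split: prod.splits)
    have "inj_on ?h ?F"
    proof (rule inj_onI)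
      fix S S' assume S: "S \<in> ?F" "S' \<in> ?F" "?h S = ?h S'"
      note q = p[OF S(1)] and q' = p[OF S(2)]
      have \<phi>eq: "\<phi> S = \<phi> S'" using S(3) by simp
      define R where "R = S - {ext S}"
      have R': "R = S' - {ext S'}"
      proof -
        have "R = {fst (\<phi> S), fst (\<phi> S) + snd (\<phi> S)} \<union> (S - {fst (\<phi> S), fst (\<phi> S) + snd (\<phi> S), ext S})"
          using q(7,8,10,11) by (auto simp: R_def)
        also have "\<dots> = {fst (\<phi> S'), fst (\<phi> S') + snd (\<phi> S')} \<union> (S' - {fst (\<phi> S'), fst (\<phi> S') + snd (\<phi> S'), ext S'})"
          using S(3) \<phi>eq by (simp only: prod.inject)
        also have "\<dots> = S' - {ext S'}" using q'(7,8,10,11) by auto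
        finally show ?thesis .
      qed
      have e: "S = insert (ext S) R" using q(9) by (auto simp: R_def)
      have e': "S' = insert (ext S') R" using q'(9) by (auto simp: R')
      have lt: "(\<forall>b\<in>R. ext S < b \<and> ext S' < b) \<or> (\<forall>b\<in>R. b < ext S \<and> b < ext S')"
      proof -
        have b1: "b \<in> S" "b \<noteq> ext S" if "b \<in> R" for b using that by (simp_all add: R_def)
        have b2: "b \<in> S'" "b \<noteq> ext S'" if "b \<in> R" for b using that by (simp_all add: R')
        note b = b1 b2
        show ?thesis
        proof (cases "ext = Min")
          case True
          have "Min S \<le> b" "Min S' \<le> b" if "b \<in> R" for b using b[OF that] q(1) q'(1) by auto
          then show ?thesis using b True by (metis order_less_le)
        next
          case False
          then have M: "ext = Max" using ext by blast
          have "b \<le> Max S" "b \<le> Max S'" if "b \<in> R" for b using b[OF that] q(1) q'(1) by auto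
          then show ?thesis using b M by (metis order_less_le)
        qed
      qed
      have fR: "finite R" using q(1) by (simp add: R_def)
      have le: "ext S \<le> ?n" "ext S' \<le> ?n" using q(2,9) q'(2,9) by auto
      have ceq: "card (side ?n (insert (ext S) R)) = card (side ?n (insert (ext S') R))"
        unfolding e[symmetric] e'[symmetric] q(4) q'(4) ..
      have "ext S = ext S'" using extreme_determined[OF fR ceq le lt] .
      then show "S = S'" using e e' by metis
    qed
    then have "card ?F = card (?h ` ?F)" by (simp add: card_image)
    also have "\<dots> \<le> card (({..<?n} \<times> {..<G}) \<times> {T. T \<subseteq> {..<?n} \<and> card T = s - 3})"
    proof (rule card_mono)
      show "?h ` ?F \<subseteq> ({..<?n} \<times> {..<G}) \<times> {T. T \<subseteq> {..<?n} \<and> card T = s - 3}"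
      proof (rule image_subsetI)
        fix S assume S: "S \<in> ?F"
        note q = p[OF S]
        have "card {fst (\<phi> S), fst (\<phi> S) + snd (\<phi> S), ext S} = 3" using q(5,10,11) by auto
        then have "card (S - {fst (\<phi> S), fst (\<phi> S) + snd (\<phi> S), ext S}) = s - 3"
          using q by (subst card_Diff_subset) auto
        then show "?h S \<in> ({..<?n} \<times> {..<G}) \<times> {T. T \<subseteq> {..<?n} \<and> card T = s - 3}"
          using q(2,6,7) by (cases "\<phi> S") auto
      qed
    qed auto
    also have "\<dots> \<le> (?n * G) * ?n ^ (s - 3)" using card_subsets_le by (simp add: card_cartesian_product)
    also have "\<dots> = G * ?n ^ Suc (s - 3)" by simp
    also have "Suc (s - 3) = s - 2" using s3 by simp
    finally show ?thesis .
  qed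
  have "{S \<in> cut_sets t m s. \<exists>c g. 0 < g \<and> g < G \<and> c \<in> S \<and> c + g \<in> S}
    \<subseteq> {S \<in> cut_sets t m s. \<exists>cg. ?P S cg (Min S)} \<union> {S \<in> cut_sets t m s. \<exists>cg. ?P S cg (Max S)}"
  proof
    fix S assume "S \<in> {S \<in> cut_sets t m s. \<exists>c g. 0 < g \<and> g < G \<and> c \<in> S \<and> c + g \<in> S}"
    then obtain c g where S: "S \<in> cut_sets t m s" and g: "0 < g" "g < G" "c \<in> S" "c + g \<in> S" by blast
    note q = cut_sets_props[OF S]
    have fin: "finite S" "S \<noteq> {}" "card S = s" using q assms by auto
    have mm: "Min S \<in> S" "Max S \<in> S" "Min S \<le> c" "c + g \<le> Max S" using fin g by auto
    \<comment> \<open>If the pair consists of both extreme cuts, a third cut between them forms an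
      even closer pair with the first one, and the last cut is then outside that pair.\<close>
    have "(Min S \<noteq> c \<and> Min S \<noteq> c + g) \<or> (Max S \<noteq> c \<and> Max S \<noteq> c + g) \<or> (\<exists>b\<in>S. c < b \<and> b < c + g)"
    proof (rule ccontr)
      assume n: "\<not> ?thesis"
      then have "Min S = c" "Max S = c + g" using mm g(1) by auto
      then have "S \<subseteq> {c, c + g}" using n Min_le[OF fin(1)] Max_ge[OF fin(1)]
        by (metis insertCI le_neq_implies_less subsetI)
      then have "card S \<le> card {c, c + g}" by (intro card_mono) auto
      then show False using fin(3) s3 g(1) by simp
    qed
    moreover have ?thesis if "False" using that by simp
    moreover have "S \<in> {S \<in> cut_sets t m s. \<exists>cg. ?P S cg (Max S)}" if "\<exists>b\<in>S. c < b \<and> b < c + g"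
    proof -
      from that obtain b where b: "b \<in> S" "c < b" "b < c + g" by blast
      have "?P S (c, b - c) (Max S)" using b g mm by auto
      then show ?thesis using S by blast
    qed
    moreover have "S \<in> {S \<in> cut_sets t m s. \<exists>cg. ?P S cg (Min S)}" if "Min S \<noteq> c \<and> Min S \<noteq> c + g"
    proof -
      have "?P S (c, g) (Min S)" using that g mm by auto
      then show ?thesis using S by blast
    qed
    moreover have "S \<in> {S \<in> cut_sets t m s. \<exists>cg. ?P S cg (Max S)}" if "Max S \<noteq> c \<and> Max S \<noteq> c + g"
    proof -
      have "?P S (c, g) (Max S)" using that g mm by auto
      then show ?thesis using S by blast
    qed
    ultimately show "S \<in> {S \<in> cut_sets t m s. \<exists>cg. ?P S cg (Min S)} \<union> {S \<in> cut_sets t m s. \<exists>cg. ?P S cg (Max S)}"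
      by blast
  qed
  then have "card {S \<in> cut_sets t m s. \<exists>c g. 0 < g \<and> g < G \<and> c \<in> S \<and> c + g \<in> S}
    \<le> card ({S \<in> cut_sets t m s. \<exists>cg. ?P S cg (Min S)} \<union> {S \<in> cut_sets t m s. \<exists>cg. ?P S cg (Max S)})"
    by (intro card_mono) auto
  also have "\<dots> \<le> card {S \<in> cut_sets t m s. \<exists>cg. ?P S cg (Min S)} + card {S \<in> cut_sets t m s. \<exists>cg. ?P S cg (Max S)}"
    by (rule card_Un_le)
  also have "\<dots> \<le> G * ?n ^ (s - 2) + G * ?n ^ (s - 2)" 
    by (rule add_mono[OF bound[of Min, OF disjI1[OF refl]] bound[of Max, OF disjI2[OF refl]]])
  finally show ?thesis by simp
qed

section \<open>The letters after the last cut\<close>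

lemma cnt_second_moment:
  assumes "t \<ge> 1" "i < t" "V \<subseteq> {..<n}"
  shows "avg t n (\<lambda>f. (real (cnt f V i) - card V / t)\<^sup>2) \<le> card V"
proof -
  have "finite V" using assms(3) finite_subset by blast
  then show ?thesis using assms(3)
  proof (induction rule: finite_induct)
    case (insert p V)
    define Z where "Z f = real (cnt f V i) - card V / t" for f
    define \<xi> where "\<xi> f = of_bool (f p = i) - 1 / real t" for f :: "nat \<Rightarrow> nat"
    have ins: "cnt f (insert p V) i = (if f p = i then 1 else 0) + cnt f V i" for f
    proof -
      have "{q \<in> insert p V. f q = i} = (if f p = i then {p} else {}) \<union> {q \<in> V. f q = i}" by auto
      then show ?thesis using insert.hyps by (simp add: cnt_def)
    qed
    have dZ: "depends_on V Z" unfolding Z_def by (rule depends_on_comp[OF cnt_depends])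
    have d\<xi>: "depends_on {p} \<xi>" by (auto simp: depends_on_def \<xi>_def)
    have "avg t n \<xi> = (\<Sum>j<t. of_bool (j = i) - 1 / real t) / t"
      unfolding \<xi>_def using insert.prems assms(1) by (intro avg_single) auto
    then have \<xi>0: "avg t n \<xi> = 0" using assms by (simp add: sum_subtractf of_bool_def)
    have eq: "real (cnt f (insert p V) i) - card (insert p V) / t = Z f + \<xi> f" for f
      using insert.hyps by (simp add: ins Z_def \<xi>_def add_divide_distrib)
    have "(real (cnt f (insert p V) i) - card (insert p V) / t)\<^sup>2 = ((Z f)\<^sup>2 + 2 * (Z f * \<xi> f)) + (\<xi> f)\<^sup>2" for f
      unfolding eq by (simp add: power2_sum)
    then have "avg t n (\<lambda>f. (real (cnt f (insert p V) i) - card (insert p V) / t)\<^sup>2)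
      = avg t n (\<lambda>f. (Z f)\<^sup>2) + 2 * (avg t n Z * avg t n \<xi>) + avg t n (\<lambda>f. (\<xi> f)\<^sup>2)"
      using insert.hyps avg_indep[OF assms(1) dZ d\<xi>, of n] by (simp add: avg_add avg_cmult)
    also have "\<dots> \<le> card V + 1"
    proof -
      have "avg t n (\<lambda>f. (\<xi> f)\<^sup>2) \<le> avg t n (\<lambda>f. 1)"
      proof (rule avg_mono)
        fix f show "(\<xi> f)\<^sup>2 \<le> 1"
        proof -
          have "0 \<le> 1 / real t" "1 / real t \<le> 1" using assms by simp_all
          then have "\<bar>\<xi> f\<bar> \<le> 1" by (cases "f p = i") (simp_all add: \<xi>_def abs_le_iff)
          then show ?thesis by (simp add: abs_square_le_1)
        qed
      qed
      then show ?thesis using insert \<xi>0 avg_const[OF assms(1), of n 1] by (simp add: Z_def)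
    qed
    finally show ?case using insert.hyps by simp
  qed (simp add: avg_def)
qed

lemma pr_cnt_deviation:
  assumes "t \<ge> 1" "i < t" "V \<subseteq> {..<n}" "0 < u"
  shows "pr t n (\<lambda>f. u < \<bar>real (cnt f V i) - card V / t\<bar>) \<le> card V / u\<^sup>2"
proof -
  have "pr t n (\<lambda>f. u < \<bar>real (cnt f V i) - card V / t\<bar>)
    \<le> pr t n (\<lambda>f. u\<^sup>2 \<le> (real (cnt f V i) - card V / t)\<^sup>2)"
  proof (rule pr_mono)
    fix f assume "u < \<bar>real (cnt f V i) - card V / t\<bar>"
    then have "u\<^sup>2 \<le> \<bar>real (cnt f V i) - card V / t\<bar>\<^sup>2" using assms(4) by (intro power_mono) auto
    then show "u\<^sup>2 \<le> (real (cnt f V i) - card V / t)\<^sup>2" by simp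
  qed
  also have "\<dots> \<le> avg t n (\<lambda>f. (real (cnt f V i) - card V / t)\<^sup>2) / u\<^sup>2"
    using assms(4) by (intro markov) auto
  also have "\<dots> \<le> card V / u\<^sup>2"
    using cnt_second_moment[OF assms(1-3)] by (intro divide_right_mono) auto
  finally show ?thesis .
qed

lemma side_before_Max:
  assumes "finite S" "S \<noteq> {}"
  shows "side n S \<subseteq> {..<Max S}"
proof
  fix p assume "p \<in> side n S"
  then have "odd (card {c \<in> S. p < c})" by (simp add: side_def)
  then have "{c \<in> S. p < c} \<noteq> {}" by (metis card.empty even_zero)
  then obtain c where "c \<in> S" "p < c" by blast
  then show "p \<in> {..<Max S}" using Max_ge[OF assms(1), of c] by simp
qed

text \<open>By balance, the deviation before the last cut is the opposite of the deviation on the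
  stretch \<open>J\<close> after it, to which Chebyshev applies. \<open>pr_halves_upper\<close> then
  adds the price of fairness.\<close>

lemma pr_bad_remainder:
  assumes t: "t \<ge> 1" "m \<ge> 1" and S: "S \<in> cut_sets t m s" "1 \<le> s" and M: "M \<ge> 1"
    and late: "Max S + M ^ 4 \<le> 2 * t * m"
  shows "pr t (2 * t * m) (\<lambda>f. balanced t m f \<and> halves t m S f \<and>
      (\<exists>i<t. real (2 * t * m - Max S) / (4 * t * M) < \<bar>dev t f i 0 (Max S)\<bar>))
    \<le> ub2 t / m ^ (t - 1) * (16 * t ^ 3 / M\<^sup>2)"
proof -
  let ?n = "2 * t * m"
  define X where "X = Max S"
  define R where "R = ?n - X"
  define J where "J = {X..<?n}"
  define B where "B = {..<?n} - side ?n S"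
  note q = cut_sets_props[OF S]
  have XS: "X \<in> S" using q by (simp add: X_def)
  then have Xn: "X < ?n" using q(3) by auto
  have RM: "M ^ 4 \<le> R" using late by (simp add: R_def X_def)
  have M4: "1 \<le> M ^ 4" using M by simp
  then have R: "1 \<le> R" using RM by linarith
  have cJ: "card J = R" by (simp add: J_def R_def)
  have sX: "side ?n S \<subseteq> {..<X}" using side_before_Max[OF q(1,2)] by (simp add: X_def)
  have JB: "J \<subseteq> B" using sX by (auto simp: J_def B_def)
  have cB: "card B = t * m" using q(5) side_subset[of ?n S] by (simp add: B_def card_Diff_subset)
  have B: "B \<subseteq> {..<?n}" "finite B" by (auto simp: B_def)
  \<comment> \<open>\<open>pr_halves_upper\<close> admits only half of a side. If \<open>J\<close>
    is longer, the rest \<open>B - J\<close> of its side is used; since that side has exactly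
    \<open>m\<close> beads of each letter, its deviation is the opposite one.\<close>
  define V where "V = (if 2 * R \<le> t * m then J else B - J)"
  have cBJ: "card (B - J) = t * m - R" using JB B cB cJ by (simp add: card_Diff_subset finite_subset)
  have RB: "R \<le> t * m" using card_mono[OF B(2) JB] cB cJ by simp
  have V: "V \<subseteq> {..<?n}" "finite V" "2 * card V \<le> t * m" "card V \<le> R"
    using B cJ cBJ RB JB finite_subset[OF JB] by (auto simp: V_def)
  define u where "u = real R / (4 * t * M)"
  have l': "u > 0" using R t M by (simp add: u_def)
  let ?Q = "\<lambda>f. \<exists>i\<in>{..<t}. u < \<bar>real (cnt f V i) - card V / t\<bar>"
  have "pr t ?n (\<lambda>f. balanced t m f \<and> halves t m S f \<and> (\<exists>i<t. real (?n - Max S) / (4 * t * M) < \<bar>dev t f i 0 (Max S)\<bar>))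
    \<le> pr t ?n (\<lambda>f. balanced t m f \<and> halves t m S f \<and> ?Q f)"
  proof (rule pr_mono)
    fix f assume f: "f \<in> words t ?n" and ev: "balanced t m f \<and> halves t m S f \<and>
      (\<exists>i<t. real (?n - Max S) / (4 * t * M) < \<bar>dev t f i 0 (Max S)\<bar>)"
    then obtain i where i: "i < t" "u < \<bar>dev t f i 0 X\<bar>" by (auto simp: u_def R_def X_def)
    have tot: "cnt f {..<?n} i = 2 * m" using ev i by (simp add: balanced_def)
    have "cnt f {..<?n} i = cnt f {0..<0 + X} i + cnt f J i"
      using Xn by (subst cnt_Un[symmetric]) (auto simp: J_def intro!: arg_cong2[where f = "cnt f"])
    then have cj: "real (cnt f J i) = 2 * real m - real (cnt f {0..<0 + X} i)" using tot by linarith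
    have Rr: "real R = 2 * t * m - real X" using Xn by (simp add: R_def of_nat_diff)
    have dJ: "real (cnt f J i) - R / t = - dev t f i 0 X"
      using t by (simp add: cj Rr dev_def field_simps)
    have "\<bar>real (cnt f V i) - card V / t\<bar> = \<bar>dev t f i 0 X\<bar>"
    proof (cases "2 * R \<le> t * m")
      case True
      then show ?thesis using dJ cJ by (simp add: V_def)
    next
      case False
      have "cnt f B i = m" using ev i tot unfolding B_def by (intro cnt_Compl side_subset) (auto simp: halves_def)
      moreover have "cnt f B i = cnt f J i + cnt f (B - J) i"
        using JB B by (subst cnt_Un[symmetric]) (auto simp: finite_subset intro!: arg_cong2[where f = "cnt f"])
      ultimately have "real (cnt f (B - J) i) = m - real (cnt f J i)" by simp
      then have "real t * real (cnt f (B - J) i) = real t * real m - real t * real (cnt f J i)"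
        by (simp only: right_diff_distrib)
      moreover have "real (card (B - J)) = real t * real m - real R"
        using cBJ RB by (simp only: of_nat_diff of_nat_mult)
      moreover have "real t * real (cnt f J i) = real R - real t * dev t f i 0 X"
        using dJ t by (simp add: field_simps)
      ultimately have "real t * real (cnt f (B - J) i) = real (card (B - J)) + real t * dev t f i 0 X"
        by linarith
      then have "real (cnt f (B - J) i) - card (B - J) / t = dev t f i 0 X"
        using t by (simp add: field_simps)
      then show ?thesis using False by (simp add: V_def)
    qed
    then have "?Q f" using i by (intro bexI[of _ i]) auto
    then show "balanced t m f \<and> halves t m S f \<and> ?Q f" using ev by blast
  qed
  also have "\<dots> \<le> ub2 t / m ^ (t - 1) * pr t ?n ?Q"
    unfolding ub2_def
  proof (rule pr_halves_upper[OF t _ V(2,3)])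
    show "depends_on V ?Q"
      by (rule depends_on_comp[OF cnt_depends, where h = "\<lambda>x. \<exists>i\<in>{..<t}. u < \<bar>real (x i) - card V / t\<bar>"])
  qed
  also have "\<dots> \<le> ub2 t / m ^ (t - 1) * (16 * t ^ 3 / M\<^sup>2)"
  proof (rule mult_left_mono)
    have "pr t ?n ?Q \<le> (\<Sum>i<t. pr t ?n (\<lambda>f. u < \<bar>real (cnt f V i) - card V / t\<bar>))"
      by (rule pr_Ex) simp
    also have "\<dots> \<le> (\<Sum>i<t. card V / u\<^sup>2)"
      using t V l' by (intro sum_mono pr_cnt_deviation) auto
    also have "\<dots> \<le> (\<Sum>i<t. R / u\<^sup>2)"
      using V by (intro sum_mono divide_right_mono) auto
    also have "\<dots> = 16 * t ^ 3 * (real M)\<^sup>2 / R"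
      using R t M by (simp add: u_def power2_eq_square power3_eq_cube)
    \<comment> \<open>The remainder has at least \<open>M ^ 4\<close> beads: the tolerance costs a
      factor \<open>M\<^sup>2\<close>, and a factor \<open>1 / M\<^sup>2\<close> is left
      over.\<close>
    also have "\<dots> \<le> 16 * t ^ 3 * (real M)\<^sup>2 / (real M) ^ 4"
    proof -
      have "real (M ^ 4) \<le> real R" using RM by (simp only: of_nat_le_iff)
      then show ?thesis using M R by (intro divide_left_mono) auto
    qed
    also have "\<dots> = 16 * t ^ 3 / M\<^sup>2" using M by (simp add: power2_eq_square power4_eq_xxxx)
    finally show "pr t ?n ?Q \<le> 16 * t ^ 3 / M\<^sup>2" .
    show "0 \<le> ub2 t / real (m ^ (t - 1))" using ub2_pos[OF t(1)] by simp
  qed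
  finally show ?thesis by (simp only: of_nat_mult of_nat_power of_nat_numeral)
qed

section \<open>Moving several cuts to the right\<close>

lemma card_restrict_sum: "finite B \<Longrightarrow> real (card {p \<in> B. P p}) = (\<Sum>p\<in>B. of_bool (P p))"
  by (simp add: of_bool_def sum.If_cases Int_def)

definition shift_cuts :: "(nat \<Rightarrow> nat) \<Rightarrow> nat set \<Rightarrow> nat set" where
  "shift_cuts \<delta> S = (\<lambda>c. c + \<delta> c) ` S"

text \<open>When the cut \<open>c\<close> moves right, the beads it passes enter \<open>side\<close>
  if this sign is 1 and leave it if it is \<open>- 1\<close>.\<close>

definition parity :: "nat set \<Rightarrow> nat \<Rightarrow> real" where
  "parity S c = (if odd (card {b \<in> S. c < b}) then - 1 else 1)"

lemma shift_disjoint: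
  fixes \<delta> :: "nat \<Rightarrow> nat"
  assumes "\<forall>c\<in>S. \<forall>b\<in>S. c < b \<longrightarrow> c + \<delta> c < b"
    and "c \<in> S" "b \<in> S" "p \<in> {c..c + \<delta> c}" "p \<in> {b..b + \<delta> b}"
  shows "c = b"
  using assms(1)[rule_format, of c b] assms(1)[rule_format, of b c] assms(2-5) by (cases c b rule: linorder_cases) auto

lemma shift_inj_on:
  fixes \<delta> :: "nat \<Rightarrow> nat"
  assumes "\<forall>c\<in>S. \<forall>b\<in>S. c < b \<longrightarrow> c + \<delta> c < b"
  shows "inj_on (\<lambda>c. c + \<delta> c) S"
proof (rule inj_onI)
  fix c b assume "c \<in> S" "b \<in> S" "c + \<delta> c = b + \<delta> b"
  then show "c = b" using shift_disjoint[OF assms, of c b "c + \<delta> c"] by auto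
qed

text \<open>The shifts are smaller than the gaps, so each position is passed by at most one cut, and
  the change can be checked position by position. The arbitrary set \<open>B\<close> serves twice:
  all positions give the size of the side, the positions of one letter give its count.\<close>

lemma card_side_shift:
  assumes S: "finite S" and gap: "\<forall>c\<in>S. \<forall>b\<in>S. c < b \<longrightarrow> c + \<delta> c < b"
    and B: "B \<subseteq> {..<n}"
  shows "real (card {p \<in> B. p \<in> side n (shift_cuts \<delta> S)}) =
    card {p \<in> B. p \<in> side n S} + (\<Sum>c\<in>S. parity S c * card {p \<in> B. p \<in> {c..<c + \<delta> c}})"
proof -
  have fB: "finite B" using B finite_subset by blast
  have point: "(of_bool (p \<in> side n (shift_cuts \<delta> S)) :: real) =
      of_bool (p \<in> side n S) + (\<Sum>c\<in>S. parity S c * of_bool (p \<in> {c..<c + \<delta> c}))"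
    if p: "p \<in> B" for p
  proof -
    have pn: "p < n" using p B by auto
    have "card {b \<in> shift_cuts \<delta> S. p < b} = card ((\<lambda>c. c + \<delta> c) ` {c \<in> S. p < c + \<delta> c})"
      by (rule arg_cong[where f = card]) (auto simp: shift_cuts_def)
    also have "\<dots> = card {c \<in> S. p < c + \<delta> c}"
      by (rule card_image[OF inj_on_subset[OF shift_inj_on[OF gap]]]) auto
    also have "{c \<in> S. p < c + \<delta> c} = {c \<in> S. p < c} \<union> {c \<in> S. p \<in> {c..<c + \<delta> c}}" by auto
    also have "card \<dots> = card {c \<in> S. p < c} + card {c \<in> S. p \<in> {c..<c + \<delta> c}}"
      using S by (intro card_Un_disjoint) auto
    finally have cd: "card {b \<in> shift_cuts \<delta> S. p < b} = card {c \<in> S. p < c} + card {c \<in> S. p \<in> {c..<c + \<delta> c}}" .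
    show ?thesis
    proof (cases "\<exists>c\<in>S. p \<in> {c..<c + \<delta> c}")
      case False
      then have "{c \<in> S. p \<in> {c..<c + \<delta> c}} = {}" by blast
      then have "card {b \<in> shift_cuts \<delta> S. p < b} = card {c \<in> S. p < c}"
        using cd by (simp only: card.empty add_0_right)
      then have "p \<in> side n (shift_cuts \<delta> S) \<longleftrightarrow> p \<in> side n S"
        unfolding side_def mem_Collect_eq by simp
      moreover have "(\<Sum>c\<in>S. parity S c * of_bool (p \<in> {c..<c + \<delta> c})) = 0"
        using False by (intro sum.neutral) (simp add: Bex_def)
      ultimately show ?thesis by simp
    next
      case True
      then obtain c where c: "c \<in> S" "p \<in> {c..<c + \<delta> c}" by blast
      have uniq: "b = c" if "b \<in> S" "p \<in> {b..<b + \<delta> b}" for b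
        using shift_disjoint[OF gap that(1) c(1), of p] that c by auto
      then have "{b \<in> S. p \<in> {b..<b + \<delta> b}} = {c}" using c by blast
      then have "card {b \<in> S. p \<in> {b..<b + \<delta> b}} = 1" by (metis card_1_singleton_iff One_nat_def)
      then have cd1: "card {b \<in> shift_cuts \<delta> S. p < b} = card {c \<in> S. p < c} + 1"
        using cd by (simp only:)
      have "p < b \<longleftrightarrow> c < b" if "b \<in> S" for b
        using gap[rule_format, OF c(1) that] c(2) by (cases "c < b") auto
      then have cp: "{b \<in> S. p < b} = {b \<in> S. c < b}" by blast
      have "(\<Sum>b\<in>S. parity S b * of_bool (p \<in> {b..<b + \<delta> b})) = (\<Sum>b\<in>S. if b = c then parity S c else 0)"
      proof (intro sum.cong refl)
        fix b assume b: "b \<in> S"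
        show "parity S b * of_bool (p \<in> {b..<b + \<delta> b}) = (if b = c then parity S c else 0)"
        proof (cases "b = c")
          case True
          then show ?thesis using c(2) by simp
        next
          case False
          then have "p \<notin> {b..<b + \<delta> b}" using uniq[OF b] by blast
          then show ?thesis using False by simp
        qed
      qed
      also have "\<dots> = parity S c" using S c by simp
      finally have sm: "(\<Sum>b\<in>S. parity S b * of_bool (p \<in> {b..<b + \<delta> b})) = parity S c" .
      have "p \<in> side n (shift_cuts \<delta> S) \<longleftrightarrow> even (card {b \<in> S. c < b})"
        using cd1 cp pn unfolding side_def mem_Collect_eq by simp
      moreover have "p \<in> side n S \<longleftrightarrow> odd (card {b \<in> S. c < b})"
        using cp pn unfolding side_def mem_Collect_eq by simp
      ultimately show ?thesis unfolding sm unfolding parity_def by simp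
    qed
  qed
  have "real (card {p \<in> B. p \<in> side n (shift_cuts \<delta> S)}) = (\<Sum>p\<in>B. of_bool (p \<in> side n (shift_cuts \<delta> S)))"
    using fB by (rule card_restrict_sum)
  also have "\<dots> = (\<Sum>p\<in>B. of_bool (p \<in> side n S)) + (\<Sum>p\<in>B. \<Sum>c\<in>S. parity S c * of_bool (p \<in> {c..<c + \<delta> c}))"
    by (simp add: point sum.distrib)
  also have "(\<Sum>p\<in>B. \<Sum>c\<in>S. parity S c * of_bool (p \<in> {c..<c + \<delta> c})) =
      (\<Sum>c\<in>S. parity S c * (\<Sum>p\<in>B. of_bool (p \<in> {c..<c + \<delta> c})))"
    by (subst sum.swap) (simp add: sum_distrib_left)
  finally show ?thesis by (simp only: card_restrict_sum[OF fB])
qed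

text \<open>Given the counts of a long stretch \<open>J\<close>, a short piece \<open>Y\<close> of
  it behaves almost as if it were free. Removing at most \<open>M\<close> beads from nearly balanced
  counts changes each factor of the multinomial quotient by a relative error of at most
  \<open>1 / (2 * M)\<close>, one half from the imbalance of \<open>r\<close> and one half from
  \<open>v i \<le> M\<close>. By Bernoulli's inequality, \<open>M\<close> such factors keep at least
  \<open>1 / 2\<close>.\<close>

lemma pr_cond_lower:
  assumes t: "t \<ge> 1" and YJ: "Y \<subseteq> J" "J \<subseteq> {..<n}" and M: "M \<ge> 1" "card Y \<le> M" "4 * t * M\<^sup>2 \<le> card J"
    and v: "(\<Sum>i<t. v i) = card Y"
    and r: "(\<Sum>i<t. r i) = card J" "\<And>i. i < t \<Longrightarrow> \<bar>real (r i) - card J / t\<bar> \<le> card J / (4 * t * M)"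
  shows "pr t n (\<lambda>f. \<forall>i<t. cnt f Y i = v i) / 2 * pr t n (\<lambda>f. \<forall>i<t. cnt f J i = r i)
    \<le> pr t n (\<lambda>f. (\<forall>i<t. cnt f Y i = v i) \<and> (\<forall>i<t. cnt f J i = r i))"
proof -
  define R where "R = card J"
  define y where "y = card Y"
  define Z where "Z = J - Y"
  have fin: "finite J" using finite_subset[OF YJ(2)] by simp
  then have fin: "finite J" "finite Y" using finite_subset[OF YJ(1)] by simp_all
  have cZ: "card Z = R - y" using YJ fin by (simp add: Z_def R_def y_def card_Diff_subset)
  have yR: "y \<le> R" using card_mono[OF fin(1) YJ(1)] by (simp add: R_def y_def)
  have RM: "4 * real t * (real M)\<^sup>2 \<le> real R"
    using M(3) by (simp add: R_def flip: of_nat_le_iff[where 'a = real])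
  have tM: "1 \<le> real t * (real M)\<^sup>2"
    using t M(1) by (intro mult_ge1_I one_le_power) auto
  then have R0: "0 < real R" using RM by linarith
  have vM: "v i \<le> M" if "i < t" for i
    using member_le_sum[of i "{..<t}" v] that v M(2) by simp
  have vR: "real (v i) \<le> real R / (4 * real t * real M)" if "i < t" for i
  proof -
    have "real (v i) * (4 * real t * real M) \<le> real M * (4 * real t * real M)"
      using vM[OF that] by (intro mult_right_mono) auto
    also have "\<dots> \<le> real R" using RM by (simp add: power2_eq_square mult_ac)
    finally show ?thesis using t M(1) by (simp add: pos_le_divide_eq)
  qed
  have rlow: "real R / t * (1 - 1 / (2 * real M)) \<le> real (r i) - real (v i)" if "i < t" for i
  proof -
    have "real R / t * (1 - 1 / (2 * real M)) = real R / real t - real R / (4 * real t * real M) - real R / (4 * real t * real M)"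
      using t M(1) by (simp add: field_simps)
    also have "\<dots> \<le> real (r i) - real (v i)"
      using vR[OF that] r(2)[OF that] unfolding abs_le_iff R_def[symmetric] by linarith
    finally show ?thesis .
  qed
  have M2: "0 \<le> 1 - 1 / (2 * real M)" using M(1) by simp
  have rv: "v i \<le> r i" if "i < t" for i
  proof -
    have "0 \<le> real R / t * (1 - 1 / (2 * real M))" using M2 by simp
    then show ?thesis using rlow[OF that] by linarith
  qed
  have sz: "(\<Sum>i<t. r i - v i) = card Z"
  proof -
    have "(\<Sum>i<t. r i) = (\<Sum>i<t. (r i - v i) + v i)" using rv by (intro sum.cong) auto
    also have "\<dots> = (\<Sum>i<t. r i - v i) + card Y" by (simp only: sum.distrib v)
    finally show ?thesis unfolding cZ R_def y_def r(1) by linarith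
  qed
  have pJ: "pr t n (\<lambda>f. \<forall>i<t. cnt f J i = r i) = fact R / (\<Prod>i<t. fact (r i)) / real t ^ R"
    unfolding R_def by (rule pr_multinomial[OF t YJ(2) r(1)])
  have pZ: "pr t n (\<lambda>f. \<forall>i<t. cnt f Z i = r i - v i) = fact (R - y) / (\<Prod>i<t. fact (r i - v i)) / real t ^ (R - y)"
    unfolding cZ[symmetric] using YJ by (intro pr_multinomial[OF t _ sz]) (auto simp: Z_def)
  have key: "pr t n (\<lambda>f. \<forall>i<t. cnt f J i = r i) / 2 \<le> pr t n (\<lambda>f. \<forall>i<t. cnt f Z i = r i - v i)"
  proof -
    have prod_ge: "(\<Prod>i<t. fact (r i - v i)) * (real R / t) ^ y * (1 / 2) \<le> (\<Prod>i<t. fact (r i) :: real)"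
    proof -
      have "1 / 2 \<le> 1 + real M * (- (1 / (2 * real M)))" using M(1) by simp
      also have "\<dots> \<le> (1 + - (1 / (2 * real M))) ^ M"
        using M(1) by (intro Bernoulli_inequality) simp
      also have "\<dots> \<le> (1 - 1 / (2 * real M)) ^ y"
        using M2 M(2) by (simp add: y_def power_decreasing)
      finally have "(\<Prod>i<t. fact (r i - v i)) * (real R / t) ^ y * (1 / 2)
        \<le> (\<Prod>i<t. fact (r i - v i)) * (real R / t) ^ y * (1 - 1 / (2 * real M)) ^ y"
        by (intro mult_left_mono) (auto intro!: mult_nonneg_nonneg prod_nonneg)
      also have "\<dots> = (\<Prod>i<t. fact (r i - v i) * (real R / t * (1 - 1 / (2 * real M))) ^ v i)"
        by (simp only: prod.distrib power_sum[symmetric] v y_def power_mult_distrib mult.assoc)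
      also have "\<dots> \<le> (\<Prod>i<t. fact (r i))"
      proof (rule prod_mono, intro conjI)
        fix i assume "i \<in> {..<t}"
        then have i: "i < t" by simp
        show "0 \<le> fact (r i - v i) * (real R / t * (1 - 1 / (2 * real M))) ^ v i"
          using M2 by (intro mult_nonneg_nonneg zero_le_power) auto
        have "fact (r i - v i) * (real R / t * (1 - 1 / (2 * real M))) ^ v i
          \<le> fact (r i - v i) * real (r i - v i) ^ v i"
          using rlow[OF i] rv[OF i] M2
          by (intro mult_left_mono power_mono) (auto simp: of_nat_diff intro!: mult_nonneg_nonneg)
        also have "\<dots> \<le> fact (r i - v i + v i)" by (rule fact_add_ge)
        finally show "fact (r i - v i) * (real R / t * (1 - 1 / (2 * real M))) ^ v i \<le> fact (r i)"
          using rv[OF i] by simp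
      qed
      finally show ?thesis .
    qed
    have fR: "fact R \<le> (fact (R - y) :: real) * real R ^ y"
      using fact_add_le[of "R - y" y] yR by simp
    have P0: "0 < (\<Prod>i<t. fact (r i) :: real)" "0 < (\<Prod>i<t. fact (r i - v i) :: real)"
      by (auto intro: prod_pos)
    have "fact R / (\<Prod>i<t. fact (r i)) / real t ^ R / 2
      \<le> fact (R - y) * real R ^ y / (\<Prod>i<t. fact (r i)) / real t ^ R / 2"
      using fR P0 t by (intro divide_right_mono) auto
    also have "\<dots> \<le> fact (R - y) * real R ^ y / ((\<Prod>i<t. fact (r i - v i)) * (real R / t) ^ y * (1 / 2)) / real t ^ R / 2"
      using prod_ge P0 R0 t
      by (intro divide_right_mono divide_left_mono mult_pos_pos) auto
    also have "\<dots> = fact (R - y) / (\<Prod>i<t. fact (r i - v i)) * (real t ^ y / real t ^ R)"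
      using R0 by (simp add: power_divide)
    also have "real t ^ y / real t ^ R = 1 / real t ^ (R - y)"
      using t yR by (simp add: power_diff)
    finally show ?thesis unfolding pJ pZ by simp
  qed
  have YZ: "cnt f J i = cnt f Y i + cnt f Z i" for f i
    using YJ fin by (subst cnt_Un[symmetric]) (auto simp: Z_def intro!: arg_cong2[where f = "cnt f"])
  have "pr t n (\<lambda>f. (\<forall>i<t. cnt f Y i = v i) \<and> (\<forall>i<t. cnt f J i = r i))
    = pr t n (\<lambda>f. (\<forall>i<t. cnt f Y i = v i) \<and> (\<forall>i<t. cnt f Z i = r i - v i))"
    using rv by (intro pr_cong) (fastforce simp: YZ)
  also have "\<dots> = pr t n (\<lambda>f. \<forall>i<t. cnt f Y i = v i) * pr t n (\<lambda>f. \<forall>i<t. cnt f Z i = r i - v i)"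
    by (rule pr_indep[OF t depends_cnt_eq depends_cnt_eq]) (auto simp: Z_def)
  finally show ?thesis using mult_left_mono[OF key pr_nonneg[of t n "\<lambda>f. \<forall>i<t. cnt f Y i = v i"]] by simp
qed

section \<open>Deviations at separate scales\<close>

text \<open>The stretch to the right of \<open>a\<close> is cut at the points
  \<open>a + 4 ^ j\<close>. The pieces are disjoint, so their contributions are independent, which a
  running maximum from \<open>a\<close> itself would not be. The 1 accounts for the first
  bead.\<close>

lemma dev_le_scales:
  assumes "t \<ge> 1" "i < t" "l \<le> 4 ^ k"
  shows "\<bar>dev t f i a l\<bar> \<le> 1 + (\<Sum>j<k. maxdev t f i (a + 4 ^ j) (3 * 4 ^ j))"
  using assms(3)
proof (induction k arbitrary: l)
  case 0
  then consider "l = 0" | "l = 1" by force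
  then show ?case
  proof cases
    case 2
    have "0 \<le> 1 / real t" "1 / real t \<le> 1" using assms by simp_all
    moreover have "\<bar>dev t f i a l\<bar> = \<bar>of_bool (f a = i) - 1 / real t\<bar>" using dev_Suc[of t f i a 0] 2 by simp
    ultimately show ?thesis by (cases "f a = i") (simp_all add: abs_le_iff)
  qed simp
next
  case (Suc k)
  show ?case
  proof (cases "l \<le> 4 ^ k")
    case True
    then show ?thesis using Suc.IH[OF True] maxdev_nonneg[of t f i "a + 4 ^ k" "3 * 4 ^ k"]
      unfolding sum.lessThan_Suc by linarith
  next
    case False
    define l' where "l' = l - 4 ^ k"
    have l: "l = 4 ^ k + l'" "l' \<le> 3 * 4 ^ k" using False Suc.prems by (auto simp: l'_def)
    have "\<bar>dev t f i a l\<bar> \<le> \<bar>dev t f i a (4 ^ k)\<bar> + \<bar>dev t f i (a + 4 ^ k) l'\<bar>"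
      unfolding l(1) dev_add by (rule abs_triangle_ineq)
    also have "\<dots> \<le> (1 + (\<Sum>j<k. maxdev t f i (a + 4 ^ j) (3 * 4 ^ j))) + maxdev t f i (a + 4 ^ k) (3 * 4 ^ k)"
      using Suc.IH[of "4 ^ k"] dev_le_maxdev[OF l(2)] by (intro add_mono) auto
    finally show ?thesis by simp
  qed
qed

definition scale_dev :: "nat \<Rightarrow> (nat \<Rightarrow> nat) \<Rightarrow> nat set \<Rightarrow> nat \<Rightarrow> real" where
  "scale_dev t f A k = (\<Sum>c\<in>A. \<Sum>i<t. maxdev t f i (c + 4 ^ k) (3 * 4 ^ k))"

lemma scale_dev_nonneg: "0 \<le> scale_dev t f A k"
  unfolding scale_dev_def by (intro sum_nonneg) simp

lemma scale_dev_depends: "depends_on (\<Union>c\<in>A. {c + 4 ^ k..<c + 4 ^ Suc k}) (\<lambda>f. scale_dev t f A k)"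
  unfolding depends_on_def
proof (intro allI impI)
  fix f g :: "nat \<Rightarrow> nat" assume eq: "\<forall>p\<in>\<Union>c\<in>A. {c + 4 ^ k..<c + 4 ^ Suc k}. f p = g p"
  have "maxdev t f i (c + 4 ^ k) (3 * 4 ^ k) = maxdev t g i (c + 4 ^ k) (3 * 4 ^ k)" if "c \<in> A" for c i
  proof -
    have "depends_on {c + 4 ^ k..<c + 4 ^ Suc k} (\<lambda>f. maxdev t f i (c + 4 ^ k) (3 * 4 ^ k))"
      by (rule maxdev_depends) auto
    then show ?thesis using eq that unfolding depends_on_def by blast
  qed
  then show "scale_dev t f A k = scale_dev t g A k" unfolding scale_dev_def by simp
qed

lemma scale_dev_second_moment:
  assumes t: "t \<ge> 1" and A: "finite A" "\<forall>c\<in>A. c + 4 ^ Suc k \<le> n"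
  shows "avg t n (\<lambda>f. (scale_dev t f A k / 2 ^ k)\<^sup>2) \<le> 12 * (real (card A) * t)\<^sup>2"
proof -
  let ?I = "A \<times> {..<t}"
  let ?x = "\<lambda>f (c, i). maxdev t f i (c + 4 ^ k) (3 * 4 ^ k)"
  have sum: "scale_dev t f A k = (\<Sum>ci\<in>?I. ?x f ci)" for f
    by (simp add: scale_dev_def sum.cartesian_product)
  have "avg t n (\<lambda>f. (scale_dev t f A k)\<^sup>2) \<le> avg t n (\<lambda>f. real (card ?I) * (\<Sum>ci\<in>?I. (?x f ci)\<^sup>2))"
  proof (rule avg_mono)
    fix f
    show "(scale_dev t f A k)\<^sup>2 \<le> real (card ?I) * (\<Sum>ci\<in>?I. (?x f ci)\<^sup>2)"
      unfolding sum using sum_squared_le_sum_of_squares[of "?x f" ?I] by (simp add: mult.commute)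
  qed
  also have "\<dots> = real (card ?I) * (\<Sum>ci\<in>?I. avg t n (\<lambda>f. (?x f ci)\<^sup>2))"
    by (simp add: avg_cmult avg_sum)
  also have "\<dots> \<le> real (card ?I) * (\<Sum>ci\<in>?I. 12 * 4 ^ k)"
  proof (intro mult_left_mono sum_mono)
    fix ci assume "ci \<in> ?I"
    then obtain c i where ci: "ci = (c, i)" "c \<in> A" "i < t" by auto
    have "c + 4 ^ k + 3 * 4 ^ k \<le> n" using bspec[OF A(2) ci(2)] by simp
    from maxdev_second_moment[OF t ci(3) this]
    show "avg t n (\<lambda>f. (?x f ci)\<^sup>2) \<le> 12 * 4 ^ k" by (simp add: ci(1))
  qed simp
  also have "\<dots> = 12 * (real (card A) * t)\<^sup>2 * 4 ^ k"
    by (simp add: card_cartesian_product power2_eq_square)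
  finally have 1: "avg t n (\<lambda>f. (scale_dev t f A k)\<^sup>2) \<le> 12 * (real (card A) * t)\<^sup>2 * 4 ^ k" .
  have "(scale_dev t f A k / 2 ^ k)\<^sup>2 = (1 / 4 ^ k) * (scale_dev t f A k)\<^sup>2" for f
  proof -
    have "((2::real) ^ k)\<^sup>2 = 4 ^ k" by (simp add: power2_eq_square flip: power_mult_distrib)
    then show ?thesis by (simp add: power_divide)
  qed
  then have "avg t n (\<lambda>f. (scale_dev t f A k / 2 ^ k)\<^sup>2) = (1 / 4 ^ k) * avg t n (\<lambda>f. (scale_dev t f A k)\<^sup>2)"
    by (simp only: avg_cmult)
  also have "\<dots> \<le> (1 / 4 ^ k) * (12 * (real (card A) * t)\<^sup>2 * 4 ^ k)"
    using 1 by (intro mult_left_mono) auto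
  finally show ?thesis by simp
qed

text \<open>Divided by their typical size \<open>2 ^ k\<close>, the deviations at different scales
  are independent with bounded second moments; the gaps keep the pieces belonging to different cuts
  apart. The variance of the sum is at most \<open>B * L\<close> and its mean at most
  \<open>B * L\<close>, so exceeding \<open>2 * B * L\<close> has probability at most
  \<open>1 / L\<close>.\<close>

lemma pr_scale_dev:
  assumes t: "t \<ge> 1" and A: "finite A" "\<forall>c\<in>A. c + 4 ^ L \<le> n"
    and gap: "\<forall>c\<in>A. \<forall>b\<in>A. c < b \<longrightarrow> c + 4 ^ L \<le> b" and L: "L \<ge> 1"
    and B: "1 + 12 * (real (card A) * t)\<^sup>2 \<le> B"
  shows "pr t n (\<lambda>f. 2 * B * L < (\<Sum>k<L. scale_dev t f A k / 2 ^ k)) \<le> 1 / L"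
proof -
  define V where "V k f = scale_dev t f A k / 2 ^ k" for k f
  define e where "e k = avg t n (V k)" for k
  define W where "W k f = V k f - e k" for k f
  have B1: "1 \<le> B" using B by (smt (verit) zero_le_power2)
  have cA: "\<forall>c\<in>A. c + 4 ^ Suc k \<le> n" if "k < L" for k
  proof
    fix c assume "c \<in> A"
    moreover have "(4::nat) ^ Suc k \<le> 4 ^ L" using that by (intro power_increasing) auto
    ultimately show "c + 4 ^ Suc k \<le> n" using A(2) by fastforce
  qed
  have V2: "avg t n (\<lambda>f. (V k f)\<^sup>2) \<le> B" if "k < L" for k
    using scale_dev_second_moment[OF t A(1) cA[OF that]] B unfolding V_def by fastforce
  \<comment> \<open>One constant serves for mean and second moment because
    \<open>x \<le> 1 + x\<^sup>2\<close>; hence the summand 1 in \<open>B\<close>.\<close>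
  have eB: "e k \<le> B" if "k < L" for k
  proof -
    have "e k \<le> avg t n (\<lambda>f. 1 + (V k f)\<^sup>2)" unfolding e_def
    proof (rule avg_mono)
      fix f
      have "0 \<le> (V k f - 1)\<^sup>2 + 1 + (V k f)\<^sup>2" by simp
      then show "V k f \<le> 1 + (V k f)\<^sup>2" by (simp add: power2_diff)
    qed
    also have "\<dots> = 1 + avg t n (\<lambda>f. (V k f)\<^sup>2)" by (simp add: avg_add avg_const[OF t])
    also have "\<dots> \<le> 1 + 12 * (real (card A) * t)\<^sup>2"
      using scale_dev_second_moment[OF t A(1) cA[OF that]] unfolding V_def by simp
    finally show ?thesis using B by simp
  qed
  have W0: "avg t n (W k) = 0" for k
    unfolding W_def[abs_def] by (simp add: avg_diff avg_const[OF t] e_def)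
  have W2: "avg t n (\<lambda>f. (W k f)\<^sup>2) \<le> B" if "k < L" for k
  proof -
    have "(W k f)\<^sup>2 = (V k f)\<^sup>2 + ((- 2 * e k) * V k f + (e k)\<^sup>2)" for f
      by (simp add: W_def power2_diff)
    then have "avg t n (\<lambda>f. (W k f)\<^sup>2) = avg t n (\<lambda>f. (V k f)\<^sup>2) + ((- 2 * e k) * e k + (e k)\<^sup>2)"
      unfolding e_def by (simp only: avg_add avg_cmult avg_const[OF t])
    also have "\<dots> \<le> B"
    proof -
      have "(- 2 * e k) * e k + (e k)\<^sup>2 \<le> 0" by (simp add: power2_eq_square)
      then show ?thesis using V2[OF that] by linarith
    qed
    finally show ?thesis .
  qed
  have dW: "depends_on (\<Union>c\<in>A. {c + 4 ^ k..<c + 4 ^ Suc k}) (W k)" for k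
    unfolding W_def[abs_def] V_def by (rule depends_on_comp[OF scale_dev_depends])
  have sq: "avg t n (\<lambda>f. (\<Sum>k<l. W k f)\<^sup>2) \<le> B * l" if "l \<le> L" for l
    using that
  proof (induction l)
    case 0
    then show ?case by (simp add: avg_const[OF t])
  next
    case (Suc l)
    have dS: "depends_on (\<Union>c\<in>A. {c..<c + 4 ^ l}) (\<lambda>f. \<Sum>k<l. W k f)"
      unfolding depends_on_def
    proof (intro allI impI sum.cong refl)
      fix f g :: "nat \<Rightarrow> nat" and k assume eq: "\<forall>p\<in>\<Union>c\<in>A. {c..<c + 4 ^ l}. f p = g p" and k: "k \<in> {..<l}"
      have "(4::nat) ^ Suc k \<le> 4 ^ l" using k by (intro power_increasing) auto
      then have "(\<Union>c\<in>A. {c + 4 ^ k..<c + 4 ^ Suc k}) \<subseteq> (\<Union>c\<in>A. {c..<c + 4 ^ l})" by fastforce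
      then have "\<forall>p\<in>\<Union>c\<in>A. {c + 4 ^ k..<c + 4 ^ Suc k}. f p = g p" using eq by (meson subsetD)
      with dW[of k] show "W k f = W k g" unfolding depends_on_def by blast
    qed
    have disj: "(\<Union>c\<in>A. {c..<c + 4 ^ l}) \<inter> (\<Union>c\<in>A. {c + 4 ^ l..<c + 4 ^ Suc l}) = {}"
    proof -
      have False if "c \<in> A" "b \<in> A" "p \<in> {c..<c + 4 ^ l}" "p \<in> {b + 4 ^ l..<b + 4 ^ Suc l}" for c b p
      proof -
        have le: "(4::nat) ^ Suc l \<le> 4 ^ L" using Suc.prems by (intro power_increasing) auto
        show False
        proof (cases c b rule: linorder_cases)
          case less
          have "(4::nat) ^ l \<le> 4 ^ L" using Suc.prems by (intro power_increasing) auto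
          then show ?thesis using gap[rule_format, OF that(1,2) less] that(3,4) unfolding atLeastLessThan_iff by linarith
        next
          case equal
          then show ?thesis using that(3,4) by simp
        next
          case greater
          then show ?thesis using gap[rule_format, OF that(2,1) greater] that(3,4) le
            unfolding atLeastLessThan_iff by linarith
        qed
      qed
      then show ?thesis by blast
    qed
    have "(\<Sum>k<Suc l. W k f)\<^sup>2 = (\<Sum>k<l. W k f)\<^sup>2 + (2 * ((\<Sum>k<l. W k f) * W l f) + (W l f)\<^sup>2)" for f
      by (simp add: power2_sum)
    then have "avg t n (\<lambda>f. (\<Sum>k<Suc l. W k f)\<^sup>2)
      = avg t n (\<lambda>f. (\<Sum>k<l. W k f)\<^sup>2) + (2 * avg t n (\<lambda>f. (\<Sum>k<l. W k f) * W l f) + avg t n (\<lambda>f. (W l f)\<^sup>2))"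
      by (simp only: avg_add avg_cmult)
    also have "avg t n (\<lambda>f. (\<Sum>k<l. W k f) * W l f) = 0"
      using avg_indep[OF t dS dW disj, of n] by (simp add: W0)
    finally show ?case using Suc.IH W2[of l] Suc.prems by (simp add: algebra_simps)
  qed
  have "pr t n (\<lambda>f. 2 * B * L < (\<Sum>k<L. scale_dev t f A k / 2 ^ k)) \<le> pr t n (\<lambda>f. (B * L)\<^sup>2 \<le> (\<Sum>k<L. W k f)\<^sup>2)"
  proof (rule pr_mono)
    fix f assume "2 * B * L < (\<Sum>k<L. scale_dev t f A k / 2 ^ k)"
    moreover have "(\<Sum>k<L. e k) \<le> B * L" using sum_bounded_above[of "{..<L}" e B] eB by (simp add: mult.commute)
    moreover have "(\<Sum>k<L. W k f) = (\<Sum>k<L. scale_dev t f A k / 2 ^ k) - (\<Sum>k<L. e k)"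
      by (simp add: W_def V_def sum_subtractf)
    ultimately have "B * L \<le> (\<Sum>k<L. W k f)" by simp
    then show "(B * L)\<^sup>2 \<le> (\<Sum>k<L. W k f)\<^sup>2" using B1 by (intro power_mono) auto
  qed
  also have "\<dots> \<le> avg t n (\<lambda>f. (\<Sum>k<L. W k f)\<^sup>2) / (B * L)\<^sup>2"
    using B1 L by (intro markov) auto
  also have "\<dots> \<le> B * L / (B * L)\<^sup>2" using sq[of L] by (intro divide_right_mono) auto
  also have "\<dots> = 1 / B * (1 / L)" using B1 L by (simp add: power2_eq_square)
  also have "\<dots> \<le> 1 * (1 / L)" using B1 by (intro mult_right_mono) auto
  finally show ?thesis by simp
qed

text \<open>A scale has to control its own deviations and those of all smaller scales. Exchanging
  the summations, the weights \<open>1 / 2 ^ k\<close> form a geometric series, so the weighted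
  partial sums add up to at most \<open>4 * B * L\<close>. Hence at most half of the scales can
  exceed \<open>8 * B\<close>.\<close>

lemma many_good_scales:
  fixes B :: real and D :: "nat \<Rightarrow> real"
  assumes D: "\<And>k. 0 \<le> D k" and B: "0 < B" and le: "(\<Sum>k<L. D k / 2 ^ k) \<le> 2 * B * L"
  shows "L \<le> 2 * card {k \<in> {..<L}. (\<Sum>j\<le>k. D j) \<le> 8 * B * 2 ^ k}"
proof -
  define T where "T k = (\<Sum>j<k. D j)" for k
  have "(\<Sum>k<L. T (Suc k) / 2 ^ k) + 2 * T L / 2 ^ L = 2 * (\<Sum>k<L. D k / 2 ^ k)"
  proof (induction L)
    case (Suc L)
    have "T (Suc L) = T L + D L" by (simp add: T_def)
    then have "T (Suc L) / 2 ^ L + 2 * T (Suc L) / 2 ^ Suc L = 2 * T L / 2 ^ L + 2 * (D L / 2 ^ L)"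
      by (simp add: field_simps)
    then show ?case using Suc unfolding sum.lessThan_Suc distrib_left by linarith
  qed (simp add: T_def)
  moreover have "0 \<le> 2 * T L / 2 ^ L" using D by (simp add: T_def sum_nonneg)
  ultimately have tot: "(\<Sum>k<L. T (Suc k) / 2 ^ k) \<le> 4 * B * L"
    using le by linarith
  let ?G = "{k \<in> {..<L}. T (Suc k) \<le> 8 * B * 2 ^ k}"
  let ?N = "{k \<in> {..<L}. \<not> T (Suc k) \<le> 8 * B * 2 ^ k}"
  have "real (card ?N) * (8 * B) = (\<Sum>k\<in>?N. 8 * B)" by simp
  also have "\<dots> \<le> (\<Sum>k\<in>?N. T (Suc k) / 2 ^ k)"
    by (intro sum_mono) (auto simp: field_simps)
  also have "\<dots> \<le> (\<Sum>k<L. T (Suc k) / 2 ^ k)"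
    using D by (intro sum_mono2) (auto simp: T_def intro!: divide_nonneg_nonneg add_nonneg_nonneg sum_nonneg)
  also have "\<dots> \<le> real L / 2 * (8 * B)" using tot by simp
  finally have "real (card ?N) \<le> real L / 2" using B by simp
  moreover have "card ?G + card ?N = L"
  proof -
    have "card (?G \<union> ?N) = card ?G + card ?N" by (intro card_Un_disjoint) auto
    moreover have "?G \<union> ?N = {..<L}" by auto
    ultimately show ?thesis by simp
  qed
  ultimately have "L \<le> 2 * card ?G" by linarith
  then show ?thesis by (simp add: T_def lessThan_Suc_atMost)
qed

definition scale_bound :: "nat \<Rightarrow> nat \<Rightarrow> real" where
  "scale_bound t s = 1 + 12 * (real s * t)\<^sup>2"

text \<open>At a scale \<open>k\<close> with small discrepancies to the right of the cuts, the cuts can be moved by about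
  \<open>4 ^ k\<close> beads, and the \<open>4 ^ (k * (s - 1))\<close> resulting sets are fair with probability of order
  \<open>4 ^ (- k * (s - 1))\<close> each if \<open>t = 2 * s - 1\<close>. So each such scale contributes a constant.\<close>

definition good_cuts :: "nat \<Rightarrow> nat \<Rightarrow> nat \<Rightarrow> nat set \<Rightarrow> (nat \<Rightarrow> nat) \<Rightarrow> bool" where
  "good_cuts t m L S f \<longleftrightarrow>
    (\<forall>c\<in>S. \<forall>b\<in>S. c < b \<longrightarrow> c + 4 ^ L \<le> b) \<and>
    Max S + (4 ^ L) ^ 4 \<le> 2 * t * m \<and>
    (\<forall>i<t. \<bar>dev t f i 0 (Max S)\<bar> \<le> real (2 * t * m - Max S) / (4 * real t * real (4 ^ L))) \<and>
    L \<le> 2 * card {k \<in> {..<L}. (\<Sum>j\<le>k. scale_dev t f (S - {Max S}) j) \<le> 8 * scale_bound t (card S) * 2 ^ k}"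

text \<open>For separated cuts with a long remainder, only the two random requirements can fail.
  Each is decided by letters covering at most half of a side, so fairness and failure together cost
  the product of their bounds.\<close>

lemma pr_bad_cuts:
  assumes t: "t \<ge> 1" "m \<ge> 1" and S: "S \<in> cut_sets t m s" "1 \<le> s" and L: "L \<ge> 1"
    and gap: "\<forall>c\<in>S. \<forall>b\<in>S. c < b \<longrightarrow> c + 4 ^ L \<le> b" and late: "Max S + (4 ^ L) ^ 4 \<le> 2 * t * m"
    and small: "2 * (s * 4 ^ L) \<le> t * m"
  shows "pr t (2 * t * m) (\<lambda>f. balanced t m f \<and> halves t m S f \<and> \<not> good_cuts t m L S f)
    \<le> ub2 t / m ^ (t - 1) * (16 * t ^ 3 / (real (4 ^ L))\<^sup>2 + 1 / L)"
proof -
  let ?n = "2 * t * m"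
  define A where "A = S - {Max S}"
  define B where "B = scale_bound t s"
  note q = cut_sets_props[OF S]
  have fA: "finite A" using q(1) by (simp add: A_def)
  have cA: "card A \<le> s" unfolding A_def using q(1,4) by (metis card_Diff1_le)
  have B1: "1 + 12 * (real (card A) * t)\<^sup>2 \<le> B"
    unfolding B_def scale_bound_def using cA by (simp add: power_mono mult_right_mono)
  have B0: "0 < B" unfolding B_def scale_bound_def by (rule add_pos_nonneg) auto
  have AX: "\<forall>c\<in>A. c + 4 ^ L \<le> Max S"
  proof
    fix c assume "c \<in> A"
    then have "c \<in> S" "c < Max S" using Max_ge[OF q(1)] by (auto simp: A_def le_neq_implies_less)
    then show "c + 4 ^ L \<le> Max S" using gap Max_in[OF q(1,2)] by blast
  qed
  have An: "\<forall>c\<in>A. c + 4 ^ L \<le> ?n" using AX late by fastforce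
  have gapA: "\<forall>c\<in>A. \<forall>b\<in>A. c < b \<longrightarrow> c + 4 ^ L \<le> b" using gap by (simp add: A_def)
  let ?Q1 = "\<lambda>f. \<exists>i<t. real (?n - Max S) / (4 * real t * real (4 ^ L)) < \<bar>dev t f i 0 (Max S)\<bar>"
  let ?Q2 = "\<lambda>f. 2 * B * L < (\<Sum>k<L. scale_dev t f A k / 2 ^ k)"
  have imp: "\<not> good_cuts t m L S f \<Longrightarrow> ?Q1 f \<or> ?Q2 f" for f
  proof (rule ccontr)
    assume bad: "\<not> good_cuts t m L S f" and n: "\<not> (?Q1 f \<or> ?Q2 f)"
    have "L \<le> 2 * card {k \<in> {..<L}. (\<Sum>j\<le>k. scale_dev t f A j) \<le> 8 * B * 2 ^ k}"
      using n B0 by (intro many_good_scales[OF scale_dev_nonneg]) auto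
    moreover have "\<forall>i<t. \<bar>dev t f i 0 (Max S)\<bar> \<le> real (?n - Max S) / (4 * real t * real (4 ^ L))"
      using n by (meson not_less)
    ultimately have "good_cuts t m L S f"
      unfolding good_cuts_def q(4) A_def[symmetric] B_def[symmetric]
      using gap late by (intro conjI)
    then show False using bad by simp
  qed
  have "pr t ?n (\<lambda>f. balanced t m f \<and> halves t m S f \<and> \<not> good_cuts t m L S f)
    \<le> pr t ?n (\<lambda>f. (balanced t m f \<and> halves t m S f \<and> ?Q1 f) \<or> (balanced t m f \<and> halves t m S f \<and> ?Q2 f))"
    using imp by (intro pr_mono) blast
  also have "\<dots> \<le> pr t ?n (\<lambda>f. balanced t m f \<and> halves t m S f \<and> ?Q1 f)
    + pr t ?n (\<lambda>f. balanced t m f \<and> halves t m S f \<and> ?Q2 f)"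
    by (rule pr_Un)
  also have "\<dots> \<le> ub2 t / m ^ (t - 1) * (16 * t ^ 3 / (real (4 ^ L))\<^sup>2) + ub2 t / m ^ (t - 1) * (1 / L)"
  proof (rule add_mono)
    show "pr t ?n (\<lambda>f. balanced t m f \<and> halves t m S f \<and> ?Q1 f)
      \<le> ub2 t / m ^ (t - 1) * (16 * t ^ 3 / (real (4 ^ L))\<^sup>2)"
    proof -
      have "1 \<le> (4::nat) ^ L" by simp
      from pr_bad_remainder[OF t S this late] show ?thesis
        by (simp only: of_nat_mult of_nat_power of_nat_numeral)
    qed
    let ?V = "\<Union>c\<in>A. {c..<c + 4 ^ L}"
    have "pr t ?n (\<lambda>f. balanced t m f \<and> halves t m S f \<and> ?Q2 f) \<le> ub2 t / m ^ (t - 1) * pr t ?n ?Q2"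
      unfolding ub2_def
    proof (rule pr_halves_upper[OF t])
      show "depends_on ?V ?Q2" unfolding depends_on_def
      proof (intro allI impI)
        fix f g :: "nat \<Rightarrow> nat" assume eq: "\<forall>p\<in>?V. f p = g p"
        have "scale_dev t f A k = scale_dev t g A k" if "k < L" for k
        proof -
          have "(4::nat) ^ Suc k \<le> 4 ^ L" using that by (intro power_increasing) auto
          then have "(\<Union>c\<in>A. {c + 4 ^ k..<c + 4 ^ Suc k}) \<subseteq> ?V" by fastforce
          then have "\<forall>p\<in>\<Union>c\<in>A. {c + 4 ^ k..<c + 4 ^ Suc k}. f p = g p" using eq by (meson subsetD)
          with scale_dev_depends[where A = A and k = k and t = t] show ?thesis unfolding depends_on_def by blast
        qed
        then show "?Q2 f = ?Q2 g" by simp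
      qed
      show "finite ?V" using fA by simp
      have "card ?V \<le> (\<Sum>c\<in>A. card {c..<c + 4 ^ L})" by (rule card_UN_le[OF fA])
      also have "\<dots> = card A * 4 ^ L" by simp
      also have "\<dots> \<le> s * 4 ^ L" using cA by simp
      finally show "2 * card ?V \<le> t * m" using small by simp
    qed
    also have "\<dots> \<le> ub2 t / m ^ (t - 1) * (1 / L)"
      using ub2_pos[OF t(1)] by (intro mult_left_mono pr_scale_dev[OF t(1) fA An gapA L B1]) auto
    finally show "pr t ?n (\<lambda>f. balanced t m f \<and> halves t m S f \<and> ?Q2 f) \<le> ub2 t / m ^ (t - 1) * (1 / L)" .
  qed
  finally show ?thesis by (simp only: distrib_left of_nat_mult of_nat_power of_nat_numeral)
qed

section \<open>Fair sets obtained by shifting a good one\<close>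

lemma nat_floor_Ints: "x \<in> \<int> \<Longrightarrow> 0 \<le> x \<Longrightarrow> real (nat \<lfloor>x\<rfloor>) = x"
  by (auto elim!: Ints_cases)

text \<open>The last cut is left out, since its move is the alternating sum of the others. The last
  but one moves by two to three times \<open>4 ^ k\<close>, and the others together by at most
  \<open>4 ^ k\<close>; so, whatever the signs, the last cut moves by at least \<open>4 ^ k\<close>
  and less than \<open>4 ^ Suc k\<close>. The interval of the last but one also reveals the scale
  \<open>k\<close>.\<close>

definition shifts :: "nat set \<Rightarrow> nat \<Rightarrow> (nat \<Rightarrow> nat) set" where
  "shifts S k = (\<Pi>\<^sub>E c\<in>S - {Max S}. if c = Max (S - {Max S}) then {2 * 4 ^ k..<3 * 4 ^ k} else {0..4 ^ k div card S})"

lemma shift_cuts_determined: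
  assumes gap: "\<forall>c\<in>S. \<forall>b\<in>S. c < b \<longrightarrow> c + M \<le> b" and lt: "\<forall>c\<in>S. \<delta> c < M" "\<forall>c\<in>S. \<delta>' c < M"
    and eq: "shift_cuts \<delta> S = shift_cuts \<delta>' S" and c: "c \<in> S"
  shows "\<delta> c = \<delta>' c"
proof -
  have "c + \<delta> c \<in> shift_cuts \<delta> S" using c by (simp add: shift_cuts_def)
  then have "c + \<delta> c \<in> shift_cuts \<delta>' S" by (simp only: eq)
  then obtain b where b: "b \<in> S" "c + \<delta> c = b + \<delta>' b" by (auto simp: shift_cuts_def)
  have "c = b"
  proof (cases c b rule: linorder_cases)
    case less
    then show ?thesis using gap[rule_format, OF c b(1)] lt(1)[rule_format, OF c] b(2) by linarith
  next
    case greater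
    then show ?thesis using gap[rule_format, OF b(1) c] lt(2)[rule_format, OF b(1)] b(2) by linarith
  qed
  then show ?thesis using b(2) by simp
qed

text \<open>The move \<open>y\<close> of the last cut restores the size of \<open>side\<close>, and
  \<open>v\<close> is the count vector that restores its contents. All other cuts pass letters known
  from \<open>g\<close>, while the last one passes only fresh letters; so the shifted set is fair as
  soon as the \<open>y\<close> fresh letters have counts \<open>v\<close>. The deviation of
  \<open>v\<close> from \<open>y / t\<close> is that of the known letters, which the scales up to
  \<open>k\<close> control.\<close>

lemma shifted_halves:
  assumes t: "t \<ge> 1" and S: "S \<in> cut_sets t m s" "2 \<le> s" and g: "g \<in> words t (2 * t * m)" "halves t m S g"
    and gap: "\<forall>c\<in>S. \<forall>b\<in>S. c < b \<longrightarrow> c + 4 ^ L \<le> b" and late: "Max S + 4 ^ L \<le> 2 * t * m"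
    and k: "k < L" and T: "(\<Sum>j\<le>k. scale_dev t g (S - {Max S}) j) \<le> T" "t * (s + T) \<le> 4 ^ k"
    and d: "d \<in> shifts S k"
  shows "\<exists>y v. shift_cuts (d(Max S := y)) S \<in> cut_sets t m s \<and> (\<forall>c\<in>S. (d(Max S := y)) c < 4 ^ L) \<and>
    4 ^ k \<le> y \<and> y < 4 ^ Suc k \<and> (\<Sum>i<t. v i) = y \<and> (\<forall>i<t. \<bar>real (v i) - y / t\<bar> \<le> s + T) \<and>
    (\<forall>f. (\<forall>i<t. cnt f {Max S..<Max S + y} i = v i) \<longrightarrow>
      halves t m (shift_cuts (d(Max S := y)) S) (override_on g f {Max S..<2 * t * m}))"
proof -
  let ?n = "2 * t * m"
  define X where "X = Max S"
  define A where "A = S - {X}"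
  define c0 where "c0 = Max A"
  define q where "q = (4::nat) ^ k"
  have s1: "1 \<le> s" using S(2) by simp
  note p = cut_sets_props[OF S(1) s1]
  have XS: "X \<in> S" using p by (simp add: X_def)
  have fA: "finite A" using p by (simp add: A_def)
  have cA: "card A = s - 1" using p XS by (simp add: A_def)
  then have "A \<noteq> {}" using S(2) by auto
  then have c0: "c0 \<in> A" using fA by (simp add: c0_def)
  have AX: "c < X" if "c \<in> A" for c
    using that Max_ge[OF p(1), of c] unfolding A_def X_def by (auto simp: le_neq_implies_less)
  have AXL: "c + 4 ^ L \<le> X" if "c \<in> A" for c
    using gap[rule_format, of c X] AX[OF that] that XS by (simp add: A_def)
  have SA: "S = insert X A" "X \<notin> A" using XS by (auto simp: A_def)
  have q1: "1 \<le> q" by (simp add: q_def)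
  have qL: "4 * q \<le> 4 ^ L"
  proof -
    have "(4::nat) ^ Suc k \<le> 4 ^ L" using k by (intro power_increasing) auto
    then show ?thesis by (simp add: q_def)
  qed
  have d0: "2 * q \<le> d c0" "d c0 < 3 * q"
    using d c0 unfolding shifts_def X_def[symmetric] A_def[symmetric] c0_def[symmetric] q_def[symmetric] p(4)
    by (auto dest!: PiE_mem)
  have d1: "d c \<le> q div s" if "c \<in> A - {c0}" for c
    using d that unfolding shifts_def X_def[symmetric] A_def[symmetric] c0_def[symmetric] q_def[symmetric] p(4)
    by (auto dest!: PiE_mem[where x = c])
  have d3: "d c < 3 * q" if "c \<in> A" for c
  proof (cases "c = c0")
    case False
    then have "d c \<le> q div s" using d1 that by simp
    also have "\<dots> \<le> q" by (rule div_le_dividend)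
    finally show ?thesis using q1 by linarith
  qed (use d0 in simp)
  \<comment> \<open>The last cut has \<open>parity\<close> 1. Reversing the sign of the others turns
    its compensating move into a plain sum, in which the last but one counts positively.\<close>
  define e where "e c = - parity S c" for c
  have e1: "\<bar>e c\<bar> = 1" "e c \<in> \<int>" for c by (simp_all add: e_def parity_def)
  have ec0: "e c0 = 1"
  proof -
    have "{b \<in> S. c0 < b} = {X}"
    proof -
      have "\<not> c0 < b" if "b \<in> A" for b using Max_ge[OF fA that] unfolding c0_def by simp
      then show ?thesis using AX[OF c0] unfolding SA(1) by blast
    qed
    then have "card {b \<in> S. c0 < b} = 1" by (metis card_1_singleton_iff One_nat_def)
    then show ?thesis unfolding e_def parity_def by simp
  qed
  have pX: "parity S X = 1"
  proof -
    have "\<not> X < b" if "b \<in> S" for b using Max_ge[OF p(1) that] unfolding X_def by simp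
    then have "{b \<in> S. X < b} = {}" by blast
    then show ?thesis unfolding parity_def by (simp only: card.empty) simp
  qed
  define yr where "yr = (\<Sum>c\<in>A. e c * real (d c))"
  have yI: "yr \<in> \<int>" unfolding yr_def using e1 by (intro Ints_sum Ints_mult) auto
  have yr_split: "yr = real (d c0) + (\<Sum>c\<in>A - {c0}. e c * real (d c))"
    unfolding yr_def using sum.remove[OF fA c0, of "\<lambda>c. e c * real (d c)"] ec0 by simp
  have rest: "\<bar>\<Sum>c\<in>A - {c0}. e c * real (d c)\<bar> \<le> q"
  proof -
    have "\<bar>\<Sum>c\<in>A - {c0}. e c * real (d c)\<bar> \<le> (\<Sum>c\<in>A - {c0}. \<bar>e c * real (d c)\<bar>)" by (rule sum_abs)
    also have "\<dots> \<le> (\<Sum>c\<in>A - {c0}. real (q div s))"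
      using d1 e1 by (intro sum_mono) (simp add: abs_mult)
    also have "\<dots> = real ((s - 2) * (q div s))" using cA c0 by (simp add: numeral_2_eq_2)
    also have "\<dots> \<le> real q"
    proof -
      have "(s - 2) * (q div s) \<le> s * (q div s)" by simp
      also have "\<dots> \<le> q" by simp
      finally show ?thesis by (simp only: of_nat_le_iff)
    qed
    finally show ?thesis .
  qed
  have d0r: "2 * real q \<le> real (d c0)" "real (d c0) + 1 \<le> 3 * real q"
    using d0 by linarith+
  have yr: "real q \<le> yr" "yr < 4 * real q"
    using rest d0r unfolding yr_split abs_le_iff by linarith+
  define y where "y = nat \<lfloor>yr\<rfloor>"
  have y: "real y = yr" unfolding y_def using yr by (intro nat_floor_Ints yI) simp
  have yq: "q \<le> y" "y < 4 * q" using yr y by linarith+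
  define \<delta> where "\<delta> = d(X := y)"
  have \<delta>A: "\<delta> c = d c" if "c \<in> A" for c using that AX[OF that] by (simp add: \<delta>_def)
  have \<delta>X: "\<delta> X = y" by (simp add: \<delta>_def)
  have \<delta>L: "\<delta> c < 4 ^ L" if "c \<in> S" for c
  proof (cases "c = X")
    case True
    then show ?thesis using yq qL by (simp add: \<delta>_def)
  next
    case False
    then have "c \<in> A" using that by (simp add: A_def)
    then show ?thesis using d3[of c] \<delta>A[of c] qL by simp
  qed
  have sp: "\<forall>c\<in>S. \<forall>b\<in>S. c < b \<longrightarrow> c + \<delta> c < b" using gap \<delta>L by fastforce
  have cX: "c \<le> X" if "c \<in> S" for c using Max_ge[OF p(1) that] by (simp add: X_def)
  have \<delta>n: "c + \<delta> c < ?n" if "c \<in> S" for c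
    using \<delta>L[OF that] cX[OF that] late unfolding X_def[symmetric] by linarith
  have esum: "(\<Sum>c\<in>S. parity S c * F c) = F X - (\<Sum>c\<in>A. e c * F c)" for F :: "nat \<Rightarrow> real"
    unfolding sum.remove[OF p(1) XS] A_def[symmetric] by (simp add: pX e_def sum_negf)
  have cut: "shift_cuts \<delta> S \<in> cut_sets t m s"
  proof -
    have "card (shift_cuts \<delta> S) = s"
      unfolding shift_cuts_def using card_image[OF shift_inj_on[OF sp]] p(4) by simp
    moreover have "shift_cuts \<delta> S \<subseteq> {1..<?n}"
      using \<delta>n S(1) unfolding shift_cuts_def cut_sets_def by fastforce
    moreover have "card (side ?n (shift_cuts \<delta> S)) = t * m"
    proof -
      have side: "{p \<in> {..<?n}. p \<in> side ?n S'} = side ?n S'" for S'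
        using side_subset[of ?n S'] by blast
      have W: "card {p \<in> {..<?n}. p \<in> {c..<c + \<delta> c}} = \<delta> c" if "c \<in> S" for c
      proof -
        have "{p \<in> {..<?n}. p \<in> {c..<c + \<delta> c}} = {c..<c + \<delta> c}" using \<delta>n[OF that] by auto
        then show ?thesis by (simp only: card_atLeastLessThan diff_add_inverse)
      qed
      have "real (card (side ?n (shift_cuts \<delta> S))) = real (card (side ?n S))
          + (\<Sum>c\<in>S. parity S c * real (card {p \<in> {..<?n}. p \<in> {c..<c + \<delta> c}}))"
        using card_side_shift[OF p(1) sp subset_refl, of ?n] unfolding side .
      also have "(\<Sum>c\<in>S. parity S c * real (card {p \<in> {..<?n}. p \<in> {c..<c + \<delta> c}})) = (\<Sum>c\<in>S. parity S c * real (\<delta> c))"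
        by (intro sum.cong refl) (simp only: W)
      also have "\<dots> = real (\<delta> X) - (\<Sum>c\<in>A. e c * real (\<delta> c))" by (rule esum)
      also have "(\<Sum>c\<in>A. e c * real (\<delta> c)) = yr" unfolding yr_def using \<delta>A by (intro sum.cong) auto
      finally have "real (card (side ?n (shift_cuts \<delta> S))) = real (t * m)"
        using y p(5) \<delta>X by linarith
      then show ?thesis by (simp only: of_nat_eq_iff)
    qed
    ultimately show ?thesis by (simp add: cut_sets_def)
  qed
  \<comment> \<open>The signed number of beads of type \<open>i\<close> passed by the cuts other
    than the last.\<close>
  define w where "w i = (\<Sum>c\<in>A. e c * real (cnt g {c..<c + d c} i))" for i
  have wI: "w i \<in> \<int>" for i unfolding w_def using e1 by (intro Ints_sum Ints_mult) auto
  have wd: "\<bar>w i - y / t\<bar> \<le> s + T" if i: "i < t" for i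
  proof -
    have "w i - y / t = (\<Sum>c\<in>A. e c * dev t g i c (d c))"
      unfolding w_def y yr_def dev_def
      by (simp add: sum_subtractf right_diff_distrib sum_divide_distrib)
    also have "\<bar>\<dots>\<bar> \<le> (\<Sum>c\<in>A. \<bar>e c * dev t g i c (d c)\<bar>)" by (rule sum_abs)
    also have "\<dots> \<le> (\<Sum>c\<in>A. 1 + (\<Sum>i<t. \<Sum>j\<le>k. maxdev t g i (c + 4 ^ j) (3 * 4 ^ j)))"
    proof (rule sum_mono)
      fix c assume c: "c \<in> A"
      have "d c \<le> 4 ^ Suc k" using d3[OF c] by (simp add: q_def)
      then have "\<bar>dev t g i c (d c)\<bar> \<le> 1 + (\<Sum>j<Suc k. maxdev t g i (c + 4 ^ j) (3 * 4 ^ j))"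
        by (rule dev_le_scales[OF t i])
      also have "(\<Sum>j<Suc k. maxdev t g i (c + 4 ^ j) (3 * 4 ^ j)) \<le> (\<Sum>i<t. \<Sum>j\<le>k. maxdev t g i (c + 4 ^ j) (3 * 4 ^ j))"
        unfolding lessThan_Suc_atMost
        using i member_le_sum[of i "{..<t}" "\<lambda>i. \<Sum>j\<le>k. maxdev t g i (c + 4 ^ j) (3 * 4 ^ j)"]
        by (simp add: sum_nonneg)
      finally show "\<bar>e c * dev t g i c (d c)\<bar> \<le> 1 + (\<Sum>i<t. \<Sum>j\<le>k. maxdev t g i (c + 4 ^ j) (3 * 4 ^ j))"
        using e1 by (simp add: abs_mult)
    qed
    also have "\<dots> = real (card A) + (\<Sum>j\<le>k. scale_dev t g A j)"
    proof -
      have "(\<Sum>c\<in>A. \<Sum>i<t. \<Sum>j\<le>k. maxdev t g i (c + 4 ^ j) (3 * 4 ^ j)) = (\<Sum>c\<in>A. \<Sum>j\<le>k. \<Sum>i<t. maxdev t g i (c + 4 ^ j) (3 * 4 ^ j))"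
        by (intro sum.cong refl sum.swap)
      also have "\<dots> = (\<Sum>j\<le>k. scale_dev t g A j)" unfolding scale_dev_def by (rule sum.swap)
      finally show ?thesis by (simp add: sum.distrib)
    qed
    also have "\<dots> \<le> s + T"
    proof -
      have "real (card A) \<le> real s" unfolding cA by simp
      then show ?thesis using T(1) unfolding A_def X_def by linarith
    qed
    finally show ?thesis .
  qed
  \<comment> \<open>The deviation is at most \<open>4 ^ k / t\<close>, hence at most
    \<open>y / t\<close>, so the required counts cannot be negative.\<close>
  have w0: "0 \<le> w i" if "i < t" for i
  proof -
    have "s + T \<le> q / t" using T(2) t by (simp add: q_def field_simps)
    also have "\<dots> \<le> y / t" using yq by (intro divide_right_mono) auto
    finally show ?thesis using wd[OF that] unfolding abs_le_iff by linarith
  qed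
  define v where "v i = nat \<lfloor>w i\<rfloor>" for i
  have v: "real (v i) = w i" if "i < t" for i unfolding v_def using w0[OF that] by (intro nat_floor_Ints wI)
  have vsum: "(\<Sum>i<t. v i) = y"
  proof -
    have "real (\<Sum>i<t. v i) = (\<Sum>i<t. w i)" using v by simp
    also have "\<dots> = (\<Sum>c\<in>A. e c * real (\<Sum>i<t. cnt g {c..<c + d c} i))"
      unfolding w_def by (subst sum.swap) (simp add: sum_distrib_left)
    also have "\<dots> = (\<Sum>c\<in>A. e c * real (d c))"
    proof (intro sum.cong refl)
      fix c assume c: "c \<in> A"
      have "c + d c < ?n" using \<delta>n[of c] \<delta>A[OF c] c by (simp add: A_def)
      then have "{c..<c + d c} \<subseteq> {..<?n}" by auto
      from sum_cnt[OF g(1) this] show "e c * real (\<Sum>i<t. cnt g {c..<c + d c} i) = e c * real (d c)" by simp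
    qed
    finally have "real (\<Sum>i<t. v i) = real y" unfolding y yr_def .
    then show ?thesis by (simp only: of_nat_eq_iff)
  qed
  have fair: "halves t m (shift_cuts \<delta> S) (override_on g f {X..<?n})"
    if f: "\<forall>i<t. cnt f {X..<X + y} i = v i" for f
    unfolding halves_def
  proof (intro allI impI)
    fix i assume i: "i < t"
    define h where "h = override_on g f {X..<?n}"
    have side: "{p \<in> {p \<in> {..<?n}. h p = i}. p \<in> side ?n S'} = {p \<in> side ?n S'. h p = i}" for S'
      using side_subset[of ?n S'] by blast
    have W: "card {p \<in> {p \<in> {..<?n}. h p = i}. p \<in> {c..<c + \<delta> c}} = cnt h {c..<c + \<delta> c} i" if "c \<in> S" for c
      unfolding cnt_def using \<delta>n[OF that] by (intro arg_cong[where f = card]) auto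
    have "real (cnt h (side ?n (shift_cuts \<delta> S)) i) = real (cnt h (side ?n S) i)
        + (\<Sum>c\<in>S. parity S c * real (card {p \<in> {p \<in> {..<?n}. h p = i}. p \<in> {c..<c + \<delta> c}}))"
      using card_side_shift[OF p(1) sp, of "{p \<in> {..<?n}. h p = i}" ?n] unfolding side cnt_def by blast
    also have "(\<Sum>c\<in>S. parity S c * real (card {p \<in> {p \<in> {..<?n}. h p = i}. p \<in> {c..<c + \<delta> c}}))
        = (\<Sum>c\<in>S. parity S c * real (cnt h {c..<c + \<delta> c} i))"
      by (intro sum.cong refl) (simp only: W)
    also have "\<dots> = real (cnt h {X..<X + \<delta> X} i) - (\<Sum>c\<in>A. e c * real (cnt h {c..<c + \<delta> c} i))" by (rule esum)
    also have "(\<Sum>c\<in>A. e c * real (cnt h {c..<c + \<delta> c} i)) = w i"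
      unfolding w_def
    proof (intro sum.cong refl)
      fix c assume c: "c \<in> A"
      have "c + d c \<le> X" using AXL[OF c] \<delta>L[of c] \<delta>A[OF c] c by (simp add: A_def)
      then have "{X..<?n} \<inter> {c..<c + d c} = {}" by auto
      then show "e c * real (cnt h {c..<c + \<delta> c} i) = e c * real (cnt g {c..<c + d c} i)"
        unfolding h_def \<delta>A[OF c] by simp
    qed
    also have "cnt h {X..<X + \<delta> X} i = v i"
    proof -
      have "{X..<X + y} \<subseteq> {X..<?n}" using \<delta>n[OF XS] unfolding \<delta>X by auto
      then show ?thesis using f i unfolding h_def \<delta>X by simp
    qed
    also have "cnt h (side ?n S) i = m"
    proof -
      have "{X..<?n} \<inter> side ?n S = {}" using side_before_Max[OF p(1,2), of ?n] unfolding X_def by auto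
      then show ?thesis using g(2) i unfolding h_def halves_def by simp
    qed
    finally show "cnt (override_on g f {X..<?n}) (side ?n (shift_cuts \<delta> S)) i = m"
      using v[OF i] unfolding h_def[symmetric] by linarith
  qed
  show ?thesis
    unfolding X_def[symmetric] \<delta>_def[symmetric]
  proof (intro exI[where x = y] exI[where x = v], unfold \<delta>_def[symmetric], intro conjI)
    show "shift_cuts \<delta> S \<in> cut_sets t m s" by (rule cut)
    show "\<forall>c\<in>S. \<delta> c < 4 ^ L" using \<delta>L by blast
    show "4 ^ k \<le> y" "y < 4 ^ Suc k" using yq by (simp_all add: q_def)
    show "sum v {..<t} = y" by (rule vsum)
    show "\<forall>i<t. \<bar>real (v i) - y / t\<bar> \<le> s + T" using wd v by simp
    show "\<forall>f. (\<forall>i<t. cnt f {X..<X + y} i = v i) \<longrightarrow> halves t m (shift_cuts \<delta> S) (override_on g f {X..<?n})"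
      using fair by blast
  qed
qed

text \<open>One cut has \<open>4 ^ k\<close> choices, each of the remaining \<open>s - 2\<close> at
  least \<open>4 ^ k / s\<close>.\<close>

lemma card_shifts:
  assumes S: "S \<in> cut_sets t m s" "2 \<le> s"
  shows "finite (shifts S k)" "((4::real) ^ k) ^ (s - 1) / real s ^ (s - 2) \<le> real (card (shifts S k))"
proof -
  define A where "A = S - {Max S}"
  define c0 where "c0 = Max A"
  define q where "q = (4::nat) ^ k"
  have s1: "1 \<le> s" using S(2) by simp
  note p = cut_sets_props[OF S(1) s1]
  have fA: "finite A" using p by (simp add: A_def)
  have cA: "card A = s - 1" using p by (simp add: A_def)
  then have "A \<noteq> {}" using S(2) by auto
  then have c0: "c0 \<in> A" using fA by (simp add: c0_def)
  have sh: "shifts S k = (\<Pi>\<^sub>E c\<in>A. if c = c0 then {2 * q..<3 * q} else {0..q div s})"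
    unfolding shifts_def A_def[symmetric] c0_def[symmetric] q_def[symmetric] p(4) ..
  show "finite (shifts S k)" unfolding sh using fA by (intro finite_PiE) auto
  have "card (shifts S k) = (\<Prod>c\<in>A. card (if c = c0 then {2 * q..<3 * q} else {0..q div s}))"
    unfolding sh by (rule card_PiE[OF fA])
  also have "\<dots> = q * (\<Prod>c\<in>A - {c0}. card (if c = c0 then {2 * q..<3 * q} else {0..q div s}))"
    by (subst prod.remove[OF fA c0]) simp
  also have "(\<Prod>c\<in>A - {c0}. card (if c = c0 then {2 * q..<3 * q} else {0..q div s})) = (\<Prod>c\<in>A - {c0}. q div s + 1)"
    by (intro prod.cong) auto
  also have "\<dots> = (q div s + 1) ^ (s - 2)" using cA c0 by (simp add: numeral_2_eq_2)
  finally have card: "real (card (shifts S k)) = real q * (real (q div s + 1)) ^ (s - 2)" by simp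
  have "q < s * (q div s) + s" using dividend_less_times_div[of s q] s1 by simp
  then have "real q < real (s * (q div s) + s)" by (simp only: of_nat_less_iff)
  then have qs: "real q / s \<le> real (q div s + 1)" using s1 by (simp add: field_simps)
  have "Suc (s - 2) = s - 1" using S(2) by simp
  then have "(real q) ^ (s - 1) = real q * real q ^ (s - 2)" by (metis power_Suc)
  then have "(real q) ^ (s - 1) / real s ^ (s - 2) = real q * (real q / s) ^ (s - 2)" by (simp add: power_divide)
  also have "\<dots> \<le> real (card (shifts S k))"
    unfolding card using qs by (intro mult_left_mono power_mono) auto
  finally show "((4::real) ^ k) ^ (s - 1) / real s ^ (s - 2) \<le> real (card (shifts S k))" by (simp add: q_def)
qed

lemma balanced_override:
  fixes X :: nat
  assumes "X \<le> 2 * t * m" "\<forall>i<t. cnt g {..<X} i \<le> 2 * m"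
  shows "balanced t m (override_on g f {X..<2 * t * m}) \<longleftrightarrow> (\<forall>i<t. cnt f {X..<2 * t * m} i = 2 * m - cnt g {..<X} i)"
proof -
  have un: "{..<2 * t * m} = {..<X} \<union> {X..<2 * t * m}" using assms(1) by auto
  have "cnt (override_on g f {X..<2 * t * m}) {..<2 * t * m} i = cnt g {..<X} i + cnt f {X..<2 * t * m} i" for i
  proof -
    have "cnt (override_on g f {X..<2 * t * m}) ({..<X} \<union> {X..<2 * t * m}) i =
        cnt (override_on g f {X..<2 * t * m}) {..<X} i + cnt (override_on g f {X..<2 * t * m}) {X..<2 * t * m} i"
      by (rule cnt_Un) auto
    moreover have "{X..<2 * t * m} \<inter> {..<X} = {}" by auto
    ultimately show ?thesis unfolding un[symmetric] by simp
  qed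
  then show ?thesis unfolding balanced_def using assms(2) by fastforce
qed

lemma shifts_scale_determined:
  assumes "2 * 4 ^ k \<le> x" "x < 3 * 4 ^ k" "2 * 4 ^ k' \<le> x" "x < 3 * (4::nat) ^ k'"
  shows "k = k'"
proof -
  have False if "a < b" "x < 3 * 4 ^ a" "2 * 4 ^ b \<le> x" for a b
  proof -
    have "(4::nat) ^ Suc a \<le> 4 ^ b" using that(1) by (intro power_increasing) auto
    then show False using that(2,3) by simp
  qed
  then show ?thesis using assms by (meson linorder_neqE_nat)
qed

text \<open>At a good scale \<open>k\<close>, of the order of \<open>4 ^ (k * (s - 1))\<close>
  shifted sets become fair with probability of order \<open>4 ^ (- k * (s - 1))\<close> each: the
  local bound applies to the fresh letters passed by the last cut, and \<open>pr_cond_lower\<close>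
  keeps the balance condition at the cost of a factor 2. Sets from different scales are distinct, so
  the contributions of order \<open>L\<close> scales add up.\<close>

lemma many_shifts:
  assumes t: "t = 2 * s - 1" and s: "2 \<le> s"
  shows "\<exists>c>0. \<exists>L0. \<forall>L\<ge>L0. \<forall>m S g. S \<in> cut_sets t m s \<longrightarrow> g \<in> words t (2 * t * m) \<longrightarrow> halves t m S g \<longrightarrow>
    good_cuts t m L S g \<longrightarrow>
    c * real L * pr t (2 * t * m) (\<lambda>f. balanced t m (override_on g f {Max S..<2 * t * m}))
      \<le> (\<Sum>S'\<in>cut_sets t m s. pr t (2 * t * m) (\<lambda>f. balanced t m (override_on g f {Max S..<2 * t * m}) \<and>
          halves t m S' (override_on g f {Max S..<2 * t * m})))"
proof -
  have t1: "t \<ge> 1" "t - 1 = 2 * (s - 1)" using t s by auto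
  define B where "B = scale_bound t s"
  have B0: "0 < B" unfolding B_def scale_bound_def by (rule add_pos_nonneg) auto
  \<comment> \<open>The prescribed counts deviate by at most \<open>s + 8 * B * 2 ^ k\<close>, hence
    by at most \<open>K * 2 ^ k\<close>, and \<open>2 ^ k \<le> sqrt y\<close>.\<close>
  define K where "K = s + 8 * B"
  have K0: "0 \<le> K" using B0 by (simp add: K_def)
  obtain c1 a0 where c1: "c1 > 0" and lower: "\<And>n A d. A \<subseteq> {..<n} \<Longrightarrow> a0 \<le> card A \<Longrightarrow>
      (\<Sum>i<t. d i) = card A \<Longrightarrow> (\<forall>i<t. \<bar>real (d i) - card A / t\<bar> \<le> K * sqrt (card A)) \<Longrightarrow>
      c1 / sqrt (real (card A) + 1) ^ (t - 1) \<le> pr t n (\<lambda>f. \<forall>i<t. cnt f A i = d i)"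
    using local_lower[OF t1(1) K0] by blast
  \<comment> \<open>From this scale on, \<open>y\<close> is large enough for the local bound and the
    deviation \<open>K * 2 ^ k\<close> is at most \<open>4 ^ k / t\<close>, as
    \<open>shifted_halves\<close> requires.\<close>
  define k0 where "k0 = a0 + nat \<lceil>t * K\<rceil>"
  have k0: "a0 \<le> 4 ^ k" "t * K \<le> 2 ^ k" if "k0 \<le> k" for k
  proof -
    have "k < 2 ^ k" by (rule less_exp)
    then have "real k < 2 ^ k" by (metis of_nat_less_iff of_nat_power of_nat_numeral)
    moreover have "t * K \<le> real (nat \<lceil>t * K\<rceil>)" by linarith
    moreover have "nat \<lceil>t * K\<rceil> \<le> k" using that unfolding k0_def by linarith
    then have "real (nat \<lceil>t * K\<rceil>) \<le> real k" by (simp only: of_nat_le_iff)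
    ultimately show "t * K \<le> 2 ^ k" by linarith
    have "(2::nat) ^ k \<le> 4 ^ k" by (rule power_mono) auto
    then show "a0 \<le> 4 ^ k" using \<open>k < 2 ^ k\<close> that unfolding k0_def by linarith
  qed
  define c2 where "c2 = c1 / (2 * 4 ^ (s - 1) * real s ^ (s - 2))"
  have c2: "c2 > 0" using c1 s by (simp add: c2_def)
  show ?thesis
  \<comment> \<open>At least \<open>L / 2\<close> scales are good, and \<open>4 * k0 \<le> L\<close>
    leaves at least \<open>L / 4\<close> of them beyond \<open>k0\<close>; this is the 4 in
    \<open>c2 / 4\<close>. The summand \<open>t + 2\<close> ensures
    \<open>4 * t \<le> M\<^sup>2\<close>.\<close>
  proof (intro exI[where x = "c2 / 4"] exI[where x = "4 * k0 + t + 2"] conjI allI impI)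
    show "0 < c2 / 4" using c2 by simp
  next
    fix L m S g
    assume L: "4 * k0 + t + 2 \<le> L" and S: "S \<in> cut_sets t m s" and g: "g \<in> words t (2 * t * m)" "halves t m S g"
      and good: "good_cuts t m L S g"
    let ?n = "2 * t * m"
    define X where "X = Max S"
    define A where "A = S - {X}"
    define M where "M = (4::nat) ^ L"
    define J where "J = {X..<?n}"
    have s1: "1 \<le> s" using s by simp
    note p = cut_sets_props[OF S s1]
    note good' = good[unfolded good_cuts_def p(4)]
    have gap: "\<forall>c\<in>S. \<forall>b\<in>S. c < b \<longrightarrow> c + 4 ^ L \<le> b" using conjunct1[OF good'] .
    have late: "X + M ^ 4 \<le> ?n"
      unfolding X_def M_def using conjunct1[OF conjunct2[OF good']] .
    have rem: "\<forall>i<t. \<bar>dev t g i 0 X\<bar> \<le> real (?n - X) / (4 * real t * real M)"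
      unfolding X_def M_def using conjunct1[OF conjunct2[OF conjunct2[OF good']]] .
    have many: "L \<le> 2 * card {k \<in> {..<L}. (\<Sum>j\<le>k. scale_dev t g A j) \<le> 8 * B * 2 ^ k}"
      unfolding A_def X_def B_def using conjunct2[OF conjunct2[OF conjunct2[OF good']]] .
    have M1: "1 \<le> M" by (simp add: M_def)
    have MM: "M \<le> M ^ 4" using power_increasing[of 1 4 M] M1 by simp
    have lateM: "Max S + 4 ^ L \<le> ?n" using late MM unfolding X_def M_def by linarith
    have cJ: "card J = ?n - X" by (simp add: J_def)
    have JR: "4 * t * M\<^sup>2 \<le> card J"
    proof -
      have "4 * t \<le> 4 * 2 ^ t" using less_exp[of t] by simp
      also have "\<dots> = 2 ^ (t + 2)" by (simp add: power_add)
      also have "\<dots> \<le> 2 ^ (4 * L)" using L by (intro power_increasing) auto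
      also have "\<dots> = M\<^sup>2"
      proof -
        have "(2::nat) ^ (4 * L) = (2 ^ 4) ^ L" by (rule power_mult)
        moreover have "M\<^sup>2 = (4\<^sup>2) ^ L" unfolding M_def by (simp only: power_mult[symmetric] mult.commute)
        ultimately show ?thesis by simp
      qed
      finally have "4 * t * M\<^sup>2 \<le> M\<^sup>2 * M\<^sup>2" by (rule mult_right_mono) simp
      also have "\<dots> = M ^ 4" by (simp add: power2_eq_square power4_eq_xxxx)
      finally show ?thesis using late cJ by linarith
    qed
    have Xn: "X \<le> ?n" using late by linarith
    have dX: "dev t g i 0 X = cnt g {..<X} i - X / t" for i by (simp add: dev_def atLeast0LessThan)
    have gX: "cnt g {..<X} i \<le> 2 * m" if i: "i < t" for i
    proof -
      have "cnt g {..<X} i - X / t \<le> real (?n - X) / (4 * real t * real M)"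
        using rem[rule_format, OF i] unfolding abs_le_iff dX by linarith
      also have "\<dots> \<le> real (?n - X) / (1 * real t)"
      proof (rule divide_left_mono)
        have "real t * 1 \<le> real t * (4 * real M)" using M1 by (intro mult_left_mono) auto
        then show "1 * real t \<le> 4 * real t * real M" by (simp add: mult_ac)
        show "0 < 4 * real t * real M * (1 * real t)" using t1(1) M1 by (intro mult_pos_pos) auto
      qed simp
      also have "\<dots> = 2 * real m - X / t"
        using Xn t1 by (simp add: of_nat_diff field_simps)
      finally have "real (cnt g {..<X} i) \<le> real (2 * m)" by simp
      then show ?thesis by (simp only: of_nat_le_iff)
    qed
    define r where "r i = 2 * m - cnt g {..<X} i" for i
    define h where "h f = override_on g f J" for f
    have bal: "balanced t m (h f) \<longleftrightarrow> (\<forall>i<t. cnt f J i = r i)" for f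
      unfolding h_def J_def r_def using Xn gX by (intro balanced_override) auto
    have rsum: "(\<Sum>i<t. r i) = card J"
    proof -
      have "(\<Sum>i<t. r i) + (\<Sum>i<t. cnt g {..<X} i) = (\<Sum>i<t. 2 * m)"
        unfolding sum.distrib[symmetric] r_def using gX by (intro sum.cong) auto
      moreover have "{..<X} \<subseteq> {..<?n}" using Xn by auto
      then have "(\<Sum>i<t. cnt g {..<X} i) = X" using sum_cnt[OF g(1)] by simp
      ultimately show ?thesis using cJ by (simp add: mult_ac)
    qed
    have rdev: "\<bar>real (r i) - real (card J) / real t\<bar> \<le> real (card J) / (4 * real t * real M)" if i: "i < t" for i
    proof -
      have "real (r i) = 2 * real m - cnt g {..<X} i" unfolding r_def using gX[OF i] by (simp add: of_nat_diff)
      moreover have "real (card J) / t = 2 * real m - X / t"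
        using cJ Xn t1 by (simp add: of_nat_diff field_simps)
      ultimately have eq: "real (r i) - real (card J) / real t = - dev t g i 0 X"
        using dX[of i] by linarith
      show ?thesis unfolding eq abs_minus_cancel unfolding cJ using rem i by blast
    qed
    define pJ where "pJ = pr t ?n (\<lambda>f. balanced t m (h f))"
    have pJ0: "0 \<le> pJ" unfolding pJ_def by (rule pr_nonneg)
    have pJ': "pJ = pr t ?n (\<lambda>f. \<forall>i<t. cnt f J i = r i)" unfolding pJ_def bal ..
    define Ks where "Ks = {k \<in> {k0..<L}. (\<Sum>j\<le>k. scale_dev t g A j) \<le> 8 * B * 2 ^ k}"
    have cK: "L \<le> 4 * card Ks"
    proof -
      have "card {k \<in> {..<L}. (\<Sum>j\<le>k. scale_dev t g A j) \<le> 8 * B * 2 ^ k} \<le> card ({..<k0} \<union> Ks)"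
        by (intro card_mono) (auto simp: Ks_def)
      also have "\<dots> \<le> k0 + card Ks" using card_Un_le[of "{..<k0}" Ks] by simp
      finally show ?thesis using many L by linarith
    qed
    define I where "I = (SIGMA k:Ks. shifts S k)"
    have fI: "finite I" 
      unfolding I_def by (intro finite_SigmaI card_shifts(1)[OF S s]) (simp add: Ks_def)
    define Sh where "Sh kd y = shift_cuts ((snd kd)(X := y)) S" for kd :: "nat \<times> (nat \<Rightarrow> nat)" and y
    let ?P = "\<lambda>kd y v. Sh kd y \<in> cut_sets t m s \<and> (\<forall>c\<in>S. ((snd kd)(X := y)) c < M) \<and>
      4 ^ fst kd \<le> y \<and> y < 4 ^ Suc (fst kd) \<and> (\<Sum>i<t. v i) = y \<and>
      (\<forall>i<t. \<bar>real (v i) - y / t\<bar> \<le> s + 8 * B * 2 ^ fst kd) \<and>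
      (\<forall>f. (\<forall>i<t. cnt f {X..<X + y} i = v i) \<longrightarrow> halves t m (Sh kd y) (h f))"
    have "\<forall>kd\<in>I. \<exists>yv. ?P kd (fst yv) (snd yv)"
    proof
      fix kd assume "kd \<in> I"
      then obtain k d where kd: "kd = (k, d)" "k0 \<le> k" "k < L" "(\<Sum>j\<le>k. scale_dev t g A j) \<le> 8 * B * 2 ^ k" "d \<in> shifts S k"
        by (auto simp: I_def Ks_def)
      have "t * (s + 8 * B * 2 ^ k) \<le> t * (K * 2 ^ k)"
      proof (rule mult_left_mono)
        have "real s * 1 \<le> real s * 2 ^ k" by (intro mult_left_mono) auto
        then show "s + 8 * B * 2 ^ k \<le> K * 2 ^ k" unfolding K_def by (simp add: distrib_right)
      qed simp
      also have "\<dots> = t * K * 2 ^ k" by simp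
      also have "\<dots> \<le> 2 ^ k * 2 ^ k" using k0(2)[OF kd(2)] by (rule mult_right_mono) simp
      also have "\<dots> = 4 ^ k" by (simp flip: power_mult_distrib)
      finally have "t * (s + 8 * B * 2 ^ k) \<le> 4 ^ k" .
      moreover have "(\<Sum>j\<le>k. scale_dev t g (S - {Max S}) j) \<le> 8 * B * 2 ^ k"
        using kd(4) unfolding A_def X_def .
      ultimately have "\<exists>y v. ?P (k, d) y v"
        unfolding X_def Sh_def h_def J_def M_def fst_conv snd_conv
        using shifted_halves[OF t1(1) S s g gap lateM kd(3) _ _ kd(5)] by blast
      then obtain y v where "?P (k, d) y v" by blast
      then show "\<exists>yv. ?P kd (fst yv) (snd yv)" unfolding kd(1) by (intro exI[where x = "(y, v)"]) simp
    qed
    from bchoice[OF this] obtain yv where yv: "\<forall>kd\<in>I. ?P kd (fst (yv kd)) (snd (yv kd))" by blast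
    define y where "y kd = fst (yv kd)" for kd
    define v where "v kd = snd (yv kd)" for kd
    note P = yv[folded y_def v_def, rule_format]
    define \<Psi> where "\<Psi> kd = Sh kd (y kd)" for kd
    \<comment> \<open>The gaps exceed all shifts, so the shifted set reveals each single move; the
      move of the last but one cut then reveals the scale.\<close>
    have inj: "inj_on \<Psi> I"
    proof (rule inj_onI)
      fix a b assume a: "a \<in> I" and b: "b \<in> I" and eq: "\<Psi> a = \<Psi> b"
      obtain k d where kd: "a = (k, d)" "d \<in> shifts S k" using a by (auto simp: I_def)
      obtain k' d' where kd': "b = (k', d')" "d' \<in> shifts S k'" using b by (auto simp: I_def)
      have same: "(d(X := y a)) c = (d'(X := y b)) c" if "c \<in> S" for c
      proof (rule shift_cuts_determined[OF gap _ _ _ that])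
        show "\<forall>c\<in>S. (d(X := y a)) c < 4 ^ L" using P[OF a] by (simp add: kd(1) M_def)
        show "\<forall>c\<in>S. (d'(X := y b)) c < 4 ^ L" using P[OF b] by (simp add: kd'(1) M_def)
        show "shift_cuts (d(X := y a)) S = shift_cuts (d'(X := y b)) S"
          using eq unfolding \<Psi>_def Sh_def kd(1) kd'(1) by simp
      qed
      have sameA: "d c = d' c" if "c \<in> A" for c using same[of c] that by (auto simp: A_def)
      have fA: "finite A" using p by (simp add: A_def)
      have "card A = s - 1" using p by (simp add: A_def X_def)
      then have "A \<noteq> {}" using s by auto
      then have c0: "Max A \<in> A" using fA by simp
      have "d (Max A) \<in> {2 * 4 ^ k..<3 * 4 ^ k}" "d' (Max A) \<in> {2 * 4 ^ k'..<3 * 4 ^ k'}"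
        using PiE_mem[OF kd(2)[unfolded shifts_def X_def[symmetric] A_def[symmetric]] c0]
          PiE_mem[OF kd'(2)[unfolded shifts_def X_def[symmetric] A_def[symmetric]] c0] by simp_all
      then have kk: "k = k'" using sameA[OF c0] by (intro shifts_scale_determined[of k "d (Max A)" k']) auto
      have dS: "d \<in> shifts S k" "d' \<in> shifts S k" using kd(2) kd'(2) kk by simp_all
      have "d = d'"
        by (rule PiE_ext[OF dS[unfolded shifts_def X_def[symmetric] A_def[symmetric]]]) (use sameA in auto)
      then show "a = b" using kk by (simp add: kd kd')
    qed
    have each: "c1 / (2 * (4 * 4 ^ fst kd) ^ (s - 1)) * pJ \<le> pr t ?n (\<lambda>f. balanced t m (h f) \<and> halves t m (\<Psi> kd) (h f))"
      if kd: "kd \<in> I" for kd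
    proof -
      define k where "k = fst kd"
      have Q: "4 ^ k \<le> y kd" "y kd < 4 ^ Suc k" "(\<Sum>i<t. v kd i) = y kd"
        "\<forall>i<t. \<bar>real (v kd i) - y kd / t\<bar> \<le> s + 8 * B * 2 ^ k"
        "\<forall>f. (\<forall>i<t. cnt f {X..<X + y kd} i = v kd i) \<longrightarrow> halves t m (Sh kd (y kd)) (h f)"
        unfolding k_def using P[OF kd] by blast+
      have kk: "k0 \<le> k" "k < L" using kd by (auto simp: I_def Ks_def k_def)
      have yM: "y kd \<le> M"
      proof -
        have "(4::nat) ^ Suc k \<le> 4 ^ L" using kk by (intro power_increasing) auto
        then show ?thesis using Q(2) unfolding M_def by linarith
      qed
      let ?Y = "{X..<X + y kd}"
      have YJ: "?Y \<subseteq> J" "J \<subseteq> {..<?n}" using yM MM late by (auto simp: J_def)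
      have cY: "card ?Y = y kd" by simp
      have low: "c1 / sqrt (real (card ?Y) + 1) ^ (t - 1) \<le> pr t ?n (\<lambda>f. \<forall>i<t. cnt f ?Y i = v kd i)"
      proof (rule lower)
        show "?Y \<subseteq> {..<?n}" using YJ by blast
        show "a0 \<le> card ?Y" unfolding cY using k0(1)[OF kk(1)] Q(1) by linarith
        show "(\<Sum>i<t. v kd i) = card ?Y" unfolding cY by (rule Q(3))
        have sq: "2 ^ k \<le> sqrt (y kd)"
        proof (rule real_le_rsqrt)
          have "((2::real) ^ k)\<^sup>2 = 4 ^ k" by (simp add: power2_eq_square flip: power_mult_distrib)
          also have "\<dots> = real (4 ^ k)" by simp
          also have "\<dots> \<le> real (y kd)" using Q(1) by (simp only: of_nat_le_iff)
          finally show "(2 ^ k)\<^sup>2 \<le> real (y kd)" .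
        qed
        have sK: "s + 8 * B * 2 ^ k \<le> K * sqrt (y kd)"
        proof -
          have "real s * 1 \<le> real s * 2 ^ k" by (intro mult_left_mono) auto
          then have "s + 8 * B * 2 ^ k \<le> K * 2 ^ k" unfolding K_def by (simp add: distrib_right)
          also have "\<dots> \<le> K * sqrt (y kd)" using sq K0 by (rule mult_left_mono)
          finally show ?thesis .
        qed
        show "\<forall>i<t. \<bar>real (v kd i) - card ?Y / t\<bar> \<le> K * sqrt (card ?Y)"
          unfolding cY using Q(4) sK by (meson order_trans)
      qed
      have sqp: "sqrt (real (card ?Y) + 1) ^ (t - 1) \<le> (4 * 4 ^ k) ^ (s - 1)"
      proof -
        have "sqrt (real (y kd) + 1) ^ (t - 1) = (real (y kd) + 1) ^ (s - 1)"
          unfolding t1(2) power_mult by simp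
        also have "\<dots> \<le> (4 * 4 ^ k) ^ (s - 1)"
        proof (rule power_mono)
          have "y kd + 1 \<le> 4 * 4 ^ k" using Q(2) by simp
          then have "real (y kd + 1) \<le> real (4 * 4 ^ k)" by (simp only: of_nat_le_iff)
          then show "real (y kd) + 1 \<le> 4 * 4 ^ k" by simp
        qed simp
        finally show ?thesis unfolding cY .
      qed
      have "c1 / (2 * (4 * 4 ^ k) ^ (s - 1)) * pJ = c1 / (4 * 4 ^ k) ^ (s - 1) / 2 * pJ" by simp
      also have "\<dots> \<le> pr t ?n (\<lambda>f. \<forall>i<t. cnt f ?Y i = v kd i) / 2 * pJ"
      proof (rule mult_right_mono[OF divide_right_mono pJ0])
        have "0 < sqrt (real (card ?Y) + 1) ^ (t - 1)" by (intro zero_less_power) simp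
        then have "c1 / (4 * 4 ^ k) ^ (s - 1) \<le> c1 / sqrt (real (card ?Y) + 1) ^ (t - 1)"
          using c1 by (intro divide_left_mono[OF sqp] mult_pos_pos) auto
        then show "c1 / (4 * 4 ^ k) ^ (s - 1) \<le> pr t ?n (\<lambda>f. \<forall>i<t. cnt f ?Y i = v kd i)"
          using low by (rule order_trans)
      qed simp
      also have "\<dots> \<le> pr t ?n (\<lambda>f. (\<forall>i<t. cnt f ?Y i = v kd i) \<and> (\<forall>i<t. cnt f J i = r i))"
        unfolding pJ'
      proof (rule pr_cond_lower[OF t1(1) YJ M1 _ JR _ rsum rdev])
        show "card ?Y \<le> M" unfolding cY by (rule yM)
        show "(\<Sum>i<t. v kd i) = card ?Y" unfolding cY by (rule Q(3))
      qed
      also have "\<dots> \<le> pr t ?n (\<lambda>f. balanced t m (h f) \<and> halves t m (\<Psi> kd) (h f))"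
        unfolding bal \<Psi>_def using Q(5) by (intro pr_mono) blast
      finally show ?thesis unfolding k_def .
    qed
    have "c2 / 4 * real L * pJ \<le> c2 * real (card Ks) * pJ"
    proof -
      have "c2 / 4 * real L * pJ = c2 * pJ / 4 * real L" by simp
      also have "\<dots> \<le> c2 * pJ / 4 * real (4 * card Ks)"
        using cK c2 pJ0 by (intro mult_left_mono) simp_all
      also have "\<dots> = c2 * real (card Ks) * pJ" by simp
      finally show ?thesis .
    qed
    also have "\<dots> = (\<Sum>k\<in>Ks. c2 * pJ)" by simp
    also have "\<dots> \<le> (\<Sum>k\<in>Ks. \<Sum>d\<in>shifts S k. c1 / (2 * (4 * 4 ^ k) ^ (s - 1)) * pJ)"
    proof (rule sum_mono)
      fix k
      have "c2 * pJ = ((4::real) ^ k) ^ (s - 1) / real s ^ (s - 2) * (c1 / (2 * (4 * 4 ^ k) ^ (s - 1)) * pJ)"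
      proof -
        define x where "x = ((4::real) ^ k) ^ (s - 1)"
        have "(4 * (4::real) ^ k) ^ (s - 1) = 4 ^ (s - 1) * x" by (simp only: x_def power_mult_distrib)
        moreover have "x \<noteq> 0" by (simp add: x_def)
        ultimately show ?thesis unfolding x_def[symmetric] c2_def by simp
      qed
      also have "\<dots> \<le> real (card (shifts S k)) * (c1 / (2 * (4 * 4 ^ k) ^ (s - 1)) * pJ)"
        using c1 pJ0 by (intro mult_right_mono card_shifts(2)[OF S s] mult_nonneg_nonneg divide_nonneg_nonneg) auto
      finally show "c2 * pJ \<le> (\<Sum>d\<in>shifts S k. c1 / (2 * (4 * 4 ^ k) ^ (s - 1)) * pJ)" by simp
    qed
    also have "\<dots> = (\<Sum>kd\<in>I. c1 / (2 * (4 * 4 ^ fst kd) ^ (s - 1)) * pJ)"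
      unfolding I_def
      by (subst sum.Sigma) (auto simp: Ks_def card_shifts(1)[OF S s] intro!: sum.cong)
    also have "\<dots> \<le> (\<Sum>kd\<in>I. pr t ?n (\<lambda>f. balanced t m (h f) \<and> halves t m (\<Psi> kd) (h f)))"
      by (rule sum_mono, rule each)
    also have "\<dots> = (\<Sum>S'\<in>\<Psi> ` I. pr t ?n (\<lambda>f. balanced t m (h f) \<and> halves t m S' (h f)))"
      by (subst sum.reindex[OF inj]) (simp only: o_def)
    also have "\<dots> \<le> (\<Sum>S'\<in>cut_sets t m s. pr t ?n (\<lambda>f. balanced t m (h f) \<and> halves t m S' (h f)))"
    proof (rule sum_mono2)
      show "\<Psi> ` I \<subseteq> cut_sets t m s"
      proof (rule image_subsetI)
        fix kd assume "kd \<in> I"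
        from P[OF this] show "\<Psi> kd \<in> cut_sets t m s" unfolding \<Psi>_def by blast
      qed
    qed (auto intro: pr_nonneg)
    finally show "c2 / 4 * real L * pr t ?n (\<lambda>f. balanced t m (override_on g f {Max S..<?n}))
      \<le> (\<Sum>S'\<in>cut_sets t m s. pr t ?n (\<lambda>f. balanced t m (override_on g f {Max S..<?n}) \<and>
          halves t m S' (override_on g f {Max S..<?n})))"
      unfolding pJ_def h_def J_def X_def .
  qed
qed

section \<open>The critical upper bound\<close>

lemma halves_depends:
  assumes "finite S" "S \<noteq> {}"
  shows "depends_on {..<Max S} (halves t m S)"
  unfolding halves_def[abs_def]
  by (rule depends_on_mono[OF depends_cnt_eq side_before_Max[OF assms]])

text \<open>The pieces inspected to the right of an earlier cut end within \<open>4 ^ L\<close>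
  beads, and the gaps place this before the last cut. The gap condition does not involve the word,
  so its failure is a trivial case.\<close>

lemma good_cuts_depends:
  assumes S: "finite S" "S \<noteq> {}"
  shows "depends_on {..<Max S} (good_cuts t m L S)"
  unfolding depends_on_def
proof (intro allI impI)
  fix f g :: "nat \<Rightarrow> nat" assume eq: "\<forall>p\<in>{..<Max S}. f p = g p"
  show "good_cuts t m L S f = good_cuts t m L S g"
  proof (cases "\<forall>c\<in>S. \<forall>b\<in>S. c < b \<longrightarrow> c + 4 ^ L \<le> b")
    case False
    then show ?thesis unfolding good_cuts_def by blast
  next
    case True
    have dev: "dev t f i 0 (Max S) = dev t g i 0 (Max S)" for i
    proof -
      have "depends_on {..<Max S} (\<lambda>f. dev t f i 0 (Max S))" by (rule dev_depends) auto
      then show ?thesis using eq unfolding depends_on_def by blast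
    qed
    have scale: "scale_dev t f (S - {Max S}) j = scale_dev t g (S - {Max S}) j" if "j < L" for j
    proof -
      have "(\<Union>c\<in>S - {Max S}. {c + 4 ^ j..<c + 4 ^ Suc j}) \<subseteq> {..<Max S}"
      proof (rule UN_least)
        fix c assume "c \<in> S - {Max S}"
        then have c: "c \<in> S" "c < Max S" using Max_ge[OF S(1), of c] by (auto simp: le_neq_implies_less)
        have "c + 4 ^ L \<le> Max S" using True c Max_in[OF S] by blast
        moreover have "(4::nat) ^ Suc j \<le> 4 ^ L" using that by (intro power_increasing) auto
        ultimately show "{c + 4 ^ j..<c + 4 ^ Suc j} \<subseteq> {..<Max S}" by auto
      qed
      from depends_on_mono[OF scale_dev_depends this] show ?thesis
        using eq unfolding depends_on_def by blast
    qed
    have "(\<Sum>j\<le>k. scale_dev t f (S - {Max S}) j) = (\<Sum>j\<le>k. scale_dev t g (S - {Max S}) j)" if "k < L" for k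
      using that by (intro sum.cong refl scale) auto
    then have "{k \<in> {..<L}. (\<Sum>j\<le>k. scale_dev t f (S - {Max S}) j) \<le> 8 * scale_bound t (card S) * 2 ^ k}
      = {k \<in> {..<L}. (\<Sum>j\<le>k. scale_dev t g (S - {Max S}) j) \<le> 8 * scale_bound t (card S) * 2 ^ k}"
      by (intro Collect_cong) (metis lessThan_iff)
    then show ?thesis unfolding good_cuts_def dev by (simp only:)
  qed
qed

text \<open>The word is read up to the smallest last cut \<open>x\<close> of a good fair set. This event does not depend on
  the beads from \<open>x\<close> on, so they are still free and provide \<open>c\<close> fair sets on average.\<close>

lemma pr_good_fair:
  assumes t: "t \<ge> 1" "m \<ge> 1" and s: "1 \<le> s" and c: "0 \<le> c"
    and many: "\<And>S g. S \<in> cut_sets t m s \<Longrightarrow> g \<in> words t (2 * t * m) \<Longrightarrow> halves t m S g \<Longrightarrow> good_cuts t m L S g \<Longrightarrow>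
      c * pr t (2 * t * m) (\<lambda>f. balanced t m (override_on g f {Max S..<2 * t * m}))
        \<le> (\<Sum>S'\<in>cut_sets t m s. pr t (2 * t * m) (\<lambda>f. balanced t m (override_on g f {Max S..<2 * t * m}) \<and>
            halves t m S' (override_on g f {Max S..<2 * t * m})))"
  shows "c * pr t (2 * t * m) (\<lambda>f. \<exists>S\<in>cut_sets t m s. balanced t m f \<and> halves t m S f \<and> good_cuts t m L S f)
    \<le> (2 * real t * real m) ^ (s - 1) * (ub2 t / real m ^ (t - 1))"
proof -
  let ?n = "2 * t * m"
  let ?C = "cut_sets t m s"
  define G where "G x f \<longleftrightarrow> (\<exists>S\<in>?C. Max S = x \<and> halves t m S f \<and> good_cuts t m L S f)" for x :: nat and f
  define F where "F x f \<longleftrightarrow> G x f \<and> (\<forall>x'<x. \<not> G x' f)" for x f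
  have dG: "depends_on {..<x} (G x)" for x
    unfolding depends_on_def
  proof (intro allI impI)
    fix f g :: "nat \<Rightarrow> nat" assume eq: "\<forall>p\<in>{..<x}. f p = g p"
    have "halves t m S f = halves t m S g \<and> good_cuts t m L S f = good_cuts t m L S g"
      if "S \<in> ?C" "Max S = x" for S
    proof -
      note p = cut_sets_props(1,2)[OF that(1) s]
      show ?thesis
        using halves_depends[OF p, of t m] good_cuts_depends[OF p, of t m L] eq that(2)
        unfolding depends_on_def by blast
    qed
    then show "G x f = G x g" unfolding G_def by blast
  qed
  have dF: "depends_on {..<x} (F x)" for x
    unfolding depends_on_def
  proof (intro allI impI)
    fix f g :: "nat \<Rightarrow> nat" assume eq: "\<forall>p\<in>{..<x}. f p = g p"
    have "G x' f = G x' g" if "x' \<le> x" for x'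
    proof -
      have "\<forall>p\<in>{..<x'}. f p = g p" using eq that by simp
      with dG[of x'] show ?thesis unfolding depends_on_def by blast
    qed
    then show "F x f = F x g" unfolding F_def by (meson order_refl less_imp_le)
  qed
  have step: "c * pr t ?n (\<lambda>f. balanced t m f \<and> F x f) \<le> (\<Sum>S'\<in>?C. pr t ?n (\<lambda>f. (balanced t m f \<and> halves t m S' f) \<and> F x f))" for x
  proof -
    let ?h = "\<lambda>g f. override_on g f {x..<?n}"
    have Fh: "F x (?h g f) = F x g" for f g by (rule depends_on_override_off[OF dF]) auto
    have fub: "pr t ?n (\<lambda>f. Q f \<and> F x f) = avg t n' (\<lambda>g. pr t ?n (\<lambda>f. Q (?h g f) \<and> F x g))" if "n' = ?n" for Q n'
      unfolding pr_def that by (subst avg_fubini[OF t(1), where A = "{x..<?n}"]) (simp only: Fh)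
    have "c * pr t ?n (\<lambda>f. balanced t m f \<and> F x f)
      = avg t ?n (\<lambda>g. c * pr t ?n (\<lambda>f. balanced t m (?h g f) \<and> F x g))"
      unfolding fub[OF refl] avg_cmult ..
    also have "\<dots> \<le> avg t ?n (\<lambda>g. \<Sum>S'\<in>?C. pr t ?n (\<lambda>f. (balanced t m (?h g f) \<and> halves t m S' (?h g f)) \<and> F x g))"
    proof (rule avg_mono)
      fix g assume g: "g \<in> words t ?n"
      show "c * pr t ?n (\<lambda>f. balanced t m (?h g f) \<and> F x g)
        \<le> (\<Sum>S'\<in>?C. pr t ?n (\<lambda>f. (balanced t m (?h g f) \<and> halves t m S' (?h g f)) \<and> F x g))"
      proof (cases "F x g")
        case True
        then obtain S where S: "S \<in> ?C" "Max S = x" "halves t m S g" "good_cuts t m L S g"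
          unfolding F_def G_def by blast
        from many[OF S(1) g S(3,4)] show ?thesis using True S(2) by simp
      next
        case False
        then have "pr t ?n (\<lambda>f. balanced t m (?h g f) \<and> F x g) = 0" by (simp add: pr_def avg_def)
        then show ?thesis by (simp add: sum_nonneg pr_nonneg)
      qed
    qed
    also have "\<dots> = (\<Sum>S'\<in>?C. pr t ?n (\<lambda>f. (balanced t m f \<and> halves t m S' f) \<and> F x f))"
      unfolding avg_sum fub[OF refl] ..
    finally show ?thesis .
  qed
  have "pr t ?n (\<lambda>f. \<exists>S\<in>?C. balanced t m f \<and> halves t m S f \<and> good_cuts t m L S f)
    \<le> pr t ?n (\<lambda>f. \<exists>x\<in>{..<?n}. balanced t m f \<and> F x f)"
  proof (rule pr_mono)
    fix f assume "\<exists>S\<in>?C. balanced t m f \<and> halves t m S f \<and> good_cuts t m L S f"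
    then obtain S where S: "S \<in> ?C" "balanced t m f" "halves t m S f" "good_cuts t m L S f" by blast
    then have ex: "G (Max S) f" unfolding G_def by blast
    define x where "x = (LEAST x. G x f)"
    have x: "G x f" unfolding x_def using ex by (rule LeastI)
    have "x \<le> Max S" unfolding x_def using ex by (rule Least_le)
    moreover have "Max S < ?n"
    proof -
      note p = cut_sets_props[OF S(1) s]
      show ?thesis using Max_in[OF p(1,2)] p(3) by blast
    qed
    moreover have "F x f" unfolding F_def using x not_less_Least[of _ "\<lambda>x. G x f"] unfolding x_def by blast
    ultimately show "\<exists>x\<in>{..<?n}. balanced t m f \<and> F x f" using S(2) by (intro bexI[of _ x]) auto
  qed
  also have "\<dots> \<le> (\<Sum>x<?n. pr t ?n (\<lambda>f. balanced t m f \<and> F x f))" by (rule pr_Ex) simp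
  finally have "c * pr t ?n (\<lambda>f. \<exists>S\<in>?C. balanced t m f \<and> halves t m S f \<and> good_cuts t m L S f)
    \<le> c * (\<Sum>x<?n. pr t ?n (\<lambda>f. balanced t m f \<and> F x f))"
    using c by (rule mult_left_mono)
  also have "\<dots> = (\<Sum>x<?n. c * pr t ?n (\<lambda>f. balanced t m f \<and> F x f))" by (rule sum_distrib_left)
  also have "\<dots> \<le> (\<Sum>x<?n. \<Sum>S'\<in>?C. pr t ?n (\<lambda>f. (balanced t m f \<and> halves t m S' f) \<and> F x f))"
    by (rule sum_mono, rule step)
  also have "\<dots> = (\<Sum>S'\<in>?C. \<Sum>x<?n. pr t ?n (\<lambda>f. (balanced t m f \<and> halves t m S' f) \<and> F x f))"
    by (rule sum.swap)
  \<comment> \<open>For a fixed \<open>S'\<close> the events \<open>F x\<close> exclude one another,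
    so summing over \<open>x\<close> costs nothing and the first moment bound applies once per cut
    set.\<close>
  also have "\<dots> \<le> (\<Sum>S'\<in>?C. ub2 t / m ^ (t - 1))"
  proof (rule sum_mono)
    fix S'
    have "(\<Sum>x<?n. pr t ?n (\<lambda>f. (balanced t m f \<and> halves t m S' f) \<and> F x f))
      \<le> pr t ?n (\<lambda>f. \<exists>x\<in>{..<?n}. (balanced t m f \<and> halves t m S' f) \<and> F x f)"
      by (rule pr_disjoint_Ex) (auto simp: F_def intro: linorder_neqE_nat)
    also have "\<dots> \<le> pr t ?n (\<lambda>f. balanced t m f \<and> halves t m S' f)"
      by (intro pr_mono) blast
    also have "\<dots> \<le> ub2 t / m ^ (t - 1)" by (rule pr_halves_upper'[OF t])
    finally show "(\<Sum>x<?n. pr t ?n (\<lambda>f. (balanced t m f \<and> halves t m S' f) \<and> F x f)) \<le> ub2 t / m ^ (t - 1)" .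
  qed
  also have "\<dots> = real (card ?C) * (ub2 t / m ^ (t - 1))" by simp
  also have "\<dots> \<le> real (?n ^ (s - 1)) * (ub2 t / m ^ (t - 1))"
  proof (rule mult_right_mono)
    show "real (card ?C) \<le> real (?n ^ (s - 1))" using card_cut_sets[OF s] by (simp only: of_nat_le_iff)
    show "0 \<le> ub2 t / real (m ^ (t - 1))" using ub2_pos[OF t(1)] by simp
  qed
  finally show ?thesis by (simp only: of_nat_mult of_nat_power of_nat_numeral)
qed

text \<open>Compared with the first moment, three cases each contribute order \<open>1 / L\<close>:
  exceptional cut sets give 3 because they are few, fair sets that are not good give
  \<open>16 * t ^ 3 + 1\<close>, and a good fair set gives \<open>1 / c\<close> because it brings
  \<open>c * L\<close> fair sets on average. The condition \<open>(4 ^ L) ^ 8 \<le> m\<close> makes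
  all powers of \<open>4 ^ L\<close> that occur harmless.\<close>

lemma pr_min_cuts_critical:
  assumes t: "t \<ge> 1" "m \<ge> 1" and s: "2 \<le> s" "s \<le> t" and L: "L \<ge> 1" and M: "(4 ^ L) ^ 8 \<le> m" and c: "0 < c"
    and many: "\<And>S g. S \<in> cut_sets t m s \<Longrightarrow> g \<in> words t (2 * t * m) \<Longrightarrow> halves t m S g \<Longrightarrow> good_cuts t m L S g \<Longrightarrow>
      c * real L * pr t (2 * t * m) (\<lambda>f. balanced t m (override_on g f {Max S..<2 * t * m}))
        \<le> (\<Sum>S'\<in>cut_sets t m s. pr t (2 * t * m) (\<lambda>f. balanced t m (override_on g f {Max S..<2 * t * m}) \<and>
            halves t m S' (override_on g f {Max S..<2 * t * m})))"
  shows "pr t (2 * t * m) (\<lambda>f. balanced t m f \<and> min_cuts t m f = s)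
    \<le> (2 * real t * real m) ^ (s - 1) * (ub2 t / real m ^ (t - 1)) * ((4 + 16 * real t ^ 3 + 1 / c) / real L)"
proof -
  let ?n = "2 * t * m"
  let ?C = "cut_sets t m s"
  define Q where "Q = (4::nat) ^ L"
  define a where "a = ub2 t / real m ^ (t - 1)"
  define N where "N = real ?n ^ (s - 1)"
  have a0: "0 \<le> a" using ub2_pos[OF t(1)] by (simp add: a_def)
  have N0: "0 \<le> N" by (simp add: N_def)
  have s1: "1 \<le> s" using s by simp
  have Q4: "4 \<le> Q" unfolding Q_def using power_increasing[of 1 L "4::nat"] L by simp
  have LQ: "L \<le> Q" unfolding Q_def by (rule less_imp_le[OF less_exp[THEN less_le_trans]]) (rule power_mono, auto)
  have Qpow: "Q ^ i \<le> Q ^ 8" if "i \<le> 8" for i using Q4 that by (intro power_increasing) auto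
  have Q8: "Q ^ 8 \<le> m" using M by (simp add: Q_def)
  have Qm: "Q ^ i \<le> m" if "i \<le> 8" for i using Qpow[OF that] Q8 by linarith
  have mt: "m \<le> t * m" using t by simp
  \<comment> \<open>Here shifted cuts might collide, or the remainder might be too short. Such sets
    have one free cut fewer, up to a power of \<open>Q\<close>, so the crude union bound is
    enough.\<close>
  define E where "E = {S \<in> ?C. \<exists>c g. 0 < g \<and> g < Q \<and> c \<in> S \<and> c + g \<in> S} \<union> {S \<in> ?C. ?n < Max S + Q ^ 4}"
  have fE: "finite E" by (simp add: E_def)
  have cE: "real (card E) * a \<le> 3 / L * (N * a)"
  proof -
    have "card E \<le> 2 * Q * ?n ^ (s - 2) + Q ^ 4 * ?n ^ (s - 2)"
    proof -
      have "Q \<le> m" using Qm[of 1] by simp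
      then have "Q \<le> t * m" using mt by (rule order_trans)
      then have "card {S \<in> ?C. \<exists>c g. 0 < g \<and> g < Q \<and> c \<in> S \<and> c + g \<in> S} \<le> 2 * Q * ?n ^ (s - 2)"
        using t by (intro card_close_cut_sets[OF s(1)]) auto
      moreover have "card {S \<in> ?C. ?n < Max S + Q ^ 4} \<le> Q ^ 4 * ?n ^ (s - 2)"
        by (rule card_late_cut_sets[OF s(1)])
      ultimately show ?thesis unfolding E_def by (intro order_trans[OF card_Un_le] add_mono)
    qed
    also have "\<dots> \<le> 3 * Q ^ 4 * ?n ^ (s - 2)"
    proof -
      have "Q \<le> Q ^ 4" using power_increasing[of 1 4 Q] Q4 by simp
      then have "(2 * Q + Q ^ 4) * ?n ^ (s - 2) \<le> 3 * Q ^ 4 * ?n ^ (s - 2)" by (intro mult_right_mono) auto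
      then show ?thesis by (simp only: distrib_right)
    qed
    finally have "card E * L \<le> 3 * Q ^ 4 * ?n ^ (s - 2) * L" by (rule mult_le_mono1)
    also have "\<dots> = 3 * (Q ^ 4 * L) * ?n ^ (s - 2)" by simp
    also have "\<dots> \<le> 3 * ?n * ?n ^ (s - 2)"
    proof -
      have "Q ^ 4 * L \<le> Q ^ 4 * Q" using LQ by simp
      also have "\<dots> = Q ^ 5" by (simp add: eval_nat_numeral)
      also have "\<dots> \<le> m" by (rule Qm) simp
      also have "\<dots> \<le> ?n" using mt by simp
      finally show ?thesis by (intro mult_right_mono mult_left_mono) auto
    qed
    also have "\<dots> = 3 * ?n ^ Suc (s - 2)" by simp
    also have "Suc (s - 2) = s - 1" using s by simp
    finally have "real (card E * L) \<le> real (3 * ?n ^ (s - 1))" by (simp only: of_nat_le_iff)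
    then have "real (card E) * real L \<le> 3 * N" unfolding N_def by simp
    then have "real (card E) \<le> 3 * N / L" using L by (simp add: pos_le_divide_eq)
    then have "real (card E) * a \<le> 3 * N / L * a" using a0 by (rule mult_right_mono)
    then show ?thesis by simp
  qed
  let ?H = "\<lambda>S f. balanced t m f \<and> halves t m S f"
  have "pr t ?n (\<lambda>f. balanced t m f \<and> min_cuts t m f = s)
    \<le> pr t ?n (\<lambda>f. (\<exists>S\<in>E. ?H S f) \<or> ((\<exists>S\<in>?C - E. balanced t m f \<and> halves t m S f \<and> \<not> good_cuts t m L S f)
        \<or> (\<exists>S\<in>?C. balanced t m f \<and> halves t m S f \<and> good_cuts t m L S f)))"
  proof (rule pr_mono)
    fix f assume f: "f \<in> words t ?n" "balanced t m f \<and> min_cuts t m f = s"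
    then obtain S where "S \<in> ?C" "halves t m S f" using min_cuts_upper[of f t m s] by blast
    then show "(\<exists>S\<in>E. ?H S f) \<or> ((\<exists>S\<in>?C - E. balanced t m f \<and> halves t m S f \<and> \<not> good_cuts t m L S f)
        \<or> (\<exists>S\<in>?C. balanced t m f \<and> halves t m S f \<and> good_cuts t m L S f))"
      using f(2) by blast
  qed
  also have "\<dots> \<le> pr t ?n (\<lambda>f. \<exists>S\<in>E. ?H S f) + (pr t ?n (\<lambda>f. \<exists>S\<in>?C - E. balanced t m f \<and> halves t m S f \<and> \<not> good_cuts t m L S f)
        + pr t ?n (\<lambda>f. \<exists>S\<in>?C. balanced t m f \<and> halves t m S f \<and> good_cuts t m L S f))"
    by (rule order_trans[OF pr_Un add_left_mono[OF pr_Un]])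
  also have "\<dots> \<le> 3 / L * (N * a) + ((16 * real t ^ 3 + 1) / L * (N * a) + 1 / (c * L) * (N * a))"
  proof (intro add_mono)
    have "pr t ?n (\<lambda>f. \<exists>S\<in>E. ?H S f) \<le> (\<Sum>S\<in>E. pr t ?n (?H S))" by (rule pr_Ex[OF fE])
    also have "\<dots> \<le> (\<Sum>S\<in>E. a)"
      using pr_halves_upper'[OF t] unfolding a_def by (intro sum_mono) simp
    also have "\<dots> = real (card E) * a" by simp
    finally show "pr t ?n (\<lambda>f. \<exists>S\<in>E. ?H S f) \<le> 3 / L * (N * a)" using cE by linarith
  next
    have bad: "pr t ?n (\<lambda>f. balanced t m f \<and> halves t m S f \<and> \<not> good_cuts t m L S f)
      \<le> a * ((16 * real t ^ 3 + 1) / L)" if S: "S \<in> ?C - E" for S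
    proof -
      have SC: "S \<in> ?C" using S by simp
      have gap: "\<forall>c\<in>S. \<forall>b\<in>S. c < b \<longrightarrow> c + 4 ^ L \<le> b"
      proof (intro ballI impI)
        fix c b assume cb: "c \<in> S" "b \<in> S" "c < b"
        show "c + 4 ^ L \<le> b"
        proof (rule ccontr)
          assume "\<not> c + 4 ^ L \<le> b"
          then have "0 < b - c \<and> b - c < Q \<and> c \<in> S \<and> c + (b - c) \<in> S"
            using cb unfolding Q_def[symmetric] by simp
          then have "S \<in> E" using SC unfolding E_def by blast
          then show False using S by blast
        qed
      qed
      have late: "Max S + (4 ^ L) ^ 4 \<le> ?n"
        unfolding Q_def[symmetric] using S unfolding E_def by (auto simp: not_less)
      have small: "2 * (s * 4 ^ L) \<le> t * m"
      proof -
        have "2 * Q \<le> Q * Q" using Q4 by (intro mult_right_mono) auto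
        also have "\<dots> = Q ^ 2" by (simp add: power2_eq_square)
        also have "\<dots> \<le> m" by (rule Qm) simp
        finally have "s * (2 * Q) \<le> t * m" using s(2) by (intro mult_mono) auto
        then show ?thesis by (simp add: Q_def)
      qed
      have "pr t ?n (\<lambda>f. balanced t m f \<and> halves t m S f \<and> \<not> good_cuts t m L S f)
        \<le> a * (16 * real t ^ 3 / (real (4 ^ L))\<^sup>2 + 1 / L)"
        unfolding a_def by (rule pr_bad_cuts[OF t SC s1 L gap late small])
      also have "\<dots> \<le> a * (16 * real t ^ 3 / L + 1 / L)"
      proof (intro mult_left_mono add_right_mono divide_left_mono)
        have "real L \<le> real Q" using LQ by (simp only: of_nat_le_iff)
        also have "\<dots> \<le> (real Q)\<^sup>2" using Q4 by (intro self_le_power) auto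
        finally show "real L \<le> (real (4 ^ L))\<^sup>2" unfolding Q_def .
      qed (use a0 L in auto)
      finally show ?thesis by (simp only: add_divide_distrib)
    qed
    have "pr t ?n (\<lambda>f. \<exists>S\<in>?C - E. balanced t m f \<and> halves t m S f \<and> \<not> good_cuts t m L S f)
      \<le> (\<Sum>S\<in>?C - E. pr t ?n (\<lambda>f. balanced t m f \<and> halves t m S f \<and> \<not> good_cuts t m L S f))"
      by (rule pr_Ex) simp
    also have "\<dots> \<le> (\<Sum>S\<in>?C - E. a * ((16 * real t ^ 3 + 1) / L))" by (rule sum_mono, rule bad)
    also have "\<dots> = real (card (?C - E)) * (a * ((16 * real t ^ 3 + 1) / L))" by simp
    also have "\<dots> \<le> N * (a * ((16 * real t ^ 3 + 1) / L))"
    proof (rule mult_right_mono)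
      have "card (?C - E) \<le> ?n ^ (s - 1)"
        using card_mono[of ?C "?C - E"] card_cut_sets[OF s1, of t m] by auto
      then have "real (card (?C - E)) \<le> real (?n ^ (s - 1))" by (simp only: of_nat_le_iff)
      then show "real (card (?C - E)) \<le> N" unfolding N_def of_nat_power .
    qed (use a0 in simp)
    also have "\<dots> = (16 * real t ^ 3 + 1) / L * (N * a)" by simp
    finally show "pr t ?n (\<lambda>f. \<exists>S\<in>?C - E. balanced t m f \<and> halves t m S f \<and> \<not> good_cuts t m L S f)
      \<le> (16 * real t ^ 3 + 1) / L * (N * a)" .
  next
    have cL: "0 < c * real L" using c L by simp
    have "c * real L * pr t ?n (\<lambda>f. \<exists>S\<in>?C. balanced t m f \<and> halves t m S f \<and> good_cuts t m L S f) \<le> N * a"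
    proof -
      have N: "N = (2 * real t * real m) ^ (s - 1)" by (simp add: N_def)
      show ?thesis unfolding N a_def
        by (rule pr_good_fair[OF t s1 less_imp_le[OF cL]]) (rule many)
    qed
    then show "pr t ?n (\<lambda>f. \<exists>S\<in>?C. balanced t m f \<and> halves t m S f \<and> good_cuts t m L S f) \<le> 1 / (c * L) * (N * a)"
      using cL by (simp add: field_simps)
  qed
  also have "\<dots> = N * a * ((4 + 16 * real t ^ 3 + 1 / c) / L)" using c L by (simp add: field_simps)
  finally show ?thesis unfolding N_def a_def by (simp only: of_nat_mult of_nat_numeral)
qed

text \<open>\<open>(4 ^ L) ^ 8 = 2 ^ (16 * L)\<close> and \<open>2 \<le> exp 1\<close>; hence the
  divisor 16.\<close>

lemma four_power_le:
  assumes "m \<ge> 1"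
  shows "(4 ^ nat \<lfloor>ln (real m) / 16\<rfloor>) ^ 8 \<le> m"
proof -
  define L where "L = nat \<lfloor>ln (real m) / 16\<rfloor>"
  have "0 \<le> ln (real m)" using assms by simp
  then have "real L \<le> ln (real m) / 16" unfolding L_def by (intro of_nat_floor) simp
  then have L: "real (16 * L) \<le> ln (real m)" by simp
  have "real ((4 ^ L) ^ 8) = (2::real) ^ (16 * L)"
  proof -
    have "((4::real) ^ L) ^ 8 = (4 ^ 8) ^ L" by (simp only: power_mult[symmetric] mult.commute)
    moreover have "(2::real) ^ (16 * L) = (2 ^ 16) ^ L" by (rule power_mult)
    ultimately show ?thesis by simp
  qed
  also have "\<dots> \<le> exp 1 ^ (16 * L)" using exp_ge_add_one_self[of 1] by (intro power_mono) auto
  also have "\<dots> = exp (real (16 * L))" by (simp flip: exp_of_nat_mult)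
  also have "\<dots> \<le> exp (ln (real m))" using L by (simp only: exp_le_cancel_iff)
  also have "\<dots> = real m" using assms by simp
  finally show ?thesis unfolding L_def by (simp only: of_nat_le_iff)
qed

lemma prob_X_upper_critical:
  assumes t: "t = 2 * s - 1" and s: "2 \<le> s"
  shows "\<exists>C>0. \<forall>\<^sub>F m in sequentially. measure_pmf.prob (random_necklace 2 t m) {w. X 2 t m w = s} \<le> C / ln (real m)"
proof -
  have t1: "t \<ge> 1" "s \<le> t" "t - 1 = 2 * (s - 1)" using t s by auto
  obtain c L0 where c: "c > 0" and many: "\<forall>L\<ge>L0. \<forall>m S g. S \<in> cut_sets t m s \<longrightarrow> g \<in> words t (2 * t * m) \<longrightarrow> halves t m S g \<longrightarrow>
    good_cuts t m L S g \<longrightarrow>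
    c * real L * pr t (2 * t * m) (\<lambda>f. balanced t m (override_on g f {Max S..<2 * t * m}))
      \<le> (\<Sum>S'\<in>cut_sets t m s. pr t (2 * t * m) (\<lambda>f. balanced t m (override_on g f {Max S..<2 * t * m}) \<and>
          halves t m S' (override_on g f {Max S..<2 * t * m})))"
    using many_shifts[OF t s] by blast
  obtain b where b: "b > 0" and low: "\<forall>\<^sub>F m in sequentially. b / sqrt (real m) ^ (t - 1) \<le> pr t (2 * t * m) (balanced t m)"
    using pr_balanced_lower[OF t1(1)] by blast
  define D where "D = (2 * real t) ^ (s - 1) * ub2 t * (4 + 16 * real t ^ 3 + 1 / c) / b"
  have D: "D > 0" unfolding D_def using ub2_pos[OF t1(1)] c b t1(1)
    by (intro divide_pos_pos mult_pos_pos zero_less_power add_nonneg_pos) auto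
  have ln: "filterlim (\<lambda>m. ln (real m)) at_top sequentially"
    by (rule filterlim_compose[OF ln_at_top filterlim_real_sequentially])
  \<comment> \<open>This makes \<open>L\<close> exceed \<open>L0 + 1\<close>, in particular
    \<open>1 \<le> L\<close>; so rounding down costs at most a factor 2 and
    \<open>ln m / 32 \<le> L\<close>.\<close>
  have big: "\<forall>\<^sub>F m in sequentially. 16 * (real L0 + 2) \<le> ln (real m)"
    using ln unfolding filterlim_at_top by blast
  have "\<forall>\<^sub>F m in sequentially. measure_pmf.prob (random_necklace 2 t m) {w. X 2 t m w = s} \<le> 32 * D / ln (real m)"
    using low big eventually_ge_at_top[of 1]
  proof eventually_elim
    case (elim m)
    define L where "L = nat \<lfloor>ln (real m) / 16\<rfloor>"
    have "0 \<le> \<lfloor>ln (real m) / 16\<rfloor>" using elim(2) by simp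
    then have "real L = of_int \<lfloor>ln (real m) / 16\<rfloor>" by (simp add: L_def)
    then have Lx: "ln (real m) / 16 < real L + 1" by linarith
    have Lx': "ln (real m) < 16 * (real L + 1)" using Lx by (simp add: field_simps)
    have "16 * (real L0 + 2) < 16 * (real L + 1)" by (rule le_less_trans[OF elim(2) Lx'])
    then have "real L0 + 2 < real L + 1" by simp
    then have Lr: "real (L0 + 1) < real L" by simp
    have "0 \<le> real (L0 + 1)" by simp
    then have Lpos: "0 < real L" using Lr by (rule le_less_trans)
    from Lr have "L0 + 1 < L" by (simp only: of_nat_less_iff)
    then have L: "L0 \<le> L" "1 \<le> L" by simp_all
    have "0 < 16 * (real L0 + 2)" by simp
    then have ln0: "0 < ln (real m)" using elim(2) by (rule less_le_trans)
    have "real L + 1 \<le> 2 * real L" using L(2) by simp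
    then have "16 * (real L + 1) \<le> 32 * real L" by simp
    then have "ln (real m) \<le> 32 * real L" using less_imp_le[OF Lx'] by (rule order_trans[rotated])
    then have L2: "ln (real m) / 32 \<le> real L" by (simp add: field_simps)
    have m0: "0 < real m" using elim(3) by simp
    have "pr t (2 * t * m) (\<lambda>f. balanced t m f \<and> min_cuts t m f = s)
      \<le> (2 * real t * real m) ^ (s - 1) * (ub2 t / real m ^ (t - 1)) * ((4 + 16 * real t ^ 3 + 1 / c) / real L)"
    proof (rule pr_min_cuts_critical[OF t1(1) elim(3) s t1(2) L(2) _ c])
      show "(4 ^ L) ^ 8 \<le> m" unfolding L_def by (rule four_power_le[OF elim(3)])
    qed (rule many[rule_format, OF L(1)])
    also have "\<dots> = D * b / real m ^ (s - 1) / real L"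
    proof -
      define z where "z = real m ^ (s - 1)"
      have "real m ^ (t - 1) = z * z" unfolding t1(3) z_def by (simp add: mult_2 power_add)
      moreover have "(2 * real t * real m) ^ (s - 1) = (2 * real t) ^ (s - 1) * z"
        by (simp only: power_mult_distrib z_def)
      moreover have "z \<noteq> 0" using m0 by (simp add: z_def)
      ultimately show ?thesis unfolding D_def z_def[symmetric] using b by simp
    qed
    also have "\<dots> \<le> D * b / real m ^ (s - 1) / (ln (real m) / 32)"
    proof (rule divide_left_mono[OF L2])
      show "0 \<le> D * b / real m ^ (s - 1)" using D b m0 by simp
      show "0 < real L * (ln (real m) / 32)" by (intro mult_pos_pos divide_pos_pos Lpos ln0) simp
    qed
    also have "\<dots> = 32 * D / ln (real m) * (b / real m ^ (s - 1))" by (simp add: mult_ac)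
    also have "b / real m ^ (s - 1) = b / sqrt (real m) ^ (t - 1)"
      unfolding t1(3) power_mult by simp
    finally have up: "pr t (2 * t * m) (\<lambda>f. balanced t m f \<and> min_cuts t m f = s)
      \<le> 32 * D / ln (real m) * (b / sqrt (real m) ^ (t - 1))" .
    also have "\<dots> \<le> 32 * D / ln (real m) * pr t (2 * t * m) (balanced t m)"
      using elim(1) D ln0 by (intro mult_left_mono) auto
    finally have "pr t (2 * t * m) (\<lambda>f. balanced t m f \<and> min_cuts t m f = s)
      \<le> 32 * D / ln (real m) * pr t (2 * t * m) (balanced t m)" .
    moreover have "0 < pr t (2 * t * m) (balanced t m)"
    proof -
      have "0 < b / sqrt (real m) ^ (t - 1)" using b m0 by simp
      then show ?thesis using elim(1) by (rule less_le_trans)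
    qed
    ultimately show ?case unfolding prob_X[OF t1(1)] by (simp only: pos_divide_le_eq)
  qed
  then show ?thesis using D by (intro exI[where x = "32 * D"]) simp
qed

text \<open>For \<open>t = 1\<close> and \<open>s = 1\<close> the middle cut is always fair and no
  cut at all never is, for \<open>m \<ge> 1\<close>; so the probability is 1 and cannot be of order
  \<open>1 / ln m\<close>. This is why the second clause excludes \<open>t = 1\<close>.\<close>

theorem theorem1p2:
  fixes t :: nat
  assumes "t \<ge> 1"
  shows
    "(\<forall>s::nat. 1 \<le> s \<and> real s < (real t + 1) / 2 \<longrightarrow>
        (\<exists>c C :: real. 0 < c \<and> c < C \<and>
          (\<forall>\<^sub>F m in sequentially.
             c * real m powr (real s - (real t + 1) / 2)
               \<le> measure_pmf.prob (random_necklace 2 t m) {w. X 2 t m w = s} \<and>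
             measure_pmf.prob (random_necklace 2 t m) {w. X 2 t m w = s}
               \<le> C * real m powr (real s - (real t + 1) / 2))))
     \<and>
     (\<forall>s::nat. t \<noteq> 1 \<and> odd t \<and> real s = (real t + 1) / 2 \<longrightarrow>
        (\<exists>c C :: real. 0 < c \<and> c < C \<and>
          (\<forall>\<^sub>F m in sequentially.
             c / ln (real m)
               \<le> measure_pmf.prob (random_necklace 2 t m) {w. X 2 t m w = s} \<and>
             measure_pmf.prob (random_necklace 2 t m) {w. X 2 t m w = s}
               \<le> C / ln (real m))))
     \<and>
     (\<forall>s::nat. (real t + 1) / 2 < real s \<and> s \<le> t \<longrightarrow>
        (\<exists>c::real. 0 < c \<and>
          (\<forall>\<^sub>F m in sequentially.
             c \<le> measure_pmf.prob (random_necklace 2 t m) {w. X 2 t m w = s})))"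
proof (intro conjI allI impI)
  fix s :: nat
  assume s: "1 \<le> s \<and> real s < (real t + 1) / 2"
  let ?P = "\<lambda>m. measure_pmf.prob (random_necklace 2 t m) {w. X 2 t m w = s}"
  let ?e = "real s - (real t + 1) / 2"
  have "real (2 * s) < real (t + 1)" using s by (simp add: field_simps)
  then have st: "s \<le> t" using s by (simp only: of_nat_less_iff)
  obtain c where c: "c > 0" and low: "\<forall>\<^sub>F m in sequentially. c * real m powr ?e / clump_sum t s m \<le> ?P m"
    using prob_X_lower[of s t] s st by blast
  obtain K where K: "K > 0" "\<And>m. clump_sum t s m \<le> K"
    using clump_sum_subcritical[OF assms, of s] s by blast
  obtain C where C: "C > 0" and up: "\<forall>\<^sub>F m in sequentially. ?P m \<le> C * real m powr ?e"
    using prob_X_upper[OF assms, of s] s by blast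
  have "\<forall>\<^sub>F m in sequentially. c / K * real m powr ?e \<le> ?P m \<and> ?P m \<le> (C + c / K) * real m powr ?e"
    using low up
  proof eventually_elim
    case (elim m)
    have "0 < clump_sum t s m" using clump_sum_pos[of t s m] by (rule less_le_trans[OF zero_less_one])
    then have "c * real m powr ?e / K \<le> c * real m powr ?e / clump_sum t s m"
      using c K by (intro divide_left_mono[OF K(2)] mult_pos_pos) auto
    from order_trans[OF this elim(1)] have "c / K * real m powr ?e \<le> ?P m" by simp
    moreover have "C * real m powr ?e \<le> (C + c / K) * real m powr ?e"
      using c K(1) by (intro mult_right_mono) auto
    ultimately show ?case using order_trans[OF elim(2)] by blast
  qed
  \<comment> \<open>The upper constant was enlarged by \<open>c / K\<close> to make it strictly
    greater than the lower one.\<close>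
  moreover have "0 < c / K" "c / K < C + c / K" using c K(1) C by simp_all
  ultimately show "\<exists>c C. 0 < c \<and> c < C \<and> (\<forall>\<^sub>F m in sequentially. c * real m powr ?e \<le> ?P m \<and> ?P m \<le> C * real m powr ?e)"
    by blast
next
  fix s :: nat
  assume s: "t \<noteq> 1 \<and> odd t \<and> real s = (real t + 1) / 2"
  let ?P = "\<lambda>m. measure_pmf.prob (random_necklace 2 t m) {w. X 2 t m w = s}"
  have "real (2 * s) = real (t + 1)" using s by simp
  then have s2: "2 * s = t + 1" by (simp only: of_nat_eq_iff)
  have "t \<noteq> 1" using s by blast
  then have "2 \<le> t" using assms by simp
  then have ts2: "2 \<le> s" using s2 by simp
  have ts1: "t = 2 * s - 1" using s2 by simp
  have "1 \<le> s" "s \<le> t" using ts2 s2 by simp_all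
  note ts = ts1 ts2 this
  have e: "real s - (real t + 1) / 2 = 0" using s by simp
  obtain c where c: "c > 0" and low: "\<forall>\<^sub>F m in sequentially. c * real m powr (real s - (real t + 1) / 2) / clump_sum t s m \<le> ?P m"
    using prob_X_lower[OF ts(3,4)] by blast
  obtain K where K: "K > 0" and Kle: "\<forall>\<^sub>F m in sequentially. clump_sum t s m \<le> K * ln (real m)"
    using clump_sum_critical[OF assms ts(2)] s by blast
  obtain C where C: "C > 0" and up: "\<forall>\<^sub>F m in sequentially. ?P m \<le> C / ln (real m)"
    using prob_X_upper_critical[OF ts(1,2)] by blast
  have "\<forall>\<^sub>F m in sequentially. c / K / ln (real m) \<le> ?P m \<and> ?P m \<le> (C + c / K) / ln (real m)"
    using low up Kle eventually_gt_at_top[of 1]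
  proof eventually_elim
    case (elim m)
    have ln0: "0 < ln (real m)" using elim(4) by simp
    have "0 < clump_sum t s m" using clump_sum_pos[of t s m] by (rule less_le_trans[OF zero_less_one])
    then have "c / (K * ln (real m)) \<le> c / clump_sum t s m"
      using c K ln0 by (intro divide_left_mono[OF elim(3)] mult_pos_pos) auto
    moreover have "c / clump_sum t s m \<le> ?P m" using elim(1,4) unfolding e by simp
    ultimately have "c / (K * ln (real m)) \<le> ?P m" by (rule order_trans)
    then have "c / K / ln (real m) \<le> ?P m" by simp
    moreover have "C / ln (real m) \<le> (C + c / K) / ln (real m)"
      using c K ln0 by (intro divide_right_mono) auto
    ultimately show ?case using order_trans[OF elim(2)] by blast
  qed
  moreover have "0 < c / K" "c / K < C + c / K" using c K C by simp_all
  ultimately show "\<exists>c C. 0 < c \<and> c < C \<and> (\<forall>\<^sub>F m in sequentially. c / ln (real m) \<le> ?P m \<and> ?P m \<le> C / ln (real m))"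
    by blast
next
  fix s :: nat
  assume s: "(real t + 1) / 2 < real s \<and> s \<le> t"
  let ?P = "\<lambda>m. measure_pmf.prob (random_necklace 2 t m) {w. X 2 t m w = s}"
  let ?e = "real s - (real t + 1) / 2"
  have "s \<noteq> 0" using s by (intro notI) simp
  then have s1: "1 \<le> s" by simp
  obtain c where c: "c > 0" and low: "\<forall>\<^sub>F m in sequentially. c * real m powr ?e / clump_sum t s m \<le> ?P m"
    using prob_X_lower[OF s1] s by blast
  obtain K where K: "K > 0" and Kle: "\<forall>m\<ge>1. clump_sum t s m \<le> K * real m powr ?e"
    using clump_sum_supercritical[OF assms] s by blast
  have "\<forall>\<^sub>F m in sequentially. c / K \<le> ?P m"
    using low eventually_ge_at_top[of 1]
  proof eventually_elim
    case (elim m)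
    have z: "0 < real m powr ?e" using elim(2) by simp
    have "0 < clump_sum t s m" using clump_sum_pos[of t s m] by (rule less_le_trans[OF zero_less_one])
    moreover have "clump_sum t s m \<le> K * real m powr ?e" using Kle elim(2) by blast
    ultimately have "c * real m powr ?e / (K * real m powr ?e) \<le> c * real m powr ?e / clump_sum t s m"
      using c K z by (intro divide_left_mono mult_pos_pos) auto
    moreover have "c * real m powr ?e / (K * real m powr ?e) = c / K" using z by simp
    ultimately show ?case using order_trans[OF _ elim(1)] by metis
  qed
  moreover have "0 < c / K" using c K by simp
  ultimately show "\<exists>c>0. \<forall>\<^sub>F m in sequentially. c \<le> ?P m" by blast
qed

end
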